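(* Let $\boldsymbol{\Sigma} = \mathbf{B} + \mathbf{Y}$ with $\mathbf{Y} = \frac{1}{\sqrt{t}} \mathbf{D}^{1/2} \mathbf{X} \tilde{\mathbf{D}}^{1/2}$, where, for each $t$, $\mathbf{B}$ is a deterministic $r\times t$ matrix, $\mathbf{D} = \mathrm{diag}(d_1,\dots,d_r)$ and $\tilde{\mathbf{D}} = \mathrm{diag}(\tilde d_1,\dots,\tilde d_t)$ are deterministic diagonal matrices with nonnegative entries, and $\mathbf{X}$ is an $r\times t$ random matrix with i.i.d. complex circular Gaussian $\mathcal{CN}(0,1)$ entries. Assume that $$\sup_t \|\mathbf{B}\| < +\infty,\quad \sup_t \|\mathbf{D}\| < +\infty,\quad \sup_t \|\tilde{\mathbf{D}}\| < +\infty,\quad \inf_t \tfrac1t \mathrm{Tr}\,\mathbf{D} > 0,\quad \inf_t \tfrac1t \mathrm{Tr}\,\tilde{\mathbf{D}} > 0 .$$ Fix $\sigma^2>0$. Then, for every deterministic $r\times r$ matrices $\mathbf{M}$ and $t\times t$ matrices $\tilde{\mathbf{M}}$ (depending on $t$) satisfying $\sup_t\|\mathbf{M}\|<+\infty$ and $\sup_t\|\tilde{\mathbf{M}}\|<+\infty$, the following hold as $t\to+\infty$: $$\mathrm{Var}\left(\tfrac1r \mathrm{Tr}[\mathbf{S}(\sigma^2)\mathbf{M}]\right) = O\left(\tfrac{1}{t^2}\right),\qquad \mathrm{Var}\left(\tfrac1t \mathrm{Tr}[\tilde{\mathbf{S}}(\sigma^2)\tilde{\mathbf{M}}]\right) =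 O\left(\tfrac{1}{t^2}\right);$$ $$\tfrac1r \mathrm{Tr}\left[(\mathbb{E}(\mathbf{S}(\sigma^2)) - \mathbf{T}(\sigma^2))\mathbf{M}\right] = O\left(\tfrac{1}{t^2}\right),\qquad \tfrac1t \mathrm{Tr}\left[(\mathbb{E}(\tilde{\mathbf{S}}(\sigma^2)) - \tilde{\mathbf{T}}(\sigma^2))\tilde{\mathbf{M}}\right] = O\left(\tfrac{1}{t^2}\right);$$ and $$J(\sigma^2) = \bar J(\sigma^2) + O\left(\tfrac1t\right).$$
   Context: Asymptotic regime: $t\to+\infty$ means that $t\to\infty$ and $r=r(t)\to\infty$ with $t/r\to c\in(0,+\infty)$. All matrices depend on $t$. $\|\cdot\|$ is the spectral norm, $(\cdot)^H$ the conjugate transpose, and for a complex random variable $x$, $\mathrm{Var}(x)=\mathbb{E}|x|^2-|\mathbb{E}x|^2$. A $\mathcal{CN}(0,1)$ variable has independent centered real Gaussian real and imaginary parts, each of variance $1/2$. Resolvents: $\mathbf{S}(\sigma^2) = [\boldsymbol{\Sigma}\boldsymbol{\Sigma}^H+\sigma^2\mathbf{I}_r]^{-1}$, $\tilde{\mathbf{S}}(\sigma^2) = [\boldsymbol{\Sigma}^H\boldsymbol{\Sigma}+\sigma^2\mathbf{I}_t]^{-1}$. Auxiliary quantities: $(\beta,\tilde\beta)=(\beta(\sigma^2),\tilde\beta(\sigma^2))$ is the unique couple of positive solutions of $$\beta = \tfrac1t\mathrm{Tr}\left[\mathbf{D}\left(\sigma^2(\mathbf{I}_r+\mathbf{D}\tilde\beta)+\mathbf{B}(\mathbf{I}_t+\tilde{\mathbf{D}}\beta)^{-1}\mathbf{B}^H\right)^{-1}\right],\quad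 \tilde\beta = \tfrac1t\mathrm{Tr}\left[\tilde{\mathbf{D}}\left(\sigma^2(\mathbf{I}_t+\tilde{\mathbf{D}}\beta)+\mathbf{B}^H(\mathbf{I}_r+\mathbf{D}\tilde\beta)^{-1}\mathbf{B}\right)^{-1}\right],$$ and $$\mathbf{T}(\sigma^2)=\left[\sigma^2(\mathbf{I}+\tilde\beta\mathbf{D})+\mathbf{B}(\mathbf{I}+\beta\tilde{\mathbf{D}})^{-1}\mathbf{B}^H\right]^{-1},\quad \tilde{\mathbf{T}}(\sigma^2)=\left[\sigma^2(\mathbf{I}+\beta\tilde{\mathbf{D}})+\mathbf{B}^H(\mathbf{I}+\tilde\beta\mathbf{D})^{-1}\mathbf{B}\right]^{-1}.$$ $J(\sigma^2)=\mathbb{E}\log\det(\mathbf{I}_r+\sigma^{-2}\boldsymbol{\Sigma}\boldsymbol{\Sigma}^H)$, and $$\bar J(\sigma^2)= r\int_{\sigma^2}^{+\infty}\left(\tfrac1\omega-\tfrac1r\mathrm{Tr}\,\mathbf{T}(\omega)\right)d\omega = \log\det\left[\mathbf{I}_r+\tilde\beta\mathbf{D}+\tfrac{1}{\sigma^2}\mathbf{B}(\mathbf{I}_t+\beta\tilde{\mathbf{D}})^{-1}\mathbf{B}^H\right]+\log\det[\mathbf{I}_t+\beta\tilde{\mathbf{D}}]-\sigma^2 t\,\beta\tilde\beta .$$ *)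

theory Defs
  imports
    "HOL-Probability.Probability"
    "HOL-Library.Landau_Symbols"
    "Jordan_Normal_Form.Gauss_Jordan_Elimination"
    "Jordan_Normal_Form.Schur_Decomposition"
begin

text \<open>Matrix sizes vary with the index t, so carrier-based matrices are used throughout;
  their sizes are read off the matrix arguments.\<close>

definition mat_trace :: "complex mat \<Rightarrow> complex" where
  "mat_trace A = (\<Sum>i<dim_row A. A $$ (i, i))"

text \<open>A total inverse; unspecified when the argument is not invertible.\<close>

definition mat_inv :: "complex mat \<Rightarrow> complex mat" where
  "mat_inv A = the (mat_inverse A)"

definition vec_l2_norm :: "complex vec \<Rightarrow> real" where
  "vec_l2_norm v = L2_set (\<lambda>i. cmod (vec_index v i)) {..<dim_vec v}"

definition spectral_norm :: "complex mat \<Rightarrow> real" where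
  "spectral_norm A =
     (SUP v\<in>{v \<in> carrier_vec (dim_col A). vec_l2_norm v \<le> 1}. vec_l2_norm (A *\<^sub>v v))"

definition mat_expectation :: "'a measure \<Rightarrow> ('a \<Rightarrow> complex mat) \<Rightarrow> nat \<Rightarrow> nat \<Rightarrow> complex mat" where
  "mat_expectation P A m n = Matrix.mat m n (\<lambda>(i, j). \<integral>\<omega>. A \<omega> $$ (i, j) \<partial>P)"

definition complex_variance :: "'a measure \<Rightarrow> ('a \<Rightarrow> complex) \<Rightarrow> real" where
  "complex_variance P x = (\<integral>\<omega>. (cmod (x \<omega>))\<^sup>2 \<partial>P) - (cmod (\<integral>\<omega>. x \<omega> \<partial>P))\<^sup>2"

text \<open>The argument of \<open>normal_density\<close> is the standard deviation, so the real and imaginary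
  parts have variance 1/2.\<close>

definition std_complex_gaussian :: "'a measure \<Rightarrow> ('a \<Rightarrow> complex) \<Rightarrow> bool" where
  "std_complex_gaussian P x \<longleftrightarrow>
     prob_space.indep_var P borel (\<lambda>\<omega>. Re (x \<omega>)) borel (\<lambda>\<omega>. Im (x \<omega>)) \<and>
     distributed P lborel (\<lambda>\<omega>. Re (x \<omega>)) (normal_density 0 (sqrt (1/2))) \<and>
     distributed P lborel (\<lambda>\<omega>. Im (x \<omega>)) (normal_density 0 (sqrt (1/2)))"

text \<open>Below, \<open>s\<close> stands for \<open>\<sigma>\<^sup>2\<close> (or for the integration variable replacing it).\<close>

definition resolvent :: "complex mat \<Rightarrow> real \<Rightarrow> complex mat" where
  "resolvent A s = mat_inv (A * mat_adjoint A + of_real s \<cdot>\<^sub>m 1\<^sub>m (dim_row A))"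

definition co_resolvent :: "complex mat \<Rightarrow> real \<Rightarrow> complex mat" where
  "co_resolvent A s = mat_inv (mat_adjoint A * A + of_real s \<cdot>\<^sub>m 1\<^sub>m (dim_col A))"

text \<open>The matrices \<open>T\<close> and \<open>T~\<close> as functions of arbitrary values \<open>b\<close>, \<open>bt\<close> of
  \<open>\<beta>\<close>, \<open>\<beta>~\<close>.\<close>

definition T_of :: "complex mat \<Rightarrow> complex mat \<Rightarrow> complex mat \<Rightarrow> real \<Rightarrow> real \<Rightarrow> real \<Rightarrow> complex mat" where
  "T_of B D Dt s b bt = mat_inv
     (of_real s \<cdot>\<^sub>m (1\<^sub>m (dim_row B) + of_real bt \<cdot>\<^sub>m D)
      + B * mat_inv (1\<^sub>m (dim_col B) + of_real b \<cdot>\<^sub>m Dt) * mat_adjoint B)"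

definition Tt_of :: "complex mat \<Rightarrow> complex mat \<Rightarrow> complex mat \<Rightarrow> real \<Rightarrow> real \<Rightarrow> real \<Rightarrow> complex mat" where
  "Tt_of B D Dt s b bt = mat_inv
     (of_real s \<cdot>\<^sub>m (1\<^sub>m (dim_col B) + of_real b \<cdot>\<^sub>m Dt)
      + mat_adjoint B * mat_inv (1\<^sub>m (dim_row B) + of_real bt \<cdot>\<^sub>m D) * B)"

definition canonical_solution ::
    "complex mat \<Rightarrow> complex mat \<Rightarrow> complex mat \<Rightarrow> real \<Rightarrow> real \<times> real \<Rightarrow> bool" where
  "canonical_solution B D Dt s = (\<lambda>(b, bt). b > 0 \<and> bt > 0 \<and>
     of_real b = 1 / of_nat (dim_col B) * mat_trace (D * T_of B D Dt s b bt) \<and>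
     of_real bt = 1 / of_nat (dim_col B) * mat_trace (Dt * Tt_of B D Dt s b bt))"

definition canonical_pair ::
    "complex mat \<Rightarrow> complex mat \<Rightarrow> complex mat \<Rightarrow> real \<Rightarrow> real \<times> real" where
  "canonical_pair B D Dt s = (THE p. canonical_solution B D Dt s p)"

definition T_mat :: "complex mat \<Rightarrow> complex mat \<Rightarrow> complex mat \<Rightarrow> real \<Rightarrow> complex mat" where
  "T_mat B D Dt s = (case canonical_pair B D Dt s of (b, bt) \<Rightarrow> T_of B D Dt s b bt)"

definition Tt_mat :: "complex mat \<Rightarrow> complex mat \<Rightarrow> complex mat \<Rightarrow> real \<Rightarrow> complex mat" where
  "Tt_mat B D Dt s = (case canonical_pair B D Dt s of (b, bt) \<Rightarrow> Tt_of B D Dt s b bt)"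

text \<open>The determinant and the trace below are real; \<open>Re\<close> only converts the type.\<close>

definition mutual_information :: "'a measure \<Rightarrow> ('a \<Rightarrow> complex mat) \<Rightarrow> real \<Rightarrow> real" where
  "mutual_information P Sig s =
     (\<integral>\<omega>. ln (Re (Determinant.det (1\<^sub>m (dim_row (Sig \<omega>))
        + of_real (1 / s) \<cdot>\<^sub>m (Sig \<omega> * mat_adjoint (Sig \<omega>))))) \<partial>P)"

definition mutual_information_approx ::
    "complex mat \<Rightarrow> complex mat \<Rightarrow> complex mat \<Rightarrow> real \<Rightarrow> real" where
  "mutual_information_approx B D Dt s = real (dim_row B) *
     (LINT w:{s..}|lborel. 1 / w - 1 / real (dim_row B) * Re (mat_trace (T_mat B D Dt w)))"

end

theory Submission
  imports Defs "HOL-Real_Asymp.Real_Asymp"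
begin

text \<open>
  The two resolvents \<open>S\<close> and \<open>S~\<close> are, up to the factor \<open>\<sigma>\<close>, the diagonal corners of the inverse \<open>G\<close>
  of one matrix \<open>L\<close> of size \<open>n = r + t\<close>: the diagonal of \<open>L\<close> is \<open>\<sigma>\<close> and its off-diagonal
  blocks are \<open>\<Sigma>\<close> and \<open>- \<Sigma>\<^sup>*\<close> (\<open>skew_lin\<close>, \<open>resolvent_eq\<close>). The matrices \<open>T\<close> and \<open>T~\<close> are corners of the inverse
  of a matrix of the same shape, with \<open>B\<close> in place of \<open>\<Sigma>\<close> and a larger diagonal (\<open>T_of_eq\<close>). Such matrices
  have a positive definite self-adjoint part, which makes them invertible with \<open>|G| \<le> 1 / \<sigma>\<close>, and the quadratic
  form of that part gives the Ward identity
  \<open>Re (G i i) = \<Sum>k. p k |G i k|\<^sup>2\<close> (\<open>res_ward\<close>).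

  Fluctuations. A trace \<open>Tr (G Q)\<close> is a smooth function of independent Gaussian coordinates. The Poincare
  inequality, obtained from its one-dimensional case by the Efron-Stein inequality, bounds its variance by a multiple of the
  squared Frobenius norm of \<open>G Q G\<close> over \<open>t\<close>, which is \<open>O(1)\<close> because it is at most \<open>n\<close> times the squared operator
  norm (\<open>variance_lin_stat\<close>). Dividing the trace by \<open>r\<close> or \<open>t\<close> yields the \<open>O(1 / t\<^sup>2)\<close> variances.

  Means. Gaussian integration by parts in the mean of \<open>L G = 1\<close> replaces the noise by the normalized traces
  of \<open>G\<close> (\<open>mean_res_row\<close>). Replacing these traces by their means costs covariances of size \<open>O(1 / t)\<close>, so the
  traces of the mean of \<open>G\<close> are within \<open>O(1 / t)\<close> of those of the inverse whose weights are the mean traces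
  (\<open>mean_res_det_res\<close>), and the mean traces solve the canonical equations up to \<open>O(1 / t\<^sup>2)\<close> (\<open>mean_wtrace_approx\<close>).
  It remains to see that approximate solutions of these equations are close to the exact one. Two applications of
  Cauchy-Schwarz bound the difference of the two sides of the equations by kernels to which the Ward identity
  applies, and the identity says exactly that these kernels contract, uniformly in the size (\<open>stability\<close>).
  The same estimate proves uniqueness and continuity of the solution; existence is Brouwer's theorem (\<open>fp_exists\<close>).

  Mutual information. The log-determinant at \<open>\<sigma>\<^sup>2\<close> is the integral over \<open>u \<ge> \<sigma>\<^sup>2\<close> of \<open>r / u\<close> minus the trace of the
  resolvent at \<open>u\<close> (\<open>logdet_integral\<close>), and the approximation is by definition the same integral with \<open>T\<close> for the
  resolvent. All constants above are uniform in \<open>u \<ge> \<sigma>\<^sup>2\<close> and the error in the traces decays like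
  \<open>1 / (t u\<^sup>3)\<close>, so integrating it gives \<open>O(1 / t)\<close> (\<open>mutual_information_estimate\<close>).
\<close>

section \<open>Matrices as functions of two indices\<close>

text \<open>Matrices of varying size are functions of two indices, of which only those below \<open>n\<close> matter.
  Associativity of the product then holds as an equation of functions, without dimension conditions.\<close>

definition mm :: "nat \<Rightarrow> (nat \<Rightarrow> nat \<Rightarrow> complex) \<Rightarrow> (nat \<Rightarrow> nat \<Rightarrow> complex) \<Rightarrow> nat \<Rightarrow> nat \<Rightarrow> complex" where
  "mm n a b = (\<lambda>i j. \<Sum>k<n. a i k * b k j)"

definition mv :: "nat \<Rightarrow> (nat \<Rightarrow> nat \<Rightarrow> complex) \<Rightarrow> (nat \<Rightarrow> complex) \<Rightarrow> nat \<Rightarrow> complex" where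
  "mv n a v = (\<lambda>i. \<Sum>k<n. a i k * v k)"

definition mtr :: "nat \<Rightarrow> (nat \<Rightarrow> nat \<Rightarrow> complex) \<Rightarrow> complex" where
  "mtr n a = (\<Sum>i<n. a i i)"

definition sqn :: "nat \<Rightarrow> (nat \<Rightarrow> complex) \<Rightarrow> real" where
  "sqn n v = (\<Sum>i<n. (cmod (v i))\<^sup>2)"

definition kron :: "nat \<Rightarrow> nat \<Rightarrow> complex" where
  "kron i j = (if i = j then 1 else 0)"

definition dg :: "(nat \<Rightarrow> real) \<Rightarrow> nat \<Rightarrow> nat \<Rightarrow> complex" where
  "dg p i j = (if i = j then of_real (p i) else 0)"

text \<open>The operator norm is at most \<open>c\<close>, stated without a supremum so that bounds compose directly.\<close>

definition op_bound :: "nat \<Rightarrow> (nat \<Rightarrow> nat \<Rightarrow> complex) \<Rightarrow> real \<Rightarrow> bool" where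
  "op_bound n a c \<longleftrightarrow> 0 \<le> c \<and> (\<forall>v. sqn n (mv n a v) \<le> c\<^sup>2 * sqn n v)"

lemma mm_assoc: "mm n (mm n a b) c = mm n a (mm n b c)"
proof (intro ext)
  fix i j
  have "mm n (mm n a b) c i j = (\<Sum>k<n. \<Sum>l<n. a i l * b l k * c k j)"
    by (simp add: mm_def sum_distrib_right)
  also have "\<dots> = (\<Sum>l<n. \<Sum>k<n. a i l * b l k * c k j)" by (rule sum.swap)
  also have "\<dots> = mm n a (mm n b c) i j"
    by (simp add: mm_def sum_distrib_left mult.assoc)
  finally show "mm n (mm n a b) c i j = mm n a (mm n b c) i j" .
qed

lemma mv_mm: "mv n (mm n a b) v = mv n a (mv n b v)"
proof (intro ext)
  fix i
  have "mv n (mm n a b) v i = (\<Sum>k<n. \<Sum>l<n. a i l * b l k * v k)"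
    by (simp add: mm_def mv_def sum_distrib_right)
  also have "\<dots> = (\<Sum>l<n. \<Sum>k<n. a i l * b l k * v k)" by (rule sum.swap)
  also have "\<dots> = mv n a (mv n b v) i"
    by (simp add: mv_def sum_distrib_left mult.assoc)
  finally show "mv n (mm n a b) v i = mv n a (mv n b v) i" .
qed

lemma mtr_comm: "mtr n (mm n a b) = mtr n (mm n b a)"
  unfolding mtr_def mm_def by (subst sum.swap) (simp add: mult.commute)

lemma mm_cong: "(\<And>k. k < n \<Longrightarrow> a i k = a' i k) \<Longrightarrow> (\<And>k. k < n \<Longrightarrow> b k j = b' k j) \<Longrightarrow> mm n a b i j = mm n a' b' i j"
  by (simp add: mm_def)

lemma mm_kron_left: "i < n \<Longrightarrow> mm n kron a i j = a i j"
  by (simp add: mm_def kron_def if_distrib[of "\<lambda>x. x * _"] cong: if_cong)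

lemma mm_kron_right: "j < n \<Longrightarrow> mm n a kron i j = a i j"
  by (simp add: mm_def kron_def if_distrib[of "\<lambda>x. _ * x"] cong: if_cong)

lemma mm_dg_left: "i < n \<Longrightarrow> mm n (dg p) a i j = of_real (p i) * a i j"
  by (simp add: mm_def dg_def if_distrib[of "\<lambda>x. x * _"] cong: if_cong)

lemma mm_dg_right: "j < n \<Longrightarrow> mm n a (dg p) i j = a i j * of_real (p j)"
  by (simp add: mm_def dg_def if_distrib[of "\<lambda>x. _ * x"] cong: if_cong)

lemma sqn_nonneg: "0 \<le> sqn n v"
  by (simp add: sqn_def sum_nonneg)

lemma cauchy_schwarz_sum:
  fixes a b :: "'i \<Rightarrow> complex"
  shows "(cmod (\<Sum>i\<in>A. a i * b i))\<^sup>2 \<le> (\<Sum>i\<in>A. (cmod (a i))\<^sup>2) * (\<Sum>i\<in>A. (cmod (b i))\<^sup>2)"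
proof -
  have "cmod (\<Sum>i\<in>A. a i * b i) \<le> (\<Sum>i\<in>A. \<bar>cmod (a i)\<bar> * \<bar>cmod (b i)\<bar>)"
    by (rule order_trans[OF norm_sum]) (simp add: norm_mult)
  also have "\<dots> \<le> L2_set (\<lambda>i. cmod (a i)) A * L2_set (\<lambda>i. cmod (b i)) A"
    by (rule L2_set_mult_ineq)
  finally have "(cmod (\<Sum>i\<in>A. a i * b i))\<^sup>2 \<le> (L2_set (\<lambda>i. cmod (a i)) A * L2_set (\<lambda>i. cmod (b i)) A)\<^sup>2"
    by (intro power_mono) auto
  then show ?thesis
    by (simp add: L2_set_def power_mult_distrib sum_nonneg)
qed

lemma op_boundD: "op_bound n a c \<Longrightarrow> sqn n (mv n a v) \<le> c\<^sup>2 * sqn n v"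
  and op_bound_nonneg: "op_bound n a c \<Longrightarrow> 0 \<le> c"
  by (auto simp: op_bound_def)

lemma op_bound_mm:
  assumes "op_bound n a c" "op_bound n b d"
  shows "op_bound n (mm n a b) (c * d)"
  unfolding op_bound_def
proof safe
  show "0 \<le> c * d" using assms by (auto simp: op_bound_def)
  fix v
  have "sqn n (mv n (mm n a b) v) \<le> c\<^sup>2 * sqn n (mv n b v)"
    unfolding mv_mm by (rule op_boundD[OF assms(1)])
  also have "\<dots> \<le> c\<^sup>2 * (d\<^sup>2 * sqn n v)"
    by (intro mult_left_mono op_boundD[OF assms(2)]) auto
  finally show "sqn n (mv n (mm n a b) v) \<le> (c * d)\<^sup>2 * sqn n v"
    by (simp add: power_mult_distrib mult.assoc)
qed

lemma op_bound_dg: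
  assumes "\<And>i. i < n \<Longrightarrow> \<bar>p i\<bar> \<le> c" "0 \<le> c"
  shows "op_bound n (dg p) c"
  unfolding op_bound_def
proof safe
  fix v
  have "mv n (dg p) v i = of_real (p i) * v i" if "i < n" for i
    using that by (simp add: mv_def dg_def if_distrib[of "\<lambda>x. x * _"] cong: if_cong)
  then have "sqn n (mv n (dg p) v) = (\<Sum>i<n. \<bar>p i\<bar>\<^sup>2 * (cmod (v i))\<^sup>2)"
    by (simp add: sqn_def norm_mult power_mult_distrib)
  also have "\<dots> \<le> (\<Sum>i<n. c\<^sup>2 * (cmod (v i))\<^sup>2)"
    using assms by (intro sum_mono mult_right_mono power_mono) auto
  finally show "sqn n (mv n (dg p) v) \<le> c\<^sup>2 * sqn n v"
    by (simp add: sqn_def sum_distrib_left)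
qed fact

lemma op_bound_column:
  assumes "op_bound n a c" "j < n"
  shows "(\<Sum>i<n. (cmod (a i j))\<^sup>2) \<le> c\<^sup>2"
proof -
  have "sqn n (mv n a (\<lambda>k. kron k j)) \<le> c\<^sup>2 * sqn n (\<lambda>k. kron k j)"
    by (rule op_boundD[OF assms(1)])
  moreover have "mv n a (\<lambda>k. kron k j) i = a i j" for i
    using assms(2) by (simp add: mv_def kron_def if_distrib[of "\<lambda>x. _ * x"] cong: if_cong)
  moreover have "sqn n (\<lambda>k. kron k j) = 1"
  proof -
    have "(cmod (kron i j))\<^sup>2 = (if i = j then 1 else 0)" for i by (simp add: kron_def)
    then show ?thesis using assms(2) by (simp add: sqn_def)
  qed
  ultimately show ?thesis by (simp add: sqn_def)
qed

lemma op_bound_frobenius: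
  assumes "op_bound n a c"
  shows "(\<Sum>j<n. \<Sum>i<n. (cmod (a i j))\<^sup>2) \<le> real n * c\<^sup>2"
proof -
  have "(\<Sum>j<n. \<Sum>i<n. (cmod (a i j))\<^sup>2) \<le> (\<Sum>j<n. c\<^sup>2)"
    by (intro sum_mono op_bound_column[OF assms]) auto
  then show ?thesis by simp
qed

lemma op_bound_entry:
  assumes "op_bound n a c" "i < n" "j < n"
  shows "cmod (a i j) \<le> c"
proof (rule power2_le_imp_le)
  have "(cmod (a i j))\<^sup>2 \<le> (\<Sum>i<n. (cmod (a i j))\<^sup>2)"
    using assms by (intro member_le_sum) auto
  also have "\<dots> \<le> c\<^sup>2" by (rule op_bound_column[OF assms(1,3)])
  finally show "(cmod (a i j))\<^sup>2 \<le> c\<^sup>2" .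
qed (rule op_bound_nonneg[OF assms(1)])

lemma op_bound_trace:
  assumes "op_bound n a c"
  shows "cmod (mtr n a) \<le> real n * c"
proof -
  have "cmod (mtr n a) \<le> (\<Sum>i<n. c)"
    unfolding mtr_def by (rule order_trans[OF norm_sum], intro sum_mono op_bound_entry[OF assms]) auto
  then show ?thesis by simp
qed

section \<open>Accretive matrices and their inverses\<close>

definition minv :: "nat \<Rightarrow> (nat \<Rightarrow> nat \<Rightarrow> complex) \<Rightarrow> nat \<Rightarrow> nat \<Rightarrow> complex" where
  "minv n a = (\<lambda>i j. mat_inv (Matrix.mat n n (\<lambda>(i, j). a i j)) $$ (i, j))"

text \<open>The self-adjoint part of \<open>a\<close> is the diagonal matrix of \<open>p\<close>.\<close>

definition accretive :: "nat \<Rightarrow> (nat \<Rightarrow> real) \<Rightarrow> (nat \<Rightarrow> nat \<Rightarrow> complex) \<Rightarrow> bool" where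
  "accretive n p a \<longleftrightarrow> (\<forall>i<n. \<forall>j<n. a i j + cnj (a j i) = 2 * dg p i j)"

text \<open>The skew-adjoint part contributes an imaginary number to the quadratic form and so drops out of
  its real part.\<close>

lemma accretive_form:
  assumes "accretive n p a"
  shows "Re (\<Sum>i<n. cnj (v i) * mv n a v i) = (\<Sum>i<n. p i * (cmod (v i))\<^sup>2)"
proof -
  define Q where "Q = (\<Sum>i<n. \<Sum>k<n. cnj (v i) * a i k * v k)"
  have Q: "(\<Sum>i<n. cnj (v i) * mv n a v i) = Q"
    by (simp add: Q_def mv_def sum_distrib_left mult.assoc)
  have "cnj Q = (\<Sum>i<n. \<Sum>k<n. v i * cnj (a i k) * cnj (v k))"
    by (simp add: Q_def)
  also have "\<dots> = (\<Sum>i<n. \<Sum>k<n. v k * cnj (a k i) * cnj (v i))" by (rule sum.swap)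
  finally have "Q + cnj Q = (\<Sum>i<n. \<Sum>k<n. cnj (v i) * a i k * v k + v k * cnj (a k i) * cnj (v i))"
    by (simp only: Q_def sum.distrib)
  also have "\<dots> = (\<Sum>i<n. \<Sum>k<n. cnj (v i) * (a i k + cnj (a k i)) * v k)"
    by (intro sum.cong refl) (simp add: algebra_simps)
  also have "\<dots> = (\<Sum>i<n. \<Sum>k<n. cnj (v i) * (2 * dg p i k) * v k)"
    using assms by (intro sum.cong refl) (simp add: accretive_def)
  also have "\<dots> = (\<Sum>i<n. 2 * of_real (p i * (cmod (v i))\<^sup>2))"
  proof (intro sum.cong refl)
    fix i assume i: "i \<in> {..<n}"
    have "(\<Sum>k<n. cnj (v i) * (2 * dg p i k) * v k) = (\<Sum>k<n. if i = k then cnj (v i) * (2 * of_real (p i)) * v k else 0)"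
      by (intro sum.cong) (auto simp: dg_def)
    also have "\<dots> = cnj (v i) * (2 * of_real (p i)) * v i" using i by simp
    also have "\<dots> = 2 * of_real (p i * (cmod (v i))\<^sup>2)"
      by (simp add: complex_norm_square[unfolded of_real_power] mult_ac)
    finally show "(\<Sum>k<n. cnj (v i) * (2 * dg p i k) * v k) = 2 * of_real (p i * (cmod (v i))\<^sup>2)" .
  qed
  also have "\<dots> = of_real (2 * (\<Sum>i<n. p i * (cmod (v i))\<^sup>2))"
    by (simp add: sum_distrib_left)
  finally have "Re (Q + cnj Q) = 2 * (\<Sum>i<n. p i * (cmod (v i))\<^sup>2)" by simp
  then show ?thesis unfolding Q by simp
qed

lemma mat_inv_inverts:
  assumes "A \<in> carrier_mat n n" "Determinant.det A \<noteq> 0"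
  shows "A * mat_inv A = 1\<^sub>m n" "mat_inv A * A = 1\<^sub>m n" "mat_inv A \<in> carrier_mat n n"
proof -
  have "A \<in> Units (ring_mat TYPE(complex) n undefined)"
    by (rule det_non_zero_imp_unit[OF assms])
  then obtain C where C: "mat_inverse A = Some C"
    using mat_inverse(1)[OF assms(1), of undefined] by (cases "mat_inverse A") auto
  from mat_inverse(2)[OF assms(1) C]
  show "A * mat_inv A = 1\<^sub>m n" "mat_inv A * A = 1\<^sub>m n" "mat_inv A \<in> carrier_mat n n"
    by (auto simp: mat_inv_def C)
qed

lemma mat_mult_entry:
  "A \<in> carrier_mat m n \<Longrightarrow> B \<in> carrier_mat n l \<Longrightarrow> i < m \<Longrightarrow> j < l \<Longrightarrow>
   (A * B) $$ (i, j) = (\<Sum>k<n. A $$ (i, k) * B $$ (k, j))"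
  by (simp add: scalar_prod_def atLeast0LessThan)

lemma minv_det:
  assumes "Determinant.det (Matrix.mat n n (\<lambda>(i, j). a i j)) \<noteq> 0" "i < n" "j < n"
  shows "mm n a (minv n a) i j = kron i j" "mm n (minv n a) a i j = kron i j"
proof -
  let ?A = "Matrix.mat n n (\<lambda>(i, j). a i j)"
  note I = mat_inv_inverts[of ?A n, OF _ assms(1)]
  have "(?A * mat_inv ?A) $$ (i, j) = (\<Sum>k<n. ?A $$ (i, k) * mat_inv ?A $$ (k, j))"
    using I(3) assms by (intro mat_mult_entry) auto
  also have "\<dots> = mm n a (minv n a) i j"
    using assms by (simp add: mm_def minv_def)
  finally show "mm n a (minv n a) i j = kron i j"
    using I(1) assms by (simp add: kron_def)
  have "(mat_inv ?A * ?A) $$ (i, j) = (\<Sum>k<n. mat_inv ?A $$ (i, k) * ?A $$ (k, j))"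
    using I(3) assms by (intro mat_mult_entry) auto
  also have "\<dots> = mm n (minv n a) a i j"
    using assms by (simp add: mm_def minv_def)
  finally show "mm n (minv n a) a i j = kron i j"
    using I(2) assms by (simp add: kron_def)
qed

text \<open>A vector in the kernel makes the quadratic form vanish, while its real part is a positive combination
  of the squared entries.\<close>

lemma accretive_det:
  assumes "accretive n p a" "\<And>i. i < n \<Longrightarrow> 0 < p i"
  shows "Determinant.det (Matrix.mat n n (\<lambda>(i, j). a i j)) \<noteq> 0"
proof
  let ?A = "Matrix.mat n n (\<lambda>(i, j). a i j)"
  assume "Determinant.det ?A = 0"
  then obtain v where v: "v \<in> carrier_vec n" "v \<noteq> 0\<^sub>v n" "?A *\<^sub>v v = 0\<^sub>v n"
    using det_0_iff_vec_prod_zero[of ?A n] by auto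
  have "mv n a (vec_index v) i = 0" if "i < n" for i
  proof -
    have "vec_index (?A *\<^sub>v v) i = mv n a (vec_index v) i"
      using that v(1) by (simp add: mv_def scalar_prod_def atLeast0LessThan)
    then show ?thesis using v(3) that by simp
  qed
  then have "(\<Sum>i<n. cnj (vec_index v i) * mv n a (vec_index v) i) = 0" by simp
  with accretive_form[OF assms(1), of "vec_index v"]
  have "(\<Sum>i<n. p i * (cmod (vec_index v i))\<^sup>2) = 0" by simp
  moreover have "0 \<le> p i * (cmod (vec_index v i))\<^sup>2" if "i < n" for i
    using assms(2)[OF that] by simp
  ultimately have "\<forall>i\<in>{..<n}. p i * (cmod (vec_index v i))\<^sup>2 = 0"
    by (subst (asm) sum_nonneg_eq_0_iff) auto
  then have "vec_index v i = 0" if "i < n" for i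
    using assms(2)[OF that] bspec[of "{..<n}" _ i] that by (metis lessThan_iff less_irrefl mult_eq_0_iff norm_eq_zero power_eq_0_iff)
  then have "v = 0\<^sub>v n" using v(1) by (intro eq_vecI) auto
  with v(2) show False by simp
qed

lemma minv_unique_left:
  assumes "Determinant.det (Matrix.mat n n (\<lambda>(i, j). a i j)) \<noteq> 0"
    and "\<And>i j. i < n \<Longrightarrow> j < n \<Longrightarrow> mm n b a i j = kron i j" and "i < n" "j < n"
  shows "b i j = minv n a i j"
proof -
  have "b i j = mm n b kron i j" using assms(4) by (simp add: mm_kron_right)
  also have "\<dots> = mm n b (mm n a (minv n a)) i j"
    using assms by (intro mm_cong) (simp_all add: minv_det)
  also have "\<dots> = mm n (mm n b a) (minv n a) i j" by (simp add: mm_assoc)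
  also have "\<dots> = mm n kron (minv n a) i j"
    using assms by (intro mm_cong) simp_all
  also have "\<dots> = minv n a i j" using assms(3) by (simp add: mm_kron_left)
  finally show ?thesis .
qed

lemma minv_unique_right:
  assumes "Determinant.det (Matrix.mat n n (\<lambda>(i, j). a i j)) \<noteq> 0"
    and "\<And>i j. i < n \<Longrightarrow> j < n \<Longrightarrow> mm n a b i j = kron i j" and "i < n" "j < n"
  shows "b i j = minv n a i j"
proof -
  have "b i j = mm n kron b i j" using assms(3) by (simp add: mm_kron_left)
  also have "\<dots> = mm n (mm n (minv n a) a) b i j"
    using assms by (intro mm_cong) (simp_all add: minv_det)
  also have "\<dots> = mm n (minv n a) (mm n a b) i j" by (simp add: mm_assoc)
  also have "\<dots> = mm n (minv n a) kron i j"
    using assms by (intro mm_cong) simp_all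
  also have "\<dots> = minv n a i j" using assms(4) by (simp add: mm_kron_right)
  finally show ?thesis .
qed

lemma minv_diff:
  assumes "Determinant.det (Matrix.mat n n (\<lambda>(i, j). a i j)) \<noteq> 0"
    and "Determinant.det (Matrix.mat n n (\<lambda>(i, j). b i j)) \<noteq> 0"
    and "i < n" "j < n"
  shows "minv n b i j - minv n a i j = mm n (minv n b) (mm n (\<lambda>i j. a i j - b i j) (minv n a)) i j"
proof -
  have "mm n (minv n b) (mm n (\<lambda>i j. a i j - b i j) (minv n a)) i j
      = mm n (minv n b) (mm n a (minv n a)) i j - mm n (minv n b) (mm n b (minv n a)) i j"
    by (simp add: mm_def sum_distrib_left left_diff_distrib right_diff_distrib sum_subtractf)
  also have "mm n (minv n b) (mm n a (minv n a)) i j = mm n (minv n b) kron i j"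
    using assms by (intro mm_cong) (simp_all add: minv_det)
  also have "mm n (minv n b) (mm n b (minv n a)) i j = mm n kron (minv n a) i j"
    unfolding mm_assoc[symmetric] using assms by (intro mm_cong) (simp_all add: minv_det)
  finally show ?thesis using assms by (simp add: mm_kron_left mm_kron_right)
qed

text \<open>For \<open>u = minv a v\<close>, coercivity and Cauchy-Schwarz give
  \<open>e |u|\<^sup>2 \<le> Re \<langle>u, a u\<rangle> \<le> |u| |v|\<close>.\<close>

lemma op_bound_minv:
  assumes "accretive n p a" "\<And>i. i < n \<Longrightarrow> e \<le> p i" "0 < e"
  shows "op_bound n (minv n a) (1 / e)"
  unfolding op_bound_def
proof safe
  show "0 \<le> 1 / e" using assms by simp
  fix v
  define u where "u = mv n (minv n a) v"
  have det: "Determinant.det (Matrix.mat n n (\<lambda>(i, j). a i j)) \<noteq> 0"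
    using assms by (intro accretive_det[of n p a]) (auto intro: less_le_trans)
  have au: "mv n a u i = v i" if "i < n" for i
  proof -
    have "mv n a u i = mv n (mm n a (minv n a)) v i" by (simp add: u_def mv_mm)
    also have "\<dots> = (\<Sum>k<n. kron i k * v k)"
      unfolding mv_def using that by (intro sum.cong) (auto simp: minv_det[OF det])
    also have "\<dots> = v i" using that by (simp add: kron_def if_distrib[of "\<lambda>x. x * _"] cong: if_cong)
    finally show ?thesis .
  qed
  have "e * sqn n u \<le> (\<Sum>i<n. p i * (cmod (u i))\<^sup>2)"
    unfolding sqn_def sum_distrib_left using assms by (intro sum_mono mult_right_mono) auto
  also have "\<dots> = Re (\<Sum>i<n. cnj (u i) * mv n a u i)"
    by (rule accretive_form[OF assms(1), symmetric])
  also have "\<dots> = Re (\<Sum>i<n. cnj (u i) * v i)" using au by simp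
  also have "\<dots> \<le> cmod (\<Sum>i<n. cnj (u i) * v i)" by (rule complex_Re_le_cmod)
  finally have "(e * sqn n u)\<^sup>2 \<le> (cmod (\<Sum>i<n. cnj (u i) * v i))\<^sup>2"
    using assms sqn_nonneg by (intro power_mono) auto
  also have "\<dots> \<le> sqn n u * sqn n v"
    using cauchy_schwarz_sum[of "\<lambda>i. cnj (u i)" v "{..<n}"] by (simp add: sqn_def)
  finally have *: "e\<^sup>2 * sqn n u * sqn n u \<le> sqn n v * sqn n u"
    by (simp add: power_mult_distrib power2_eq_square mult_ac)
  have "e\<^sup>2 * sqn n u \<le> sqn n v"
  proof (cases "sqn n u = 0")
    case False
    then show ?thesis using * sqn_nonneg[of n u] mult_right_le_imp_le by fastforce
  qed (simp add: sqn_nonneg)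
  then show "sqn n (mv n (minv n a) v) \<le> (1 / e)\<^sup>2 * sqn n v"
    using assms(3) by (simp add: u_def power_divide field_simps)
qed

section \<open>The skew linearization of a rectangular matrix\<close>

text \<open>The block matrix with the positive diagonal \<open>p\<close>, upper right block \<open>C\<close> and lower left block
  \<open>-C\<^sup>*\<close>. Its off-diagonal part is skew-adjoint, hence the matrix is accretive whatever \<open>C\<close> is. Its inverse
  has the corners \<open>\<surd>s (C C\<^sup>* + s)^(-1)\<close> and \<open>\<surd>s (C\<^sup>* C + s)^(-1)\<close> when \<open>p\<close> is constantly \<open>\<surd>s\<close>, so both
  resolvents are handled at once, and the noise enters linearly.\<close>

definition skew_lin :: "nat \<Rightarrow> (nat \<Rightarrow> real) \<Rightarrow> (nat \<Rightarrow> nat \<Rightarrow> complex) \<Rightarrow> nat \<Rightarrow> nat \<Rightarrow> complex" where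
  "skew_lin r p C i j = (if i = j then of_real (p i) else if i < r \<and> r \<le> j then C i (j - r)
     else if r \<le> i \<and> j < r then - cnj (C j (i - r)) else 0)"

text \<open>Conjugation by this signature turns \<open>skew_lin\<close> into its adjoint; hence the inverse has a real diagonal
  and entries of symmetric modulus.\<close>

definition sg :: "nat \<Rightarrow> nat \<Rightarrow> complex" where
  "sg r i = (if i < r then 1 else - 1)"

definition res :: "nat \<Rightarrow> nat \<Rightarrow> (nat \<Rightarrow> real) \<Rightarrow> (nat \<Rightarrow> nat \<Rightarrow> complex) \<Rightarrow> nat \<Rightarrow> nat \<Rightarrow> complex" where
  "res n r p C = minv n (skew_lin r p C)"

lemma skew_lin_accretive: "accretive n p (skew_lin r p C)"
  by (auto simp: accretive_def skew_lin_def dg_def)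

lemma skew_lin_cnj: "cnj (skew_lin r p C j i) = sg r i * sg r j * skew_lin r p C i j"
  by (auto simp: skew_lin_def sg_def)

lemma sg_sq [simp]: "sg r i * sg r i = 1" "sg r i * (sg r i * z) = z"
  by (auto simp: sg_def)

lemma skew_lin_det:
  assumes "\<And>i. i < n \<Longrightarrow> 0 < p i"
  shows "Determinant.det (Matrix.mat n n (\<lambda>(i, j). skew_lin r p C i j)) \<noteq> 0"
  by (rule accretive_det[OF skew_lin_accretive assms])

lemma res_inverse:
  assumes "\<And>i. i < n \<Longrightarrow> 0 < p i" "i < n" "j < n"
  shows "mm n (skew_lin r p C) (res n r p C) i j = kron i j" "mm n (res n r p C) (skew_lin r p C) i j = kron i j"
  unfolding res_def by (rule minv_det[OF skew_lin_det[OF assms(1)] assms(2,3)], assumption)+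

lemma res_cnj:
  assumes "\<And>i. i < n \<Longrightarrow> 0 < p i" "i < n" "j < n"
  shows "cnj (res n r p C j i) = sg r i * sg r j * res n r p C i j"
proof -
  have "sg r i * sg r j * cnj (res n r p C j i) = res n r p C i j" if "i < n" "j < n" for i j
    unfolding res_def[of n r p C, THEN fun_cong, THEN fun_cong, of i j]
  proof (rule minv_unique_left[OF skew_lin_det[OF assms(1)] _ that])
    fix i j assume ij: "i < n" "j < n"
    have "mm n (\<lambda>i j. sg r i * sg r j * cnj (res n r p C j i)) (skew_lin r p C) i j
      = sg r i * sg r j * cnj (mm n (skew_lin r p C) (res n r p C) j i)"
      unfolding mm_def cnj_sum sum_distrib_left
      by (intro sum.cong refl) (simp add: skew_lin_cnj mult_ac)
    also have "\<dots> = kron i j"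
      using ij assms(1) by (subst res_inverse) (auto simp: kron_def)
    finally show "mm n (\<lambda>i j. sg r i * sg r j * cnj (res n r p C j i)) (skew_lin r p C) i j = kron i j" .
  qed
  from this[OF assms(2,3)] have "res n r p C i j = sg r i * sg r j * cnj (res n r p C j i)" by simp
  then show ?thesis by (simp add: mult_ac)
qed

lemma cmod_sg [simp]: "cmod (sg r i) = 1"
  by (simp add: sg_def)

lemma res_cmod_sym:
  assumes "\<And>i. i < n \<Longrightarrow> 0 < p i" "i < n" "j < n"
  shows "cmod (res n r p C j i) = cmod (res n r p C i j)"
  using arg_cong[OF res_cnj[OF assms], where f=cmod] by (simp add: norm_mult)

lemma res_diag_real:
  assumes "\<And>i. i < n \<Longrightarrow> 0 < p i" "i < n"
  shows "res n r p C i i = of_real (Re (res n r p C i i))"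
  using res_cnj[OF assms(1) assms(2,2)] by (simp add: complex_eq_iff)

text \<open>The Ward identity, the real part of the quadratic form of \<open>skew_lin\<close> at a column of its inverse. It
  expresses a diagonal entry as a weighted sum of squares along a row; the contraction property of the
  fixed-point equation rests on it.\<close>

lemma res_ward:
  assumes "\<And>i. i < n \<Longrightarrow> 0 < p i" "i < n"
  shows "Re (res n r p C i i) = (\<Sum>k<n. p k * (cmod (res n r p C i k))\<^sup>2)"
proof -
  let ?v = "\<lambda>k. res n r p C k i"
  have "(\<Sum>k<n. p k * (cmod (res n r p C i k))\<^sup>2) = (\<Sum>k<n. p k * (cmod (?v k))\<^sup>2)"
    using assms by (intro sum.cong refl) (simp add: res_cmod_sym[of n p i])
  also have "\<dots> = Re (\<Sum>k<n. cnj (?v k) * mv n (skew_lin r p C) ?v k)"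
    by (rule accretive_form[OF skew_lin_accretive, symmetric])
  also have "(\<Sum>k<n. cnj (?v k) * mv n (skew_lin r p C) ?v k) = (\<Sum>k<n. cnj (?v k) * kron k i)"
    using res_inverse(1)[OF assms(1) _ assms(2)]
    by (intro sum.cong refl) (simp add: mv_def mm_def)
  also have "\<dots> = cnj (?v i)"
    using assms(2) by (simp add: kron_def if_distrib[of "\<lambda>x. _ * x"] cong: if_cong)
  finally show ?thesis by simp
qed

lemma op_bound_res:
  assumes "\<And>i. i < n \<Longrightarrow> e \<le> p i" "0 < e"
  shows "op_bound n (res n r p C) (1 / e)"
  unfolding res_def by (rule op_bound_minv[OF skew_lin_accretive assms])

lemma res_row_le:
  assumes "\<And>i. i < n \<Longrightarrow> e \<le> p i" "0 < e" "i < n"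
  shows "(\<Sum>k<n. (cmod (res n r p C i k))\<^sup>2) \<le> 1 / e\<^sup>2"
proof -
  have "(\<Sum>k<n. (cmod (res n r p C i k))\<^sup>2) = (\<Sum>k<n. (cmod (res n r p C k i))\<^sup>2)"
    using assms by (intro sum.cong refl) (subst res_cmod_sym; force intro: less_le_trans)
  also have "\<dots> \<le> (1 / e)\<^sup>2" by (rule op_bound_column[OF op_bound_res[OF assms(1,2)] assms(3)])
  finally show ?thesis by (simp add: power_divide)
qed

lemma sum_split: "(\<Sum>k<r + t. f k) = (\<Sum>k<r. f k) + (\<Sum>k<t. f (r + k :: nat))" for f :: "nat \<Rightarrow> 'a :: comm_monoid_add"
  by (induction t) (simp_all add: add.assoc)

lemma skew_lin_column:
  assumes "n = r + t" "i < n"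
    and rows: "\<And>i. i < r \<Longrightarrow> (\<Sum>j<t. (cmod (C i j))\<^sup>2) \<le> b\<^sup>2"
    and cols: "\<And>j. j < t \<Longrightarrow> (\<Sum>i<r. (cmod (C i j))\<^sup>2) \<le> b\<^sup>2"
  shows "(\<Sum>k<n. (cmod (skew_lin r p C k i))\<^sup>2) \<le> (p i)\<^sup>2 + b\<^sup>2"
proof (cases "i < r")
  case True
  have "(\<Sum>k<r. (cmod (skew_lin r p C k i))\<^sup>2) = (\<Sum>k<r. if k = i then (p i)\<^sup>2 else 0)"
    using True by (intro sum.cong) (auto simp: skew_lin_def)
  moreover have "(\<Sum>k<t. (cmod (skew_lin r p C (r + k) i))\<^sup>2) = (\<Sum>k<t. (cmod (C i k))\<^sup>2)"
    using True by (intro sum.cong) (auto simp: skew_lin_def)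
  ultimately show ?thesis using True rows[OF True] by (simp add: assms(1) sum_split)
next
  case False
  have "(\<Sum>k<t. (cmod (skew_lin r p C (r + k) i))\<^sup>2) = (\<Sum>k<t. if k = i - r then (p i)\<^sup>2 else 0)"
    using False by (intro sum.cong) (auto simp: skew_lin_def)
  moreover have "(\<Sum>k<r. (cmod (skew_lin r p C k i))\<^sup>2) = (\<Sum>k<r. (cmod (C k (i - r)))\<^sup>2)"
    using False by (intro sum.cong) (auto simp: skew_lin_def)
  moreover have "i - r < t" using False assms by auto
  ultimately show ?thesis using False cols[of "i - r"] by (simp add: assms(1) sum_split)
qed

text \<open>The diagonal entry of a matrix times its inverse is one; Cauchy-Schwarz then bounds a row of the
  inverse from below by the corresponding column of the matrix.\<close>

lemma res_row_ge:
  assumes "\<And>i. i < n \<Longrightarrow> 0 < p i" "i < n" "(\<Sum>k<n. (cmod (skew_lin r p C k i))\<^sup>2) \<le> c" "0 < c"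
  shows "1 / c \<le> (\<Sum>k<n. (cmod (res n r p C i k))\<^sup>2)"
proof -
  have "1 = (cmod (\<Sum>k<n. res n r p C i k * skew_lin r p C k i))\<^sup>2"
    using res_inverse(2)[OF assms(1) assms(2,2), where r=r and C=C] by (simp add: mm_def kron_def)
  also have "\<dots> \<le> (\<Sum>k<n. (cmod (res n r p C i k))\<^sup>2) * (\<Sum>k<n. (cmod (skew_lin r p C k i))\<^sup>2)"
    by (rule cauchy_schwarz_sum)
  also have "\<dots> \<le> (\<Sum>k<n. (cmod (res n r p C i k))\<^sup>2) * c"
    using assms(3) by (intro mult_left_mono sum_nonneg) auto
  finally show ?thesis using assms(4) by (simp add: field_simps)
qed

lemma res_diff:
  assumes "\<And>i. i < n \<Longrightarrow> 0 < p i" "\<And>i. i < n \<Longrightarrow> 0 < p' i" "i < n" "j < n"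
  shows "res n r p' C' i j - res n r p C i j
     = mm n (res n r p' C') (mm n (\<lambda>i j. skew_lin r p C i j - skew_lin r p' C' i j) (res n r p C)) i j"
  unfolding res_def by (rule minv_diff[OF skew_lin_det[OF assms(1)] skew_lin_det[OF assms(2)] assms(3,4)])

lemma res_diff_diag:
  assumes "\<And>i. i < n \<Longrightarrow> 0 < p i" "\<And>i. i < n \<Longrightarrow> 0 < p' i" "i < n" "j < n"
  shows "res n r p' C i j - res n r p C i j
     = (\<Sum>k<n. of_real (p k - p' k) * res n r p' C i k * res n r p C k j)"
proof -
  have eq: "(\<lambda>i j. skew_lin r p C i j - skew_lin r p' C i j) = dg (\<lambda>k. p k - p' k)"
    by (auto simp: skew_lin_def dg_def fun_eq_iff)
  have "res n r p' C i j - res n r p C i j = mm n (res n r p' C) (mm n (dg (\<lambda>k. p k - p' k)) (res n r p C)) i j"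
    unfolding eq[symmetric] by (rule res_diff[OF assms])
  also have "\<dots> = (\<Sum>k<n. res n r p' C i k * mm n (dg (\<lambda>k. p k - p' k)) (res n r p C) k j)"
    by (simp only: mm_def[of n "res n r p' C"])
  also have "\<dots> = (\<Sum>k<n. of_real (p k - p' k) * res n r p' C i k * res n r p C k j)"
    by (intro sum.cong refl) (simp add: mm_dg_left mult_ac)
  finally show ?thesis .
qed

section \<open>The canonical equations as a fixed-point problem\<close>

text \<open>The two profiles are indexed by booleans. The weight of a row index carries \<open>x True\<close> and the weight
  of a column index carries \<open>x False\<close>, because the noise block couples rows with columns.\<close>

definition wt :: "(bool \<Rightarrow> nat \<Rightarrow> real) \<Rightarrow> real \<Rightarrow> (bool \<Rightarrow> real) \<Rightarrow> nat \<Rightarrow> real" where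
  "wt pp e x k = e + x False * pp True k + x True * pp False k"

text \<open>A fixed point \<open>x\<close> of \<open>Phi\<close> is \<open>e\<close> times the pair of \<open>\<beta>\<close> (index \<open>False\<close>) and
  \<open>\<beta>~\<close> (index \<open>True\<close>), where \<open>e\<close> is the square root of \<open>\<sigma>\<^sup>2\<close>.\<close>

definition Phi :: "nat \<Rightarrow> nat \<Rightarrow> nat \<Rightarrow> (bool \<Rightarrow> nat \<Rightarrow> real) \<Rightarrow> (nat \<Rightarrow> nat \<Rightarrow> complex) \<Rightarrow> real \<Rightarrow> (bool \<Rightarrow> real) \<Rightarrow> bool \<Rightarrow> real" where
  "Phi n r t pp C e x a = (\<Sum>i<n. pp a i * Re (res n r (wt pp e x) C i i)) / real t"

text \<open>For \<open>G\<close> a \<open>res\<close> this bounds the entry of the Jacobian of \<open>Phi\<close> that belongs to the profiles \<open>u\<close> and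
  \<open>w\<close>, whose terms \<open>G i k * G k i\<close> have modulus \<open>|G i k|\<^sup>2\<close>.\<close>

definition Ker :: "nat \<Rightarrow> nat \<Rightarrow> nat \<Rightarrow> (nat \<Rightarrow> real) \<Rightarrow> (nat \<Rightarrow> real) \<Rightarrow> (nat \<Rightarrow> nat \<Rightarrow> complex) \<Rightarrow> real" where
  "Ker n r t u w G = (\<Sum>i<n. \<Sum>k<n. u i * w k * (cmod (G i k))\<^sup>2) / real t"

text \<open>Two nonnegative profiles on the \<open>n = r + t\<close> indices, with the quantities on which the estimates
  depend: the upper bound \<open>pm\<close> of the profiles, the bound \<open>nu\<close> of \<open>n / t\<close>, and the lower bound
  \<open>dl\<close> of their normalized traces.\<close>

locale profile =
  fixes r t n :: nat and pp :: "bool \<Rightarrow> nat \<Rightarrow> real" and pm nu dl :: real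
  assumes t_pos: "0 < t" and n_eq: "n = r + t"
    and pp_nonneg: "\<And>a i. i < n \<Longrightarrow> 0 \<le> pp a i"
    and pp_le: "\<And>a i. i < n \<Longrightarrow> pp a i \<le> pm"
    and n_le: "real n \<le> nu * real t"
    and dl_pos: "0 < dl" and dl_le: "\<And>a. dl \<le> (\<Sum>i<n. pp a i) / real t"
begin

lemma n_pos: "0 < n" using n_eq t_pos by simp

lemma pm_nonneg: "0 \<le> pm"
  using pp_nonneg[of 0 True] pp_le[of 0 True] n_pos by linarith

lemma nu_pos: "0 < nu"
proof -
  have "0 < nu * real t" using n_pos n_le by linarith
  then show ?thesis using t_pos by (simp add: zero_less_mult_iff)
qed

lemma pm_pos: "0 < pm"
proof (rule ccontr)
  assume "\<not> 0 < pm"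
  then have "pp True i \<le> 0" if "i < n" for i using pp_le[OF that, of True] by linarith
  then have "(\<Sum>i<n. pp True i) \<le> 0" by (intro sum_nonpos) simp
  then have "(\<Sum>i<n. pp True i) / real t \<le> 0" by (simp add: divide_nonpos_nonneg)
  then show False using dl_le[of True] dl_pos by linarith
qed

lemma wt_ge: "0 \<le> x True \<Longrightarrow> 0 \<le> x False \<Longrightarrow> i < n \<Longrightarrow> e \<le> wt pp e x i"
  unfolding wt_def using pp_nonneg by (simp add: add.assoc)

lemma wt_le: "x True \<le> h \<Longrightarrow> x False \<le> h \<Longrightarrow> 0 \<le> h \<Longrightarrow> i < n \<Longrightarrow> wt pp e x i \<le> e + 2 * h * pm"
proof -
  assume a: "x True \<le> h" "x False \<le> h" "0 \<le> h" "i < n"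
  have "x False * pp True i \<le> h * pm" using a pp_nonneg pp_le by (intro mult_mono) auto
  moreover have "x True * pp False i \<le> h * pm" using a pp_nonneg pp_le by (intro mult_mono) auto
  ultimately show ?thesis by (simp add: wt_def)
qed

lemma avg_le:
  assumes "\<And>i. i < n \<Longrightarrow> f i \<le> c" "0 \<le> c"
  shows "(\<Sum>i<n. pp a i * f i) / real t \<le> pm * nu * c"
proof -
  have "(\<Sum>i<n. pp a i * f i) \<le> (\<Sum>i<n. pm * c)"
    using assms pp_nonneg pp_le pm_nonneg
    by (intro sum_mono order_trans[OF mult_left_mono[of "f _" c] mult_right_mono]) auto
  also have "\<dots> = real n * (pm * c)" by simp
  also have "\<dots> \<le> nu * real t * (pm * c)" using n_le pm_nonneg assms by (intro mult_right_mono) auto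
  finally show ?thesis using t_pos by (simp add: field_simps)
qed

context
  fixes C :: "nat \<Rightarrow> nat \<Rightarrow> complex" and e :: real
  assumes e_pos: "0 < e"
begin

abbreviation "G x \<equiv> res n r (wt pp e x) C"
abbreviation "Ph x a \<equiv> Phi n r t pp C e x a"
abbreviation "K x a b \<equiv> Ker n r t (pp a) (pp b) (G x)"
abbreviation "w x a \<equiv> Ker n r t (pp a) (\<lambda>_. 1) (G x)"

lemma wt_pos: "0 \<le> x True \<Longrightarrow> 0 \<le> x False \<Longrightarrow> i < n \<Longrightarrow> 0 < wt pp e x i"
  using wt_ge[of x i e] e_pos by linarith

lemma K_nonneg: "0 \<le> K x a b"
  unfolding Ker_def by (intro divide_nonneg_nonneg sum_nonneg mult_nonneg_nonneg pp_nonneg) auto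

lemma w_nonneg: "0 \<le> w x a"
  unfolding Ker_def by (intro divide_nonneg_nonneg sum_nonneg mult_nonneg_nonneg pp_nonneg) auto

text \<open>The Ward identity averaged against a profile. At a fixed point it says that the matrix with entries
  \<open>K\<close>, acting on the vector with swapped components, maps the fixed point strictly below itself.\<close>

lemma Phi_ward:
  assumes "0 \<le> x True" "0 \<le> x False"
  shows "Ph x a = e * w x a + x False * K x a True + x True * K x a False"
proof -
  have "(\<Sum>i<n. pp a i * Re (G x i i)) = (\<Sum>i<n. \<Sum>k<n. pp a i * (wt pp e x k * (cmod (G x i k))\<^sup>2))"
    using wt_pos[OF assms] by (intro sum.cong refl) (subst res_ward, auto simp: sum_distrib_left)
  also have "\<dots> = (\<Sum>i<n. \<Sum>k<n. e * (pp a i * 1 * (cmod (G x i k))\<^sup>2)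
      + x False * (pp a i * pp True k * (cmod (G x i k))\<^sup>2)
      + x True * (pp a i * pp False k * (cmod (G x i k))\<^sup>2))"
    by (intro sum.cong refl) (simp add: wt_def algebra_simps)
  finally show ?thesis
    unfolding Phi_def Ker_def by (simp only: sum.distrib sum_distrib_left[symmetric] add_divide_distrib times_divide_eq_right)
qed

lemma Phi_le:
  assumes "0 \<le> x True" "0 \<le> x False"
  shows "Ph x a \<le> pm * nu / e"
proof -
  have "Re (G x i i) \<le> 1 / e" if "i < n" for i
  proof -
    have "Re (G x i i) \<le> cmod (G x i i)" by (rule complex_Re_le_cmod)
    also have "\<dots> \<le> 1 / e" by (rule op_bound_entry[OF op_bound_res that that]) (use wt_ge assms e_pos in auto)
    finally show ?thesis .
  qed
  from avg_le[of "\<lambda>i. Re (G x i i)" "1 / e", OF this] show ?thesis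
    using e_pos by (simp add: Phi_def)
qed

lemma K_le:
  assumes "0 \<le> x True" "0 \<le> x False"
  shows "K x a b \<le> pm\<^sup>2 * nu / e\<^sup>2"
proof -
  have "(\<Sum>k<n. pp b k * (cmod (G x i k))\<^sup>2) \<le> pm / e\<^sup>2" if "i < n" for i
  proof -
    have "(\<Sum>k<n. pp b k * (cmod (G x i k))\<^sup>2) \<le> (\<Sum>k<n. pm * (cmod (G x i k))\<^sup>2)"
      using pp_le by (intro sum_mono mult_right_mono) auto
    also have "\<dots> \<le> pm * (1 / e\<^sup>2)"
      unfolding sum_distrib_left[symmetric] using wt_ge assms e_pos that pm_nonneg
      by (intro mult_left_mono res_row_le) auto
    finally show ?thesis by simp
  qed
  from avg_le[of "\<lambda>i. \<Sum>k<n. pp b k * (cmod (G x i k))\<^sup>2", OF this, of a] show ?thesis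
    using e_pos pm_nonneg by (simp add: Ker_def sum_distrib_left mult.assoc power2_eq_square mult_ac)
qed

text \<open>The mixed kernel of two different weights is controlled by the geometric mean of the two pure
  kernels.\<close>

lemma cross_le:
  assumes "0 \<le> x True" "0 \<le> x False" "0 \<le> m True" "0 \<le> m False"
  shows "cmod (\<Sum>i<n. \<Sum>k<n. of_real (pp a i * pp b k) * (G x i k * G m k i)) / real t
     \<le> sqrt (K x a b) * sqrt (K m a b)"
proof -
  define A where "A = {..<n} \<times> {..<n}"
  define s where "s = (\<lambda>(i, k). complex_of_real (sqrt (pp a i * pp b k)))"
  have s2: "(cmod (s (i, k)))\<^sup>2 = pp a i * pp b k" if "i < n" "k < n" for i k
    using that pp_nonneg by (simp add: s_def)
  have "(\<Sum>i<n. \<Sum>k<n. of_real (pp a i * pp b k) * (G x i k * G m k i))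
     = (\<Sum>z\<in>A. (s z * (case z of (i, k) \<Rightarrow> G x i k)) * (s z * (case z of (i, k) \<Rightarrow> G m k i)))"
    unfolding A_def sum.cartesian_product
  proof (intro sum.cong refl, clarsimp simp only: prod.case mem_Times_iff lessThan_iff fst_conv snd_conv)
    fix i k assume ik: "i < n" "k < n"
    have "complex_of_real (pp a i * pp b k) = s (i, k) * s (i, k)"
      using ik pp_nonneg by (simp add: s_def flip: of_real_mult)
    then show "complex_of_real (pp a i * pp b k) * (G x i k * G m k i) = s (i, k) * G x i k * (s (i, k) * G m k i)"
      by (simp add: mult_ac)
  qed
  then have "(cmod (\<Sum>i<n. \<Sum>k<n. of_real (pp a i * pp b k) * (G x i k * G m k i)))\<^sup>2
     \<le> (\<Sum>z\<in>A. (cmod (s z * (case z of (i, k) \<Rightarrow> G x i k)))\<^sup>2) * (\<Sum>z\<in>A. (cmod (s z * (case z of (i, k) \<Rightarrow> G m k i)))\<^sup>2)"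
    using cauchy_schwarz_sum by metis
  also have "(\<Sum>z\<in>A. (cmod (s z * (case z of (i, k) \<Rightarrow> G x i k)))\<^sup>2) = real t * K x a b"
    unfolding Ker_def A_def sum.cartesian_product
    using t_pos s2 by (simp add: norm_mult power_mult_distrib) (intro sum.cong refl, auto)
  also have "(\<Sum>z\<in>A. (cmod (s z * (case z of (i, k) \<Rightarrow> G m k i)))\<^sup>2) = real t * K m a b"
    unfolding Ker_def A_def sum.cartesian_product
    using t_pos s2 res_cmod_sym[OF wt_pos[of m], of n]  assms
    by (simp add: norm_mult power_mult_distrib) (intro sum.cong refl, auto)
  finally have "(cmod (\<Sum>i<n. \<Sum>k<n. of_real (pp a i * pp b k) * (G x i k * G m k i)))\<^sup>2
    \<le> (real t * (sqrt (K x a b) * sqrt (K m a b)))\<^sup>2"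
    using K_nonneg by (simp add: power_mult_distrib power2_eq_square mult_ac)
  then have "cmod (\<Sum>i<n. \<Sum>k<n. of_real (pp a i * pp b k) * (G x i k * G m k i))
    \<le> real t * (sqrt (K x a b) * sqrt (K m a b))"
    by (rule power2_le_imp_le) (use K_nonneg in auto)
  then show ?thesis using t_pos by (simp add: field_simps)
qed

lemma Phi_diff:
  assumes "0 \<le> x True" "0 \<le> x False" "0 \<le> m True" "0 \<le> m False"
  shows "\<bar>Ph x a - Ph m a\<bar> \<le> \<bar>m False - x False\<bar> * (sqrt (K x a True) * sqrt (K m a True))
     + \<bar>m True - x True\<bar> * (sqrt (K x a False) * sqrt (K m a False))"
proof -
  define T where "T b = (\<Sum>i<n. \<Sum>k<n. complex_of_real (pp a i * pp b k) * (G x i k * G m k i))" for b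
  have 1: "G x i i - G m i i = (\<Sum>k<n. of_real ((m False - x False) * pp True k + (m True - x True) * pp False k) * (G x i k * G m k i))"
    if "i < n" for i
  proof -
    have eq: "(m False - x False) * pp True k + (m True - x True) * pp False k = wt pp e m k - wt pp e x k" for k
      by (simp add: wt_def algebra_simps)
    show ?thesis unfolding eq
      using res_diff_diag[of n "wt pp e m" "wt pp e x" i i r C] wt_pos assms that by (simp add: mult.assoc)
  qed
  have "Ph x a - Ph m a = Re (\<Sum>i<n. of_real (pp a i) * (G x i i - G m i i)) / real t"
    by (simp add: Phi_def right_diff_distrib sum_subtractf diff_divide_distrib)
  moreover have "(\<Sum>i<n. of_real (pp a i) * (G x i i - G m i i)) = of_real (m False - x False) * T True + of_real (m True - x True) * T False"
  proof -
    have "(\<Sum>i<n. of_real (pp a i) * (G x i i - G m i i))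
      = (\<Sum>i<n. \<Sum>k<n. of_real (m False - x False) * (complex_of_real (pp a i * pp True k) * (G x i k * G m k i))
         + of_real (m True - x True) * (complex_of_real (pp a i * pp False k) * (G x i k * G m k i)))"
      by (intro sum.cong refl) (simp add: 1 sum_distrib_left algebra_simps)
    then show ?thesis by (simp only: T_def sum.distrib sum_distrib_left)
  qed
  ultimately have "\<bar>Ph x a - Ph m a\<bar> = \<bar>Re (of_real (m False - x False) * T True + of_real (m True - x True) * T False)\<bar> / real t"
    by simp
  also have "\<dots> \<le> cmod (of_real (m False - x False) * T True + of_real (m True - x True) * T False) / real t"
    by (intro divide_right_mono abs_Re_le_cmod) simp
  also have "\<dots> \<le> (\<bar>m False - x False\<bar> * cmod (T True) + \<bar>m True - x True\<bar> * cmod (T False)) / real t"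
    using norm_triangle_ineq[of "of_real (m False - x False) * T True" "of_real (m True - x True) * T False"]
    unfolding norm_mult norm_of_real by (rule divide_right_mono) simp
  also have "\<dots> = \<bar>m False - x False\<bar> * (cmod (T True) / real t) + \<bar>m True - x True\<bar> * (cmod (T False) / real t)"
    by (simp add: add_divide_distrib)
  also have "\<dots> \<le> \<bar>m False - x False\<bar> * (sqrt (K x a True) * sqrt (K m a True)) + \<bar>m True - x True\<bar> * (sqrt (K x a False) * sqrt (K m a False))"
    unfolding T_def by (intro add_mono mult_left_mono cross_le assms) auto
  finally show ?thesis .
qed

context
  fixes b :: real
  assumes rows: "\<And>i. i < r \<Longrightarrow> (\<Sum>j<t. (cmod (C i j))\<^sup>2) \<le> b\<^sup>2"
    and cols: "\<And>j. j < t \<Longrightarrow> (\<Sum>i<r. (cmod (C i j))\<^sup>2) \<le> b\<^sup>2"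
begin

text \<open>Every row of the inverse has length bounded below, so the strict gap in the averaged Ward identity is
  uniform in the size.\<close>

lemma w_ge:
  assumes "0 \<le> x True" "0 \<le> x False" "x True \<le> h" "x False \<le> h"
  shows "e * dl / ((e + 2 * h * pm)\<^sup>2 + b\<^sup>2) \<le> e * w x a"
proof -
  define c where "c = (e + 2 * h * pm)\<^sup>2 + b\<^sup>2"
  have h: "0 \<le> h" using assms by linarith
  then have "0 < e + 2 * h * pm" using e_pos pm_nonneg by (intro add_pos_nonneg mult_nonneg_nonneg) auto
  then have c: "0 < c" by (auto simp: c_def intro!: add_pos_nonneg)
  have row: "1 / c \<le> (\<Sum>k<n. (cmod (G x i k))\<^sup>2)" if "i < n" for i
  proof (rule res_row_ge[OF wt_pos[OF assms(1,2)] that _ c])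
    have "(\<Sum>k<n. (cmod (skew_lin r (wt pp e x) C k i))\<^sup>2) \<le> (wt pp e x i)\<^sup>2 + b\<^sup>2"
      by (rule skew_lin_column[OF n_eq that rows cols])
    also have "\<dots> \<le> c"
      using wt_le[OF assms(3,4) h that, of e] wt_pos[OF assms(1,2) that] by (simp add: c_def power_mono)
    finally show "(\<Sum>k<n. (cmod (skew_lin r (wt pp e x) C k i))\<^sup>2) \<le> c" .
  qed
  have "dl / c \<le> (\<Sum>i<n. pp a i) / real t / c" using dl_le[of a] c by (intro divide_right_mono) auto
  also have "\<dots> = (\<Sum>i<n. pp a i * (1 / c)) / real t" by (simp add: sum_divide_distrib mult_ac)
  also have "\<dots> \<le> (\<Sum>i<n. pp a i * (\<Sum>k<n. (cmod (G x i k))\<^sup>2)) / real t"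
    using row pp_nonneg by (intro divide_right_mono sum_mono mult_left_mono) auto
  also have "\<dots> = w x a" by (simp add: Ker_def sum_distrib_left)
  finally show ?thesis using e_pos mult_left_mono[of "dl / c" "w x a" e] by (simp add: c_def)
qed

lemma Phi_ge:
  assumes "0 \<le> x True" "0 \<le> x False" "x True \<le> h" "x False \<le> h"
  shows "e * dl / ((e + 2 * h * pm)\<^sup>2 + b\<^sup>2) \<le> Ph x a"
  using w_ge[OF assms, of a] Phi_ward[OF assms(1,2), of a]
    mult_nonneg_nonneg[OF assms(2) K_nonneg[of a True x]] mult_nonneg_nonneg[OF assms(1) K_nonneg[of a False x]]
  by linarith

lemma cs2: "a1 * b1 + a2 * b2 \<le> sqrt (a1\<^sup>2 + a2\<^sup>2) * sqrt (b1\<^sup>2 + b2\<^sup>2)" for a1 :: real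
proof (rule power2_le_imp_le)
  have "(a1 * b1 + a2 * b2)\<^sup>2 + (a1 * b2 - a2 * b1)\<^sup>2 = (a1\<^sup>2 + a2\<^sup>2) * (b1\<^sup>2 + b2\<^sup>2)"
    by (simp add: power2_eq_square algebra_simps)
  then show "(a1 * b1 + a2 * b2)\<^sup>2 \<le> (sqrt (a1\<^sup>2 + a2\<^sup>2) * sqrt (b1\<^sup>2 + b2\<^sup>2))\<^sup>2"
    by (simp add: power_mult_distrib) (metis le_add_same_cancel1 zero_le_power2)
qed simp

text \<open>Let \<open>D\<close> be the distance between the approximate and the exact fixed point, and measure it in the
  scale \<open>\<surd>(x b m b)\<close>. The mixed kernel is at most \<open>\<surd>(K x) \<surd>(K m)\<close>, so a second Cauchy-Schwarz
  inequality separates \<open>x\<close> from \<open>m\<close>. The Ward identity bounds the \<open>x\<close> factor by \<open>x a\<close> and the \<open>m\<close> factor by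
  strictly less than \<open>m a\<close>, hence \<open>Phi\<close> contracts in this scale by the factor \<open>1 - fp_floor / (2 h)\<close>.\<close>

lemma stability:
  assumes x: "0 < x True" "0 < x False" "x True \<le> h" "x False \<le> h"
    and m: "0 < m True" "0 < m False" "m True \<le> h" "m False \<le> h"
    and fp: "\<And>a. Ph m a = m a"
    and approx: "\<And>a. \<bar>x a - Ph x a\<bar> \<le> eps"
    and fp_floor_def: "fp_floor = e * dl / ((e + 2 * h * pm)\<^sup>2 + b\<^sup>2)" and eps: "eps \<le> fp_floor / 2"
  shows "\<bar>x a - m a\<bar> \<le> 4 * (h / fp_floor)\<^sup>2 * eps"
proof -
  have x': "0 \<le> x True" "0 \<le> x False" and m': "0 \<le> m True" "0 \<le> m False" using x m by auto
  have h: "0 < h" using x by linarith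
  then have "0 < e + 2 * h * pm" using e_pos pm_nonneg by (intro add_pos_nonneg mult_nonneg_nonneg) auto
  then have fp_floor: "0 < fp_floor"
    unfolding fp_floor_def using e_pos dl_pos by (intro divide_pos_pos mult_pos_pos add_pos_nonneg) auto
  have eps0: "0 \<le> eps" using approx[of True] by linarith
  define D where "D a = \<bar>x a - m a\<bar>" for a
  define s where "s a = sqrt (x a) * sqrt (m a)" for a
  have xlo: "fp_floor / 2 \<le> x a" for a
    using Phi_ge[OF x' x(3,4), of a] approx[of a] eps unfolding fp_floor_def[symmetric] by linarith
  have mlo: "fp_floor \<le> m a" for a
    using Phi_ge[OF m' m(3,4), of a] fp[of a] by (simp add: fp_floor_def)
  have mh: "m a \<le> h" "0 < m a" for a using m by (cases a; simp)+
  have xh: "x a \<le> h" "0 < x a" for a using x by (cases a; simp)+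
  have loh: "fp_floor \<le> h" using mlo mh order_trans by blast
  have s_pos: "0 < s a" for a using xh mh by (simp add: s_def)
  have s_le: "s a \<le> h" for a
  proof -
    have "s a \<le> sqrt h * sqrt h" unfolding s_def using xh[of a] mh[of a] by (intro mult_mono) auto
    then show ?thesis using h by simp
  qed
  have s_ge: "fp_floor / 2 \<le> s a" for a
  proof -
    have "sqrt (fp_floor / 2) * sqrt (fp_floor / 2) \<le> s a" unfolding s_def
      using xlo[of a] mlo[of a] fp_floor by (intro mult_mono) auto
    then show ?thesis using fp_floor by simp
  qed
  have "\<exists>a0. \<forall>b. f b \<le> f a0" for f :: "bool \<Rightarrow> real"
    using linear[of "f True" "f False"] by (auto simp: all_bool_eq ex_bool_eq)
  (* a0 is the index at which the distance is largest in the scale s *)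
  from this[of "\<lambda>b. D b / s b"] obtain a0 where a0: "D b / s b \<le> D a0 / s a0" for b by blast
  define q where "q = D a0 / s a0"
  have q0: "0 \<le> q" using s_pos[of a0] by (simp add: q_def D_def)
  have Dq: "D b \<le> q * s b" for b using a0[of b] s_pos[of b] by (simp add: q_def field_simps)
  have Dq0: "D a0 = q * s a0" using s_pos[of a0] by (simp add: q_def)
  have wx: "x False * K x a0 True + x True * K x a0 False \<le> x a0"
    using Phi_ward[OF x', of a0] w_ge[OF x' x(3,4), of a0] approx[of a0] eps fp_floor unfolding fp_floor_def[symmetric] by linarith
  (* the exact fixed point loses at least the floor, a fraction fp_floor / h of m a0 *)
  have wm: "m False * K m a0 True + m True * K m a0 False \<le> m a0 * (1 - fp_floor / (2 * h))\<^sup>2"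
  proof -
    have "m False * K m a0 True + m True * K m a0 False \<le> m a0 - fp_floor"
      using Phi_ward[OF m', of a0] w_ge[OF m' m(3,4), of a0] fp[of a0] unfolding fp_floor_def[symmetric] by linarith
    also have "\<dots> \<le> m a0 - m a0 * (fp_floor / h)"
      using mult_right_mono[OF mh(1)[of a0], of "fp_floor / h"] fp_floor h by simp
    also have "\<dots> \<le> m a0 * (1 - fp_floor / (2 * h))\<^sup>2"
    proof -
      have "m a0 * (1 - fp_floor / (2 * h))\<^sup>2 = m a0 - m a0 * (fp_floor / h) + m a0 * (fp_floor / (2 * h))\<^sup>2"
        by (simp add: power2_eq_square algebra_simps)
      then show ?thesis using mh(2)[of a0] by simp
    qed
    finally show ?thesis .
  qed
  have "D a0 \<le> eps + \<bar>Ph x a0 - Ph m a0\<bar>"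
    using approx[of a0] fp[of a0] by (simp add: D_def)
  also have "\<bar>Ph x a0 - Ph m a0\<bar> \<le> D False * (sqrt (K x a0 True) * sqrt (K m a0 True))
     + D True * (sqrt (K x a0 False) * sqrt (K m a0 False))"
    using Phi_diff[OF x' m', of a0] by (simp add: D_def abs_minus_commute)
  also have "\<dots> \<le> (q * s False) * (sqrt (K x a0 True) * sqrt (K m a0 True))
     + (q * s True) * (sqrt (K x a0 False) * sqrt (K m a0 False))"
    using Dq K_nonneg by (intro add_mono mult_right_mono) auto
  also have "\<dots> = q * ((sqrt (x False) * sqrt (K x a0 True)) * (sqrt (m False) * sqrt (K m a0 True))
       + (sqrt (x True) * sqrt (K x a0 False)) * (sqrt (m True) * sqrt (K m a0 False)))"
    by (simp add: s_def algebra_simps)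
  also have "\<dots> \<le> q * (sqrt ((sqrt (x False) * sqrt (K x a0 True))\<^sup>2 + (sqrt (x True) * sqrt (K x a0 False))\<^sup>2)
     * sqrt ((sqrt (m False) * sqrt (K m a0 True))\<^sup>2 + (sqrt (m True) * sqrt (K m a0 False))\<^sup>2))"
    by (rule mult_left_mono[OF cs2 q0])
  also have "\<dots> = q * (sqrt (x False * K x a0 True + x True * K x a0 False) * sqrt (m False * K m a0 True + m True * K m a0 False))"
    using x' m' K_nonneg by (simp add: power_mult_distrib)
  also have "\<dots> \<le> q * (sqrt (x a0) * sqrt (m a0 * (1 - fp_floor / (2 * h))\<^sup>2))"
    using wx wm q0 xh(2)[of a0] by (intro mult_left_mono mult_mono real_sqrt_le_mono)
      (auto intro!: add_nonneg_nonneg mult_nonneg_nonneg x' m' K_nonneg)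
  also have "\<dots> = D a0 * (1 - fp_floor / (2 * h))"
  proof -
    have "0 \<le> 1 - fp_floor / (2 * h)" using loh h fp_floor by (simp add: field_simps)
    then show ?thesis by (simp only: Dq0 s_def real_sqrt_mult real_sqrt_abs abs_of_nonneg mult.assoc)
  qed
  finally have "D a0 * (fp_floor / (2 * h)) \<le> eps" by (simp add: algebra_simps)
  then have D0: "D a0 \<le> 2 * (h / fp_floor) * eps" using fp_floor h by (simp add: field_simps)
  (* back to the unscaled distance at an arbitrary index, where s varies between fp_floor / 2 and h *)
  have "D a \<le> q * s a" by (rule Dq)
  also have "\<dots> = D a0 * (s a / s a0)" by (simp add: q_def)
  also have "\<dots> \<le> (2 * (h / fp_floor) * eps) * (h / (fp_floor / 2))"
    using D0 s_le[of a] s_ge[of a0] s_pos[of a] s_pos[of a0] h fp_floor eps0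
    by (intro mult_mono frac_le) auto
  also have "\<dots> = 4 * (h / fp_floor)\<^sup>2 * eps" by (simp add: power2_eq_square)
  finally show ?thesis by (simp add: D_def)
qed

end
end
end

section \<open>Existence, uniqueness and continuity of the solution\<close>

definition is_fixed_point :: "nat \<Rightarrow> nat \<Rightarrow> nat \<Rightarrow> (bool \<Rightarrow> nat \<Rightarrow> real) \<Rightarrow> (nat \<Rightarrow> nat \<Rightarrow> complex) \<Rightarrow> real \<Rightarrow> (bool \<Rightarrow> real) \<Rightarrow> bool" where
  "is_fixed_point n r t pp C e m \<longleftrightarrow> (\<forall>a. 0 < m a \<and> Phi n r t pp C e m a = m a)"

context profile
begin

lemma Phi_lipschitz:
  assumes "0 < e" "\<And>a. 0 \<le> x a" "\<And>a. 0 \<le> m a"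
  shows "\<bar>Phi n r t pp C e x a - Phi n r t pp C e m a\<bar>
    \<le> pm\<^sup>2 * nu / e\<^sup>2 * (\<bar>x False - m False\<bar> + \<bar>x True - m True\<bar>)"
proof -
  let ?K = "\<lambda>x b. Ker n r t (pp a) (pp b) (res n r (wt pp e x) C)"
  define k where "k = pm\<^sup>2 * nu / e\<^sup>2"
  have k0: "0 \<le> k" using nu_pos by (simp add: k_def)
  have "sqrt (?K x b) * sqrt (?K m b) \<le> sqrt k * sqrt k" for b
    unfolding k_def using assms by (intro mult_mono real_sqrt_le_mono K_le real_sqrt_ge_zero K_nonneg k0[unfolded k_def]) auto
  then have k: "sqrt (?K x b) * sqrt (?K m b) \<le> k" for b using k0 by simp
  have "\<bar>Phi n r t pp C e x a - Phi n r t pp C e m a\<bar> \<le>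
     \<bar>m False - x False\<bar> * (sqrt (?K x True) * sqrt (?K m True)) + \<bar>m True - x True\<bar> * (sqrt (?K x False) * sqrt (?K m False))"
    by (rule Phi_diff) (use assms in auto)
  also have "\<dots> \<le> \<bar>m False - x False\<bar> * k + \<bar>m True - x True\<bar> * k"
    by (intro add_mono mult_left_mono k) auto
  also have "\<dots> = k * (\<bar>x False - m False\<bar> + \<bar>x True - m True\<bar>)"
    by (simp add: distrib_left mult.commute abs_minus_commute)
  finally show ?thesis unfolding k_def .
qed

lemma Phi_nonneg:
  assumes "0 < e" "\<And>a. 0 \<le> x a"
  shows "0 \<le> Phi n r t pp C e x a"
  using Phi_ward[of e x C a] assms w_nonneg[of e a x C] K_nonneg[of e a _ x C]
  by (auto intro!: add_nonneg_nonneg)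

text \<open>Brouwer on the box \<open>[0, pm nu / e]\<^sup>2\<close>, which \<open>Phi\<close> maps into itself; the lower bound of \<open>Phi\<close> on
  the box makes the fixed point strictly positive.\<close>

lemma fp_exists:
  assumes e: "0 < e" and rows: "\<And>i. i < r \<Longrightarrow> (\<Sum>j<t. (cmod (C i j))\<^sup>2) \<le> b\<^sup>2"
    and cols: "\<And>j. j < t \<Longrightarrow> (\<Sum>i<r. (cmod (C i j))\<^sup>2) \<le> b\<^sup>2"
  shows "\<exists>m. is_fixed_point n r t pp C e m"
proof -
  define h where "h = pm * nu / e"
  have h: "0 \<le> h" using e pm_nonneg nu_pos by (simp add: h_def)
  (* Brouwer needs a Euclidean space, so the boolean-indexed pair is encoded as a point of the plane *)
  define X :: "real \<times> real \<Rightarrow> bool \<Rightarrow> real" where "X z a = (if a then snd z else fst z)" for z a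
  define f where "f z = (Phi n r t pp C e (X z) False, Phi n r t pp C e (X z) True)" for z
  define S where "S = cbox (0 :: real \<times> real) (h, h)"
  have S: "z \<in> S \<longleftrightarrow> 0 \<le> fst z \<and> fst z \<le> h \<and> 0 \<le> snd z \<and> snd z \<le> h" for z
    by (cases z) (auto simp: S_def zero_prod_def cbox_Pair_eq)
  have X0: "0 \<le> X z a" if "z \<in> S" for z a using that by (auto simp: S X_def)
  define L where "L = pm\<^sup>2 * nu / e\<^sup>2"
  have L: "0 \<le> L" using nu_pos by (simp add: L_def)
  have lip: "\<bar>Phi n r t pp C e (X z) a - Phi n r t pp C e (X y) a\<bar> \<le> 2 * L * dist z y" if "z \<in> S" "y \<in> S" for z y a
  proof -
    have "\<bar>Phi n r t pp C e (X z) a - Phi n r t pp C e (X y) a\<bar> \<le> L * (\<bar>X z False - X y False\<bar> + \<bar>X z True - X y True\<bar>)"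
      unfolding L_def by (rule Phi_lipschitz[OF e X0 X0]) (use that in auto)
    also have "\<dots> \<le> L * (dist z y + dist z y)"
      using dist_fst_le[of z y] dist_snd_le[of z y] L
      by (intro mult_left_mono add_mono) (auto simp: X_def dist_real_def)
    finally show ?thesis by simp
  qed
  have cont: "continuous_on S (\<lambda>z. Phi n r t pp C e (X z) a)" for a
    by (rule lipschitz_on_continuous_on[of "2 * L"], rule lipschitz_onI) (use lip L in \<open>auto simp: dist_real_def\<close>)
  obtain z where z: "z \<in> S" "f z = z"
  proof (rule brouwer[of S f])
    show "compact S" "convex S" by (auto simp: S_def)
    show "S \<noteq> {}" using h S[of 0] by auto
    show "continuous_on S f" unfolding f_def by (intro continuous_on_Pair cont)
    show "f \<in> S \<rightarrow> S"
    proof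
      fix z assume z: "z \<in> S"
      have "Phi n r t pp C e (X z) a \<le> h" for a
        unfolding h_def by (rule Phi_le) (use e X0[OF z] in auto)
      then show "f z \<in> S" using Phi_nonneg[OF e X0[OF z]] by (auto simp: S f_def)
    qed
  qed
  have eq: "Phi n r t pp C e (X z) a = X z a" for a
    using arg_cong[OF z(2), of fst] arg_cong[OF z(2), of snd] by (cases a) (auto simp: f_def X_def)
  have le: "X z a \<le> h" for a using z(1) by (auto simp: S X_def)
  have "e * dl / ((e + 2 * h * pm)\<^sup>2 + b\<^sup>2) \<le> X z a" for a
    unfolding eq[of a, symmetric] by (rule Phi_ge[OF e rows cols]) (auto intro: X0 z le)
  moreover have "0 < e * dl / ((e + 2 * h * pm)\<^sup>2 + b\<^sup>2)"
  proof -
    have "0 < e + 2 * h * pm" using e h pm_nonneg by (intro add_pos_nonneg mult_nonneg_nonneg) auto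
    then show ?thesis using e dl_pos by (intro divide_pos_pos mult_pos_pos add_pos_nonneg) auto
  qed
  ultimately show ?thesis unfolding is_fixed_point_def using eq by (intro exI[of _ "X z"]) (auto intro: less_le_trans)
qed

lemma is_fixed_point_le:
  assumes "0 < e" "is_fixed_point n r t pp C e m"
  shows "m a \<le> pm * nu / e"
  using Phi_le[of e m C a] assms by (auto simp: is_fixed_point_def less_imp_le)

text \<open>Stability with error zero.\<close>

lemma fp_unique:
  assumes e: "0 < e" and rows: "\<And>i. i < r \<Longrightarrow> (\<Sum>j<t. (cmod (C i j))\<^sup>2) \<le> b\<^sup>2"
    and cols: "\<And>j. j < t \<Longrightarrow> (\<Sum>i<r. (cmod (C i j))\<^sup>2) \<le> b\<^sup>2"
    and m: "is_fixed_point n r t pp C e m" and x: "is_fixed_point n r t pp C e x"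
  shows "x = m"
proof
  fix a
  define h where "h = pm * nu / e"
  have hm: "m a \<le> h" and hx: "x a \<le> h" for a
    using is_fixed_point_le[OF e m] is_fixed_point_le[OF e x] by (auto simp: h_def)
  have "\<bar>x a - m a\<bar> \<le> 4 * (h / (e * dl / ((e + 2 * h * pm)\<^sup>2 + b\<^sup>2)))\<^sup>2 * 0"
    by (rule stability[OF e rows cols]) (use m x hm hx dl_pos e in \<open>auto simp: is_fixed_point_def\<close>)
  then show "x a = m a" by simp
qed

text \<open>The lower bound of \<open>Phi\<close> on the box \<open>[0, pm nu / e]\<^sup>2\<close>.\<close>

definition fp_floor :: "real \<Rightarrow> real \<Rightarrow> real" where
  "fp_floor b e = e * dl / ((e + 2 * (pm * nu / e) * pm)\<^sup>2 + b\<^sup>2)"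

definition stab_const :: "real \<Rightarrow> real \<Rightarrow> real" where
  "stab_const b e = 4 * ((pm * nu / e) / fp_floor b e)\<^sup>2"

lemma fp_floor_pos: "0 < e \<Longrightarrow> 0 < fp_floor b e"
proof -
  assume e: "0 < e"
  then have "0 < e + 2 * (pm * nu / e) * pm" using pm_nonneg nu_pos by (intro add_pos_nonneg mult_nonneg_nonneg) auto
  then show ?thesis unfolding fp_floor_def using e dl_pos by (intro divide_pos_pos mult_pos_pos add_pos_nonneg) auto
qed

lemma fp_stable:
  assumes e: "0 < e" and rows: "\<And>i. i < r \<Longrightarrow> (\<Sum>j<t. (cmod (C i j))\<^sup>2) \<le> b\<^sup>2"
    and cols: "\<And>j. j < t \<Longrightarrow> (\<Sum>i<r. (cmod (C i j))\<^sup>2) \<le> b\<^sup>2"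
    and m: "is_fixed_point n r t pp C e m"
    and x: "\<And>a. 0 < x a" "\<And>a. x a \<le> pm * nu / e"
    and approx: "\<And>a. \<bar>x a - Phi n r t pp C e x a\<bar> \<le> eps" and eps: "eps \<le> fp_floor b e / 2"
  shows "\<bar>x a - m a\<bar> \<le> stab_const b e * eps"
proof -
  have hm: "m a \<le> pm * nu / e" for a
    using is_fixed_point_le[OF e m] by simp
  show ?thesis unfolding stab_const_def
    by (rule stability[OF e rows cols]) (use m x hm approx eps in \<open>auto simp: is_fixed_point_def fp_floor_def\<close>)
qed

text \<open>The log-determinant is an integral over all \<open>e\<close> above some \<open>e0\<close>, so the stability estimate is needed
  with a constant that does not depend on \<open>e\<close>.\<close>

lemma uniform_bounds:
  assumes "0 < e0"
  obtains Cs Cl where "0 < Cs" "0 < Cl" "\<And>e. e0 \<le> e \<Longrightarrow> stab_const b e \<le> Cs" "\<And>e. e0 \<le> e \<Longrightarrow> Cl / e \<le> fp_floor b e"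
    "Cs = 4 * (pm * nu * ((1 + 2 * pm\<^sup>2 * nu / e0\<^sup>2)\<^sup>2 + b\<^sup>2 / e0\<^sup>2) / dl)\<^sup>2"
    "Cl = dl / ((1 + 2 * pm\<^sup>2 * nu / e0\<^sup>2)\<^sup>2 + b\<^sup>2 / e0\<^sup>2)"
proof -
  define k where "k = (1 + 2 * pm\<^sup>2 * nu / e0\<^sup>2)\<^sup>2 + b\<^sup>2 / e0\<^sup>2"
  have "0 < 1 + 2 * pm\<^sup>2 * nu / e0\<^sup>2" using assms nu_pos by (intro add_pos_nonneg) auto
  then have k: "0 < k" using assms by (simp add: k_def add_pos_nonneg)
  have fp_floor_ge: "dl / k / e \<le> fp_floor b e" if e: "e0 \<le> e" for e
  proof -
    have e': "0 < e" using e assms by linarith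
    have sq: "e0\<^sup>2 \<le> e\<^sup>2" using e assms by (intro power_mono) auto
    have "2 * (pm * nu / e) * pm = e * (2 * pm\<^sup>2 * nu / e\<^sup>2)"
      using e' by (simp add: field_simps power2_eq_square)
    also have "\<dots> \<le> e * (2 * pm\<^sup>2 * nu / e0\<^sup>2)"
      using sq e' assms nu_pos by (intro mult_left_mono divide_left_mono) auto
    finally have "e + 2 * (pm * nu / e) * pm \<le> e * (1 + 2 * pm\<^sup>2 * nu / e0\<^sup>2)" by (simp add: algebra_simps)
    then have "(e + 2 * (pm * nu / e) * pm)\<^sup>2 \<le> (e * (1 + 2 * pm\<^sup>2 * nu / e0\<^sup>2))\<^sup>2"
      using e' pm_nonneg nu_pos by (intro power_mono add_nonneg_nonneg mult_nonneg_nonneg) auto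
    moreover have "b\<^sup>2 \<le> e\<^sup>2 * (b\<^sup>2 / e0\<^sup>2)"
      using mult_right_mono[OF sq, of "b\<^sup>2 / e0\<^sup>2"] assms by simp
    ultimately have den: "(e + 2 * (pm * nu / e) * pm)\<^sup>2 + b\<^sup>2 \<le> e\<^sup>2 * k"
      unfolding k_def power_mult_distrib distrib_left[of "e\<^sup>2"] by (rule add_mono)
    have "dl / k / e = e * dl / (e\<^sup>2 * k)" using e' by (simp add: power2_eq_square)
    also have "\<dots> \<le> fp_floor b e" unfolding fp_floor_def
    proof (rule divide_left_mono[OF den])
      have "0 < (e + 2 * (pm * nu / e) * pm)\<^sup>2 + b\<^sup>2"
        using e' pm_nonneg nu_pos
        by (intro add_pos_nonneg zero_less_power mult_nonneg_nonneg) auto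
      then show "0 < e\<^sup>2 * k * ((e + 2 * (pm * nu / e) * pm)\<^sup>2 + b\<^sup>2)" using e' k by simp
    qed (use e' dl_pos in auto)
    finally show ?thesis .
  qed
  show ?thesis
  proof (rule that[of "4 * (pm * nu * k / dl)\<^sup>2" "dl / k"])
    show "0 < 4 * (pm * nu * k / dl)\<^sup>2" using pm_pos nu_pos k dl_pos by simp
    show "stab_const b e \<le> 4 * (pm * nu * k / dl)\<^sup>2" if "e0 \<le> e" for e
    proof -
      have e': "0 < e" using that assms by linarith
      have "(pm * nu / e) / fp_floor b e \<le> (pm * nu / e) / (dl / k / e)"
        using fp_floor_ge[OF that] e' k dl_pos pm_pos nu_pos fp_floor_pos[OF e', of b] by (intro divide_left_mono) auto
      also have "\<dots> = pm * nu * k / dl" using e' k by simp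
      finally show ?thesis unfolding stab_const_def using pm_pos nu_pos e' fp_floor_pos[OF e', of b]
        by (intro mult_left_mono power_mono) auto
    qed
  qed (use dl_pos k fp_floor_ge in \<open>auto simp: k_def\<close>)
qed

definition fixed_pt :: "(nat \<Rightarrow> nat \<Rightarrow> complex) \<Rightarrow> real \<Rightarrow> bool \<Rightarrow> real" where
  "fixed_pt C e = (THE m. is_fixed_point n r t pp C e m)"

lemma fixed_pt:
  assumes e: "0 < e" and rows: "\<And>i. i < r \<Longrightarrow> (\<Sum>j<t. (cmod (C i j))\<^sup>2) \<le> b\<^sup>2"
    and cols: "\<And>j. j < t \<Longrightarrow> (\<Sum>i<r. (cmod (C i j))\<^sup>2) \<le> b\<^sup>2"
  shows "is_fixed_point n r t pp C e (fixed_pt C e)"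
proof -
  obtain m where m: "is_fixed_point n r t pp C e m" using fp_exists[OF e rows cols] by blast
  show ?thesis unfolding fixed_pt_def
    by (rule theI[of _ m]) (use m fp_unique[OF e rows cols] in auto)
qed

text \<open>A fixed point for the parameter \<open>e'\<close> is an approximate fixed point for the parameter \<open>e\<close>, with error
  of order \<open>e' - e\<close>, so stability applies to it.\<close>

lemma fixed_pt_close:
  assumes rows: "\<And>i. i < r \<Longrightarrow> (\<Sum>j<t. (cmod (C i j))\<^sup>2) \<le> b\<^sup>2"
    and cols: "\<And>j. j < t \<Longrightarrow> (\<Sum>i<r. (cmod (C i j))\<^sup>2) \<le> b\<^sup>2"
    and e: "0 < e0" "e0 \<le> e" "e \<le> e'"
    and small: "pm * nu / e0\<^sup>2 * (e' - e) \<le> fp_floor b e / 2"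
  shows "\<bar>fixed_pt C e' a - fixed_pt C e a\<bar> \<le> stab_const b e * (pm * nu / e0\<^sup>2 * (e' - e))"
proof -
  have e': "0 < e" "0 < e'" using e by auto
  define x where "x = fixed_pt C e'"
  note fp = fixed_pt[OF e'(1) rows cols]
  have fp': "is_fixed_point n r t pp C e' x" unfolding x_def by (rule fixed_pt[OF e'(2) rows cols])
  then have x0: "0 < x a" for a by (simp add: is_fixed_point_def)
  show ?thesis unfolding x_def[symmetric]
  proof (rule fp_stable[OF e'(1) rows cols fp x0 _ _ small])
    show "x a \<le> pm * nu / e" for a
    proof -
      have "x a \<le> pm * nu / e'" by (rule is_fixed_point_le[OF e'(2) fp'])
      also have "\<dots> \<le> pm * nu / e" using e' e(3) pm_nonneg nu_pos by (intro divide_left_mono) auto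
      finally show ?thesis .
    qed
    show "\<bar>x a - Phi n r t pp C e x a\<bar> \<le> pm * nu / e0\<^sup>2 * (e' - e)" for a
    proof -
      let ?R = "\<lambda>e. res n r (wt pp e x) C"
      have wtp: "0 < wt pp u x i" if "0 < u" "i < n" for u i
        using wt_pos[OF that(1), of x i] x0 that by (simp add: less_imp_le)
      have d: "\<bar>Re (?R e i i) - Re (?R e' i i)\<bar> \<le> (e' - e) / e0\<^sup>2" if i: "i < n" for i
      proof -
        have "\<bar>Re (?R e i i) - Re (?R e' i i)\<bar> \<le> cmod (?R e i i - ?R e' i i)"
          using abs_Re_le_cmod[of "?R e i i - ?R e' i i"] by simp
        also have "?R e i i - ?R e' i i = (\<Sum>k<n. of_real (wt pp e' x k - wt pp e x k) * ?R e i k * ?R e' k i)"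
          by (rule res_diff_diag) (use wtp e' i in auto)
        also have "\<dots> = of_real (e' - e) * (\<Sum>k<n. ?R e i k * ?R e' k i)"
          unfolding sum_distrib_left by (intro sum.cong refl) (simp add: wt_def)
        also have "\<dots> = of_real (e' - e) * mm n (?R e) (?R e') i i" by (simp only: mm_def)
        also have "cmod \<dots> = (e' - e) * cmod (mm n (?R e) (?R e') i i)"
          using e(3) by (simp add: norm_mult del: of_real_diff)
        also have "\<dots> \<le> (e' - e) * (1 / e0 * (1 / e0))"
        proof (rule mult_left_mono)
          have "cmod (mm n (?R e) (?R e') i i) \<le> 1 / e * (1 / e')"
            by (rule op_bound_entry[OF op_bound_mm[OF op_bound_res op_bound_res] i i])
              (use e' in \<open>auto intro!: wt_ge less_imp_le[OF x0]\<close>)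
          also have "\<dots> \<le> 1 / e0 * (1 / e0)"
            using e by (intro mult_mono divide_left_mono) auto
          finally show "cmod (mm n (?R e) (?R e') i i) \<le> 1 / e0 * (1 / e0)" .
        qed (use e in simp)
        finally show ?thesis by (simp add: power2_eq_square)
      qed
      have "x a = Phi n r t pp C e' x a" using fp' by (simp add: is_fixed_point_def)
      then have eq: "x a - Phi n r t pp C e x a = (\<Sum>i<n. pp a i * (Re (?R e' i i) - Re (?R e i i))) / real t"
        by (simp add: Phi_def right_diff_distrib sum_subtractf diff_divide_distrib)
      have "\<bar>x a - Phi n r t pp C e x a\<bar> \<le> (\<Sum>i<n. pp a i * \<bar>Re (?R e i i) - Re (?R e' i i)\<bar>) / real t"
        unfolding eq abs_divide using pp_nonneg
        by (simp, intro divide_right_mono order_trans[OF sum_abs] sum_mono) (auto simp: abs_mult abs_minus_commute)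
      also have "\<dots> \<le> pm * nu * ((e' - e) / e0\<^sup>2)"
      proof (rule avg_le)
        show "0 \<le> (e' - e) / e0\<^sup>2" using e by simp
      qed (rule d)
      finally show ?thesis by simp
    qed
  qed
qed

text \<open>Continuity provides the measurability in the integral that represents the log-determinant, and stability
  provides it without the implicit function theorem.\<close>

lemma fixed_pt_continuous:
  assumes rows: "\<And>i. i < r \<Longrightarrow> (\<Sum>j<t. (cmod (C i j))\<^sup>2) \<le> b\<^sup>2"
    and cols: "\<And>j. j < t \<Longrightarrow> (\<Sum>i<r. (cmod (C i j))\<^sup>2) \<le> b\<^sup>2"
  shows "continuous_on {0<..} (\<lambda>e. fixed_pt C e a)"
proof (rule continuous_at_imp_continuous_on, intro ballI)
  fix e1 :: real assume "e1 \<in> {0<..}"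
  then have e1: "0 < e1" by simp
  (* half of e1 leaves room on both sides of e1 for the uniform constants *)
  define e0 where "e0 = e1 / 2"
  have e0: "0 < e0" "e0 < e1" using e1 by (auto simp: e0_def)
  obtain Cs Cl where C: "0 < Cs" "0 < Cl" "\<And>e. e0 \<le> e \<Longrightarrow> stab_const b e \<le> Cs" "\<And>e. e0 \<le> e \<Longrightarrow> Cl / e \<le> fp_floor b e"
    using uniform_bounds[OF e0(1), of b] by metis
  define q where "q = pm * nu / e0\<^sup>2"
  have q: "0 < q" using pm_pos nu_pos e0 by (simp add: q_def)
  have main: "\<bar>fixed_pt C e' a - fixed_pt C e a\<bar> \<le> Cs * (q * \<bar>e' - e\<bar>)"
    if "e0 \<le> e" "e \<le> e'" "e \<le> e1" "q * (e' - e) \<le> Cl / e1 / 2" for e e'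
  proof -
    have "Cl / e1 \<le> Cl / e" using that e0 C(2) by (intro divide_left_mono) auto
    then have "Cl / e1 \<le> fp_floor b e" using C(4)[OF that(1)] by linarith
    then have "\<bar>fixed_pt C e' a - fixed_pt C e a\<bar> \<le> stab_const b e * (pm * nu / e0\<^sup>2 * (e' - e))"
    proof (intro fixed_pt_close[OF rows cols])
      show "pm * nu / e0\<^sup>2 * (e' - e) \<le> fp_floor b e / 2"
        unfolding q_def[symmetric] by (rule order_trans[OF that(4) divide_right_mono[OF \<open>Cl / e1 \<le> fp_floor b e\<close>]]) simp
    qed (use that e0 in auto)
    also have "\<dots> \<le> Cs * (q * (e' - e))" unfolding q_def[symmetric]
      using C(3)[OF that(1)] q that by (intro mult_right_mono) auto
    finally show ?thesis using that by simp
  qed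
  have ev: "eventually (\<lambda>e. q * \<bar>e - e1\<bar> \<le> Cl / e1 / 2 \<and> e0 \<le> e) (at e1)"
  proof (intro eventually_conj)
    have "((\<lambda>e. q * \<bar>e - e1\<bar>) \<longlongrightarrow> q * \<bar>e1 - e1\<bar>) (at e1)" by (intro tendsto_intros)
    then have "((\<lambda>e. q * \<bar>e - e1\<bar>) \<longlongrightarrow> 0) (at e1)" by simp
    then have "eventually (\<lambda>e. q * \<bar>e - e1\<bar> < Cl / e1 / 2) (at e1)"
      using C(2) e1 by (intro order_tendstoD(2)[of _ 0]) auto
    then show "eventually (\<lambda>e. q * \<bar>e - e1\<bar> \<le> Cl / e1 / 2) (at e1)" by eventually_elim simp
    have "eventually (\<lambda>e. e0 < e) (at e1)" using order_tendstoD(1)[OF tendsto_ident_at e0(2)] .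
    then show "eventually (\<lambda>e. e0 \<le> e) (at e1)" by eventually_elim simp
  qed
  have "((\<lambda>e. fixed_pt C e a - fixed_pt C e1 a) \<longlongrightarrow> 0) (at e1)"
  proof (rule tendsto_0_le[of "\<lambda>e. q * \<bar>e - e1\<bar>" _ _ Cs])
    have "((\<lambda>e. q * \<bar>e - e1\<bar>) \<longlongrightarrow> q * \<bar>e1 - e1\<bar>) (at e1)" by (intro tendsto_intros)
    then show "((\<lambda>e. q * \<bar>e - e1\<bar>) \<longlongrightarrow> 0) (at e1)" by simp
    from ev show "eventually (\<lambda>e. norm (fixed_pt C e a - fixed_pt C e1 a) \<le> norm (q * \<bar>e - e1\<bar>) * Cs) (at e1)"
    proof eventually_elim
      case (elim e)
      show ?case
      proof (cases "e \<le> e1")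
        case True
        then show ?thesis using main[of e e1] elim q by (simp add: abs_minus_commute mult_ac abs_mult)
      next
        case False
        then show ?thesis using main[of e1 e] elim q e0 by (simp add: abs_minus_commute mult_ac abs_mult)
      qed
    qed
  qed
  then show "isCont (\<lambda>e. fixed_pt C e a) e1" unfolding isCont_def by (rule LIM_zero_cancel)
qed

end

section \<open>The centered normal law of variance one half\<close>

text \<open>The common law of the real and imaginary parts of the noise.\<close>

definition gauss :: "real measure" where
  "gauss = density lborel (\<lambda>u. ennreal (normal_density 0 (sqrt (1/2)) u))"

lemma prob_space_gauss: "prob_space gauss"
  unfolding gauss_def by (rule prob_space_normal_density) simp

lemma sets_gauss [simp, measurable_cong]: "sets gauss = sets borel"
  and space_gauss [simp]: "space gauss = UNIV"
  by (simp_all add: gauss_def)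

lemma gauss_density: "normal_density 0 (sqrt (1/2)) u = exp (- (u\<^sup>2)) / sqrt pi"
  by (simp add: normal_density_def)

lemma integrable_gauss_iff:
  fixes f :: "real \<Rightarrow> 'a :: {banach, second_countable_topology}"
  assumes "f \<in> borel_measurable borel"
  shows "integrable gauss f \<longleftrightarrow> integrable lborel (\<lambda>u. normal_density 0 (sqrt (1/2)) u *\<^sub>R f u)"
  unfolding gauss_def using assms by (subst integrable_density) auto

lemma integral_gauss:
  fixes f :: "real \<Rightarrow> 'a :: {banach, second_countable_topology}"
  assumes "f \<in> borel_measurable borel"
  shows "integral\<^sup>L gauss f = (\<integral>u. normal_density 0 (sqrt (1/2)) u *\<^sub>R f u \<partial>lborel)"
  unfolding gauss_def using assms by (subst integral_density) auto

lemma integrable_gauss_poly: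
  "integrable gauss (\<lambda>u. \<bar>u\<bar> ^ k)"
  using integrable_normal_moment_abs[of "sqrt (1/2)" 0 k]
  by (subst integrable_gauss_iff) auto

text \<open>The derivative of the density \<open>ph\<close> is \<open>-2 u ph u\<close>, so the derivative of \<open>ph F\<close> integrates to
  zero. Linear growth of \<open>F\<close> is allowed because the Poincare inequality below applies the formula to an
  unbounded antiderivative.\<close>

lemma gauss_ibp:
  fixes F F' :: "real \<Rightarrow> 'a :: euclidean_space"
  assumes der: "\<And>u. (F has_vector_derivative F' u) (at u)"
    and cont: "\<And>u. isCont F' u" and F': "\<And>u. norm (F' u) \<le> c" and F: "\<And>u. norm (F u) \<le> A + c * \<bar>u\<bar>"
  shows "(\<integral>u. u *\<^sub>R F u \<partial>gauss) = (1/2) *\<^sub>R (\<integral>u. F' u \<partial>gauss)"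
    and "integrable gauss (\<lambda>u. u *\<^sub>R F u)"
proof -
  interpret prob_space gauss by (rule prob_space_gauss)
  have Fc: "isCont F u" for u using der has_vector_derivative_continuous by blast
  have Fm[measurable]: "F \<in> borel_measurable borel"
    using Fc by (intro borel_measurable_continuous_onI) (simp add: continuous_at_imp_continuous_on)
  have F'm[measurable]: "F' \<in> borel_measurable borel"
    using cont by (intro borel_measurable_continuous_onI) (simp add: continuous_at_imp_continuous_on)
  have c0: "0 \<le> c" using F'[of 0] norm_ge_zero order_trans by blast
  have A0: "0 \<le> A" using order_trans[OF norm_ge_zero F[of 0]] by simp
  show int1: "integrable gauss (\<lambda>u. u *\<^sub>R F u)"
  proof (rule Bochner_Integration.integrable_bound)
    show "integrable gauss (\<lambda>u. A * \<bar>u\<bar> ^ 1 + c * \<bar>u\<bar> ^ 2)"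
      by (intro Bochner_Integration.integrable_add integrable_mult_right integrable_gauss_poly)
    have "norm (u *\<^sub>R F u) \<le> norm (A * \<bar>u\<bar> ^ 1 + c * \<bar>u\<bar> ^ 2)" for u
      using mult_left_mono[OF F[of u], of "\<bar>u\<bar>"] A0 c0
      by (simp add: power2_eq_square algebra_simps)
    then show "AE u in gauss. norm (u *\<^sub>R F u) \<le> norm (A * \<bar>u\<bar> ^ 1 + c * \<bar>u\<bar> ^ 2)" by simp
  qed simp
  have int2: "integrable gauss F'"
    by (rule integrable_const_bound[of _ c]) (use F' in auto)
  define k where "k = 1 / sqrt pi"
  have k: "0 < k" by (simp add: k_def)
  define ph where "ph u = k * exp (- (u\<^sup>2))" for u :: real
  have ph: "normal_density 0 (sqrt (1/2)) = ph" by (rule ext) (simp add: gauss_density ph_def k_def)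
  have ph': "(ph has_real_derivative - 2 * u * ph u) (at u)" for u
    unfolding ph_def by (auto intro!: derivative_eq_intros)
  have phc: "isCont ph u" for u using ph' DERIV_isCont by blast
  (* f is the derivative of ph F *)
  define f where "f u = ph u *\<^sub>R F' u - 2 *\<^sub>R (ph u *\<^sub>R (u *\<^sub>R F u))" for u
  have i1: "integrable lborel (\<lambda>u. ph u *\<^sub>R (u *\<^sub>R F u))" and i2: "integrable lborel (\<lambda>u. ph u *\<^sub>R F' u)"
    using int1 int2 integrable_gauss_iff[of "\<lambda>u. u *\<^sub>R F u"] integrable_gauss_iff[of F'] by (simp_all only: ph, simp_all)
  have fint: "integrable lborel f"
    unfolding f_def by (intro Bochner_Integration.integrable_diff integrable_scaleR_right i1 i2)
  have lim: "((\<lambda>u. ph u *\<^sub>R F u) \<longlongrightarrow> 0) G" if "G = at_top \<or> G = at_bot" for G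
  proof (rule Lim_null_comparison)
    show "eventually (\<lambda>u. norm (ph u *\<^sub>R F u) \<le> ph u * (A + c * \<bar>u\<bar>)) G"
      using F k by (auto simp: ph_def intro!: always_eventually mult_left_mono)
    have "((\<lambda>u. ph u * (A + c * \<bar>u\<bar>)) \<longlongrightarrow> 0) at_top" "((\<lambda>u. ph u * (A + c * \<bar>u\<bar>)) \<longlongrightarrow> 0) at_bot"
      unfolding ph_def using k by real_asymp+
    then show "((\<lambda>u. ph u * (A + c * \<bar>u\<bar>)) \<longlongrightarrow> 0) G" using that by auto
  qed
  have "(LBINT u=-\<infinity>..\<infinity>. f u) = 0 - 0"
  proof (rule interval_integral_FTC_integrable)
    show "((\<lambda>u. ph u *\<^sub>R F u) has_vector_derivative f u) (at u)" for u
      unfolding f_def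
      by (rule has_vector_derivative_eq_rhs, rule has_vector_derivative_scaleR[OF ph' der]) (simp add: algebra_simps)
    show "isCont f u" for u unfolding f_def by (intro continuous_intros cont Fc phc)
    show "set_integrable lborel (einterval (-\<infinity>) \<infinity>) f"
      using fint by (simp add: set_integrable_def)
    show "(((\<lambda>u. ph u *\<^sub>R F u) \<circ> real_of_ereal) \<longlongrightarrow> 0) (at_right (-\<infinity>))"
      "(((\<lambda>u. ph u *\<^sub>R F u) \<circ> real_of_ereal) \<longlongrightarrow> 0) (at_left \<infinity>)"
      using lim by (simp_all add: ereal_tendsto_simps1)
  qed simp
  then have "integral\<^sup>L lborel f = 0"
    by (simp add: interval_lebesgue_integral_def set_lebesgue_integral_def)
  moreover have "integral\<^sup>L lborel f = (\<integral>u. F' u \<partial>gauss) - 2 *\<^sub>R (\<integral>u. u *\<^sub>R F u \<partial>gauss)"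
    unfolding f_def Bochner_Integration.integral_diff[OF i2 integrable_scaleR_right[OF i1]]
    by (simp only: ph integral_gauss[of F'] integral_gauss[of "\<lambda>u. u *\<^sub>R F u"] integral_scaleR_right F'm) (simp add: integral_gauss ph)
  ultimately show "(\<integral>u. u *\<^sub>R F u \<partial>gauss) = (1/2) *\<^sub>R (\<integral>u. F' u \<partial>gauss)" by simp
qed

text \<open>Cauchy-Schwarz for the integral of \<open>F'\<close> over an interval. Phrasing it with an antiderivative \<open>H\<close> of
  the squared speed allows a proof by the mean value inequality, through
  \<open>|F'| \<le> (l + |F'|\<^sup>2 / l) / 2\<close> with the optimal \<open>l\<close>.\<close>

lemma increment_sq_le:
  fixes F F' :: "real \<Rightarrow> 'a :: euclidean_space"
  assumes der: "\<And>u. (F has_vector_derivative F' u) (at u)"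
    and H: "\<And>u. (H has_vector_derivative (norm (F' u))\<^sup>2) (at u)" and ab: "a < b"
  shows "(norm (F b - F a))\<^sup>2 \<le> (b - a) * (H b - H a)"
proof (cases "F b = F a")
  case True
  have "norm (0 :: real) \<le> H b - H a"
    using differentiable_bound_general[OF ab, of "\<lambda>_. 0 :: real" H "\<lambda>_. 0" "\<lambda>u. (norm (F' u))\<^sup>2"] H
    by (auto intro!: continuous_at_imp_continuous_on has_vector_derivative_continuous)
  then show ?thesis using True ab by simp
next
  case False
  define D where "D = norm (F b - F a)"
  have D: "0 < D" using False by (simp add: D_def)
  (* the mean speed is the optimal balance in the arithmetic-geometric inequality *)
  define l where "l = D / (b - a)"
  have l: "0 < l" using D ab by (simp add: l_def)
  have "norm (F b - F a) \<le> (l * b + H b / l) / 2 - (l * a + H a / l) / 2"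
  proof (rule differentiable_bound_general[OF ab])
    show "((\<lambda>u. (l * u + H u / l) / 2) has_vector_derivative (l + (norm (F' u))\<^sup>2 / l) / 2) (at u)" for u
      using H[of u] l unfolding has_real_derivative_iff_has_vector_derivative[symmetric]
      by (auto intro!: derivative_eq_intros simp: field_simps)
    then show "continuous_on {a..b} (\<lambda>u. (l * u + H u / l) / 2)"
      by (intro continuous_at_imp_continuous_on ballI) (rule has_vector_derivative_continuous)
    show "continuous_on {a..b} F"
      using der by (intro continuous_at_imp_continuous_on ballI) (rule has_vector_derivative_continuous)
    show "norm (F' x) \<le> (l + (norm (F' x))\<^sup>2 / l) / 2" for x
    proof -
      have "0 \<le> (l - norm (F' x))\<^sup>2" by simp
      then have "norm (F' x) * (2 * l) \<le> l * l + (norm (F' x))\<^sup>2" by (simp add: power2_eq_square algebra_simps)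
      then show ?thesis using l by (simp add: field_simps)
    qed
  qed (rule der)
  also have "\<dots> = (l * (b - a) + (H b - H a) / l) / 2" by (simp add: algebra_simps diff_divide_distrib)
  finally have "2 * D \<le> l * (b - a) + (H b - H a) / l" by (simp add: D_def)
  then have "D \<le> (H b - H a) * (b - a) / D" using ab D by (simp add: l_def)
  then have "D * D \<le> (H b - H a) * (b - a)" using D by (simp add: pos_le_divide_eq)
  then show ?thesis by (simp add: D_def power2_eq_square mult.commute)
qed

lemma (in prob_space) integrable_bdd:
  fixes f :: "'a \<Rightarrow> 'b :: {banach, second_countable_topology}"
  assumes "f \<in> borel_measurable M" "\<And>x. x \<in> space M \<Longrightarrow> norm (f x) \<le> c"
  shows "integrable M f"
  by (rule integrable_const_bound[of _ c]) (use assms in auto)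

lemma (in prob_space) variance_decomp:
  fixes f :: "'a \<Rightarrow> complex"
  assumes "integrable M f" "integrable M (\<lambda>x. (cmod (f x))\<^sup>2)"
  shows "(\<integral>x. (cmod (f x - c))\<^sup>2 \<partial>M) = complex_variance M f + (cmod ((\<integral>x. f x \<partial>M) - c))\<^sup>2"
proof -
  have eq: "(cmod (z - w))\<^sup>2 = (cmod z)\<^sup>2 - 2 * Re (cnj w * z) + (cmod w)\<^sup>2" for z w
    unfolding cmod_power2 by (simp add: power2_eq_square algebra_simps)
  have i: "integrable M (\<lambda>x. cnj c * f x)" using assms(1) by simp
  have "(\<integral>x. (cmod (f x - c))\<^sup>2 \<partial>M) = (\<integral>x. (cmod (f x))\<^sup>2 \<partial>M) - 2 * (\<integral>x. Re (cnj c * f x) \<partial>M) + (cmod c)\<^sup>2"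
    unfolding eq using assms i by (simp add: prob_space)
  also have "(\<integral>x. Re (cnj c * f x) \<partial>M) = Re (cnj c * (\<integral>x. f x \<partial>M))"
    using integral_Re[OF i] by simp
  finally show ?thesis unfolding eq complex_variance_def by simp
qed

lemma (in prob_space) variance_eq:
  fixes f :: "'a \<Rightarrow> complex"
  assumes "integrable M f" "integrable M (\<lambda>x. (cmod (f x))\<^sup>2)"
  shows "complex_variance M f = (\<integral>x. (cmod (f x - (\<integral>x. f x \<partial>M)))\<^sup>2 \<partial>M)"
  using variance_decomp[OF assms, of "\<integral>x. f x \<partial>M"] by simp

text \<open>The mean is the point of least mean square distance.\<close>

lemma (in prob_space) variance_le:
  fixes f :: "'a \<Rightarrow> complex"
  assumes "integrable M f" "integrable M (\<lambda>x. (cmod (f x))\<^sup>2)"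
  shows "complex_variance M f \<le> (\<integral>x. (cmod (f x - c))\<^sup>2 \<partial>M)"
  using variance_decomp[OF assms, of c] by simp

lemma (in prob_space) variance_nonneg:
  fixes f :: "'a \<Rightarrow> complex"
  assumes "integrable M f" "integrable M (\<lambda>x. (cmod (f x))\<^sup>2)"
  shows "0 \<le> complex_variance M f"
  using variance_eq[OF assms] by simp

text \<open>With \<open>H\<close> the antiderivative of \<open>|F'|\<^sup>2\<close> vanishing at zero, \<open>|F u - F 0|\<^sup>2 \<le> u H u\<close>, and
  integration by parts turns the mean of \<open>u H u\<close> into half the mean of \<open>|F'|\<^sup>2\<close>.\<close>

lemma gauss_poincare:
  fixes F F' :: "real \<Rightarrow> complex"
  assumes der: "\<And>u. (F has_vector_derivative F' u) (at u)"
    and cont: "\<And>u. isCont F' u" and F': "\<And>u. norm (F' u) \<le> c" and F: "\<And>u. norm (F u) \<le> A"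
  shows "complex_variance gauss F \<le> (1/2) * (\<integral>u. (cmod (F' u))\<^sup>2 \<partial>gauss)"
proof -
  interpret prob_space gauss by (rule prob_space_gauss)
  have Fm[measurable]: "F \<in> borel_measurable borel"
    using der by (intro borel_measurable_continuous_onI continuous_at_imp_continuous_on ballI) (rule has_vector_derivative_continuous)
  have contsq: "isCont (\<lambda>u. (cmod (F' u))\<^sup>2) u" for u by (intro continuous_intros cont)
  obtain H0 where H0: "\<And>u. (H0 has_vector_derivative (cmod (F' u))\<^sup>2) (at u)"
    using einterval_antiderivative[of "-\<infinity>" \<infinity> "\<lambda>u. (cmod (F' u))\<^sup>2"] contsq by auto
  define H where "H u = H0 u - H0 0" for u
  have H: "(H has_vector_derivative (cmod (F' u))\<^sup>2) (at u)" for u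
    unfolding H_def using H0[of u] by (auto intro!: derivative_eq_intros)
  have c0: "0 \<le> c" using F'[of 0] norm_ge_zero order_trans by blast
  have sq: "(cmod (F' u))\<^sup>2 \<le> c\<^sup>2" for u using F'[of u] by (intro power_mono) auto
  have Hlin: "norm (H u) \<le> 0 + c\<^sup>2 * \<bar>u\<bar>" for u
  proof -
    have "norm (H u - H 0) \<le> c\<^sup>2 * norm (u - 0)"
    proof (rule differentiable_bound[of UNIV])
      show "(H has_derivative (\<lambda>h. h *\<^sub>R (cmod (F' x))\<^sup>2)) (at x within UNIV)" for x
        using H[of x] by (simp add: has_vector_derivative_def)
      show "onorm (\<lambda>h. h *\<^sub>R (cmod (F' x))\<^sup>2) \<le> c\<^sup>2" for x
        by (rule onorm_le) (use sq[of x] in \<open>simp add: abs_mult mult.commute mult_left_mono\<close>)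
    qed auto
    then show ?thesis by (simp add: H_def)
  qed
  note ibp = gauss_ibp[OF H contsq _ Hlin]
  have sqn: "norm ((cmod (F' u))\<^sup>2) \<le> c\<^sup>2" for u using sq[of u] by simp
  have FH: "(cmod (F u - F 0))\<^sup>2 \<le> u * H u" for u
  proof -
    consider "u = 0" | "0 < u" | "u < 0" by linarith
    then show ?thesis
    proof cases
      case 2 then show ?thesis using increment_sq_le[OF der H, of 0 u] by (simp add: H_def)
    next
      case 3 then show ?thesis using increment_sq_le[OF der H, of u 0] by (simp add: H_def norm_minus_commute algebra_simps)
    qed simp
  qed
  have Fi: "integrable gauss F" by (rule integrable_bdd[of _ A]) (use F in auto)
  have Fi2: "integrable gauss (\<lambda>u. (cmod (F u))\<^sup>2)"
    by (rule integrable_bdd[of _ "A\<^sup>2"]) (use F in \<open>auto intro!: power_mono\<close>)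
  have "complex_variance gauss F \<le> (\<integral>u. (cmod (F u - F 0))\<^sup>2 \<partial>gauss)"
    by (rule variance_le[OF Fi Fi2])
  also have "\<dots> \<le> (\<integral>u. u *\<^sub>R H u \<partial>gauss)"
  proof (rule integral_mono)
    show "integrable gauss (\<lambda>u. (cmod (F u - F 0))\<^sup>2)"
    proof (rule integrable_bdd[of _ "(2 * A)\<^sup>2"])
      show "norm ((cmod (F u - F 0))\<^sup>2) \<le> (2 * A)\<^sup>2" for u
        using norm_triangle_ineq4[of "F u" "F 0"] F[of u] F[of 0] power_mono[of "cmod (F u - F 0)" "2 * A" 2] by simp
    qed simp
    show "integrable gauss (\<lambda>u. u *\<^sub>R H u)" by (rule ibp(2)[OF sqn])
    show "(cmod (F u - F 0))\<^sup>2 \<le> u *\<^sub>R H u" for u using FH by simp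
  qed
  also have "\<dots> = (1/2) * (\<integral>u. (cmod (F' u))\<^sup>2 \<partial>gauss)"
    using ibp(1)[OF sqn] by simp
  finally show ?thesis .
qed

lemma (in prob_space) variance_bounds:
  fixes f :: "'a \<Rightarrow> complex"
  assumes "f \<in> borel_measurable M" "\<And>x. x \<in> space M \<Longrightarrow> cmod (f x) \<le> c"
  shows "0 \<le> complex_variance M f" "complex_variance M f \<le> c\<^sup>2"
    "integrable M f" "integrable M (\<lambda>x. (cmod (f x))\<^sup>2)"
proof -
  show i1: "integrable M f" by (rule integrable_bdd[OF assms])
  show i2: "integrable M (\<lambda>x. (cmod (f x))\<^sup>2)"
    by (rule integrable_bdd[of _ "c\<^sup>2"]) (use assms in \<open>auto intro!: power_mono\<close>)
  show "0 \<le> complex_variance M f" by (rule variance_nonneg[OF i1 i2])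
  have "complex_variance M f \<le> (\<integral>x. (cmod (f x))\<^sup>2 \<partial>M)" by (simp add: complex_variance_def)
  also have "\<dots> \<le> (\<integral>x. c\<^sup>2 \<partial>M)"
    by (rule integral_mono[OF i2]) (use assms in \<open>auto intro!: power_mono\<close>)
  finally show "complex_variance M f \<le> c\<^sup>2" by (simp add: prob_space)
qed

lemma (in prob_space) norm_integral_le:
  fixes f :: "'a \<Rightarrow> 'b :: {banach, second_countable_topology}"
  assumes "\<And>x. x \<in> space M \<Longrightarrow> norm (f x) \<le> c" "0 \<le> c"
  shows "norm (\<integral>x. f x \<partial>M) \<le> c"
proof (cases "integrable M f")
  case True
  have "norm (\<integral>x. f x \<partial>M) \<le> (\<integral>x. norm (f x) \<partial>M)" by (rule integral_norm_bound)
  also have "\<dots> \<le> (\<integral>x. c \<partial>M)"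
    by (rule integral_mono) (use True assms in auto)
  finally show ?thesis by (simp add: prob_space)
qed (simp add: not_integrable_integral_eq assms)

section \<open>Efron-Stein and Poincare inequalities on product spaces\<close>

text \<open>Averaging over an independent variable does not increase the variance, by convexity of the square;
  this is the induction step of the Efron-Stein inequality.\<close>

lemma variance_average_le:
  fixes G :: "'a \<Rightarrow> 'b \<Rightarrow> complex"
  assumes "prob_space A" "prob_space B"
    and G[measurable]: "(\<lambda>(a, b). G a b) \<in> borel_measurable (A \<Otimes>\<^sub>M B)"
    and bd: "\<And>a b. a \<in> space A \<Longrightarrow> b \<in> space B \<Longrightarrow> cmod (G a b) \<le> c"
  shows "complex_variance A (\<lambda>a. \<integral>b. G a b \<partial>B) \<le> (\<integral>b. complex_variance A (\<lambda>a. G a b) \<partial>B)"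
proof -
  interpret A: prob_space A by fact
  interpret B: prob_space B by fact
  interpret P: pair_sigma_finite A B ..
  interpret PP: pair_prob_space A B ..
  have c0: "0 \<le> c"
    using bd A.not_empty B.not_empty norm_ge_zero order_trans by (metis all_not_in_conv)
  define h where "h b = (\<integral>a. G a b \<partial>A)" for b
  have [measurable]: "h \<in> borel_measurable B"
    unfolding h_def by measurable
  define U where "U a b = G a b - h b" for a b
  have [measurable]: "(\<lambda>(a, b). U a b) \<in> borel_measurable (A \<Otimes>\<^sub>M B)"
    unfolding U_def by measurable
  have hb: "cmod (h b) \<le> c" if "b \<in> space B" for b
    unfolding h_def by (rule A.norm_integral_le[OF bd[OF _ that] c0])
  have Ub: "cmod (U a b) \<le> 2 * c" if "a \<in> space A" "b \<in> space B" for a b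
    using norm_triangle_ineq4[of "G a b" "h b"] bd[OF that] hb[OF that(2)] by (simp add: U_def)
  have GA: "(\<lambda>a. G a b) \<in> borel_measurable A" if "b \<in> space B" for b
    using measurable_compose[OF measurable_Pair2'[OF that] G] by simp
  have GB: "(\<lambda>b. G a b) \<in> borel_measurable B" if "a \<in> space A" for a
    using measurable_compose[OF measurable_Pair1'[OF that] G] by simp
  have UB: "(\<lambda>b. U a b) \<in> borel_measurable B" if "a \<in> space A" for a
    unfolding U_def using GB[OF that] by measurable
  have gb: "cmod (\<integral>b. G a b \<partial>B) \<le> c" if "a \<in> space A" for a
    by (rule B.norm_integral_le[OF bd[OF that] c0])
  have U2i: "integrable (A \<Otimes>\<^sub>M B) (\<lambda>(a, b). (cmod (U a b))\<^sup>2)"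
    by (rule PP.integrable_bdd[of _ "(2 * c)\<^sup>2"]) (use power_mono[OF Ub norm_ge_zero, where n=2] in \<open>auto simp: space_pair_measure\<close>)
  have Gi: "integrable (A \<Otimes>\<^sub>M B) (\<lambda>(a, b). G a b)"
    by (rule PP.integrable_bdd[of _ c]) (use bd in \<open>auto simp: space_pair_measure\<close>)
  have Gmean: "(\<integral>a. (\<integral>b. G a b \<partial>B) \<partial>A) = (\<integral>b. h b \<partial>B)"
    unfolding h_def using P.Fubini_integral[OF Gi] by simp
  have gm: "(\<lambda>a. \<integral>b. G a b \<partial>B) \<in> borel_measurable A" by measurable
  note gv = A.variance_bounds[OF gm gb]
  have "complex_variance A (\<lambda>a. \<integral>b. G a b \<partial>B) = (\<integral>a. (cmod ((\<integral>b. G a b \<partial>B) - (\<integral>b. h b \<partial>B)))\<^sup>2 \<partial>A)"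
    using A.variance_eq[OF gv(3,4)] Gmean by simp
  also have "\<dots> \<le> (\<integral>a. (\<integral>b. (cmod (U a b))\<^sup>2 \<partial>B) \<partial>A)"
  proof (rule integral_mono)
    have "integrable A (\<lambda>a. (cmod ((\<integral>b. G a b \<partial>B) - (\<integral>b. h b \<partial>B)))\<^sup>2)"
    proof (rule A.integrable_bdd[of _ "(2 * c)\<^sup>2"])
      fix a assume a: "a \<in> space A"
      have "cmod (\<integral>b. h b \<partial>B) \<le> c" by (rule B.norm_integral_le[OF hb c0])
      then show "norm ((cmod ((\<integral>b. G a b \<partial>B) - (\<integral>b. h b \<partial>B)))\<^sup>2) \<le> (2 * c)\<^sup>2"
        using norm_triangle_ineq4[of "\<integral>b. G a b \<partial>B" "\<integral>b. h b \<partial>B"] gb[OF a]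
          power_mono[of "cmod ((\<integral>b. G a b \<partial>B) - (\<integral>b. h b \<partial>B))" "2 * c" 2] by simp
    qed measurable
    then show "integrable A (\<lambda>a. (cmod ((\<integral>b. G a b \<partial>B) - (\<integral>b. h b \<partial>B)))\<^sup>2)" .
    show "integrable A (\<lambda>a. \<integral>b. (cmod (U a b))\<^sup>2 \<partial>B)" using P.integrable_fst'[OF U2i] by simp
    fix a assume a: "a \<in> space A"
    have "(\<integral>b. G a b \<partial>B) - (\<integral>b. h b \<partial>B) = (\<integral>b. U a b \<partial>B)"
      unfolding U_def
      by (rule Bochner_Integration.integral_diff[symmetric]) (use B.integrable_bdd[OF GB[OF a], of c] B.integrable_bdd[of h c] bd hb a in auto)
    moreover have "(cmod (\<integral>b. U a b \<partial>B))\<^sup>2 \<le> (\<integral>b. (cmod (U a b))\<^sup>2 \<partial>B)"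
      using B.variance_bounds(1)[OF UB[OF a] Ub[OF a]] by (simp add: complex_variance_def)
    ultimately show "(cmod ((\<integral>b. G a b \<partial>B) - (\<integral>b. h b \<partial>B)))\<^sup>2 \<le> (\<integral>b. (cmod (U a b))\<^sup>2 \<partial>B)" by simp
  qed
  also have "\<dots> = (\<integral>b. (\<integral>a. (cmod (U a b))\<^sup>2 \<partial>A) \<partial>B)"
    using P.Fubini_integral[OF U2i] by simp
  also have "\<dots> = (\<integral>b. complex_variance A (\<lambda>a. G a b) \<partial>B)"
  proof (rule Bochner_Integration.integral_cong[OF refl])
    fix b assume b: "b \<in> space B"
    note v = A.variance_bounds[OF GA[OF b] bd[OF _ b]]
    show "(\<integral>a. (cmod (U a b))\<^sup>2 \<partial>A) = complex_variance A (\<lambda>a. G a b)"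
      using A.variance_eq[OF v(3,4)] by (simp add: U_def h_def)
  qed
  finally show ?thesis .
qed

lemma upd_measurable:
  "k \<in> I \<Longrightarrow> (\<lambda>(x, y). x(k := y)) \<in> measurable (Pi\<^sub>M I (\<lambda>_. N) \<Otimes>\<^sub>M N) (Pi\<^sub>M I (\<lambda>_. N))"
  using measurable_add_dim[of k I "\<lambda>_. N"] by (simp add: insert_absorb)

lemma PiM_upd_space: "x \<in> space (Pi\<^sub>M I (\<lambda>_. N)) \<Longrightarrow> y \<in> space N \<Longrightarrow> x(k := y) \<in> space (Pi\<^sub>M (insert k I) (\<lambda>_. N))"
  by (auto simp: space_PiM PiE_def extensional_def)

lemma PiM_upd_space': "x \<in> space (Pi\<^sub>M I (\<lambda>_. N)) \<Longrightarrow> y \<in> space N \<Longrightarrow> k \<in> I \<Longrightarrow> x(k := y) \<in> space (Pi\<^sub>M I (\<lambda>_. N))"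
  using PiM_upd_space[of x I N y k] by (simp add: insert_absorb)

lemma variance_upd_measurable:
  fixes F :: "('i \<Rightarrow> 'a) \<Rightarrow> complex"
  assumes N: "prob_space N" and "k \<in> I" and F: "F \<in> borel_measurable (Pi\<^sub>M I (\<lambda>_. N))"
  shows "(\<lambda>x. complex_variance N (\<lambda>u. F (x(k := u)))) \<in> borel_measurable (Pi\<^sub>M I (\<lambda>_. N))"
proof -
  interpret N: prob_space N by fact
  have [measurable]: "(\<lambda>(x, y). F (x(k := y))) \<in> borel_measurable (Pi\<^sub>M I (\<lambda>_. N) \<Otimes>\<^sub>M N)"
    using measurable_compose[OF upd_measurable[OF assms(2)] F] by (simp add: case_prod_unfold del: fun_upd_apply)
  show ?thesis unfolding complex_variance_def by measurable
qed

lemma upd_section_measurable: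
  assumes "x \<in> space (Pi\<^sub>M I (\<lambda>_. N))" "k \<in> I" "F \<in> measurable (Pi\<^sub>M I (\<lambda>_. N)) K"
  shows "(\<lambda>u. F (x(k := u))) \<in> measurable N K"
  using measurable_compose[OF measurable_compose[OF measurable_Pair1'[OF assms(1)] upd_measurable[OF assms(2)]] assms(3)]
  by simp

text \<open>Adding one coordinate, the variance splits into the mean conditional variance in that coordinate and
  the variance of the conditional mean, and the latter is controlled by averaging the induction
  hypothesis.\<close>

lemma efron_stein:
  fixes F :: "('i \<Rightarrow> 'a) \<Rightarrow> complex"
  assumes N: "prob_space N" and "finite I"
    and "F \<in> borel_measurable (Pi\<^sub>M I (\<lambda>_. N))" "\<And>x. x \<in> space (Pi\<^sub>M I (\<lambda>_. N)) \<Longrightarrow> cmod (F x) \<le> c"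
  shows "complex_variance (Pi\<^sub>M I (\<lambda>_. N)) F
    \<le> (\<Sum>k\<in>I. \<integral>x. complex_variance N (\<lambda>u. F (x(k := u))) \<partial>Pi\<^sub>M I (\<lambda>_. N))"
  using assms(2-)
proof (induction I arbitrary: F rule: finite_induct)
  case empty
  show ?case by (simp add: PiM_empty complex_variance_def lebesgue_integral_count_space_finite)
next
  case (insert i I)
  interpret N: prob_space N by fact
  interpret S: product_sigma_finite "\<lambda>_ :: 'i. N" by standard
  let ?P = "\<lambda>J. Pi\<^sub>M J (\<lambda>_ :: 'i. N)"
  have PP: "prob_space (?P J)" for J by (rule prob_space_PiM) (rule N)
  interpret P: prob_space "?P I" by (rule PP)
  interpret Q: prob_space "?P (insert i I)" by (rule PP)
  note [measurable] = insert.prems(1)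
  note bd = insert.prems(2)
  have upd[measurable]: "(\<lambda>(x, y). x(i := y)) \<in> measurable (?P I \<Otimes>\<^sub>M N) (?P (insert i I))"
    by (rule measurable_add_dim)
  have Fi[measurable]: "(\<lambda>(x, y). F (x(i := y))) \<in> borel_measurable (?P I \<Otimes>\<^sub>M N)"
    using measurable_compose[OF upd insert.prems(1)] by (simp add: case_prod_unfold del: fun_upd_apply)
  have c0: "0 \<le> c" using bd Q.not_empty norm_ge_zero order_trans by (metis all_not_in_conv)
  have sec: "(\<lambda>y. F (x(i := y))) \<in> borel_measurable N" if "x \<in> space (?P I)" for x
    using measurable_compose[OF measurable_Pair1'[OF that] Fi] by simp
  have bdi: "cmod (F (x(i := y))) \<le> c" if "x \<in> space (?P I)" "y \<in> space N" for x y
    by (rule bd, rule PiM_upd_space[OF that])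
  define g where "g x = (\<integral>y. F (x(i := y)) \<partial>N)" for x
  have gm[measurable]: "g \<in> borel_measurable (?P I)" unfolding g_def by measurable
  have gb: "cmod (g x) \<le> c" if "x \<in> space (?P I)" for x
    unfolding g_def by (rule N.norm_integral_le[OF bdi[OF that] c0])
  note Fv = Q.variance_bounds[OF insert.prems]
  note gv = P.variance_bounds[OF gm gb]
  have intF: "(\<integral>x. f x \<partial>?P (insert i I)) = (\<integral>x. (\<integral>y. f (x(i := y)) \<partial>N) \<partial>?P I)"
    if "integrable (?P (insert i I)) f" for f :: "('i \<Rightarrow> 'a) \<Rightarrow> 'z :: {banach, second_countable_topology}"
    by (rule S.product_integral_insert[OF insert.hyps that])
  have V: "integrable (?P (insert i I)) (\<lambda>x. complex_variance N (\<lambda>u. F (x(k := u))))" if k: "k \<in> insert i I" for k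
  proof (rule Q.integrable_bdd[OF variance_upd_measurable[OF N k insert.prems(1)]])
    fix x assume x: "x \<in> space (?P (insert i I))"
    show "norm (complex_variance N (\<lambda>u. F (x(k := u)))) \<le> c\<^sup>2"
      using N.variance_bounds(1,2)[of "\<lambda>u. F (x(k := u))" c] upd_section_measurable[OF x k insert.prems(1)] bd[OF PiM_upd_space'[OF x _ k]]
      by (simp del: fun_upd_apply)
  qed
  have g2: "integrable (?P I) (\<lambda>x. \<integral>y. (cmod (F (x(i := y))))\<^sup>2 \<partial>N)"
  proof (rule P.integrable_bdd[of _ "c\<^sup>2"])
    fix x assume x: "x \<in> space (?P I)"
    show "norm (\<integral>y. (cmod (F (x(i := y))))\<^sup>2 \<partial>N) \<le> c\<^sup>2"
      by (rule N.norm_integral_le) (use bdi[OF x] in \<open>auto intro!: power_mono\<close>)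
  qed measurable
  have "complex_variance (?P (insert i I)) F
      = (\<integral>x. (\<integral>y. (cmod (F (x(i := y))))\<^sup>2 \<partial>N) \<partial>?P I) - (cmod (\<integral>x. g x \<partial>?P I))\<^sup>2"
    using intF[OF Fv(4)] intF[OF Fv(3)] by (simp only: complex_variance_def g_def)
  also have "\<dots> = (\<integral>x. complex_variance N (\<lambda>y. F (x(i := y))) \<partial>?P I) + complex_variance (?P I) g"
    unfolding complex_variance_def g_def[symmetric] using g2 gv(4) by simp
  also have "(\<integral>x. complex_variance N (\<lambda>y. F (x(i := y))) \<partial>?P I)
      = (\<integral>x. complex_variance N (\<lambda>y. F (x(i := y))) \<partial>?P (insert i I))"
    by (subst intF[OF V]) (simp_all add: N.prob_space)
  also have "complex_variance (?P I) g
      \<le> (\<Sum>k\<in>I. \<integral>x. complex_variance N (\<lambda>u. F (x(k := u))) \<partial>?P (insert i I))"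
  proof -
    have "complex_variance (?P I) g \<le> (\<Sum>k\<in>I. \<integral>x. complex_variance N (\<lambda>u. g (x(k := u))) \<partial>?P I)"
      by (rule insert.IH[OF gm gb])
    also have "\<dots> \<le> (\<Sum>k\<in>I. \<integral>x. complex_variance N (\<lambda>u. F (x(k := u))) \<partial>?P (insert i I))"
    proof (rule sum_mono)
      fix k assume k: "k \<in> I"
      then have ki: "k \<noteq> i" using insert.hyps by auto
      have swap: "x(k := u, i := y) = x(i := y, k := u)" for x :: "'i \<Rightarrow> 'a" and u y
        using ki by (rule fun_upd_twist)
      have kI: "k \<in> insert i I" using k by simp
      note Vm = V[OF kI]
      have "(\<integral>x. complex_variance N (\<lambda>u. g (x(k := u))) \<partial>?P I)
        \<le> (\<integral>x. (\<integral>y. complex_variance N (\<lambda>u. F (x(i := y, k := u))) \<partial>N) \<partial>?P I)"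
      proof (rule integral_mono)
        show "integrable (?P I) (\<lambda>x. complex_variance N (\<lambda>u. g (x(k := u))))"
        proof (rule P.integrable_bdd[OF variance_upd_measurable[OF N k gm]])
          fix x assume x: "x \<in> space (?P I)"
          show "norm (complex_variance N (\<lambda>u. g (x(k := u)))) \<le> c\<^sup>2"
            using N.variance_bounds(1,2)[OF upd_section_measurable[OF x k gm] gb[OF PiM_upd_space'[OF x _ k]]] by simp
        qed
        have m2: "(\<lambda>(x, y). complex_variance N (\<lambda>u. F (x(i := y, k := u)))) \<in> borel_measurable (?P I \<Otimes>\<^sub>M N)"
          using measurable_compose[OF upd variance_upd_measurable[OF N kI insert.prems(1)]] by (simp add: case_prod_unfold del: fun_upd_apply)
        have b2: "0 \<le> complex_variance N (\<lambda>u. F (x(i := y, k := u)))" "complex_variance N (\<lambda>u. F (x(i := y, k := u))) \<le> c\<^sup>2"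
          if "x \<in> space (?P I)" "y \<in> space N" for x y
        proof -
          have z: "x(i := y) \<in> space (?P (insert i I))" using that by (rule PiM_upd_space)
          show "0 \<le> complex_variance N (\<lambda>u. F (x(i := y, k := u)))" "complex_variance N (\<lambda>u. F (x(i := y, k := u))) \<le> c\<^sup>2"
            using N.variance_bounds(1,2)[OF upd_section_measurable[OF z kI insert.prems(1)] bd[OF PiM_upd_space'[OF z _ kI]]]
            by (simp_all del: fun_upd_apply)
        qed
        show "integrable (?P I) (\<lambda>x. \<integral>y. complex_variance N (\<lambda>u. F (x(i := y, k := u))) \<partial>N)"
        proof (rule P.integrable_bdd[of _ "c\<^sup>2"])
          show "(\<lambda>x. \<integral>y. complex_variance N (\<lambda>u. F (x(i := y, k := u))) \<partial>N) \<in> borel_measurable (?P I)"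
            using m2 by measurable
          fix x assume x: "x \<in> space (?P I)"
          show "norm (\<integral>y. complex_variance N (\<lambda>u. F (x(i := y, k := u))) \<partial>N) \<le> c\<^sup>2"
            by (rule N.norm_integral_le) (use b2[OF x] in auto)
        qed
        fix x assume x: "x \<in> space (?P I)"
        have xu: "x(k := u) \<in> space (?P I)" if "u \<in> space N" for u using PiM_upd_space'[OF x that k] .
        have "complex_variance N (\<lambda>u. \<integral>y. F (x(k := u, i := y)) \<partial>N) \<le> (\<integral>y. complex_variance N (\<lambda>u. F (x(k := u, i := y))) \<partial>N)"
        proof (rule variance_average_le[OF N N])
          have "(\<lambda>(u, y). (x(k := u), y)) \<in> measurable (N \<Otimes>\<^sub>M N) (?P I \<Otimes>\<^sub>M N)"
          proof -
            have [measurable]: "(\<lambda>u. x(k := u)) \<in> measurable N (?P I)"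
              using upd_section_measurable[OF x k measurable_ident] by simp
            show ?thesis by measurable
          qed
          from measurable_compose[OF this Fi]
          show "(\<lambda>(u, y). F (x(k := u, i := y))) \<in> borel_measurable (N \<Otimes>\<^sub>M N)" by (simp add: case_prod_unfold del: fun_upd_apply)
        qed (use bdi xu in auto)
        then show "complex_variance N (\<lambda>u. g (x(k := u))) \<le> (\<integral>y. complex_variance N (\<lambda>u. F (x(i := y, k := u))) \<partial>N)"
          unfolding g_def swap .
      qed
      also have "\<dots> = (\<integral>x. complex_variance N (\<lambda>u. F (x(k := u))) \<partial>?P (insert i I))"
        by (subst intF[OF Vm]) simp
      finally show "(\<integral>x. complex_variance N (\<lambda>u. g (x(k := u))) \<partial>?P I)
        \<le> (\<integral>x. complex_variance N (\<lambda>u. F (x(k := u))) \<partial>?P (insert i I))" .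
    qed
    finally show ?thesis .
  qed
  finally show ?case using insert.hyps by (simp del: fun_upd_apply)
qed

text \<open>Replacing one coordinate by an independent copy does not change the law.\<close>

lemma PiM_resample:
  fixes f :: "('i \<Rightarrow> 'a) \<Rightarrow> 'b :: {banach, second_countable_topology}"
  assumes N: "prob_space N" and I: "finite I" "k \<in> I"
    and f: "f \<in> borel_measurable (Pi\<^sub>M I (\<lambda>_. N))" and bd: "\<And>x. norm (f x) \<le> c"
  shows "(\<integral>x. (\<integral>u. f (x(k := u)) \<partial>N) \<partial>Pi\<^sub>M I (\<lambda>_. N)) = (\<integral>x. f x \<partial>Pi\<^sub>M I (\<lambda>_. N))"
proof -
  interpret N: prob_space N by fact
  interpret S: product_sigma_finite "\<lambda>_ :: 'i. N" by standard
  define J where "J = I - {k}"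
  have J: "finite J" "k \<notin> J" "insert k J = I" using I by (auto simp: J_def)
  have PP: "prob_space (Pi\<^sub>M I (\<lambda>_ :: 'i. N))" by (rule prob_space_PiM) (rule N)
  interpret P: prob_space "Pi\<^sub>M I (\<lambda>_ :: 'i. N)" by (rule PP)
  have intF: "(\<integral>x. g x \<partial>Pi\<^sub>M I (\<lambda>_. N)) = (\<integral>x. (\<integral>y. g (x(k := y)) \<partial>N) \<partial>Pi\<^sub>M J (\<lambda>_. N))"
    if "integrable (Pi\<^sub>M I (\<lambda>_. N)) g" for g :: "('i \<Rightarrow> 'a) \<Rightarrow> 'b"
    using S.product_integral_insert[OF J(1,2)] that J(3) by simp
  have c0: "0 \<le> c" using bd norm_ge_zero order_trans by blast
  have m: "(\<lambda>(x, y). f (x(k := y))) \<in> borel_measurable (Pi\<^sub>M I (\<lambda>_. N) \<Otimes>\<^sub>M N)"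
    using measurable_compose[OF upd_measurable[OF I(2)] f] by (simp add: case_prod_unfold del: fun_upd_apply)
  have "integrable (Pi\<^sub>M I (\<lambda>_. N)) (\<lambda>x. \<integral>u. f (x(k := u)) \<partial>N)"
  proof (rule P.integrable_bdd)
    show "(\<lambda>x. \<integral>u. f (x(k := u)) \<partial>N) \<in> borel_measurable (Pi\<^sub>M I (\<lambda>_. N))" using m by measurable
    show "norm (\<integral>u. f (x(k := u)) \<partial>N) \<le> c" for x by (rule N.norm_integral_le) (use bd c0 in auto)
  qed
  from intF[OF this] intF[OF P.integrable_bdd[OF f bd]] show ?thesis
    by (simp add: N.prob_space del: fun_upd_apply)
qed

text \<open>A bounded function of finitely many independent Gaussian coordinates with bounded continuous partial
  derivatives. The derivative \<open>D k\<close> is taken along the line through \<open>x\<close> in direction \<open>k\<close>, which suffices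
  since both integration by parts and the Poincare inequality tensorize.\<close>

locale gaussian_function =
  fixes I :: "'i set" and F :: "('i \<Rightarrow> real) \<Rightarrow> complex" and D :: "'i \<Rightarrow> ('i \<Rightarrow> real) \<Rightarrow> complex" and A c :: real
  assumes fin: "finite I"
    and F_meas: "F \<in> borel_measurable (Pi\<^sub>M I (\<lambda>_. gauss))" and F_le: "\<And>x. cmod (F x) \<le> A"
    and D_meas: "\<And>k. k \<in> I \<Longrightarrow> D k \<in> borel_measurable (Pi\<^sub>M I (\<lambda>_. gauss))"
    and D_le: "\<And>k x. k \<in> I \<Longrightarrow> cmod (D k x) \<le> c"
    and D_der: "\<And>k x u. k \<in> I \<Longrightarrow> ((\<lambda>u. F (x(k := u))) has_vector_derivative D k (x(k := u))) (at u)"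
    and D_cont: "\<And>k x u. k \<in> I \<Longrightarrow> isCont (\<lambda>u. D k (x(k := u))) u"
begin

abbreviation "PG \<equiv> Pi\<^sub>M I (\<lambda>_. gauss)"

lemma PG: "prob_space PG"
  by (rule prob_space_PiM) (rule prob_space_gauss)

lemma poincare:
  "complex_variance PG F \<le> (1/2) * (\<Sum>k\<in>I. \<integral>x. (cmod (D k x))\<^sup>2 \<partial>PG)"
proof -
  interpret P: prob_space PG by (rule PG)
  interpret N: prob_space gauss by (rule prob_space_gauss)
  have "complex_variance PG F \<le> (\<Sum>k\<in>I. \<integral>x. complex_variance gauss (\<lambda>u. F (x(k := u))) \<partial>PG)"
    by (rule efron_stein[OF prob_space_gauss fin F_meas F_le])
  also have "\<dots> \<le> (\<Sum>k\<in>I. (1/2) * (\<integral>x. (cmod (D k x))\<^sup>2 \<partial>PG))"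
  proof (rule sum_mono)
    fix k assume k: "k \<in> I"
    have Dm: "(\<lambda>x. (cmod (D k x))\<^sup>2) \<in> borel_measurable PG" using D_meas[OF k] by measurable
    have Dle: "norm ((cmod (D k x))\<^sup>2) \<le> c\<^sup>2" for x using D_le[OF k, of x] by (simp add: power_mono)
    have m: "(\<lambda>(x, y). (cmod (D k (x(k := y))))\<^sup>2) \<in> borel_measurable (PG \<Otimes>\<^sub>M gauss)"
      using measurable_compose[OF upd_measurable[OF k] Dm] by (simp add: case_prod_unfold del: fun_upd_apply)
    have "(\<integral>x. complex_variance gauss (\<lambda>u. F (x(k := u))) \<partial>PG) \<le> (\<integral>x. (1/2) * (\<integral>u. (cmod (D k (x(k := u))))\<^sup>2 \<partial>gauss) \<partial>PG)"
    proof (rule integral_mono)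
      show "integrable PG (\<lambda>x. complex_variance gauss (\<lambda>u. F (x(k := u))))"
      proof (rule P.integrable_bdd[OF variance_upd_measurable[OF prob_space_gauss k F_meas]])
        fix x assume x: "x \<in> space PG"
        show "norm (complex_variance gauss (\<lambda>u. F (x(k := u)))) \<le> A\<^sup>2"
          using N.variance_bounds(1,2)[OF upd_section_measurable[OF x k F_meas] F_le] by (simp del: fun_upd_apply)
      qed
      show "integrable PG (\<lambda>x. (1/2) * (\<integral>u. (cmod (D k (x(k := u))))\<^sup>2 \<partial>gauss))"
      proof (intro integrable_mult_right P.integrable_bdd)
        show "(\<lambda>x. \<integral>u. (cmod (D k (x(k := u))))\<^sup>2 \<partial>gauss) \<in> borel_measurable PG"
          using m by measurable
        show "norm (\<integral>u. (cmod (D k (x(k := u))))\<^sup>2 \<partial>gauss) \<le> c\<^sup>2" for x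
          by (rule N.norm_integral_le) (use Dle in auto)
      qed
      show "complex_variance gauss (\<lambda>u. F (x(k := u))) \<le> (1/2) * (\<integral>u. (cmod (D k (x(k := u))))\<^sup>2 \<partial>gauss)" for x
        by (rule gauss_poincare[OF D_der[OF k] D_cont[OF k] D_le[OF k] F_le])
    qed
    also have "\<dots> = (1/2) * (\<integral>x. (cmod (D k x))\<^sup>2 \<partial>PG)"
      using PiM_resample[OF prob_space_gauss fin k Dm Dle] by simp
    finally show "(\<integral>x. complex_variance gauss (\<lambda>u. F (x(k := u))) \<partial>PG) \<le> (1/2) * (\<integral>x. (cmod (D k x))\<^sup>2 \<partial>PG)" .
  qed
  finally show ?thesis by (simp add: sum_distrib_left)
qed

lemma coord_integrable:
  assumes k: "k \<in> I"
  shows "integrable PG (\<lambda>x. x k *\<^sub>R F x)"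
proof (rule Bochner_Integration.integrable_bound)
  have "integrable (distr PG gauss (\<lambda>x. x k)) (\<lambda>u. A * \<bar>u\<bar>)"
    using integrable_gauss_poly[of 1] distr_PiM_component[of I "\<lambda>_. gauss" k] prob_space_gauss k by simp
  then show "integrable PG (\<lambda>x. A * \<bar>x k\<bar>)"
    using k by (subst (asm) integrable_distr_eq) auto
  show "(\<lambda>x. x k *\<^sub>R F x) \<in> borel_measurable PG"
    using F_meas k measurable_component_singleton[OF k, of "\<lambda>_. gauss"] by measurable
  show "AE x in PG. norm (x k *\<^sub>R F x) \<le> norm (A * \<bar>x k\<bar>)"
  proof (rule AE_I2)
    fix x show "norm (x k *\<^sub>R F x) \<le> norm (A * \<bar>x k\<bar>)"
      using mult_left_mono[OF F_le[of x], of "\<bar>x k\<bar>"] order_trans[OF norm_ge_zero F_le[of x]]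
      by (simp add: abs_mult mult.commute)
  qed
qed

lemma ibp:
  assumes k: "k \<in> I"
  shows "(\<integral>x. x k *\<^sub>R F x \<partial>PG) = (1/2) *\<^sub>R (\<integral>x. D k x \<partial>PG)"
proof -
  interpret N: prob_space gauss by (rule prob_space_gauss)
  interpret S: product_sigma_finite "\<lambda>_ :: 'i. gauss" by standard
  interpret P: prob_space PG by (rule PG)
  define J where "J = I - {k}"
  have J: "finite J" "k \<notin> J" "insert k J = I" using k fin by (auto simp: J_def)
  have intF: "(\<integral>x. g x \<partial>PG) = (\<integral>x. (\<integral>y. g (x(k := y)) \<partial>gauss) \<partial>Pi\<^sub>M J (\<lambda>_. gauss))"
    if "integrable PG g" for g :: "('i \<Rightarrow> real) \<Rightarrow> complex"
    using S.product_integral_insert[OF J(1,2)] that J(3) by simp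
  have c0: "0 \<le> c" using D_le[OF k] norm_ge_zero order_trans by blast
  have sec: "(\<integral>y. y *\<^sub>R F (x(k := y)) \<partial>gauss) = (1/2) *\<^sub>R (\<integral>y. D k (x(k := y)) \<partial>gauss)" for x
  proof (rule gauss_ibp(1)[OF D_der[OF k] D_cont[OF k] D_le[OF k]])
    show "norm (F (x(k := u))) \<le> A + c * \<bar>u\<bar>" for u
      using F_le[of "x(k := u)"] c0 by (simp add: add_increasing2)
  qed
  have "(\<integral>x. x k *\<^sub>R F x \<partial>PG) = (\<integral>x. (\<integral>y. y *\<^sub>R F (x(k := y)) \<partial>gauss) \<partial>Pi\<^sub>M J (\<lambda>_. gauss))"
    using intF[OF coord_integrable[OF k]] by simp
  also have "\<dots> = (1/2) *\<^sub>R (\<integral>x. (\<integral>y. D k (x(k := y)) \<partial>gauss) \<partial>Pi\<^sub>M J (\<lambda>_. gauss))"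
    unfolding sec by simp
  also have "\<dots> = (1/2) *\<^sub>R (\<integral>x. D k x \<partial>PG)"
    using intF[OF P.integrable_bdd[OF D_meas[OF k] D_le[OF k]]] by simp
  finally show ?thesis .
qed

end

section \<open>Measurability and differentiability of inverses\<close>

lemma det_measurable:
  fixes a :: "'x \<Rightarrow> nat \<Rightarrow> nat \<Rightarrow> complex"
  assumes "\<And>i j. i < n \<Longrightarrow> j < n \<Longrightarrow> (\<lambda>x. a x i j) \<in> borel_measurable M"
  shows "(\<lambda>x. Determinant.det (Matrix.mat n n (\<lambda>(i, j). a x i j))) \<in> borel_measurable M"
proof -
  have "Determinant.det (Matrix.mat n n (\<lambda>(i, j). a x i j))
     = (\<Sum>p\<in>{p. p permutes {0..<n}}. signof p * (\<Prod>i = 0..<n. a x i (p i)))" for x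
  proof -
    have "Matrix.mat n n (\<lambda>(i, j). a x i j) $$ (i, p i) = a x i (p i)" if "p permutes {0..<n}" "i \<in> {0..<n}" for p i
      using that permutes_in_image[OF that(1), of i] by simp
    then show ?thesis unfolding Determinant.det_def by (auto intro!: sum.cong prod.cong)
  qed
  moreover have "(\<lambda>x. \<Sum>p\<in>{p. p permutes {0..<n}}. signof p * (\<Prod>i = 0..<n. a x i (p i))) \<in> borel_measurable M"
    by (intro borel_measurable_sum borel_measurable_times borel_measurable_prod borel_measurable_const assms)
      (use permutes_in_image in fastforce)+
  ultimately show ?thesis by simp
qed

text \<open>Cramer's rule gives measurability of the inverse in its entries and its link with the derivative of
  the determinant.\<close>

lemma minv_cofactor:
  assumes "Determinant.det (Matrix.mat n n (\<lambda>(i, j). a i j)) \<noteq> 0" "i < n" "j < n"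
  shows "minv n a i j = cofactor (Matrix.mat n n (\<lambda>(i, j). a i j)) j i / Determinant.det (Matrix.mat n n (\<lambda>(i, j). a i j))"
proof -
  let ?A = "Matrix.mat n n (\<lambda>(i, j). a i j)"
  let ?b = "\<lambda>i j. cofactor ?A j i / Determinant.det ?A"
  have A: "?A \<in> carrier_mat n n" by simp
  show ?thesis
  proof (rule minv_unique_right[OF assms(1) _ assms(2,3), of ?b, symmetric])
    fix i j assume ij: "i < n" "j < n"
    have "(?A * adj_mat ?A) $$ (i, j) = (\<Sum>k<n. ?A $$ (i, k) * adj_mat ?A $$ (k, j))"
      using adj_mat(1)[OF A] ij by (intro mat_mult_entry) auto
    also have "\<dots> = (\<Sum>k<n. a i k * cofactor ?A j k)" using ij by (simp add: adj_mat_def)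
    finally have "(\<Sum>k<n. a i k * cofactor ?A j k) = Determinant.det ?A * kron i j"
      unfolding adj_mat(2)[OF A] using ij by (simp add: kron_def)
    then show "mm n a ?b i j = kron i j"
      using assms(1) by (simp add: mm_def sum_divide_distrib[symmetric])
  qed
qed

lemma minv_measurable:
  fixes a :: "'x \<Rightarrow> nat \<Rightarrow> nat \<Rightarrow> complex"
  assumes a: "\<And>i j. i < n \<Longrightarrow> j < n \<Longrightarrow> (\<lambda>x. a x i j) \<in> borel_measurable M"
    and det: "\<And>x. x \<in> space M \<Longrightarrow> Determinant.det (Matrix.mat n n (\<lambda>(i, j). a x i j)) \<noteq> 0"
    and ij: "i < n" "j < n"
  shows "(\<lambda>x. minv n (a x) i j) \<in> borel_measurable M"
proof -
  have cof: "cofactor (Matrix.mat n n (\<lambda>(i, j). a x i j)) j i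
    = (-1) ^ (j + i) * Determinant.det (Matrix.mat (n - 1) (n - 1) (\<lambda>(p, q). a x (if p < j then p else Suc p) (if q < i then q else Suc q)))" for x
    unfolding cofactor_def mat_delete_def by (auto intro!: arg_cong[where f = Determinant.det] eq_matI)
  have "(\<lambda>x. cofactor (Matrix.mat n n (\<lambda>(i, j). a x i j)) j i) \<in> borel_measurable M"
    unfolding cof by (intro borel_measurable_times borel_measurable_const det_measurable a) auto
  then have "(\<lambda>x. cofactor (Matrix.mat n n (\<lambda>(i, j). a x i j)) j i / Determinant.det (Matrix.mat n n (\<lambda>(i, j). a x i j))) \<in> borel_measurable M"
    by (intro borel_measurable_divide det_measurable a) auto
  then show ?thesis
    by (subst measurable_cong[of _ _ "\<lambda>x. cofactor (Matrix.mat n n (\<lambda>(i, j). a x i j)) j i / Determinant.det (Matrix.mat n n (\<lambda>(i, j). a x i j))"])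
      (auto simp: minv_cofactor[OF det ij])
qed

text \<open>Differentiability from an exact difference quotient. The resolvent identity supplies such a quotient,
  so derivatives of the inverse need no differentiation of determinants.\<close>

lemma caratheodory_vector:
  fixes f g :: "real \<Rightarrow> 'a :: real_normed_vector"
  assumes "\<And>u. f u - f v = (u - v) *\<^sub>R g u" "isCont g v"
  shows "(f has_vector_derivative g v) (at v)"
proof -
  have "((\<lambda>u. norm (g u - g v)) \<longlongrightarrow> 0) (at v)"
    using assms(2) by (intro tendsto_norm_zero LIM_zero) (simp add: isCont_def)
  moreover have "norm (f u - f v - (u - v) *\<^sub>R g v) / norm (u - v) = norm (g u - g v)" if "u \<noteq> v" for u
    using that by (simp add: assms(1) scaleR_diff_right[symmetric])
  then have "eventually (\<lambda>u. norm (g u - g v) = norm (f u - f v - (u - v) *\<^sub>R g v) / norm (u - v)) (at v)"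
    by (auto simp: eventually_at_filter)
  ultimately have "((\<lambda>u. norm (f u - f v - (u - v) *\<^sub>R g v) / norm (u - v)) \<longlongrightarrow> 0) (at v)"
    by (rule Lim_transform_eventually)
  then show ?thesis
    unfolding has_vector_derivative_def has_derivative_iff_norm by (simp add: bounded_linear_scaleR_left)
qed

section \<open>The Gaussian model at a fixed size\<close>

text \<open>The model at a fixed size. The noise has the real coordinates \<open>((i, j), False)\<close> and
  \<open>((i, j), True)\<close>, the real and the imaginary part of the entry \<open>(i, j)\<close>; \<open>e\<close> is the square root of
  \<open>\<sigma>\<^sup>2\<close>.\<close>

locale gaussian_model = profile +
  fixes d dt :: "nat \<Rightarrow> real" and B :: "nat \<Rightarrow> nat \<Rightarrow> complex" and e :: real
  assumes pp_def: "\<And>i. pp False i = (if i < r then d i else 0)" "\<And>i. pp True i = (if i < r then 0 else dt (i - r))"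
    and d0: "\<And>i. i < r \<Longrightarrow> 0 \<le> d i" and dt0: "\<And>j. j < t \<Longrightarrow> 0 \<le> dt j"
    and e_pos: "0 < e"
begin

definition I :: "((nat \<times> nat) \<times> bool) set" where "I = ({..<r} \<times> {..<t}) \<times> UNIV"
definition noise_scale :: "nat \<Rightarrow> nat \<Rightarrow> real" where "noise_scale i j = sqrt (d i) * sqrt (dt j) / sqrt (real t)"
definition noisy :: "((nat \<times> nat) \<times> bool \<Rightarrow> real) \<Rightarrow> nat \<Rightarrow> nat \<Rightarrow> complex" where
  "noisy x i j = B i j + of_real (noise_scale i j) * Complex (x ((i, j), False)) (x ((i, j), True))"
definition rand_res :: "((nat \<times> nat) \<times> bool \<Rightarrow> real) \<Rightarrow> nat \<Rightarrow> nat \<Rightarrow> complex" where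
  "rand_res x = res n r (\<lambda>_. e) (noisy x)"
definition coord_dir :: "(nat \<times> nat) \<times> bool \<Rightarrow> complex" where
  "coord_dir k = (case k of ((i, j), b) \<Rightarrow> of_real (noise_scale i j) * (if b then \<i> else 1))"

lemma finite_I [simp]: "finite I" by (simp add: I_def)

lemma d_le: "i < r \<Longrightarrow> d i \<le> pm" and dt_le: "j < t \<Longrightarrow> dt j \<le> pm"
  using pp_le[of i False] pp_le[of "r + j" True] n_eq by (auto simp: pp_def)

lemma noise_scale_sq: "i < r \<Longrightarrow> j < t \<Longrightarrow> (noise_scale i j)\<^sup>2 = d i * dt j / real t"
  using d0 dt0 by (simp add: noise_scale_def power_mult_distrib power_divide)

lemma noise_scale_sq_le: "i < r \<Longrightarrow> j < t \<Longrightarrow> (noise_scale i j)\<^sup>2 \<le> pm\<^sup>2 / real t"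
proof -
  assume a: "i < r" "j < t"
  have "d i * dt j \<le> pm * pm" using a d0 dt0 d_le dt_le pm_nonneg by (intro mult_mono) auto
  then show ?thesis unfolding noise_scale_sq[OF a] power2_eq_square[of pm] by (rule divide_right_mono) simp
qed

lemma coord_dir_le: "k \<in> I \<Longrightarrow> cmod (coord_dir k) \<le> pm"
proof -
  assume "k \<in> I"
  then obtain i j b where k: "k = ((i, j), b)" "i < r" "j < t" by (auto simp: I_def)
  have "(noise_scale i j)\<^sup>2 \<le> pm\<^sup>2 / real t" by (rule noise_scale_sq_le[OF k(2,3)])
  also have "\<dots> \<le> pm\<^sup>2" using t_pos by (simp add: divide_le_eq mult_le_cancel_left1)
  finally have "\<bar>noise_scale i j\<bar> \<le> pm" using pm_nonneg by (rule power2_le_iff_abs_le[THEN iffD1, rotated])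
  then show ?thesis by (simp add: coord_dir_def k norm_mult)
qed

lemma op_bound_rand_res: "op_bound n (rand_res x) (1 / e)"
  unfolding rand_res_def by (rule op_bound_res) (use e_pos in auto)

lemma rand_res_entry: "i < n \<Longrightarrow> j < n \<Longrightarrow> cmod (rand_res x i j) \<le> 1 / e"
  by (rule op_bound_entry[OF op_bound_rand_res])

lemma rand_res_diff:
  assumes ij: "i < r" "j < t" and pq: "p < n" "q < n" and k_def: "k = ((i, j), b)"
  shows "rand_res (x(k := u)) p q - rand_res (x(k := v)) p q = (u - v) *\<^sub>R
    - (coord_dir k * (rand_res (x(k := u)) p i * rand_res (x(k := v)) (r + j) q)
       - cnj (coord_dir k) * (rand_res (x(k := u)) p (r + j) * rand_res (x(k := v)) i q))"
proof -
  let ?G = "rand_res (x(k := u))" and ?H = "rand_res (x(k := v))"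
  let ?E = "\<lambda>i j. skew_lin r (\<lambda>_. e) (noisy (x(k := v))) i j - skew_lin r (\<lambda>_. e) (noisy (x(k := u))) i j"
  have ijn: "i < n" "r + j < n" using ij n_eq by auto
  have C: "noisy (x(k := v)) a c - noisy (x(k := u)) a c = (if a = i \<and> c = j then of_real (v - u) * coord_dir k else 0)" for a c
    by (auto simp: noisy_def k_def coord_dir_def complex_eq_iff algebra_simps)
  have C': "cnj (noisy (x(k := u)) a c) - cnj (noisy (x(k := v)) a c) = (if a = i \<and> c = j then - (of_real (v - u) * cnj (coord_dir k)) else 0)" for a c
    using arg_cong[OF C[of a c], of "\<lambda>z. - cnj z"] by (simp split: if_splits)
  have E: "?E a c = (if a = i \<and> c = r + j then of_real (v - u) * coord_dir k else 0)
     - (if a = r + j \<and> c = i then of_real (v - u) * cnj (coord_dir k) else 0)" for a c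
    using ij C[of a "c - r"] C'[of c "a - r"]
    by (auto simp: skew_lin_def simp del: of_real_diff split: if_splits)
  have "?G p q - ?H p q = mm n ?G (mm n ?E ?H) p q"
    unfolding rand_res_def by (rule res_diff) (use e_pos pq in auto)
  also have "\<dots> = (\<Sum>a<n. ?G p a * (\<Sum>c<n. ?E a c * ?H c q))"
    by (simp only: mm_def)
  also have "\<dots> = (\<Sum>a<n. ?G p a * ((if a = i then of_real (v - u) * coord_dir k * ?H (r + j) q else 0)
      - (if a = r + j then of_real (v - u) * cnj (coord_dir k) * ?H i q else 0)))"
  proof (intro sum.cong refl arg_cong2[where f = "(*)"])
    fix a
    have "(\<Sum>c<n. ?E a c * ?H c q) = (\<Sum>c<n. (if c = r + j then (if a = i then of_real (v - u) * coord_dir k * ?H c q else 0) else 0)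
      - (if c = i then (if a = r + j then of_real (v - u) * cnj (coord_dir k) * ?H c q else 0) else 0))"
      unfolding E by (intro sum.cong refl) (auto simp: left_diff_distrib simp del: of_real_diff)
    also have "\<dots> = (if a = i then of_real (v - u) * coord_dir k * ?H (r + j) q else 0)
      - (if a = r + j then of_real (v - u) * cnj (coord_dir k) * ?H i q else 0)"
      using ijn by (simp add: sum_subtractf)
    finally show "(\<Sum>c<n. ?E a c * ?H c q) = (if a = i then of_real (v - u) * coord_dir k * ?H (r + j) q else 0)
      - (if a = r + j then of_real (v - u) * cnj (coord_dir k) * ?H i q else 0)" .
  qed
  also have "\<dots> = ?G p i * (of_real (v - u) * coord_dir k * ?H (r + j) q) - ?G p (r + j) * (of_real (v - u) * cnj (coord_dir k) * ?H i q)"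
    using ijn by (simp add: right_diff_distrib sum_subtractf if_distrib[of "\<lambda>z. _ * z"] del: of_real_diff cong: if_cong)
  finally show ?thesis by (simp add: scaleR_conv_of_real algebra_simps)
qed

lemma rand_res_cont:
  assumes ij: "i < r" "j < t" and pq: "p < n" "q < n"
  shows "isCont (\<lambda>u. rand_res (x(((i, j), b) := u)) p q) v"
proof -
  define k where "k = ((i, j), b)"
  have k: "k \<in> I" using ij by (simp add: k_def I_def)
  have ijn: "i < n" "r + j < n" using ij n_eq by auto
  have bd: "cmod (rand_res (x(k := u)) p q - rand_res (x(k := v)) p q) \<le> cmod (of_real (u - v)) * (2 * pm / e\<^sup>2)" for u
  proof -
    let ?G = "rand_res (x(k := u))" and ?H = "rand_res (x(k := v))"
    have prod: "cmod (?G a c * ?H a' c') \<le> 1 / e * (1 / e)" if "a < n" "c < n" "a' < n" "c' < n" for a c a' c'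
      unfolding norm_mult using rand_res_entry that e_pos by (intro mult_mono) auto
    have "cmod (coord_dir k * (?G p i * ?H (r + j) q) - cnj (coord_dir k) * (?G p (r + j) * ?H i q))
      \<le> pm * (1 / e * (1 / e)) + pm * (1 / e * (1 / e))"
      using prod pq ijn coord_dir_le[OF k] pm_nonneg
      by (intro order_trans[OF norm_triangle_ineq4] add_mono) (simp_all only: norm_mult[of "coord_dir k"] norm_mult[of "cnj (coord_dir k)"] complex_mod_cnj, (intro mult_mono; simp)+)
    also have "\<dots> = 2 * pm / e\<^sup>2" by (simp add: power2_eq_square)
    finally show ?thesis
      unfolding rand_res_diff[OF ij pq k_def, of x u v] norm_scaleR norm_minus_cancel norm_of_real
      by (rule mult_left_mono) simp
  qed
  have "((\<lambda>u. rand_res (x(k := u)) p q - rand_res (x(k := v)) p q) \<longlongrightarrow> 0) (at v)"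
  proof (rule tendsto_0_le[of "\<lambda>u. complex_of_real (u - v)" _ _ "2 * pm / e\<^sup>2"])
    have "((\<lambda>u. complex_of_real (u - v)) \<longlongrightarrow> complex_of_real (v - v)) (at v)" by (intro tendsto_intros)
    then show "((\<lambda>u. complex_of_real (u - v)) \<longlongrightarrow> 0) (at v)" by simp
  qed (use bd in auto)
  then show ?thesis unfolding isCont_def k_def by (rule LIM_zero_cancel)
qed

definition lin_stat :: "(nat \<Rightarrow> nat \<Rightarrow> complex) \<Rightarrow> ((nat \<times> nat) \<times> bool \<Rightarrow> real) \<Rightarrow> complex" where
  "lin_stat Q x = mtr n (mm n (rand_res x) Q)"

definition lin_stat_deriv :: "(nat \<Rightarrow> nat \<Rightarrow> complex) \<Rightarrow> (nat \<times> nat) \<times> bool \<Rightarrow> ((nat \<times> nat) \<times> bool \<Rightarrow> real) \<Rightarrow> complex" where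
  "lin_stat_deriv Q k x = (case k of ((i, j), b) \<Rightarrow>
     - (coord_dir k * mm n (mm n (rand_res x) Q) (rand_res x) (r + j) i - cnj (coord_dir k) * mm n (mm n (rand_res x) Q) (rand_res x) i (r + j)))"

lemma rand_res_measurable: "p < n \<Longrightarrow> q < n \<Longrightarrow> (\<lambda>x. rand_res x p q) \<in> borel_measurable (Pi\<^sub>M I (\<lambda>_. gauss))"
  unfolding rand_res_def res_def
proof (rule minv_measurable)
  fix i j assume ij: "i < n" "j < n"
  have [measurable]: "(\<lambda>x. noisy x i j) \<in> borel_measurable (Pi\<^sub>M I (\<lambda>_. gauss))" if "i < r" "j < t" for i j
  proof -
    have [measurable]: "(\<lambda>x. x ((i, j), b)) \<in> borel_measurable (Pi\<^sub>M I (\<lambda>_. gauss))" for b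
      using measurable_component_singleton[of "((i, j), b)" I "\<lambda>_. gauss"] that
      by (simp add: I_def cong: measurable_cong_sets)
    show ?thesis unfolding noisy_def Complex_eq by measurable
  qed
  show "(\<lambda>x. skew_lin r (\<lambda>_. e) (noisy x) i j) \<in> borel_measurable (Pi\<^sub>M I (\<lambda>_. gauss))"
  proof -
    consider "i = j" | "i \<noteq> j" "i < r" "r \<le> j" | "i \<noteq> j" "r \<le> i" "j < r" | "i \<noteq> j" "i < r" "j < r" | "i \<noteq> j" "r \<le> i" "r \<le> j"
      by linarith
    moreover have "(\<lambda>x. cnj (noisy x i j)) \<in> borel_measurable (Pi\<^sub>M I (\<lambda>_. gauss))" if "i < r" "j < t" for i j
    proof -
      have "cnj \<in> borel_measurable borel" by (intro borel_measurable_continuous_onI continuous_intros)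
      with that show ?thesis by measurable
    qed
    ultimately show ?thesis using ij n_eq by cases (simp_all add: skew_lin_def)
  qed
qed (use skew_lin_det e_pos in auto)

lemma gaussian_function_lin_stat:
  assumes Q: "op_bound n Q c"
  shows "gaussian_function I (lin_stat Q) (lin_stat_deriv Q) (real n * (1 / e * c)) (2 * pm * (1 / e * c * (1 / e)))"
proof
  note [measurable] = rand_res_measurable
  have c0: "0 \<le> c" by (rule op_bound_nonneg[OF Q])
  note Z = op_bound_mm[OF op_bound_mm[OF op_bound_rand_res Q] op_bound_rand_res]
  show "finite I" by simp
  show "lin_stat Q \<in> borel_measurable (Pi\<^sub>M I (\<lambda>_. gauss))"
    unfolding lin_stat_def mtr_def mm_def
    by (intro borel_measurable_sum borel_measurable_times borel_measurable_const rand_res_measurable) auto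
  show "cmod (lin_stat Q x) \<le> real n * (1 / e * c)" for x
    unfolding lin_stat_def by (rule op_bound_trace[OF op_bound_mm[OF op_bound_rand_res Q]])
  fix k assume kI: "k \<in> I"
  then obtain i j b where k: "k = ((i, j), b)" "i < r" "j < t" by (auto simp: I_def)
  have ijn: "i < n" "r + j < n" using k n_eq by auto
  show "lin_stat_deriv Q k \<in> borel_measurable (Pi\<^sub>M I (\<lambda>_. gauss))"
    unfolding lin_stat_deriv_def mm_def k(1) prod.case using ijn
    by (intro borel_measurable_sum borel_measurable_times borel_measurable_const borel_measurable_diff borel_measurable_uminus rand_res_measurable) auto
  show "cmod (lin_stat_deriv Q k x) \<le> 2 * pm * (1 / e * c * (1 / e))" for x
  proof -
    have "cmod (lin_stat_deriv Q k x) \<le> pm * (1 / e * c * (1 / e)) + pm * (1 / e * c * (1 / e))"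
      unfolding lin_stat_deriv_def k(1) prod.case norm_minus_cancel
      using op_bound_entry[OF Z] ijn coord_dir_le[OF kI] pm_nonneg k(1)
      by (intro order_trans[OF norm_triangle_ineq4] add_mono) (simp_all only: norm_mult[of "coord_dir _"] norm_mult[of "cnj (coord_dir _)"] complex_mod_cnj, (intro mult_mono; simp)+)
    then show ?thesis by (simp add: mult_ac)
  qed
  fix x v
  show "isCont (\<lambda>u. lin_stat_deriv Q k (x(k := u))) v"
    unfolding lin_stat_deriv_def mm_def k(1) prod.case using ijn
    by (intro continuous_intros rand_res_cont k) auto
  define g where "g u = - (coord_dir k * mm n (mm n (rand_res (x(k := v))) Q) (rand_res (x(k := u))) (r + j) i
     - cnj (coord_dir k) * mm n (mm n (rand_res (x(k := v))) Q) (rand_res (x(k := u))) i (r + j))" for u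
  have gc: "isCont g v"
    unfolding g_def mm_def k(1) using ijn
    by (intro continuous_intros rand_res_cont k) auto
  have "lin_stat Q (x(k := u)) - lin_stat Q (x(k := v)) = (u - v) *\<^sub>R g u" for u
  proof -
    let ?G = "rand_res (x(k := u))" and ?H = "rand_res (x(k := v))"
    have "lin_stat Q (x(k := u)) - lin_stat Q (x(k := v)) = (\<Sum>p<n. \<Sum>q<n. (?G p q - ?H p q) * Q q p)"
      by (simp add: lin_stat_def mtr_def mm_def sum_subtractf left_diff_distrib)
    also have "\<dots> = (\<Sum>p<n. \<Sum>q<n. (u - v) *\<^sub>R - (coord_dir k * (?H (r + j) q * Q q p * ?G p i) - cnj (coord_dir k) * (?H i q * Q q p * ?G p (r + j))))"
    proof (intro sum.cong refl)
      fix p q assume "p \<in> {..<n}" "q \<in> {..<n}"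
      then have pq: "p < n" "q < n" by auto
      show "(?G p q - ?H p q) * Q q p = (u - v) *\<^sub>R - (coord_dir k * (?H (r + j) q * Q q p * ?G p i) - cnj (coord_dir k) * (?H i q * Q q p * ?G p (r + j)))"
        unfolding rand_res_diff[OF k(2,3) pq k(1)] by (simp add: algebra_simps)
    qed
    also have "\<dots> = (u - v) *\<^sub>R g u"
      unfolding g_def mm_def
      by (simp only: scaleR_sum_right[symmetric] sum_negf sum_subtractf sum_distrib_left[symmetric] sum_distrib_right)
    finally show ?thesis .
  qed
  from caratheodory_vector[OF this gc]
  show "((\<lambda>u. lin_stat Q (x(k := u))) has_vector_derivative lin_stat_deriv Q k (x(k := v))) (at v)"
    by (simp add: g_def lin_stat_deriv_def k(1) del: fun_upd_apply)
qed

abbreviation "PG \<equiv> Pi\<^sub>M I (\<lambda>_. gauss)"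

lemma PG: "prob_space PG"
  by (rule prob_space_PiM) (rule prob_space_gauss)

text \<open>The gradient of \<open>Tr (G Q)\<close> consists of entries of \<open>G Q G\<close>, each scaled by a standard deviation of
  order \<open>1 / \<surd>t\<close>. The squared Frobenius norm of \<open>G Q G\<close> is at most \<open>n\<close> times its squared
  operator norm, so the Poincare inequality gives a variance bound that does not grow with the size.\<close>

lemma variance_lin_stat:
  assumes Q: "op_bound n Q c"
  shows "complex_variance PG (lin_stat Q) \<le> pm\<^sup>2 * nu * c\<^sup>2 / e ^ 4"
proof -
  interpret g: gaussian_function I "lin_stat Q" "lin_stat_deriv Q" "real n * (1 / e * c)" "2 * pm * (1 / e * c * (1 / e))"
    by (rule gaussian_function_lin_stat[OF Q])
  interpret P: prob_space PG by (rule PG)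
  have pair_point: "(\<Sum>k\<in>I. (cmod (lin_stat_deriv Q k x))\<^sup>2) \<le> 2 * (pm\<^sup>2 * nu * c\<^sup>2 / e ^ 4)" for x
  proof -
    define Z where "Z = mm n (mm n (rand_res x) Q) (rand_res x)"
    have Z: "op_bound n Z (1 / e * c * (1 / e))" unfolding Z_def by (intro op_bound_mm op_bound_rand_res Q)
    have par: "(cmod (a - b))\<^sup>2 + (cmod (a + b))\<^sup>2 = 2 * ((cmod a)\<^sup>2 + (cmod b)\<^sup>2)" for a b
      unfolding cmod_power2 by (simp add: power2_eq_square algebra_simps)
    have Db: "(\<Sum>b\<in>UNIV. (cmod (lin_stat_deriv Q ((i, j), b) x))\<^sup>2) = 2 * (noise_scale i j)\<^sup>2 * ((cmod (Z (r + j) i))\<^sup>2 + (cmod (Z i (r + j)))\<^sup>2)" for i j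
    proof -
      let ?a = "of_real (noise_scale i j) * Z (r + j) i" and ?b = "of_real (noise_scale i j) * Z i (r + j)"
      have "cmod (lin_stat_deriv Q ((i, j), False) x) = cmod (?a - ?b)"
        by (simp add: lin_stat_deriv_def coord_dir_def Z_def[symmetric] norm_minus_commute)
      moreover have "lin_stat_deriv Q ((i, j), True) x = - (\<i> * (?a + ?b))"
        by (simp add: lin_stat_deriv_def coord_dir_def Z_def[symmetric] algebra_simps)
      then have "cmod (lin_stat_deriv Q ((i, j), True) x) = cmod (?a + ?b)" by (simp only: norm_minus_cancel norm_mult norm_ii mult_1)
      ultimately have "(\<Sum>b\<in>UNIV. (cmod (lin_stat_deriv Q ((i, j), b) x))\<^sup>2) = 2 * ((cmod ?a)\<^sup>2 + (cmod ?b)\<^sup>2)"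
        using par[of ?a ?b] by (simp add: UNIV_bool)
      then show ?thesis by (simp add: norm_mult power_mult_distrib algebra_simps)
    qed
    have "(\<Sum>k\<in>I. (cmod (lin_stat_deriv Q k x))\<^sup>2) = (\<Sum>i<r. \<Sum>j<t. \<Sum>b\<in>UNIV. (cmod (lin_stat_deriv Q ((i, j), b) x))\<^sup>2)"
      by (simp add: I_def sum.cartesian_product')
    also have "\<dots> \<le> (\<Sum>i<r. \<Sum>j<t. 2 * (pm\<^sup>2 / real t) * ((cmod (Z (r + j) i))\<^sup>2 + (cmod (Z i (r + j)))\<^sup>2))"
      unfolding Db by (intro sum_mono mult_right_mono mult_left_mono noise_scale_sq_le) auto
    also have "\<dots> = 2 * (pm\<^sup>2 / real t) * ((\<Sum>i<r. \<Sum>j<t. (cmod (Z (r + j) i))\<^sup>2) + (\<Sum>i<r. \<Sum>j<t. (cmod (Z i (r + j)))\<^sup>2))"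
      by (simp only: sum_distrib_left[symmetric] sum.distrib)
    also have "\<dots> \<le> 2 * (pm\<^sup>2 / real t) * (\<Sum>j<n. \<Sum>i<n. (cmod (Z i j))\<^sup>2)"
    proof (rule mult_left_mono)
      have "(\<Sum>j<n. \<Sum>i<n. (cmod (Z i j))\<^sup>2) = (\<Sum>j<r. \<Sum>i<r. (cmod (Z i j))\<^sup>2) + (\<Sum>j<r. \<Sum>i<t. (cmod (Z (r + i) j))\<^sup>2)
         + ((\<Sum>j<t. \<Sum>i<r. (cmod (Z i (r + j)))\<^sup>2) + (\<Sum>j<t. \<Sum>i<t. (cmod (Z (r + i) (r + j)))\<^sup>2))"
        unfolding n_eq sum_split by (simp add: sum.distrib)
      moreover have "(\<Sum>j<t. \<Sum>i<r. (cmod (Z i (r + j)))\<^sup>2) = (\<Sum>i<r. \<Sum>j<t. (cmod (Z i (r + j)))\<^sup>2)" by (rule sum.swap)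
      moreover have "0 \<le> (\<Sum>j<r. \<Sum>i<r. (cmod (Z i j))\<^sup>2)" "0 \<le> (\<Sum>j<t. \<Sum>i<t. (cmod (Z (r + i) (r + j)))\<^sup>2)"
        by (intro sum_nonneg; simp)+
      ultimately show "(\<Sum>i<r. \<Sum>j<t. (cmod (Z (r + j) i))\<^sup>2) + (\<Sum>i<r. \<Sum>j<t. (cmod (Z i (r + j)))\<^sup>2) \<le> (\<Sum>j<n. \<Sum>i<n. (cmod (Z i j))\<^sup>2)"
        by linarith
    qed simp
    also have "\<dots> \<le> 2 * (pm\<^sup>2 / real t) * (real n * (1 / e * c * (1 / e))\<^sup>2)"
      by (intro mult_left_mono op_bound_frobenius[OF Z]) simp
    also have "\<dots> \<le> 2 * (pm\<^sup>2 / real t) * (nu * real t * (1 / e * c * (1 / e))\<^sup>2)"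
      by (intro mult_left_mono mult_right_mono n_le) auto
    also have "\<dots> = 2 * (pm\<^sup>2 * nu * c\<^sup>2 / e ^ 4)"
      using t_pos by (simp add: power_divide power_mult_distrib power4_eq_xxxx power2_eq_square mult_ac)
    finally show ?thesis .
  qed
  have Di: "integrable PG (\<lambda>x. (cmod (lin_stat_deriv Q k x))\<^sup>2)" if "k \<in> I" for k
    using P.variance_bounds(4)[OF g.D_meas[OF that] g.D_le[OF that]] .
  have "complex_variance PG (lin_stat Q) \<le> (1/2) * (\<Sum>k\<in>I. \<integral>x. (cmod (lin_stat_deriv Q k x))\<^sup>2 \<partial>PG)"
    by (rule g.poincare)
  also have "(\<Sum>k\<in>I. \<integral>x. (cmod (lin_stat_deriv Q k x))\<^sup>2 \<partial>PG) = (\<integral>x. (\<Sum>k\<in>I. (cmod (lin_stat_deriv Q k x))\<^sup>2) \<partial>PG)"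
    using Di by (simp add: Bochner_Integration.integral_sum)
  also have "\<dots> \<le> (\<integral>x. 2 * (pm\<^sup>2 * nu * c\<^sup>2 / e ^ 4) \<partial>PG)"
    using Di pair_point by (intro integral_mono Bochner_Integration.integrable_sum) auto
  finally show ?thesis by (simp add: P.prob_space)
qed

end

section \<open>The mean resolvent and its deterministic equivalent\<close>

context gaussian_model
begin

text \<open>The matrix unit in position \<open>(q, p)\<close>, so that the trace against it picks the entry \<open>(p, q)\<close>.\<close>

definition mat_unit :: "nat \<Rightarrow> nat \<Rightarrow> nat \<Rightarrow> nat \<Rightarrow> complex" where
  "mat_unit p q = (\<lambda>a b. if a = q \<and> b = p then 1 else 0)"

lemma op_bound_mat_unit: "p < n \<Longrightarrow> op_bound n (mat_unit p q) 1"
  unfolding op_bound_def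
proof safe
  fix v assume p: "p < n"
  have "mv n (mat_unit p q) v i = (if i = q then v p else 0)" for i
  proof -
    have "mv n (mat_unit p q) v i = (\<Sum>k<n. if k = p then (if i = q then v k else 0) else 0)"
      unfolding mv_def mat_unit_def by (intro sum.cong) auto
    then show ?thesis using p by simp
  qed
  then have "sqn n (mv n (mat_unit p q) v) = (\<Sum>i<n. if i = q then (cmod (v p))\<^sup>2 else 0)"
    unfolding sqn_def by (intro sum.cong) auto
  also have "\<dots> \<le> (cmod (v p))\<^sup>2" by simp
  also have "\<dots> \<le> sqn n v"
    unfolding sqn_def using p by (intro member_le_sum[of p "{..<n}" "\<lambda>i. (cmod (v i))\<^sup>2"]) auto
  finally show "sqn n (mv n (mat_unit p q) v) \<le> 1\<^sup>2 * sqn n v" by simp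
qed simp

lemma mat_unit_mult:
  assumes "q < n"
  shows "mm n a (mat_unit p q) i j = (if j = p then a i q else 0)"
proof -
  have "mm n a (mat_unit p q) i j = (\<Sum>k<n. if k = q then (if j = p then a i k else 0) else 0)"
    unfolding mm_def mat_unit_def by (intro sum.cong) auto
  then show ?thesis using assms by simp
qed

lemma lin_stat_mat_unit: "p < n \<Longrightarrow> q < n \<Longrightarrow> lin_stat (mat_unit p q) x = rand_res x p q"
  by (simp add: lin_stat_def mtr_def mat_unit_mult)

lemma lin_stat_deriv_mat_unit:
  assumes "p < n" "q < n" "k = ((i, j), b)"
  shows "lin_stat_deriv (mat_unit p q) k x = - (coord_dir k * (rand_res x (r + j) q * rand_res x p i) - cnj (coord_dir k) * (rand_res x i q * rand_res x p (r + j)))"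
proof -
  have "mm n (mm n (rand_res x) (mat_unit p q)) (rand_res x) a c = rand_res x a q * rand_res x p c" for a c
  proof -
    have "mm n (mm n (rand_res x) (mat_unit p q)) (rand_res x) a c = (\<Sum>k<n. if k = p then rand_res x a q * rand_res x k c else 0)"
      unfolding mm_def[of n "mm n (rand_res x) (mat_unit p q)"] mat_unit_mult[OF assms(2)] by (intro sum.cong) auto
    then show ?thesis using assms by simp
  qed
  then show ?thesis by (simp add: lin_stat_deriv_def assms(3))
qed

lemma rand_res_product_integrable:
  assumes "a < n" "b < n" "c < n" "g < n"
  shows "integrable PG (\<lambda>x. rand_res x a b * rand_res x c g)" "integrable PG (\<lambda>x. rand_res x a b)"
proof -
  interpret P: prob_space PG by (rule PG)
  note [measurable] = rand_res_measurable
  have m: "(\<lambda>x. rand_res x a b) \<in> borel_measurable PG" "(\<lambda>x. rand_res x c g) \<in> borel_measurable PG"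
    by (intro rand_res_measurable assms)+
  show "integrable PG (\<lambda>x. rand_res x a b)"
    by (rule P.integrable_bdd[OF m(1), of "1 / e"]) (use rand_res_entry assms in auto)
  show "integrable PG (\<lambda>x. rand_res x a b * rand_res x c g)"
  proof (rule P.integrable_bdd[of _ "1 / e * (1 / e)"])
    show "norm (rand_res x a b * rand_res x c g) \<le> 1 / e * (1 / e)" for x
      unfolding norm_mult using rand_res_entry assms e_pos by (intro mult_mono) auto
  qed (use m in measurable)
qed

lemma coord_ibp:
  assumes ij: "i < r" "j < t" and pq: "p < n" "q < n"
  shows "(\<integral>x. of_real (x ((i, j), b)) * rand_res x p q \<partial>PG) = (1/2) * (\<integral>x. lin_stat_deriv (mat_unit p q) ((i, j), b) x \<partial>PG)"
    and "integrable PG (\<lambda>x. of_real (x ((i, j), b)) * rand_res x p q)"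
proof -
  interpret g: gaussian_function I "lin_stat (mat_unit p q)" "lin_stat_deriv (mat_unit p q)" "real n * (1 / e * 1)" "2 * pm * (1 / e * 1 * (1 / e))"
    by (rule gaussian_function_lin_stat[OF op_bound_mat_unit[OF pq(1)]])
  have k: "((i, j), b) \<in> I" using ij by (simp add: I_def)
  show "(\<integral>x. of_real (x ((i, j), b)) * rand_res x p q \<partial>PG) = (1/2) * (\<integral>x. lin_stat_deriv (mat_unit p q) ((i, j), b) x \<partial>PG)"
    using g.ibp[OF k] by (simp add: scaleR_conv_of_real lin_stat_mat_unit pq)
  show "integrable PG (\<lambda>x. of_real (x ((i, j), b)) * rand_res x p q)"
    using g.coord_integrable[OF k] by (simp add: scaleR_conv_of_real lin_stat_mat_unit pq)
qed

text \<open>Combining the derivatives in the real and the imaginary direction leaves only one of the two products: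
  the circular symmetry of the noise cancels the other one.\<close>

lemma complex_ibp:
  assumes ij: "i < r" "j < t" and l: "l < n"
  shows "(\<integral>x. Complex (x ((i, j), False)) (x ((i, j), True)) * rand_res x (r + j) l \<partial>PG)
      = of_real (noise_scale i j) * (\<integral>x. rand_res x (r + j) (r + j) * rand_res x i l \<partial>PG)"
    and "(\<integral>x. cnj (Complex (x ((i, j), False)) (x ((i, j), True))) * rand_res x i l \<partial>PG)
      = - (of_real (noise_scale i j) * (\<integral>x. rand_res x i i * rand_res x (r + j) l \<partial>PG))"
    and "integrable PG (\<lambda>x. Complex (x ((i, j), False)) (x ((i, j), True)) * rand_res x (r + j) l)"
    and "integrable PG (\<lambda>x. cnj (Complex (x ((i, j), False)) (x ((i, j), True))) * rand_res x i l)"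
proof -
  have ijn: "i < n" "r + j < n" using ij n_eq by auto
  have split: "Complex u v * z = of_real u * z + \<i> * (of_real v * z)" "cnj (Complex u v) * z = of_real u * z - \<i> * (of_real v * z)" for u v z
    by (simp_all add: Complex_eq algebra_simps)
  have Di: "integrable PG (lin_stat_deriv (mat_unit p q) ((i, j), b))" if "p < n" "q < n" for p q b
  proof -
    interpret P: prob_space PG by (rule PG)
    interpret g: gaussian_function I "lin_stat (mat_unit p q)" "lin_stat_deriv (mat_unit p q)" "real n * (1 / e * 1)" "2 * pm * (1 / e * 1 * (1 / e))"
      by (rule gaussian_function_lin_stat[OF op_bound_mat_unit[OF that(1)]])
    have k: "((i, j), b) \<in> I" using ij by (simp add: I_def)
    show ?thesis by (rule P.integrable_bdd[OF g.D_meas[OF k] g.D_le[OF k]])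
  qed
  note J1 = coord_ibp[OF ij ijn(2) l] and J2 = coord_ibp[OF ij ijn(1) l]
  show "integrable PG (\<lambda>x. Complex (x ((i, j), False)) (x ((i, j), True)) * rand_res x (r + j) l)"
    "integrable PG (\<lambda>x. cnj (Complex (x ((i, j), False)) (x ((i, j), True))) * rand_res x i l)"
    unfolding split
    by (intro Bochner_Integration.integrable_add Bochner_Integration.integrable_diff integrable_mult_right J1(2) J2(2))+
  have "(\<integral>x. Complex (x ((i, j), False)) (x ((i, j), True)) * rand_res x (r + j) l \<partial>PG)
    = (1/2) * ((\<integral>x. lin_stat_deriv (mat_unit (r + j) l) ((i, j), False) x \<partial>PG) + \<i> * (\<integral>x. lin_stat_deriv (mat_unit (r + j) l) ((i, j), True) x \<partial>PG))"
    unfolding split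
    by (subst Bochner_Integration.integral_add) (intro integrable_mult_right J1(2), intro integrable_mult_right J1(2), simp only: integral_mult_right_zero J1(1) distrib_left mult.left_commute[of "\<i>" "1/2"])
  also have "\<dots> = (1/2) * (\<integral>x. lin_stat_deriv (mat_unit (r + j) l) ((i, j), False) x + \<i> * lin_stat_deriv (mat_unit (r + j) l) ((i, j), True) x \<partial>PG)"
    using Di[OF ijn(2) l] by simp
  also have "\<dots> = (1/2) * (\<integral>x. 2 * (of_real (noise_scale i j) * (rand_res x (r + j) (r + j) * rand_res x i l)) \<partial>PG)"
    unfolding lin_stat_deriv_mat_unit[OF ijn(2) l refl] by (simp add: coord_dir_def algebra_simps)
  finally show "(\<integral>x. Complex (x ((i, j), False)) (x ((i, j), True)) * rand_res x (r + j) l \<partial>PG)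
      = of_real (noise_scale i j) * (\<integral>x. rand_res x (r + j) (r + j) * rand_res x i l \<partial>PG)" by simp
  have "(\<integral>x. cnj (Complex (x ((i, j), False)) (x ((i, j), True))) * rand_res x i l \<partial>PG)
    = (1/2) * ((\<integral>x. lin_stat_deriv (mat_unit i l) ((i, j), False) x \<partial>PG) - \<i> * (\<integral>x. lin_stat_deriv (mat_unit i l) ((i, j), True) x \<partial>PG))"
    unfolding split
    by (subst Bochner_Integration.integral_diff) (intro integrable_mult_right J2(2), intro integrable_mult_right J2(2), simp only: integral_mult_right_zero J2(1) right_diff_distrib mult.left_commute[of "\<i>" "1/2"])
  also have "\<dots> = (1/2) * (\<integral>x. lin_stat_deriv (mat_unit i l) ((i, j), False) x - \<i> * lin_stat_deriv (mat_unit i l) ((i, j), True) x \<partial>PG)"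
    using Di[OF ijn(1) l] by simp
  also have "\<dots> = (1/2) * (\<integral>x. - (2 * (of_real (noise_scale i j) * (rand_res x i i * rand_res x (r + j) l))) \<partial>PG)"
    unfolding lin_stat_deriv_mat_unit[OF ijn(1) l refl] by (simp add: coord_dir_def algebra_simps)
  finally show "(\<integral>x. cnj (Complex (x ((i, j), False)) (x ((i, j), True))) * rand_res x i l \<partial>PG)
      = - (of_real (noise_scale i j) * (\<integral>x. rand_res x i i * rand_res x (r + j) l \<partial>PG))" by simp
qed

definition mean_res :: "nat \<Rightarrow> nat \<Rightarrow> complex" where "mean_res i l = (\<integral>x. rand_res x i l \<partial>PG)"
definition wtrace :: "bool \<Rightarrow> ((nat \<times> nat) \<times> bool \<Rightarrow> real) \<Rightarrow> complex" where
  "wtrace a x = (\<Sum>k<n. of_real (pp a k) * rand_res x k k) / of_nat t"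

lemma sum_n: "(\<Sum>k<n. f k) = (\<Sum>k<r. f k) + (\<Sum>k<t. f (r + k))" for f :: "nat \<Rightarrow> complex"
  unfolding n_eq by (rule sum_split)

text \<open>Taking the mean of \<open>L G = 1\<close> and integrating the noise by parts replaces the noise by random diagonal
  weights built from the normalized traces of \<open>G\<close> itself.\<close>

lemma mean_res_row:
  assumes il: "i < n" "l < n"
  shows "mm n (skew_lin r (\<lambda>_. e) B) mean_res i l
     + (\<integral>x. (of_real (pp False i) * wtrace True x + of_real (pp True i) * wtrace False x) * rand_res x i l \<partial>PG) = kron i l"
proof -
  interpret P: prob_space PG by (rule PG)
  note Gi = rand_res_product_integrable
  have inv: "mm n (skew_lin r (\<lambda>_. e) (noisy x)) (rand_res x) i l = kron i l" for x
    unfolding rand_res_def by (rule res_inverse(1)) (use e_pos il in auto)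
  have Lm: "integrable PG (\<lambda>x. mm n (skew_lin r (\<lambda>_. e) B) (rand_res x) i l)"
    unfolding mm_def by (intro Bochner_Integration.integrable_sum integrable_mult_right Gi(2)) (use il in auto)
  have LE: "(\<integral>x. mm n (skew_lin r (\<lambda>_. e) B) (rand_res x) i l \<partial>PG) = mm n (skew_lin r (\<lambda>_. e) B) mean_res i l"
    unfolding mm_def mean_res_def using il
    by (subst Bochner_Integration.integral_sum) (auto intro!: Gi(2) integrable_mult_right)
  have sq: "complex_of_real (noise_scale i j) * of_real (noise_scale i j) = of_real (d i * dt j / real t)" if "i < r" "j < t" for i j
    unfolding noise_scale_sq[OF that, symmetric] power2_eq_square by simp
  show ?thesis
  proof (cases "i < r")
    case True
    let ?f = "\<lambda>j x. of_real (noise_scale i j) * (Complex (x ((i, j), False)) (x ((i, j), True)) * rand_res x (r + j) l)"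
    have ptw: "mm n (skew_lin r (\<lambda>_. e) (noisy x)) (rand_res x) i l = mm n (skew_lin r (\<lambda>_. e) B) (rand_res x) i l + (\<Sum>j<t. ?f j x)" for x
    proof -
      have a: "(\<Sum>k<r. skew_lin r (\<lambda>_. e) (noisy x) i k * rand_res x k l) = (\<Sum>k<r. skew_lin r (\<lambda>_. e) B i k * rand_res x k l)"
        using True by (intro sum.cong) (auto simp: skew_lin_def)
      have b: "(\<Sum>k<t. skew_lin r (\<lambda>_. e) (noisy x) i (r + k) * rand_res x (r + k) l)
         = (\<Sum>k<t. skew_lin r (\<lambda>_. e) B i (r + k) * rand_res x (r + k) l) + (\<Sum>j<t. ?f j x)"
        unfolding sum.distrib[symmetric] using True by (intro sum.cong) (auto simp: skew_lin_def noisy_def algebra_simps)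
      show ?thesis unfolding mm_def sum_n a b by (simp add: add.assoc)
    qed
    have fi: "integrable PG (?f j)" if "j < t" for j
      by (rule integrable_mult_right, rule complex_ibp(3)[OF True that il(2)])
    have "kron i l = (\<integral>x. mm n (skew_lin r (\<lambda>_. e) B) (rand_res x) i l + (\<Sum>j<t. ?f j x) \<partial>PG)"
      using ptw inv by (simp add: P.prob_space)
    also have "\<dots> = mm n (skew_lin r (\<lambda>_. e) B) mean_res i l + (\<integral>x. (\<Sum>j<t. ?f j x) \<partial>PG)"
      unfolding LE[symmetric] by (rule Bochner_Integration.integral_add[OF Lm]) (use fi in auto)
    also have "(\<integral>x. (\<Sum>j<t. ?f j x) \<partial>PG) = (\<Sum>j<t. (\<integral>x. ?f j x \<partial>PG))"
      by (rule Bochner_Integration.integral_sum) (use fi in auto)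
    also have "(\<Sum>j<t. (\<integral>x. ?f j x \<partial>PG)) = (\<Sum>j<t. (\<integral>x. of_real (d i * dt j / real t) * (rand_res x (r + j) (r + j) * rand_res x i l) \<partial>PG))"
    proof (intro sum.cong refl)
      fix j assume "j \<in> {..<t}"
      then have j: "j < t" by simp
      show "(\<integral>x. ?f j x \<partial>PG) = (\<integral>x. of_real (d i * dt j / real t) * (rand_res x (r + j) (r + j) * rand_res x i l) \<partial>PG)"
        unfolding integral_mult_right_zero complex_ibp(1)[OF True j il(2)]
        unfolding mult.assoc[symmetric] sq[OF True j] ..
    qed
    also have "\<dots> = (\<integral>x. (\<Sum>j<t. of_real (d i * dt j / real t) * (rand_res x (r + j) (r + j) * rand_res x i l)) \<partial>PG)"
      by (rule Bochner_Integration.integral_sum[symmetric], rule integrable_mult_right, rule Gi(1)) (use n_eq il in auto)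
    also have "\<dots> = (\<integral>x. (of_real (pp False i) * wtrace True x + of_real (pp True i) * wtrace False x) * rand_res x i l \<partial>PG)"
      using True by (simp add: wtrace_def sum_n pp_def sum_distrib_left sum_distrib_right sum_divide_distrib mult_ac)
    finally show ?thesis by simp
  next
    case False
    define j where "j = i - r"
    have j: "j < t" "i = r + j" using False il n_eq by (auto simp: j_def)
    let ?f = "\<lambda>i x. of_real (noise_scale i j) * (cnj (Complex (x ((i, j), False)) (x ((i, j), True))) * rand_res x i l)"
    have ptw: "mm n (skew_lin r (\<lambda>_. e) (noisy x)) (rand_res x) (r + j) l = mm n (skew_lin r (\<lambda>_. e) B) (rand_res x) (r + j) l - (\<Sum>i<r. ?f i x)" for x
    proof -
      have a: "(\<Sum>k<t. skew_lin r (\<lambda>_. e) (noisy x) (r + j) (r + k) * rand_res x (r + k) l) = (\<Sum>k<t. skew_lin r (\<lambda>_. e) B (r + j) (r + k) * rand_res x (r + k) l)"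
        by (intro sum.cong) (auto simp: skew_lin_def)
      have b: "(\<Sum>k<r. skew_lin r (\<lambda>_. e) (noisy x) (r + j) k * rand_res x k l)
         = (\<Sum>k<r. skew_lin r (\<lambda>_. e) B (r + j) k * rand_res x k l) - (\<Sum>i<r. ?f i x)"
        unfolding sum_subtractf[symmetric] by (intro sum.cong) (auto simp: skew_lin_def noisy_def algebra_simps)
      show ?thesis unfolding mm_def sum_n a b by simp
    qed
    have fi: "integrable PG (?f i)" if "i < r" for i
      by (rule integrable_mult_right, rule complex_ibp(4)[OF that j(1) il(2)])
    have "kron i l = (\<integral>x. mm n (skew_lin r (\<lambda>_. e) B) (rand_res x) i l - (\<Sum>i<r. ?f i x) \<partial>PG)"
      using ptw inv j(2) by (simp add: P.prob_space)
    also have "\<dots> = mm n (skew_lin r (\<lambda>_. e) B) mean_res i l - (\<integral>x. (\<Sum>i<r. ?f i x) \<partial>PG)"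
      unfolding LE[symmetric] by (rule Bochner_Integration.integral_diff[OF Lm]) (use fi in auto)
    also have "(\<integral>x. (\<Sum>i<r. ?f i x) \<partial>PG) = (\<Sum>i<r. (\<integral>x. ?f i x \<partial>PG))"
      by (rule Bochner_Integration.integral_sum) (use fi in auto)
    also have "(\<Sum>i<r. (\<integral>x. ?f i x \<partial>PG)) = (\<Sum>i<r. - (\<integral>x. of_real (d i * dt j / real t) * (rand_res x i i * rand_res x (r + j) l) \<partial>PG))"
    proof (intro sum.cong refl)
      fix i assume "i \<in> {..<r}"
      then have i: "i < r" by simp
      show "(\<integral>x. ?f i x \<partial>PG) = - (\<integral>x. of_real (d i * dt j / real t) * (rand_res x i i * rand_res x (r + j) l) \<partial>PG)"
        unfolding integral_mult_right_zero complex_ibp(2)[OF i j(1) il(2)] mult_minus_right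
        unfolding mult.assoc[symmetric] sq[OF i j(1)] ..
    qed
    also have "\<dots> = - (\<Sum>i<r. (\<integral>x. of_real (d i * dt j / real t) * (rand_res x i i * rand_res x (r + j) l) \<partial>PG))"
      by (rule sum_negf)
    also have "(\<Sum>i<r. (\<integral>x. of_real (d i * dt j / real t) * (rand_res x i i * rand_res x (r + j) l) \<partial>PG))
        = (\<integral>x. (\<Sum>i<r. of_real (d i * dt j / real t) * (rand_res x i i * rand_res x (r + j) l)) \<partial>PG)"
      by (rule Bochner_Integration.integral_sum[symmetric], rule integrable_mult_right, rule Gi(1)) (use n_eq il j in auto)
    also have "\<dots> = (\<integral>x. (of_real (pp False i) * wtrace True x + of_real (pp True i) * wtrace False x) * rand_res x i l \<partial>PG)"
      using False j by (simp add: wtrace_def sum_n pp_def sum_distrib_left sum_distrib_right sum_divide_distrib mult_ac)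
    finally show ?thesis by simp
  qed
qed

lemma wtrace_lin_stat: "wtrace a = lin_stat (dg (\<lambda>k. pp a k / real t))"
  unfolding wtrace_def lin_stat_def mtr_def
  by (intro ext) (simp add: mm_dg_right sum_divide_distrib mult.commute)

lemma op_bound_pp: "op_bound n (dg (\<lambda>k. pp a k / real t)) (pm / real t)"
  by (rule op_bound_dg) (use pp_nonneg pp_le pm_nonneg in \<open>auto simp: divide_right_mono\<close>)

definition mean_wtrace :: "bool \<Rightarrow> real" where "mean_wtrace a = Re (\<integral>x. wtrace a x \<partial>PG)"

lemma rand_res_diag: "i < n \<Longrightarrow> rand_res x i i = of_real (Re (rand_res x i i))"
  unfolding rand_res_def by (rule res_diag_real) (use e_pos in auto)

lemma rand_res_diag_nonneg: "i < n \<Longrightarrow> 0 \<le> Re (rand_res x i i)"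
  unfolding rand_res_def by (subst res_ward) (use e_pos in \<open>auto intro!: sum_nonneg\<close>)

lemma wtrace_real: "wtrace a x = of_real ((\<Sum>k<n. pp a k * Re (rand_res x k k)) / real t)"
proof -
  have "(\<Sum>k<n. of_real (pp a k) * rand_res x k k) = (\<Sum>k<n. of_real (pp a k * Re (rand_res x k k)))"
    by (intro sum.cong refl) (subst rand_res_diag, auto)
  then show ?thesis by (simp add: wtrace_def)
qed

lemma mean_wtrace_integral: "mean_wtrace a = (\<integral>x. (\<Sum>k<n. pp a k * Re (rand_res x k k)) / real t \<partial>PG)"
  and mean_wtrace_eq: "(\<integral>x. wtrace a x \<partial>PG) = of_real (mean_wtrace a)"
  unfolding mean_wtrace_def wtrace_real integral_complex_of_real by simp_all

lemma mean_wtrace_bounds: "0 \<le> mean_wtrace a" "mean_wtrace a \<le> pm * nu / e"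
proof -
  interpret P: prob_space PG by (rule PG)
  have b: "0 \<le> (\<Sum>k<n. pp a k * Re (rand_res x k k)) / real t \<and> (\<Sum>k<n. pp a k * Re (rand_res x k k)) / real t \<le> pm * nu / e" for x
  proof
    show "0 \<le> (\<Sum>k<n. pp a k * Re (rand_res x k k)) / real t"
      by (intro divide_nonneg_nonneg sum_nonneg mult_nonneg_nonneg pp_nonneg rand_res_diag_nonneg) auto
    have "Re (rand_res x k k) \<le> 1 / e" if "k < n" for k
      using complex_Re_le_cmod[of "rand_res x k k"] rand_res_entry[OF that that, of x] by linarith
    from avg_le[of "\<lambda>k. Re (rand_res x k k)" "1 / e", OF this]
    show "(\<Sum>k<n. pp a k * Re (rand_res x k k)) / real t \<le> pm * nu / e" using e_pos by simp
  qed
  note eq = mean_wtrace_integral[of a]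
  show "0 \<le> mean_wtrace a" unfolding eq using b by (intro Bochner_Integration.integral_nonneg) auto
  have "norm (\<integral>x. (\<Sum>k<n. pp a k * Re (rand_res x k k)) / real t \<partial>PG) \<le> pm * nu / e"
  proof (rule P.norm_integral_le)
    show "norm ((\<Sum>k<n. pp a k * Re (rand_res x k k)) / real t) \<le> pm * nu / e" for x
      unfolding real_norm_def using b[of x] by (subst abs_of_nonneg) blast+
    show "0 \<le> pm * nu / e" using pm_nonneg nu_pos e_pos by simp
  qed
  then show "mean_wtrace a \<le> pm * nu / e" unfolding eq real_norm_def by (rule order_trans[OF abs_ge_self])
qed

definition det_res :: "nat \<Rightarrow> nat \<Rightarrow> complex" where "det_res = res n r (wt pp e mean_wtrace) B"

text \<open>The error made when the random traces \<open>wtrace\<close> are replaced by their means.\<close>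

definition cov_defect :: "nat \<Rightarrow> nat \<Rightarrow> complex" where
  "cov_defect i l = (\<integral>x. (of_real (pp False i) * (wtrace True x - of_real (mean_wtrace True))
     + of_real (pp True i) * (wtrace False x - of_real (mean_wtrace False))) * rand_res x i l \<partial>PG)"

lemma lin_stat_props:
  assumes "op_bound n Q c"
  shows "lin_stat Q \<in> borel_measurable PG" "\<And>x. cmod (lin_stat Q x) \<le> real n * (1 / e * c)"
proof -
  interpret g: gaussian_function I "lin_stat Q" "lin_stat_deriv Q" "real n * (1 / e * c)" "2 * pm * (1 / e * c * (1 / e))"
    by (rule gaussian_function_lin_stat[OF assms])
  show "lin_stat Q \<in> borel_measurable PG" "\<And>x. cmod (lin_stat Q x) \<le> real n * (1 / e * c)"
    by (rule g.F_meas, rule g.F_le)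
qed

lemma lin_stat_product_integrable:
  assumes "op_bound n Q c" "op_bound n Q' c'"
  shows "integrable PG (\<lambda>x. (lin_stat Q x - z) * (lin_stat Q' x - z'))" "integrable PG (lin_stat Q)"
proof -
  interpret P: prob_space PG by (rule PG)
  note [measurable] = lin_stat_props(1)[OF assms(1)] lin_stat_props(1)[OF assms(2)]
  note b = lin_stat_props(2)[OF assms(1)] lin_stat_props(2)[OF assms(2)]
  show "integrable PG (lin_stat Q)" by (rule P.integrable_bdd[OF _ b(1)]) simp
  show "integrable PG (\<lambda>x. (lin_stat Q x - z) * (lin_stat Q' x - z'))"
  proof (rule P.integrable_bdd)
    fix x
    have "cmod (lin_stat Q x - z) \<le> real n * (1 / e * c) + cmod z" "cmod (lin_stat Q' x - z') \<le> real n * (1 / e * c') + cmod z'"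
      using norm_triangle_ineq4[of "lin_stat Q x" z] norm_triangle_ineq4[of "lin_stat Q' x" z'] b(1)[of x] b(2)[of x] by linarith+
    then show "norm ((lin_stat Q x - z) * (lin_stat Q' x - z')) \<le> (real n * (1 / e * c) + cmod z) * (real n * (1 / e * c') + cmod z')"
      unfolding norm_mult using op_bound_nonneg[OF assms(1)] e_pos by (intro mult_mono) auto
  qed measurable
qed

text \<open>A covariance is bounded by the geometric mean of the two variances. The bound is bilinear in the
  operator bounds \<open>c\<close> and \<open>c'\<close>, so a normalized trace contributes a factor \<open>1 / t\<close>.\<close>

lemma lin_stat_covariance:
  assumes Q: "op_bound n Q c" and Q': "op_bound n Q' c'"
  defines "z \<equiv> (\<integral>x. lin_stat Q x \<partial>PG)"
  shows "cmod (\<integral>x. (lin_stat Q x - z) * lin_stat Q' x \<partial>PG) \<le> pm\<^sup>2 * nu * c * c' / e ^ 4"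
proof -
  interpret P: prob_space PG by (rule PG)
  define z' where "z' = (\<integral>x. lin_stat Q' x \<partial>PG)"
  note i = lin_stat_product_integrable[OF Q Q'] and iQ' = lin_stat_product_integrable(2)[OF Q' Q]
  note v = P.variance_bounds(3,4)[OF lin_stat_props[OF Q]] and v' = P.variance_bounds(3,4)[OF lin_stat_props[OF Q']]
  have c0: "0 \<le> c" "0 \<le> c'" using op_bound_nonneg Q Q' by auto
  have "(\<integral>x. (lin_stat Q x - z) * lin_stat Q' x \<partial>PG) = (\<integral>x. (lin_stat Q x - z) * (lin_stat Q' x - z') \<partial>PG)"
  proof -
    have "(\<integral>x. (lin_stat Q x - z) * lin_stat Q' x \<partial>PG) = (\<integral>x. (lin_stat Q x - z) * (lin_stat Q' x - z') + z' * (lin_stat Q x - z) \<partial>PG)"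
      by (intro Bochner_Integration.integral_cong refl) (simp add: algebra_simps)
    also have "\<dots> = (\<integral>x. (lin_stat Q x - z) * (lin_stat Q' x - z') \<partial>PG) + (\<integral>x. z' * (lin_stat Q x - z) \<partial>PG)"
      by (rule Bochner_Integration.integral_add[OF i(1)]) (use i(2) in auto)
    also have "(\<integral>x. z' * (lin_stat Q x - z) \<partial>PG) = 0"
      using i(2) by (simp add: z_def P.prob_space)
    finally show ?thesis by simp
  qed
  moreover have "cmod (\<integral>x. (lin_stat Q x - z) * (lin_stat Q' x - z') \<partial>PG) \<le> pm\<^sup>2 * nu * c * c' / e ^ 4"
  proof (cases "c = 0 \<or> c' = 0")
    case True
    (* a zero bound forces the functional to vanish *)
    have z0: "lin_stat R x = 0" if "op_bound n R 0" for R x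
      using lin_stat_props(2)[OF that, of x] by simp
    from True show ?thesis
    proof
      assume "c = 0" then show ?thesis using z0 Q by (simp add: z_def)
    next
      assume "c' = 0" then show ?thesis using z0 Q' by (simp add: z'_def)
    qed
  next
    case False
    then have cp: "0 < c" "0 < c'" using c0 by auto
    (* weighted AM-GM with weights c' / c balances the two variances *)
    have Qi: "integrable PG (\<lambda>x. (cmod (lin_stat Q x - z))\<^sup>2)" and Qi': "integrable PG (\<lambda>x. (cmod (lin_stat Q' x - z'))\<^sup>2)"
    proof -
      have "integrable PG (\<lambda>x. cmod ((lin_stat Q x - z) * (lin_stat Q x - z)))" "integrable PG (\<lambda>x. cmod ((lin_stat Q' x - z') * (lin_stat Q' x - z')))"
        by (rule integrable_norm, rule lin_stat_product_integrable(1)[OF Q Q], rule integrable_norm, rule lin_stat_product_integrable(1)[OF Q' Q'])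
      then show "integrable PG (\<lambda>x. (cmod (lin_stat Q x - z))\<^sup>2)" "integrable PG (\<lambda>x. (cmod (lin_stat Q' x - z'))\<^sup>2)"
        by (simp_all add: norm_mult power2_eq_square)
    qed
    have "cmod (\<integral>x. (lin_stat Q x - z) * (lin_stat Q' x - z') \<partial>PG) \<le> (\<integral>x. cmod ((lin_stat Q x - z) * (lin_stat Q' x - z')) \<partial>PG)"
      by (rule integral_norm_bound)
    also have "\<dots> \<le> (\<integral>x. (c' / (2 * c)) * (cmod (lin_stat Q x - z))\<^sup>2 + (c / (2 * c')) * (cmod (lin_stat Q' x - z'))\<^sup>2 \<partial>PG)"
    proof (rule integral_mono)
      show "integrable PG (\<lambda>x. cmod ((lin_stat Q x - z) * (lin_stat Q' x - z')))" using i(1) by simp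
      show "integrable PG (\<lambda>x. (c' / (2 * c)) * (cmod (lin_stat Q x - z))\<^sup>2 + (c / (2 * c')) * (cmod (lin_stat Q' x - z'))\<^sup>2)"
        using Qi Qi' by simp
      show "cmod ((lin_stat Q x - z) * (lin_stat Q' x - z')) \<le> (c' / (2 * c)) * (cmod (lin_stat Q x - z))\<^sup>2 + (c / (2 * c')) * (cmod (lin_stat Q' x - z'))\<^sup>2" for x
      proof -
        have "2 * c * c' * (a * b) \<le> (c' * a)\<^sup>2 + (c * b)\<^sup>2" for a b :: real
          using zero_le_power2[of "c' * a - c * b"] by (simp add: power2_eq_square algebra_simps)
        then have "a * b \<le> (c' / (2 * c)) * a\<^sup>2 + (c / (2 * c')) * b\<^sup>2" for a b :: real
          using cp by (simp add: field_simps power2_eq_square)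
        then show ?thesis unfolding norm_mult .
      qed
    qed
    also have "\<dots> = (c' / (2 * c)) * complex_variance PG (lin_stat Q) + (c / (2 * c')) * complex_variance PG (lin_stat Q')"
      using Qi Qi' by (simp add: P.variance_eq[OF v] P.variance_eq[OF v'] z_def z'_def)
    also have "\<dots> \<le> (c' / (2 * c)) * (pm\<^sup>2 * nu * c\<^sup>2 / e ^ 4) + (c / (2 * c')) * (pm\<^sup>2 * nu * c'\<^sup>2 / e ^ 4)"
      by (intro add_mono mult_left_mono variance_lin_stat Q Q') (use cp in auto)
    also have "\<dots> = pm\<^sup>2 * nu * c * c' / e ^ 4"
      using cp by (simp add: power2_eq_square field_simps)
    finally show ?thesis .
  qed
  ultimately show ?thesis by simp
qed

lemma det_res_pos: "i < n \<Longrightarrow> 0 < wt pp e mean_wtrace i"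
  using wt_ge[of mean_wtrace i e] mean_wtrace_bounds e_pos by (simp add: less_le_trans)

text \<open>With means in place of the random traces, the averaged equation becomes the deterministic one up to
  \<open>cov_defect\<close>.\<close>

lemma mean_res_perturbed:
  assumes il: "i < n" "l < n"
  shows "mm n (skew_lin r (wt pp e mean_wtrace) B) mean_res i l = kron i l - cov_defect i l"
proof -
  interpret P: prob_space PG by (rule PG)
  have XG: "integrable PG (\<lambda>x. wtrace a x * rand_res x i l)" for a
  proof -
    have "integrable PG (\<lambda>x. (wtrace a x - 0) * (rand_res x i l - 0))"
      using lin_stat_product_integrable(1)[OF op_bound_pp[of a] op_bound_mat_unit[OF il(1), of l], of 0 0] il by (simp add: wtrace_lin_stat lin_stat_mat_unit)
    then show ?thesis by simp
  qed
  have Gi: "integrable PG (\<lambda>x. rand_res x i l)" by (rule rand_res_product_integrable(2)) (use il in auto)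
  have "cov_defect i l = (\<integral>x. (of_real (pp False i) * wtrace True x + of_real (pp True i) * wtrace False x) * rand_res x i l
      - of_real (pp False i * mean_wtrace True + pp True i * mean_wtrace False) * rand_res x i l \<partial>PG)"
    unfolding cov_defect_def by (intro Bochner_Integration.integral_cong refl) (simp add: algebra_simps)
  also have "\<dots> = (\<integral>x. (of_real (pp False i) * wtrace True x + of_real (pp True i) * wtrace False x) * rand_res x i l \<partial>PG)
      - (\<integral>x. of_real (pp False i * mean_wtrace True + pp True i * mean_wtrace False) * rand_res x i l \<partial>PG)"
  proof (rule Bochner_Integration.integral_diff)
    show "integrable PG (\<lambda>x. (of_real (pp False i) * wtrace True x + of_real (pp True i) * wtrace False x) * rand_res x i l)"
      unfolding distrib_right mult.assoc by (intro Bochner_Integration.integrable_add integrable_mult_right XG)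
  qed (intro integrable_mult_right Gi)
  also have "(\<integral>x. of_real (pp False i * mean_wtrace True + pp True i * mean_wtrace False) * rand_res x i l \<partial>PG) = of_real (pp False i * mean_wtrace True + pp True i * mean_wtrace False) * mean_res i l"
    by (simp only: integral_mult_right_zero mean_res_def)
  also have "(\<integral>x. (of_real (pp False i) * wtrace True x + of_real (pp True i) * wtrace False x) * rand_res x i l \<partial>PG)
      = kron i l - mm n (skew_lin r (\<lambda>_. e) B) mean_res i l"
    by (rule eq_diff_eq[THEN iffD2, OF trans[OF add.commute mean_res_row[OF il]]])
  finally have D: "cov_defect i l = kron i l - mm n (skew_lin r (\<lambda>_. e) B) mean_res i l - of_real (pp False i * mean_wtrace True + pp True i * mean_wtrace False) * mean_res i l" .
  have "skew_lin r (wt pp e mean_wtrace) B i k = skew_lin r (\<lambda>_. e) B i k + dg (\<lambda>i. pp False i * mean_wtrace True + pp True i * mean_wtrace False) i k" for k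
    by (simp add: skew_lin_def dg_def wt_def)
  then have "mm n (skew_lin r (wt pp e mean_wtrace) B) mean_res i l = mm n (skew_lin r (\<lambda>_. e) B) mean_res i l + mm n (dg (\<lambda>i. pp False i * mean_wtrace True + pp True i * mean_wtrace False)) mean_res i l"
    by (simp add: mm_def distrib_right sum.distrib)
  then show ?thesis using D il by (simp add: mm_dg_left)
qed

lemma mean_res_eq:
  assumes il: "i < n" "l < n"
  shows "mean_res i l = det_res i l - mm n det_res cov_defect i l"
proof -
  have "mean_res i l = mm n kron mean_res i l" using il by (simp add: mm_kron_left)
  also have "\<dots> = mm n (mm n det_res (skew_lin r (wt pp e mean_wtrace) B)) mean_res i l"
    by (rule mm_cong) (use res_inverse(2)[OF det_res_pos] il in \<open>simp_all add: det_res_def\<close>)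
  also have "\<dots> = mm n det_res (\<lambda>i l. kron i l - cov_defect i l) i l"
    unfolding mm_assoc by (rule mm_cong) (use mean_res_perturbed il in auto)
  also have "\<dots> = mm n det_res kron i l - mm n det_res cov_defect i l"
    by (simp add: mm_def right_diff_distrib sum_subtractf)
  finally show ?thesis using il by (simp add: mm_kron_right)
qed

lemma op_bound_det_res: "op_bound n det_res (1 / e)"
  unfolding det_res_def by (rule op_bound_res) (use wt_ge[of mean_wtrace] mean_wtrace_bounds e_pos in auto)

text \<open>The trace of \<open>cov_defect\<close> against a bounded matrix is a sum of two covariances between a normalized
  trace, of standard deviation \<open>O(1 / t)\<close>, and a trace, of standard deviation \<open>O(1)\<close>.\<close>

lemma mean_res_det_res:
  assumes Q: "op_bound n Q c"
  shows "cmod (mtr n (mm n mean_res Q) - mtr n (mm n det_res Q)) \<le> 2 * pm ^ 4 * nu * c / (real t * e ^ 5)"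
proof -
  define Z where "Z = mm n Q det_res"
  have Z: "op_bound n Z (c * (1 / e))" unfolding Z_def by (intro op_bound_mm Q op_bound_det_res)
  (* the trace with index a multiplies the opposite profile, see wt *)
  define Y where "Y a = mm n Z (dg (pp (\<not> a)))" for a
  have Y: "op_bound n (Y a) (c * (1 / e) * pm)" for a
    unfolding Y_def by (intro op_bound_mm Z op_bound_dg) (use pp_nonneg pp_le pm_nonneg in auto)
  have "mtr n (mm n mean_res Q) = mtr n (mm n (\<lambda>i l. det_res i l - mm n det_res cov_defect i l) Q)"
    unfolding mtr_def mm_def[of n mean_res] mm_def[of n "\<lambda>i l. det_res i l - mm n det_res cov_defect i l"]
    by (intro sum.cong refl) (simp add: mean_res_eq)
  also have "\<dots> = mtr n (mm n det_res Q) - mtr n (mm n (mm n det_res cov_defect) Q)"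
    by (simp add: mtr_def mm_def[of n "\<lambda>i l. det_res i l - mm n det_res cov_defect i l"] mm_def[of n det_res Q] mm_def[of n "mm n det_res cov_defect" Q] left_diff_distrib sum_subtractf)
  also have "mtr n (mm n (mm n det_res cov_defect) Q) = mtr n (mm n cov_defect Z)"
    unfolding Z_def mm_assoc by (subst mtr_comm) (simp add: mm_assoc)
  finally have eq: "mtr n (mm n mean_res Q) - mtr n (mm n det_res Q) = - mtr n (mm n cov_defect Z)" by simp
  have "mtr n (mm n cov_defect Z) = (\<integral>x. (wtrace True x - of_real (mean_wtrace True)) * lin_stat (Y True) x \<partial>PG) + (\<integral>x. (wtrace False x - of_real (mean_wtrace False)) * lin_stat (Y False) x \<partial>PG)"
  proof -
    have tr: "(\<Sum>i<n. \<Sum>l<n. of_real (pp (\<not> a) i) * rand_res x i l * Z l i) = lin_stat (Y a) x" for a x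
      unfolding lin_stat_def mtr_def mm_def[of n "rand_res x"]
      by (intro sum.cong refl) (simp add: Y_def mm_dg_right mult_ac)
    have ii: "integrable PG (\<lambda>x. (wtrace a x - of_real (mean_wtrace a)) * rand_res x i l)" if "i < n" "l < n" for a i l
      using lin_stat_product_integrable(1)[OF op_bound_pp[of a] op_bound_mat_unit[OF that(1), of l], of "of_real (mean_wtrace a)" 0] that
      by (simp add: wtrace_lin_stat lin_stat_mat_unit)
    have Dl: "cov_defect i l * Z l i = (\<integral>x. (wtrace True x - of_real (mean_wtrace True)) * (of_real (pp False i) * rand_res x i l * Z l i) \<partial>PG)
        + (\<integral>x. (wtrace False x - of_real (mean_wtrace False)) * (of_real (pp True i) * rand_res x i l * Z l i) \<partial>PG)" if "i < n" "l < n" for i l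
    proof -
      have "cov_defect i l * Z l i = (\<integral>x. (of_real (pp False i) * Z l i) * ((wtrace True x - of_real (mean_wtrace True)) * rand_res x i l)
        + (of_real (pp True i) * Z l i) * ((wtrace False x - of_real (mean_wtrace False)) * rand_res x i l) \<partial>PG)"
        unfolding cov_defect_def integral_mult_left_zero[symmetric]
        by (intro Bochner_Integration.integral_cong refl) (simp add: algebra_simps)
      also have "\<dots> = (\<integral>x. (of_real (pp False i) * Z l i) * ((wtrace True x - of_real (mean_wtrace True)) * rand_res x i l) \<partial>PG)
        + (\<integral>x. (of_real (pp True i) * Z l i) * ((wtrace False x - of_real (mean_wtrace False)) * rand_res x i l) \<partial>PG)"
        by (rule Bochner_Integration.integral_add) (intro integrable_mult_right ii that)+
      finally show ?thesis by (simp only: mult_ac)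
    qed
    have i2: "integrable PG (\<lambda>x. (wtrace a x - of_real (mean_wtrace a)) * (of_real (pp a' i) * rand_res x i l * Z l i))" if "i < n" "l < n" for a a' i l
    proof -
      have "integrable PG (\<lambda>x. (of_real (pp a' i) * Z l i) * ((wtrace a x - of_real (mean_wtrace a)) * rand_res x i l))"
        by (intro integrable_mult_right ii that)
      then show ?thesis by (simp only: mult_ac)
    qed
    have S: "(\<Sum>i<n. \<Sum>l<n. (\<integral>x. (wtrace a x - of_real (mean_wtrace a)) * (of_real (pp (\<not> a) i) * rand_res x i l * Z l i) \<partial>PG))
       = (\<integral>x. (wtrace a x - of_real (mean_wtrace a)) * lin_stat (Y a) x \<partial>PG)" for a
    proof -
      have "(\<integral>x. (wtrace a x - of_real (mean_wtrace a)) * lin_stat (Y a) x \<partial>PG)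
        = (\<integral>x. (\<Sum>i<n. \<Sum>l<n. (wtrace a x - of_real (mean_wtrace a)) * (of_real (pp (\<not> a) i) * rand_res x i l * Z l i)) \<partial>PG)"
        unfolding tr[symmetric] sum_distrib_left ..
      also have "\<dots> = (\<Sum>i<n. \<Sum>l<n. (\<integral>x. (wtrace a x - of_real (mean_wtrace a)) * (of_real (pp (\<not> a) i) * rand_res x i l * Z l i) \<partial>PG))"
      proof -
        have "(\<integral>x. (\<Sum>i<n. \<Sum>l<n. (wtrace a x - of_real (mean_wtrace a)) * (of_real (pp (\<not> a) i) * rand_res x i l * Z l i)) \<partial>PG)
          = (\<Sum>i<n. (\<integral>x. (\<Sum>l<n. (wtrace a x - of_real (mean_wtrace a)) * (of_real (pp (\<not> a) i) * rand_res x i l * Z l i)) \<partial>PG))"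
          by (rule Bochner_Integration.integral_sum, rule Bochner_Integration.integrable_sum) (auto intro: i2)
        also have "\<dots> = (\<Sum>i<n. \<Sum>l<n. (\<integral>x. (wtrace a x - of_real (mean_wtrace a)) * (of_real (pp (\<not> a) i) * rand_res x i l * Z l i) \<partial>PG))"
          by (rule sum.cong[OF refl], rule Bochner_Integration.integral_sum) (auto intro: i2)
        finally show ?thesis .
      qed
      finally show ?thesis by simp
    qed
    have "mtr n (mm n cov_defect Z) = (\<Sum>i<n. \<Sum>l<n. cov_defect i l * Z l i)" by (simp add: mtr_def mm_def)
    also have "\<dots> = (\<Sum>i<n. \<Sum>l<n. (\<integral>x. (wtrace True x - of_real (mean_wtrace True)) * (of_real (pp False i) * rand_res x i l * Z l i) \<partial>PG))
        + (\<Sum>i<n. \<Sum>l<n. (\<integral>x. (wtrace False x - of_real (mean_wtrace False)) * (of_real (pp True i) * rand_res x i l * Z l i) \<partial>PG))"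
      using Dl by (simp add: sum.distrib)
    finally show ?thesis using S[of True] S[of False] by simp
  qed
  then have "cmod (mtr n (mm n cov_defect Z)) \<le> cmod (\<integral>x. (wtrace True x - of_real (mean_wtrace True)) * lin_stat (Y True) x \<partial>PG)
      + cmod (\<integral>x. (wtrace False x - of_real (mean_wtrace False)) * lin_stat (Y False) x \<partial>PG)"
    using norm_triangle_ineq by simp
  also have "\<dots> \<le> pm\<^sup>2 * nu * (pm / real t) * (c * (1 / e) * pm) / e ^ 4 + pm\<^sup>2 * nu * (pm / real t) * (c * (1 / e) * pm) / e ^ 4"
    unfolding mean_wtrace_eq[symmetric] wtrace_lin_stat by (intro add_mono lin_stat_covariance op_bound_pp Y)
  also have "\<dots> = 2 * pm ^ 4 * nu * c / (real t * e ^ 5)"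
    using e_pos t_pos by (simp add: field_simps eval_nat_numeral)
  finally show ?thesis unfolding eq norm_minus_cancel .
qed

text \<open>The previous estimate for the test matrix \<open>dg (pp a) / t\<close>, whose operator bound contributes a second
  factor \<open>1 / t\<close>: the mean traces solve the canonical equations up to \<open>O(1 / t\<^sup>2)\<close>.\<close>

lemma mean_wtrace_approx: "\<bar>mean_wtrace a - Phi n r t pp B e mean_wtrace a\<bar> \<le> 2 * pm ^ 5 * nu / ((real t)\<^sup>2 * e ^ 5)"
proof -
  have 1: "mtr n (mm n mean_res (dg (\<lambda>k. pp a k / real t))) = of_real (mean_wtrace a)"
  proof -
    have "(\<integral>x. wtrace a x \<partial>PG) = (\<Sum>k<n. of_real (pp a k) * mean_res k k) / of_nat t"
      unfolding wtrace_def mean_res_def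
      by (simp, subst Bochner_Integration.integral_sum) (auto intro!: rand_res_product_integrable(2))
    then show ?thesis unfolding mean_wtrace_eq by (simp add: mtr_def mm_dg_right sum_divide_distrib mult.commute)
  qed
  have 2: "mtr n (mm n det_res (dg (\<lambda>k. pp a k / real t))) = of_real (Phi n r t pp B e mean_wtrace a)"
  proof -
    have "det_res k k = of_real (Re (det_res k k))" if "k < n" for k
      unfolding det_res_def by (rule res_diag_real[OF det_res_pos that])
    then have "(\<Sum>k<n. det_res k k * of_real (pp a k / real t)) = (\<Sum>k<n. of_real (Re (det_res k k) * (pp a k / real t)))"
    proof (intro sum.cong refl)
      fix k assume "k \<in> {..<n}"
      then have "det_res k k * of_real (pp a k / real t) = of_real (Re (det_res k k)) * of_real (pp a k / real t)"
        using \<open>\<And>k. k < n \<Longrightarrow> det_res k k = of_real (Re (det_res k k))\<close>[of k] by (metis lessThan_iff)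
      then show "det_res k k * of_real (pp a k / real t) = of_real (Re (det_res k k) * (pp a k / real t))"
        by (simp only: of_real_mult)
    qed
    then show ?thesis
      by (simp add: mtr_def mm_dg_right Phi_def det_res_def[symmetric] sum_divide_distrib mult.commute del: of_real_divide)
  qed
  have "\<bar>mean_wtrace a - Phi n r t pp B e mean_wtrace a\<bar> = cmod (of_real (mean_wtrace a) - of_real (Phi n r t pp B e mean_wtrace a))"
    by (simp only: norm_of_real of_real_diff[symmetric])
  also have "\<dots> \<le> 2 * pm ^ 4 * nu * (pm / real t) / (real t * e ^ 5)"
    unfolding 1[symmetric] 2[symmetric] by (rule mean_res_det_res[OF op_bound_pp])
  also have "\<dots> = 2 * pm ^ 5 * nu / ((real t)\<^sup>2 * e ^ 5)"
    by (simp add: field_simps eval_nat_numeral)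
  finally show ?thesis .
qed

text \<open>By stability the mean traces are within \<open>O(1 / t\<^sup>2)\<close> of the exact solution. Since the trace of a product of
  bounded matrices is at most of order \<open>n\<close>, exchanging one for the other costs \<open>O(1 / t)\<close> in the trace, the
  same order as the covariance error.\<close>

lemma mean_res_fixed_point:
  assumes rows: "\<And>i. i < r \<Longrightarrow> (\<Sum>j<t. (cmod (B i j))\<^sup>2) \<le> b\<^sup>2"
    and cols: "\<And>j. j < t \<Longrightarrow> (\<Sum>i<r. (cmod (B i j))\<^sup>2) \<le> b\<^sup>2"
    and m: "is_fixed_point n r t pp B e m" and Q: "op_bound n Q c"
    and small: "2 * pm ^ 5 * nu / ((real t)\<^sup>2 * e ^ 5) \<le> fp_floor b e / 2"
  shows "cmod (mtr n (mm n mean_res Q) - mtr n (mm n (res n r (wt pp e m) B) Q))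
    \<le> c / (real t * e ^ 5) * (2 * pm ^ 4 * nu + 4 * stab_const b e * pm ^ 6 * nu\<^sup>2 / e\<^sup>2)"
proof -
  define eps where "eps = 2 * pm ^ 5 * nu / ((real t)\<^sup>2 * e ^ 5)"
  have c0: "0 \<le> c" by (rule op_bound_nonneg[OF Q])
  have m0: "0 \<le> m True" "0 \<le> m False" using m by (auto simp: is_fixed_point_def less_imp_le)
  define M where "M = res n r (wt pp e m) B"
  have M: "op_bound n M (1 / e)" unfolding M_def by (rule op_bound_res) (use wt_ge[of m] m0 e_pos in auto)
  (* stability asks for strictly positive arguments; the small error keeps the mean traces above half the floor *)
  have xpos: "0 < mean_wtrace a" for a
  proof -
    have "fp_floor b e \<le> Phi n r t pp B e mean_wtrace a"
      unfolding fp_floor_def by (rule Phi_ge[OF e_pos rows cols]) (use mean_wtrace_bounds in auto)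
    then show ?thesis using mean_wtrace_approx[of a] small fp_floor_pos[OF e_pos, of b] by linarith
  qed
  have close: "\<bar>mean_wtrace a - m a\<bar> \<le> stab_const b e * eps" for a
    using fp_stable[OF e_pos rows cols m xpos mean_wtrace_bounds(2) mean_wtrace_approx small] by (simp add: eps_def)
  define W where "W a = mtr n (mm n (mm n (mm n det_res (dg (pp a))) M) Q)" for a
  have W: "cmod (W a) \<le> real n * (1 / e * pm * (1 / e) * c)" for a
    unfolding W_def by (intro op_bound_trace op_bound_mm op_bound_det_res M Q op_bound_dg) (use pp_nonneg pp_le pm_nonneg in auto)
  (* the resolvent identity, linear in the difference of the weights *)
  have RM: "det_res i j - M i j = of_real (m True - mean_wtrace True) * mm n (mm n det_res (dg (pp False))) M i j
     + of_real (m False - mean_wtrace False) * mm n (mm n det_res (dg (pp True))) M i j" if "i < n" "j < n" for i j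
  proof -
    have "det_res i j - M i j = (\<Sum>k<n. of_real (wt pp e m k - wt pp e mean_wtrace k) * det_res i k * M k j)"
      unfolding det_res_def M_def
      by (rule res_diff_diag) (use wt_pos[OF e_pos m0] det_res_pos that in auto)
    also have "\<dots> = (\<Sum>k<n. of_real (m True - mean_wtrace True) * (det_res i k * of_real (pp False k) * M k j) + of_real (m False - mean_wtrace False) * (det_res i k * of_real (pp True k) * M k j))"
      by (intro sum.cong refl) (simp add: wt_def algebra_simps)
    also have "\<dots> = of_real (m True - mean_wtrace True) * (\<Sum>k<n. mm n det_res (dg (pp False)) i k * M k j) + of_real (m False - mean_wtrace False) * (\<Sum>k<n. mm n det_res (dg (pp True)) i k * M k j)"
      by (simp add: mm_dg_right sum.distrib sum_distrib_left)
    finally show ?thesis by (simp only: mm_def[of n "mm n det_res _" M])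
  qed
  have "mtr n (mm n det_res Q) - mtr n (mm n M Q) = (\<Sum>i<n. \<Sum>j<n. (det_res i j - M i j) * Q j i)"
    by (simp add: mtr_def mm_def left_diff_distrib sum_subtractf)
  also have "\<dots> = (\<Sum>i<n. \<Sum>j<n. of_real (m True - mean_wtrace True) * (mm n (mm n det_res (dg (pp False))) M i j * Q j i)
     + of_real (m False - mean_wtrace False) * (mm n (mm n det_res (dg (pp True))) M i j * Q j i))"
    by (intro sum.cong refl) (simp add: RM algebra_simps)
  also have "\<dots> = of_real (m True - mean_wtrace True) * W False + of_real (m False - mean_wtrace False) * W True"
    unfolding W_def mtr_def mm_def[of n "mm n (mm n det_res _) M" Q] by (simp only: sum.distrib sum_distrib_left)
  finally have "cmod (mtr n (mm n det_res Q) - mtr n (mm n M Q)) \<le> cmod (of_real (m True - mean_wtrace True) * W False) + cmod (of_real (m False - mean_wtrace False) * W True)"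
    using norm_triangle_ineq by simp
  also have "\<dots> = \<bar>mean_wtrace True - m True\<bar> * cmod (W False) + \<bar>mean_wtrace False - m False\<bar> * cmod (W True)"
    unfolding norm_mult norm_of_real by (simp only: abs_minus_commute)
  also have "\<dots> \<le> stab_const b e * eps * (real n * (1 / e * pm * (1 / e) * c)) + stab_const b e * eps * (real n * (1 / e * pm * (1 / e) * c))"
    by (intro add_mono mult_mono close W) (auto intro: order_trans[OF abs_ge_zero close])
  also have "\<dots> \<le> stab_const b e * eps * (nu * real t * (1 / e * pm * (1 / e) * c)) + stab_const b e * eps * (nu * real t * (1 / e * pm * (1 / e) * c))"
    by (intro add_mono mult_left_mono mult_right_mono n_le) (use c0 e_pos pm_nonneg order_trans[OF abs_ge_zero close] in auto)
  also have "\<dots> = c / (real t * e ^ 5) * (4 * stab_const b e * pm ^ 6 * nu\<^sup>2 / e\<^sup>2)"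
    using t_pos e_pos by (simp add: eps_def field_simps eval_nat_numeral)
  finally have 2: "cmod (mtr n (mm n det_res Q) - mtr n (mm n M Q)) \<le> c / (real t * e ^ 5) * (4 * stab_const b e * pm ^ 6 * nu\<^sup>2 / e\<^sup>2)" .
  have "cmod (mtr n (mm n mean_res Q) - mtr n (mm n M Q)) \<le> cmod (mtr n (mm n mean_res Q) - mtr n (mm n det_res Q)) + cmod (mtr n (mm n det_res Q) - mtr n (mm n M Q))"
    using norm_triangle_ineq[of "mtr n (mm n mean_res Q) - mtr n (mm n det_res Q)" "mtr n (mm n det_res Q) - mtr n (mm n M Q)"] by simp
  also have "\<dots> \<le> 2 * pm ^ 4 * nu * c / (real t * e ^ 5) + c / (real t * e ^ 5) * (4 * stab_const b e * pm ^ 6 * nu\<^sup>2 / e\<^sup>2)"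
    by (intro add_mono mean_res_det_res[OF Q] 2)
  finally show ?thesis unfolding M_def by (simp add: algebra_simps)
qed

end

section \<open>Resolvents as corners of the linearized inverse\<close>

text \<open>A one-sided inverse determines \<open>mat_inv\<close>; this identifies the inverses in the definitions of the resolvents with corners
  of \<open>res\<close>.\<close>

lemma mat_inv_eqI:
  assumes A: "A \<in> carrier_mat n n" and B: "B \<in> carrier_mat n n" and AB: "A * B = 1\<^sub>m n"
  shows "mat_inv A = B"
proof -
  have "Determinant.det A * Determinant.det B = 1"
    using det_mult[OF A B] AB by simp
  then have "Determinant.det A \<noteq> 0" by auto
  note I = mat_inv_inverts[OF A this]
  have "mat_inv A = mat_inv A * (A * B)" using I(3) AB by simp
  also have "\<dots> = (mat_inv A * A) * B" by (rule assoc_mult_mat[symmetric, OF I(3) A B])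
  finally show ?thesis using I(2) B by simp
qed

lemma mat_adjoint_entry: "i < dim_col A \<Longrightarrow> j < dim_row A \<Longrightarrow> mat_adjoint A $$ (i, j) = cnj (A $$ (j, i))"
  for A :: "complex mat"
  by (simp add: mat_adjoint_def mat_of_rows_def conjugate_complex_def)

lemma mat_adjoint_carrier: "A \<in> carrier_mat r t \<Longrightarrow> mat_adjoint A \<in> carrier_mat t r"
  for A :: "complex mat"
  by (auto simp: mat_adjoint_def mat_of_rows_def)

lemma res_rows:
  assumes p: "\<And>i. i < r + t \<Longrightarrow> 0 < p i" and l: "l < r + t"
  shows "i < r \<Longrightarrow> of_real (p i) * res (r + t) r p C i l + (\<Sum>j<t. C i j * res (r + t) r p C (r + j) l) = kron i l"
    and "j < t \<Longrightarrow> of_real (p (r + j)) * res (r + t) r p C (r + j) l - (\<Sum>i<r. cnj (C i j) * res (r + t) r p C i l) = kron (r + j) l"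
proof -
  let ?R = "res (r + t) r p C"
  assume i: "i < r"
  have "kron i l = (\<Sum>k<r. skew_lin r p C i k * ?R k l) + (\<Sum>k<t. skew_lin r p C i (r + k) * ?R (r + k) l)"
    using res_inverse(1)[OF p _ l, where i=i and r=r and C=C] i unfolding mm_def sum_split by simp
  also have "(\<Sum>k<r. skew_lin r p C i k * ?R k l) = (\<Sum>k<r. if k = i then of_real (p i) * ?R i l else 0)"
    using i by (intro sum.cong) (auto simp: skew_lin_def)
  also have "(\<Sum>k<t. skew_lin r p C i (r + k) * ?R (r + k) l) = (\<Sum>k<t. C i k * ?R (r + k) l)"
    using i by (intro sum.cong) (auto simp: skew_lin_def)
  finally show "of_real (p i) * ?R i l + (\<Sum>j<t. C i j * ?R (r + j) l) = kron i l" using i by simp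
next
  let ?R = "res (r + t) r p C"
  assume j: "j < t"
  have "kron (r + j) l = (\<Sum>k<r. skew_lin r p C (r + j) k * ?R k l) + (\<Sum>k<t. skew_lin r p C (r + j) (r + k) * ?R (r + k) l)"
    using res_inverse(1)[OF p _ l, where i="r + j" and r=r and C=C] j unfolding mm_def sum_split by simp
  also have "(\<Sum>k<t. skew_lin r p C (r + j) (r + k) * ?R (r + k) l) = (\<Sum>k<t. if k = j then of_real (p (r + j)) * ?R (r + j) l else 0)"
    by (intro sum.cong) (auto simp: skew_lin_def)
  also have "(\<Sum>k<r. skew_lin r p C (r + j) k * ?R k l) = (\<Sum>k<r. - (cnj (C k j) * ?R k l))"
    by (intro sum.cong) (auto simp: skew_lin_def)
  finally show "of_real (p (r + j)) * ?R (r + j) l - (\<Sum>i<r. cnj (C i j) * ?R i l) = kron (r + j) l"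
    using j by (simp add: sum_negf)
qed

text \<open>Eliminating the lower block of \<open>res\<close> from its defining equations leaves the Schur complement of the
  upper block.\<close>

lemma schur_first:
  assumes p: "\<And>i. i < r + t \<Longrightarrow> 0 < p i" and e: "0 < e"
    and W: "W \<in> carrier_mat r r"
    and We: "\<And>i k. i < r \<Longrightarrow> k < r \<Longrightarrow> W $$ (i, k) = of_real e * (of_real (p i) * kron i k + (\<Sum>j<t. C i j * cnj (C k j) / of_real (p (r + j))))"
  shows "mat_inv W = Matrix.mat r r (\<lambda>(i, k). res (r + t) r p C i k / of_real e)"
proof (rule mat_inv_eqI[OF W])
  let ?R = "res (r + t) r p C"
  let ?T = "Matrix.mat r r (\<lambda>(i, k). ?R i k / of_real e)"
  show "W * ?T = 1\<^sub>m r"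
  proof (rule eq_matI)
    fix i k assume "i < dim_row (1\<^sub>m r)" "k < dim_col (1\<^sub>m r)"
    then have ik: "i < r" "k < r" by auto
    have off: "?R (r + j) k = (\<Sum>m<r. cnj (C m j) * ?R m k) / of_real (p (r + j))" if "j < t" for j
    proof -
      have "of_real (p (r + j)) * ?R (r + j) k - (\<Sum>i<r. cnj (C i j) * ?R i k) = kron (r + j) k"
        by (rule res_rows(2)[OF p]) (use that ik in auto)
      then show ?thesis using p[of "r + j"] that ik by (simp add: kron_def field_simps)
    qed
    have "(W * ?T) $$ (i, k) = (\<Sum>m<r. W $$ (i, m) * ?T $$ (m, k))"
      using W ik by (intro mat_mult_entry) auto
    also have "\<dots> = (\<Sum>m<r. (of_real (p i) * kron i m) * ?R m k + (\<Sum>j<t. C i j * (cnj (C m j) * ?R m k / of_real (p (r + j)))))"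
      using ik e by (intro sum.cong refl) (simp add: We distrib_right distrib_left sum_distrib_right sum_distrib_left mult_ac)
    also have "\<dots> = (\<Sum>m<r. if m = i then of_real (p i) * ?R i k else 0) + (\<Sum>j<t. \<Sum>m<r. C i j * (cnj (C m j) * ?R m k / of_real (p (r + j))))"
      unfolding sum.distrib by (subst sum.swap) (intro arg_cong2[where f = "(+)"] sum.cong refl, auto simp: kron_def)
    also have "\<dots> = of_real (p i) * ?R i k + (\<Sum>j<t. C i j * ?R (r + j) k)"
      using ik by (simp add: off sum_distrib_left sum_divide_distrib)
    also have "\<dots> = kron i k" by (rule res_rows(1)[OF p]) (use ik in auto)
    finally show "(W * ?T) $$ (i, k) = 1\<^sub>m r $$ (i, k)" using ik by (simp add: kron_def)
  qed (use W in auto)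
qed simp

lemma schur_second:
  assumes p: "\<And>i. i < r + t \<Longrightarrow> 0 < p i" and e: "0 < e"
    and W: "W \<in> carrier_mat t t"
    and We: "\<And>j l. j < t \<Longrightarrow> l < t \<Longrightarrow> W $$ (j, l) = of_real e * (of_real (p (r + j)) * kron j l + (\<Sum>i<r. cnj (C i j) * C i l / of_real (p i)))"
  shows "mat_inv W = Matrix.mat t t (\<lambda>(j, l). res (r + t) r p C (r + j) (r + l) / of_real e)"
proof (rule mat_inv_eqI[OF W])
  let ?R = "res (r + t) r p C"
  let ?T = "Matrix.mat t t (\<lambda>(j, l). ?R (r + j) (r + l) / of_real e)"
  show "W * ?T = 1\<^sub>m t"
  proof (rule eq_matI)
    fix j k assume "j < dim_row (1\<^sub>m t)" "k < dim_col (1\<^sub>m t)"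
    then have jk: "j < t" "k < t" by auto
    have off: "?R i (r + k) = - (\<Sum>m<t. C i m * ?R (r + m) (r + k)) / of_real (p i)" if "i < r" for i
    proof -
      have "of_real (p i) * ?R i (r + k) = - (\<Sum>m<t. C i m * ?R (r + m) (r + k))"
      proof -
        have "of_real (p i) * ?R i (r + k) + (\<Sum>j<t. C i j * ?R (r + j) (r + k)) = kron i (r + k)"
          by (rule res_rows(1)[OF p]) (use that jk in auto)
        then show ?thesis using that by (simp add: kron_def eq_neg_iff_add_eq_0)
      qed
      then show ?thesis using p[of i] that by (simp add: field_simps)
    qed
    have "(W * ?T) $$ (j, k) = (\<Sum>m<t. W $$ (j, m) * ?T $$ (m, k))"
      using W jk by (intro mat_mult_entry) auto
    also have "\<dots> = (\<Sum>m<t. (of_real (p (r + j)) * kron j m) * ?R (r + m) (r + k) + (\<Sum>i<r. cnj (C i j) * (C i m * ?R (r + m) (r + k) / of_real (p i))))"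
      using jk e by (intro sum.cong refl) (simp add: We distrib_right distrib_left sum_distrib_right sum_distrib_left mult_ac)
    also have "\<dots> = (\<Sum>m<t. if m = j then of_real (p (r + j)) * ?R (r + j) (r + k) else 0) + (\<Sum>i<r. \<Sum>m<t. cnj (C i j) * (C i m * ?R (r + m) (r + k) / of_real (p i)))"
      unfolding sum.distrib by (subst sum.swap) (intro arg_cong2[where f = "(+)"] sum.cong refl, auto simp: kron_def)
    also have "\<dots> = of_real (p (r + j)) * ?R (r + j) (r + k) - (\<Sum>i<r. cnj (C i j) * ?R i (r + k))"
      using jk by (simp add: off sum_distrib_left sum_divide_distrib sum_negf)
    also have "\<dots> = kron (r + j) (r + k)" by (rule res_rows(2)[OF p]) (use jk in auto)
    finally show "(W * ?T) $$ (j, k) = 1\<^sub>m t $$ (j, k)" using jk by (simp add: kron_def)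
  qed (use W in auto)
qed simp

lemma mat_diag_inv:
  assumes "\<And>i. i < n \<Longrightarrow> f i \<noteq> 0"
  shows "mat_inv (mat_diag n f) = mat_diag n (\<lambda>i. 1 / f i)"
proof (rule mat_inv_eqI)
  have "mat_diag n (\<lambda>i. f i * (1 / f i)) = mat_diag n (\<lambda>_. 1 :: complex)"
    using assms by (auto simp: mat_diag_def)
  then show "mat_diag n f * mat_diag n (\<lambda>i. 1 / f i) = 1\<^sub>m n" by simp
qed auto

lemma one_plus_diag: "1\<^sub>m n + of_real b \<cdot>\<^sub>m mat_diag n (\<lambda>i. complex_of_real (d i)) = mat_diag n (\<lambda>i. of_real (1 + b * d i))"
  by (rule eq_matI) (auto simp: mat_diag_def)

lemma diag_sandwich_entry:
  fixes A C :: "complex mat"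
  assumes "A \<in> carrier_mat r t" "C \<in> carrier_mat t l" "i < r" "k < l"
  shows "(A * mat_diag t f * C) $$ (i, k) = (\<Sum>j<t. A $$ (i, j) * f j * C $$ (j, k))"
proof -
  have "(A * mat_diag t f * C) $$ (i, k) = (\<Sum>j<t. (A * mat_diag t f) $$ (i, j) * C $$ (j, k))"
    using assms by (intro mat_mult_entry) (auto intro!: mult_carrier_mat)
  then show ?thesis using assms by (simp add: mat_diag_mult_right)
qed

text \<open>The matrices \<open>T\<close> and \<open>T~\<close> are corners of an inverse of the same form as the resolvents, with the
  weights \<open>\<surd>s\<close> multiplied by \<open>1 + \<beta>~ d\<close> on rows and \<open>1 + \<beta> d~\<close> on columns.\<close>

lemma T_of_eq:
  fixes d dt :: "nat \<Rightarrow> real"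
  assumes A: "A \<in> carrier_mat r t" and s: "0 < s" and d: "\<And>i. i < r \<Longrightarrow> 0 \<le> d i" and dt: "\<And>j. j < t \<Longrightarrow> 0 \<le> dt j"
    and b: "0 \<le> b" and bt: "0 \<le> bt"
    and p: "\<And>i. i < r \<Longrightarrow> p i = sqrt s * (1 + bt * d i)" "\<And>j. j < t \<Longrightarrow> p (r + j) = sqrt s * (1 + b * dt j)"
  shows "T_of A (mat_diag r (\<lambda>i. of_real (d i))) (mat_diag t (\<lambda>j. of_real (dt j))) s b bt
       = Matrix.mat r r (\<lambda>(i, k). res (r + t) r p (\<lambda>i j. A $$ (i, j)) i k / of_real (sqrt s))"
    and "Tt_of A (mat_diag r (\<lambda>i. of_real (d i))) (mat_diag t (\<lambda>j. of_real (dt j))) s b bt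
       = Matrix.mat t t (\<lambda>(j, l). res (r + t) r p (\<lambda>i j. A $$ (i, j)) (r + j) (r + l) / of_real (sqrt s))"
proof -
  have dims: "dim_row A = r" "dim_col A = t" using A by auto
  note adj = mat_adjoint_carrier[OF A]
  have es: "0 < sqrt s" "of_real (sqrt s) * of_real (sqrt s) = complex_of_real s"
    using s by (simp_all flip: of_real_mult)
  have pos1: "0 < 1 + bt * d i" if "i < r" for i using bt d[OF that] by (simp add: add_pos_nonneg)
  have pos2: "0 < 1 + b * dt j" if "j < t" for j using b dt[OF that] by (simp add: add_pos_nonneg)
  have ppos: "0 < p i" if "i < r + t" for i
  proof (cases "i < r")
    case False
    then show ?thesis using p(2)[of "i - r"] pos2[of "i - r"] es that by simp
  qed (use p(1) pos1 es in simp)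
  have inv1: "mat_inv (1\<^sub>m r + of_real bt \<cdot>\<^sub>m mat_diag r (\<lambda>i. complex_of_real (d i))) = mat_diag r (\<lambda>i. 1 / of_real (1 + bt * d i))"
    unfolding one_plus_diag
    by (rule mat_diag_inv, unfold of_real_eq_0_iff, drule pos1, simp)
  have inv2: "mat_inv (1\<^sub>m t + of_real b \<cdot>\<^sub>m mat_diag t (\<lambda>j. complex_of_real (dt j))) = mat_diag t (\<lambda>j. 1 / of_real (1 + b * dt j))"
    unfolding one_plus_diag
    by (rule mat_diag_inv, unfold of_real_eq_0_iff, drule pos2, simp)
  have scale1: "complex_of_real (sqrt s) * (z / of_real (p i)) = z * (1 / of_real (1 + bt * d i))" if "i < r" for z i
    using es(1) unfolding p(1)[OF that] of_real_mult by simp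
  have scale2: "complex_of_real (sqrt s) * (z / of_real (p (r + j))) = z * (1 / of_real (1 + b * dt j))" if "j < t" for z j
    using es(1) unfolding p(2)[OF that] of_real_mult by simp
  show "T_of A (mat_diag r (\<lambda>i. of_real (d i))) (mat_diag t (\<lambda>j. of_real (dt j))) s b bt
       = Matrix.mat r r (\<lambda>(i, k). res (r + t) r p (\<lambda>i j. A $$ (i, j)) i k / of_real (sqrt s))"
    unfolding T_of_def dims inv2 unfolding one_plus_diag
  proof (rule schur_first[OF ppos es(1)])
    have [simp]: "A * mat_diag t f * mat_adjoint A \<in> carrier_mat r r" for f
      using A adj by (intro mult_carrier_mat[of _ r t]) auto
    show "of_real s \<cdot>\<^sub>m mat_diag r (\<lambda>i. of_real (1 + bt * d i)) + A * mat_diag t (\<lambda>j. 1 / of_real (1 + b * dt j)) * mat_adjoint A \<in> carrier_mat r r"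
      by simp
    fix i k assume ik: "i < r" "k < r"
    have "(of_real s \<cdot>\<^sub>m mat_diag r (\<lambda>i. complex_of_real (1 + bt * d i)) + A * mat_diag t (\<lambda>j. 1 / of_real (1 + b * dt j)) * mat_adjoint A) $$ (i, k)
      = of_real s * (of_real (1 + bt * d i) * kron i k) + (\<Sum>j<t. A $$ (i, j) * (1 / of_real (1 + b * dt j)) * cnj (A $$ (k, j)))"
      using ik adj carrier_matD[OF adj] diag_sandwich_entry[OF A adj ik] carrier_matD[of "A * mat_diag t _ * mat_adjoint A" r r]
      by (subst index_add_mat) (auto simp: mat_diag_def kron_def dims mat_adjoint_entry)
    also have "\<dots> = of_real (sqrt s) * (of_real (p i) * kron i k) + (\<Sum>j<t. of_real (sqrt s) * (A $$ (i, j) * cnj (A $$ (k, j)) / of_real (p (r + j))))"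
    proof (intro arg_cong2[where f = "(+)"] sum.cong refl)
      show "of_real s * (of_real (1 + bt * d i) * kron i k) = of_real (sqrt s) * (of_real (p i) * kron i k)"
        unfolding p(1)[OF ik(1)] of_real_mult es(2)[symmetric] by (simp only: mult.assoc)
      fix j assume "j \<in> {..<t}"
      then show "A $$ (i, j) * (1 / of_real (1 + b * dt j)) * cnj (A $$ (k, j)) = of_real (sqrt s) * (A $$ (i, j) * cnj (A $$ (k, j)) / of_real (p (r + j)))"
        by (subst scale2) simp_all
    qed
    also have "\<dots> = of_real (sqrt s) * (of_real (p i) * kron i k + (\<Sum>j<t. A $$ (i, j) * cnj (A $$ (k, j)) / of_real (p (r + j))))"
      by (simp only: distrib_left sum_distrib_left)
    finally show "(of_real s \<cdot>\<^sub>m mat_diag r (\<lambda>i. complex_of_real (1 + bt * d i)) + A * mat_diag t (\<lambda>j. 1 / of_real (1 + b * dt j)) * mat_adjoint A) $$ (i, k)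
      = of_real (sqrt s) * (of_real (p i) * kron i k + (\<Sum>j<t. A $$ (i, j) * cnj (A $$ (k, j)) / of_real (p (r + j))))" .
  qed
  show "Tt_of A (mat_diag r (\<lambda>i. of_real (d i))) (mat_diag t (\<lambda>j. of_real (dt j))) s b bt
       = Matrix.mat t t (\<lambda>(j, l). res (r + t) r p (\<lambda>i j. A $$ (i, j)) (r + j) (r + l) / of_real (sqrt s))"
    unfolding Tt_of_def dims inv1 unfolding one_plus_diag
  proof (rule schur_second[OF ppos es(1)])
    have [simp]: "mat_adjoint A * mat_diag r f * A \<in> carrier_mat t t" for f
      using A adj by (intro mult_carrier_mat[of _ t r]) auto
    show "of_real s \<cdot>\<^sub>m mat_diag t (\<lambda>i. of_real (1 + b * dt i)) + mat_adjoint A * mat_diag r (\<lambda>j. 1 / of_real (1 + bt * d j)) * A \<in> carrier_mat t t"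
      by simp
    fix i k assume ik: "i < t" "k < t"
    have "(of_real s \<cdot>\<^sub>m mat_diag t (\<lambda>i. complex_of_real (1 + b * dt i)) + mat_adjoint A * mat_diag r (\<lambda>j. 1 / of_real (1 + bt * d j)) * A) $$ (i, k)
      = of_real s * (of_real (1 + b * dt i) * kron i k) + (\<Sum>j<r. cnj (A $$ (j, i)) * (1 / of_real (1 + bt * d j)) * A $$ (j, k))"
    proof -
      let ?Y = "mat_adjoint A * mat_diag r (\<lambda>j. 1 / complex_of_real (1 + bt * d j)) * A"
      have Y: "?Y \<in> carrier_mat t t" by simp
      have "(of_real s \<cdot>\<^sub>m mat_diag t (\<lambda>i. complex_of_real (1 + b * dt i)) + ?Y) $$ (i, k)
        = (of_real s \<cdot>\<^sub>m mat_diag t (\<lambda>i. complex_of_real (1 + b * dt i))) $$ (i, k) + ?Y $$ (i, k)"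
        by (rule index_add_mat(1)) (use ik carrier_matD[OF Y] in auto)
      also have "(of_real s \<cdot>\<^sub>m mat_diag t (\<lambda>i. complex_of_real (1 + b * dt i))) $$ (i, k) = of_real s * (of_real (1 + b * dt i) * kron i k)"
        using ik by (simp add: mat_diag_def kron_def)
      also have "?Y $$ (i, k) = (\<Sum>j<r. cnj (A $$ (j, i)) * (1 / of_real (1 + bt * d j)) * A $$ (j, k))"
        unfolding diag_sandwich_entry[OF adj A ik] using ik dims by (intro sum.cong refl) (simp add: mat_adjoint_entry)
      finally show ?thesis .
    qed
    also have "\<dots> = of_real (sqrt s) * (of_real (p (r + i)) * kron i k) + (\<Sum>j<r. of_real (sqrt s) * (cnj (A $$ (j, i)) * A $$ (j, k) / of_real (p j)))"
    proof (intro arg_cong2[where f = "(+)"] sum.cong refl)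
      show "of_real s * (of_real (1 + b * dt i) * kron i k) = of_real (sqrt s) * (of_real (p (r + i)) * kron i k)"
        unfolding p(2)[OF ik(1)] of_real_mult es(2)[symmetric] by (simp only: mult.assoc)
      fix j assume "j \<in> {..<r}"
      then show "cnj (A $$ (j, i)) * (1 / of_real (1 + bt * d j)) * A $$ (j, k) = of_real (sqrt s) * (cnj (A $$ (j, i)) * A $$ (j, k) / of_real (p j))"
        by (subst scale1) simp_all
    qed
    also have "\<dots> = of_real (sqrt s) * (of_real (p (r + i)) * kron i k + (\<Sum>j<r. cnj (A $$ (j, i)) * A $$ (j, k) / of_real (p j)))"
      by (simp only: distrib_left sum_distrib_left)
    finally show "(of_real s \<cdot>\<^sub>m mat_diag t (\<lambda>i. complex_of_real (1 + b * dt i)) + mat_adjoint A * mat_diag r (\<lambda>j. 1 / of_real (1 + bt * d j)) * A) $$ (i, k)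
      = of_real (sqrt s) * (of_real (p (r + i)) * kron i k + (\<Sum>j<r. cnj (A $$ (j, i)) * A $$ (j, k) / of_real (p j)))" .
  qed
qed

lemma resolvent_eq:
  assumes A: "A \<in> carrier_mat r t" and s: "0 < s"
  shows "resolvent A s = Matrix.mat r r (\<lambda>(i, k). res (r + t) r (\<lambda>_. sqrt s) (\<lambda>i j. A $$ (i, j)) i k / of_real (sqrt s))"
    and "co_resolvent A s = Matrix.mat t t (\<lambda>(j, l). res (r + t) r (\<lambda>_. sqrt s) (\<lambda>i j. A $$ (i, j)) (r + j) (r + l) / of_real (sqrt s))"
proof -
  have dims: "dim_row A = r" "dim_col A = t" using A by auto
  note adj = mat_adjoint_carrier[OF A]
  have es: "0 < sqrt s" "of_real (sqrt s) * of_real (sqrt s) = complex_of_real s"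
    using s by (simp_all flip: of_real_mult)
  show "resolvent A s = Matrix.mat r r (\<lambda>(i, k). res (r + t) r (\<lambda>_. sqrt s) (\<lambda>i j. A $$ (i, j)) i k / of_real (sqrt s))"
    unfolding resolvent_def dims
  proof (rule schur_first[OF _ es(1)])
    have c: "A * mat_adjoint A \<in> carrier_mat r r" using A adj by (rule mult_carrier_mat)
    show "A * mat_adjoint A + of_real s \<cdot>\<^sub>m 1\<^sub>m r \<in> carrier_mat r r" by simp
    fix i k assume ik: "i < r" "k < r"
    have "(A * mat_adjoint A + of_real s \<cdot>\<^sub>m 1\<^sub>m r) $$ (i, k) = (\<Sum>j<t. A $$ (i, j) * mat_adjoint A $$ (j, k)) + of_real s * kron i k"
      using ik mat_mult_entry[OF A adj ik] by (subst index_add_mat) (auto simp: kron_def)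
    also have "\<dots> = of_real (sqrt s) * (of_real (sqrt s) * kron i k + (\<Sum>j<t. A $$ (i, j) * cnj (A $$ (k, j)) / of_real (sqrt s)))"
      using es ik by (simp add: dims mat_adjoint_entry distrib_left sum_distrib_left mult.assoc[symmetric])
    finally show "(A * mat_adjoint A + of_real s \<cdot>\<^sub>m 1\<^sub>m r) $$ (i, k)
      = of_real (sqrt s) * (of_real (sqrt s) * kron i k + (\<Sum>j<t. A $$ (i, j) * cnj (A $$ (k, j)) / of_real (sqrt s)))" .
  qed (use es in auto)
  show "co_resolvent A s = Matrix.mat t t (\<lambda>(j, l). res (r + t) r (\<lambda>_. sqrt s) (\<lambda>i j. A $$ (i, j)) (r + j) (r + l) / of_real (sqrt s))"
    unfolding co_resolvent_def dims
  proof (rule schur_second[OF _ es(1)])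
    show "mat_adjoint A * A + of_real s \<cdot>\<^sub>m 1\<^sub>m t \<in> carrier_mat t t" by simp
    fix i k assume ik: "i < t" "k < t"
    have "(mat_adjoint A * A + of_real s \<cdot>\<^sub>m 1\<^sub>m t) $$ (i, k) = (\<Sum>j<r. mat_adjoint A $$ (i, j) * A $$ (j, k)) + of_real s * kron i k"
      using ik mat_mult_entry[OF adj A ik] by (subst index_add_mat) (auto simp: kron_def)
    also have "\<dots> = of_real (sqrt s) * (of_real (sqrt s) * kron i k + (\<Sum>j<r. cnj (A $$ (j, i)) * A $$ (j, k) / of_real (sqrt s)))"
      using es ik by (simp add: dims mat_adjoint_entry distrib_left sum_distrib_left mult.assoc[symmetric])
    finally show "(mat_adjoint A * A + of_real s \<cdot>\<^sub>m 1\<^sub>m t) $$ (i, k)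
      = of_real (sqrt s) * (of_real (sqrt s) * kron i k + (\<Sum>j<r. cnj (A $$ (j, i)) * A $$ (j, k) / of_real (sqrt s)))" .
  qed (use es in auto)
qed

lemma res_cong:
  assumes "\<And>i. i < r + t \<Longrightarrow> p i = p' i" "\<And>i j. i < r \<Longrightarrow> j < t \<Longrightarrow> C i j = C' i j"
  shows "res (r + t) r p C = res (r + t) r p' C'"
proof -
  have "Matrix.mat (r + t) (r + t) (\<lambda>(i, j). skew_lin r p C i j) = Matrix.mat (r + t) (r + t) (\<lambda>(i, j). skew_lin r p' C' i j)"
    by (rule eq_matI) (use assms in \<open>auto simp: skew_lin_def\<close>)
  then show ?thesis by (simp add: res_def minv_def)
qed

section \<open>Spectral norms and traces against test matrices\<close>

lemma vec_l2_norm_sq: "(vec_l2_norm v)\<^sup>2 = (\<Sum>i<dim_vec v. (cmod (vec_index v i))\<^sup>2)"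
  by (simp add: vec_l2_norm_def L2_set_def sum_nonneg)

lemma vec_l2_norm_nonneg: "0 \<le> vec_l2_norm v"
  by (simp add: vec_l2_norm_def L2_set_nonneg)

lemma spectral_norm_bdd:
  assumes A: "A \<in> carrier_mat m k"
  shows "bdd_above ((\<lambda>v. vec_l2_norm (A *\<^sub>v v)) ` {v \<in> carrier_vec (dim_col A). vec_l2_norm v \<le> 1})"
proof (rule bdd_aboveI2)
  define c where "c = (\<Sum>i<m. \<Sum>j<k. (cmod (A $$ (i, j)))\<^sup>2)"
  have c0: "0 \<le> c" unfolding c_def by (intro sum_nonneg) auto
  fix u assume "u \<in> {v \<in> carrier_vec (dim_col A). vec_l2_norm v \<le> 1}"
  then have u: "u \<in> carrier_vec k" "vec_l2_norm u \<le> 1" using A by auto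
  have "(vec_l2_norm (A *\<^sub>v u))\<^sup>2 = (\<Sum>i<m. (cmod (\<Sum>j<k. A $$ (i, j) * vec_index u j))\<^sup>2)"
    using A u by (auto simp: vec_l2_norm_sq scalar_prod_def atLeast0LessThan intro!: sum.cong)
  also have "\<dots> \<le> (\<Sum>i<m. (\<Sum>j<k. (cmod (A $$ (i, j)))\<^sup>2) * (\<Sum>j<k. (cmod (vec_index u j))\<^sup>2))"
    by (intro sum_mono cauchy_schwarz_sum)
  also have "\<dots> = c * (vec_l2_norm u)\<^sup>2" using u by (simp add: c_def vec_l2_norm_sq sum_distrib_right)
  also have "\<dots> \<le> c * 1" using u vec_l2_norm_nonneg[of u] c0 by (intro mult_left_mono power_le_one) auto
  finally have "(vec_l2_norm (A *\<^sub>v u))\<^sup>2 \<le> (sqrt c)\<^sup>2" using c0 by simp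
  then show "vec_l2_norm (A *\<^sub>v u) \<le> sqrt c" by (rule power2_le_imp_le) (use c0 in simp)
qed

lemma vec_l2_norm_scale:
  assumes "0 \<le> a"
  shows "vec_l2_norm (complex_of_real a \<cdot>\<^sub>v z) = a * vec_l2_norm z"
proof -
  have "(vec_l2_norm (complex_of_real a \<cdot>\<^sub>v z))\<^sup>2 = (a * vec_l2_norm z)\<^sup>2"
    by (simp add: vec_l2_norm_sq norm_mult power_mult_distrib sum_distrib_left)
  then show ?thesis by (rule power2_eq_imp_eq) (use assms vec_l2_norm_nonneg in auto)
qed

lemma vec_l2_norm_eq_0:
  assumes "vec_l2_norm v = 0" "i < dim_vec v"
  shows "vec_index v i = 0"
proof -
  have "(\<Sum>i<dim_vec v. (cmod (vec_index v i))\<^sup>2) = 0" using vec_l2_norm_sq[of v] assms(1) by simp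
  then show ?thesis using assms(2) by (subst (asm) sum_nonneg_eq_0_iff) auto
qed

lemma spectral_norm_bound:
  assumes A: "A \<in> carrier_mat m k" and v: "v \<in> carrier_vec k"
  shows "vec_l2_norm (A *\<^sub>v v) \<le> spectral_norm A * vec_l2_norm v"
proof (cases "vec_l2_norm v = 0")
  case True
  have "vec_index (A *\<^sub>v v) i = 0" if "i < m" for i
    using that A v vec_l2_norm_eq_0[OF True] by (simp add: scalar_prod_def)
  then have "(vec_l2_norm (A *\<^sub>v v))\<^sup>2 = 0" using A by (simp add: vec_l2_norm_sq)
  then show ?thesis using True by simp
next
  case False
  then have pos: "0 < vec_l2_norm v" using vec_l2_norm_nonneg[of v] by simp
  define u where "u = complex_of_real (1 / vec_l2_norm v) \<cdot>\<^sub>v v"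
  have un: "vec_l2_norm u = 1" unfolding u_def using pos by (subst vec_l2_norm_scale) auto
  have "u \<in> {v \<in> carrier_vec (dim_col A). vec_l2_norm v \<le> 1}" using v A un by (simp add: u_def)
  then have "vec_l2_norm (A *\<^sub>v u) \<le> spectral_norm A"
    unfolding spectral_norm_def by (rule cSUP_upper[OF _ spectral_norm_bdd[OF A]])
  moreover have "A *\<^sub>v u = complex_of_real (1 / vec_l2_norm v) \<cdot>\<^sub>v (A *\<^sub>v v)"
    unfolding u_def using A v by (rule mult_mat_vec)
  moreover have "vec_l2_norm (complex_of_real (1 / vec_l2_norm v) \<cdot>\<^sub>v (A *\<^sub>v v)) = 1 / vec_l2_norm v * vec_l2_norm (A *\<^sub>v v)"
    using pos by (intro vec_l2_norm_scale) simp
  ultimately have "1 / vec_l2_norm v * vec_l2_norm (A *\<^sub>v v) \<le> spectral_norm A" by (simp only:)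
  then show ?thesis using pos by (simp add: field_simps)
qed

lemma spectral_norm_nonneg:
  assumes A: "A \<in> carrier_mat m k"
  shows "0 \<le> spectral_norm A"
proof -
  have z: "(vec_l2_norm (0\<^sub>v k :: complex vec))\<^sup>2 = 0" by (simp add: vec_l2_norm_sq)
  have "0 \<le> vec_l2_norm (A *\<^sub>v 0\<^sub>v k)" by (rule vec_l2_norm_nonneg)
  also have "\<dots> \<le> spectral_norm A"
    unfolding spectral_norm_def by (rule cSUP_upper[OF _ spectral_norm_bdd[OF A]]) (use A z in simp)
  finally show ?thesis .
qed

lemma spectral_norm_sq:
  assumes "A \<in> carrier_mat m k"
  shows "(\<Sum>i<m. (cmod (\<Sum>j<k. A $$ (i, j) * v j))\<^sup>2) \<le> (spectral_norm A)\<^sup>2 * (\<Sum>j<k. (cmod (v j))\<^sup>2)"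
proof -
  let ?v = "Matrix.vec k v"
  have "vec_l2_norm (A *\<^sub>v ?v) \<le> spectral_norm A * vec_l2_norm ?v"
    by (rule spectral_norm_bound[OF assms]) simp
  then have "(vec_l2_norm (A *\<^sub>v ?v))\<^sup>2 \<le> (spectral_norm A * vec_l2_norm ?v)\<^sup>2"
    by (intro power_mono vec_l2_norm_nonneg)
  moreover have "(vec_l2_norm (A *\<^sub>v ?v))\<^sup>2 = (\<Sum>i<m. (cmod (\<Sum>j<k. A $$ (i, j) * v j))\<^sup>2)"
    using assms by (auto simp: vec_l2_norm_sq scalar_prod_def atLeast0LessThan intro!: sum.cong)
  ultimately show ?thesis by (simp add: power_mult_distrib vec_l2_norm_sq)
qed

lemma spectral_norm_columns:
  assumes "A \<in> carrier_mat m k" "j < k"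
  shows "(\<Sum>i<m. (cmod (A $$ (i, j)))\<^sup>2) \<le> (spectral_norm A)\<^sup>2"
proof -
  have "(cmod (kron l j))\<^sup>2 = (if l = j then 1 else 0)" for l by (simp add: kron_def)
  then show ?thesis
    using spectral_norm_sq[OF assms(1), of "\<lambda>l. kron l j"] assms(2)
    by (simp add: kron_def if_distrib[of "\<lambda>x. _ * x"] cong: if_cong)
qed

lemma spectral_norm_rows:
  assumes "A \<in> carrier_mat m k" "i < m"
  shows "(\<Sum>j<k. (cmod (A $$ (i, j)))\<^sup>2) \<le> (spectral_norm A)\<^sup>2"
proof -
  define q where "q = (\<Sum>j<k. (cmod (A $$ (i, j)))\<^sup>2)"
  have q0: "0 \<le> q" unfolding q_def by (intro sum_nonneg) auto
  let ?v = "\<lambda>j. cnj (A $$ (i, j))"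
  have "(\<Sum>j<k. A $$ (i, j) * ?v j) = of_real q"
    by (simp add: q_def complex_norm_square[unfolded of_real_power])
  then have "q\<^sup>2 = (cmod (\<Sum>j<k. A $$ (i, j) * ?v j))\<^sup>2" using q0 by simp
  also have "\<dots> \<le> (\<Sum>i<m. (cmod (\<Sum>j<k. A $$ (i, j) * ?v j))\<^sup>2)"
    using assms(2) by (intro member_le_sum) auto
  also have "\<dots> \<le> (spectral_norm A)\<^sup>2 * q"
    using spectral_norm_sq[OF assms(1), of ?v] by (simp add: q_def)
  finally have "q * q \<le> (spectral_norm A)\<^sup>2 * q" by (simp add: power2_eq_square)
  then have "q \<le> (spectral_norm A)\<^sup>2"
    using q0 by (cases "q = 0") (auto dest: mult_right_le_imp_le)
  then show ?thesis by (simp add: q_def)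
qed

text \<open>The extension by zero of a test matrix to the size of the linearization.\<close>

definition corner :: "nat \<Rightarrow> complex mat \<Rightarrow> nat \<Rightarrow> nat \<Rightarrow> complex" where
  "corner r M a b = (if a < r \<and> b < r then M $$ (a, b) else 0)"

definition cocorner :: "nat \<Rightarrow> complex mat \<Rightarrow> nat \<Rightarrow> nat \<Rightarrow> complex" where
  "cocorner r M a b = (if r \<le> a \<and> r \<le> b then M $$ (a - r, b - r) else 0)"

lemma op_bound_corner:
  assumes "M \<in> carrier_mat r r" "spectral_norm M \<le> c"
  shows "op_bound (r + t) (corner r M) c"
  unfolding op_bound_def
proof safe
  show c0: "0 \<le> c" using spectral_norm_nonneg[OF assms(1)] assms(2) by linarith
  fix v
  have 1: "(\<Sum>i<r. (cmod (mv (r + t) (corner r M) v i))\<^sup>2) = (\<Sum>i<r. (cmod (\<Sum>j<r. M $$ (i, j) * v j))\<^sup>2)"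
    unfolding mv_def sum_split by (intro sum.cong refl) (simp add: corner_def)
  have 2: "(\<Sum>i<t. (cmod (mv (r + t) (corner r M) v (r + i)))\<^sup>2) = 0"
    unfolding mv_def by (simp add: corner_def)
  have "sqn (r + t) (mv (r + t) (corner r M) v) = (\<Sum>i<r. (cmod (\<Sum>j<r. M $$ (i, j) * v j))\<^sup>2)"
    unfolding sqn_def sum_split 1 2 by simp
  also have "\<dots> \<le> (spectral_norm M)\<^sup>2 * (\<Sum>j<r. (cmod (v j))\<^sup>2)" by (rule spectral_norm_sq[OF assms(1)])
  also have "\<dots> \<le> c\<^sup>2 * sqn (r + t) v"
    using assms spectral_norm_nonneg[OF assms(1)] unfolding sqn_def sum_split
    by (intro mult_mono power_mono) (auto intro: sum_nonneg)
  finally show "sqn (r + t) (mv (r + t) (corner r M) v) \<le> c\<^sup>2 * sqn (r + t) v" .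
qed

lemma op_bound_cocorner:
  assumes "M \<in> carrier_mat t t" "spectral_norm M \<le> c"
  shows "op_bound (r + t) (cocorner r M) c"
  unfolding op_bound_def
proof safe
  show c0: "0 \<le> c" using spectral_norm_nonneg[OF assms(1)] assms(2) by linarith
  fix v
  have 1: "(\<Sum>i<r. (cmod (mv (r + t) (cocorner r M) v i))\<^sup>2) = 0"
    unfolding mv_def by (simp add: cocorner_def)
  have 2: "(\<Sum>i<t. (cmod (mv (r + t) (cocorner r M) v (r + i)))\<^sup>2) = (\<Sum>i<t. (cmod (\<Sum>j<t. M $$ (i, j) * v (r + j)))\<^sup>2)"
    unfolding mv_def sum_split by (intro sum.cong refl) (simp add: cocorner_def)
  have "sqn (r + t) (mv (r + t) (cocorner r M) v) = (\<Sum>i<t. (cmod (\<Sum>j<t. M $$ (i, j) * v (r + j)))\<^sup>2)"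
    unfolding sqn_def sum_split 1 2 by simp
  also have "\<dots> \<le> (spectral_norm M)\<^sup>2 * (\<Sum>j<t. (cmod (v (r + j)))\<^sup>2)" by (rule spectral_norm_sq[OF assms(1)])
  also have "\<dots> \<le> c\<^sup>2 * sqn (r + t) v"
    using assms spectral_norm_nonneg[OF assms(1)] unfolding sqn_def sum_split
    by (intro mult_mono power_mono) (auto intro: sum_nonneg)
  finally show "sqn (r + t) (mv (r + t) (cocorner r M) v) \<le> c\<^sup>2 * sqn (r + t) v" .
qed

lemma mat_trace_corner:
  assumes M: "M \<in> carrier_mat r r"
  shows "mat_trace (Matrix.mat r r (\<lambda>(i, k). R i k / z) * M) = mtr (r + t) (mm (r + t) R (corner r M)) / z"
proof -
  have "mat_trace (Matrix.mat r r (\<lambda>(i, k). R i k / z) * M) = (\<Sum>i<r. (Matrix.mat r r (\<lambda>(i, k). R i k / z) * M) $$ (i, i))"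
    by (simp add: mat_trace_def)
  also have "\<dots> = (\<Sum>i<r. \<Sum>k<r. R i k / z * M $$ (k, i))"
    by (intro sum.cong refl, subst mat_mult_entry[OF _ M]) auto
  also have "\<dots> = mtr (r + t) (mm (r + t) R (corner r M)) / z"
    unfolding mtr_def mm_def sum_split by (simp add: corner_def sum_divide_distrib)
  finally show ?thesis .
qed

lemma mat_trace_cocorner:
  assumes M: "M \<in> carrier_mat t t"
  shows "mat_trace (Matrix.mat t t (\<lambda>(i, k). R (r + i) (r + k) / z) * M) = mtr (r + t) (mm (r + t) R (cocorner r M)) / z"
proof -
  have "mat_trace (Matrix.mat t t (\<lambda>(i, k). R (r + i) (r + k) / z) * M) = (\<Sum>i<t. (Matrix.mat t t (\<lambda>(i, k). R (r + i) (r + k) / z) * M) $$ (i, i))"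
    by (simp add: mat_trace_def)
  also have "\<dots> = (\<Sum>i<t. \<Sum>k<t. R (r + i) (r + k) / z * M $$ (k, i))"
    by (intro sum.cong refl, subst mat_mult_entry[OF _ M]) auto
  also have "\<dots> = mtr (r + t) (mm (r + t) R (cocorner r M)) / z"
    unfolding mtr_def mm_def sum_split by (simp add: cocorner_def sum_divide_distrib)
  finally show ?thesis .
qed

section \<open>The log-determinant as an integral of traces\<close>

lemma det_shift:
  fixes H :: "complex mat"
  assumes "H \<in> carrier_mat r r"
  shows "Determinant.det (H + w \<cdot>\<^sub>m 1\<^sub>m r) = (-1) ^ r * poly (char_poly H) (- w)"
proof -
  have "- (char_matrix H (- w)) = (-1) \<cdot>\<^sub>m (H + w \<cdot>\<^sub>m 1\<^sub>m r)"
    using assms by (intro eq_matI) (auto simp: char_matrix_def)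
  then have "poly (char_poly H) (- w) = (-1) ^ r * Determinant.det (H + w \<cdot>\<^sub>m 1\<^sub>m r)"
    unfolding char_poly_matrix[OF assms] using assms by (simp add: det_smult)
  then show ?thesis by (simp flip: mult.assoc power_mult_distrib)
qed

text \<open>Jacobi's formula for a shift of the diagonal, obtained from the derivative of the characteristic
  polynomial.\<close>

lemma det_shift_derivative:
  fixes H :: "complex mat"
  assumes H: "H \<in> carrier_mat r r"
  shows "((\<lambda>w. Determinant.det (H + w \<cdot>\<^sub>m 1\<^sub>m r)) has_field_derivative
     (\<Sum>i<r. Determinant.cofactor (H + w \<cdot>\<^sub>m 1\<^sub>m r) i i)) (at w)"
proof -
  have cof: "Determinant.cofactor (H + w \<cdot>\<^sub>m 1\<^sub>m r) i i = (-1) ^ (r - 1) * poly (char_poly (mat_delete H i i)) (- w)" if "i < r" for i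
  proof -
    have d: "mat_delete H i i \<in> carrier_mat (r - 1) (r - 1)" using H by (simp add: mat_delete_def)
    have "mat_delete (H + w \<cdot>\<^sub>m 1\<^sub>m r) i i = mat_delete H i i + w \<cdot>\<^sub>m 1\<^sub>m (r - 1)"
      using H that by (intro eq_matI) (auto simp: mat_delete_def)
    then show ?thesis unfolding Determinant.cofactor_def by (simp only: det_shift[OF d]) simp
  qed
  have "((\<lambda>w. (-1) ^ r * poly (char_poly H) (- w)) has_field_derivative
     (-1) ^ r * (poly (pderiv (char_poly H)) (- w) * (- 1))) (at w)"
    by (intro DERIV_cmult DERIV_chain'[of uminus, OF _ poly_DERIV]) (auto intro!: derivative_eq_intros)
  also have "(-1) ^ r * (poly (pderiv (char_poly H)) (- w) * (- 1)) = (\<Sum>i<r. (-1) ^ (r - 1) * poly (char_poly (mat_delete H i i)) (- w))"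
  proof (cases r)
    case (Suc k)
    then show ?thesis
      unfolding pderiv_char_poly[OF H] poly_sum sum_distrib_left[symmetric] by (simp del: sum.lessThan_Suc)
  qed (simp add: pderiv_char_poly[OF H])
  also have "\<dots> = (\<Sum>i<r. Determinant.cofactor (H + w \<cdot>\<^sub>m 1\<^sub>m r) i i)" by (simp add: cof)
  finally show ?thesis unfolding det_shift[OF H] .
qed

text \<open>The eigenvalues of a Gram matrix are nonnegative reals; listing them gives the limit at infinity and the
  positivity of the normalized determinant.\<close>

lemma gram_char_poly:
  fixes A :: "complex mat"
  assumes A: "A \<in> carrier_mat r t"
  obtains bs :: "real list" where "\<forall>b\<in>set bs. 0 \<le> b" "length bs = r"
    "\<And>w. Determinant.det (A * mat_adjoint A + of_real w \<cdot>\<^sub>m 1\<^sub>m r) = of_real (\<Prod>b\<leftarrow>bs. w + b)"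
proof -
  define H where "H = A * mat_adjoint A"
  note adj = mat_adjoint_carrier[OF A]
  have H: "H \<in> carrier_mat r r" unfolding H_def using A adj by (rule mult_carrier_mat)
  obtain as where as: "char_poly H = (\<Prod>a\<leftarrow>as. [:- a, 1:])" "length as = r"
    using char_poly_factorized[OF H] by blast
  have real: "a = of_real (Re a) \<and> 0 \<le> Re a" if "a \<in> set as" for a
  proof -
    have "poly (char_poly H) a = 0" unfolding as(1) poly_prod_list
      using that by (auto simp: prod_list_zero_iff)
    then obtain v where v: "v \<in> carrier_vec r" "v \<noteq> 0\<^sub>v r" "H *\<^sub>v v = a \<cdot>\<^sub>v v"
      using eigenvalue_root_char_poly[OF H, of a] H by (auto simp: eigenvalue_def eigenvector_def)
    define u where "u j = (\<Sum>i<r. cnj (A $$ (i, j)) * vec_index v i)" for j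
    have Hv: "(\<Sum>j<t. A $$ (i, j) * u j) = a * vec_index v i" if i: "i < r" for i
    proof -
      have "vec_index (H *\<^sub>v v) i = (\<Sum>m<r. H $$ (i, m) * vec_index v m)"
        using H v(1) i by (simp add: scalar_prod_def atLeast0LessThan)
      also have "\<dots> = (\<Sum>m<r. \<Sum>j<t. A $$ (i, j) * cnj (A $$ (m, j)) * vec_index v m)"
      proof (intro sum.cong refl)
        fix m assume "m \<in> {..<r}"
        then have m: "m < r" by simp
        have "H $$ (i, m) = (\<Sum>j<t. A $$ (i, j) * mat_adjoint A $$ (j, m))"
          unfolding H_def by (rule mat_mult_entry[OF A adj i m])
        then show "H $$ (i, m) * vec_index v m = (\<Sum>j<t. A $$ (i, j) * cnj (A $$ (m, j)) * vec_index v m)"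
          using A m by (simp add: mat_adjoint_entry sum_distrib_right)
      qed
      also have "\<dots> = (\<Sum>j<t. A $$ (i, j) * u j)"
        by (subst sum.swap) (simp add: u_def sum_distrib_left mult.assoc)
      finally show ?thesis using v(1,3) i by simp
    qed
    have "a * of_real (sqn r (vec_index v)) = (\<Sum>i<r. cnj (vec_index v i) * (a * vec_index v i))"
      by (simp add: sqn_def sum_distrib_left complex_norm_square[unfolded of_real_power] mult_ac)
    also have "\<dots> = (\<Sum>i<r. \<Sum>j<t. cnj (vec_index v i) * A $$ (i, j) * u j)"
      by (intro sum.cong refl) (simp add: Hv[symmetric] sum_distrib_left mult.assoc)
    also have "\<dots> = (\<Sum>j<t. cnj (u j) * u j)"
      by (subst sum.swap) (simp add: u_def sum_distrib_right sum_distrib_left mult_ac)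
    also have "\<dots> = of_real (sqn t u)"
      by (simp add: sqn_def complex_norm_square[unfolded of_real_power] mult_ac)
    finally have eq: "a * of_real (sqn r (vec_index v)) = of_real (sqn t u)" .
    have pos: "0 < sqn r (vec_index v)"
    proof (rule ccontr)
      assume "\<not> 0 < sqn r (vec_index v)"
      then have "sqn r (vec_index v) = 0" using sqn_nonneg[of r "vec_index v"] by linarith
      then have "\<forall>i\<in>{..<r}. (cmod (vec_index v i))\<^sup>2 = 0"
        unfolding sqn_def by (subst (asm) sum_nonneg_eq_0_iff) auto
      then have "v = 0\<^sub>v r" using v(1) by (intro eq_vecI) auto
      with v(2) show False by simp
    qed
    have "a = of_real (sqn t u / sqn r (vec_index v))" using eq pos by (simp add: field_simps)
    then show ?thesis using sqn_nonneg[of t u] pos by simp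
  qed
  define bs where "bs = map Re as"
  have "Determinant.det (H + of_real w \<cdot>\<^sub>m 1\<^sub>m r) = of_real (\<Prod>b\<leftarrow>bs. w + b)" for w
  proof -
    have "(-1) ^ length xs * (\<Prod>a\<leftarrow>xs. - a - of_real w) = of_real (\<Prod>b\<leftarrow>map Re xs. w + b)"
      if "\<forall>a\<in>set xs. a = of_real (Re a)" for xs
      using that
    proof (induction xs)
      case (Cons x xs)
      then have x: "x = of_real (Re x)" and IH: "(-1) ^ length xs * (\<Prod>a\<leftarrow>xs. - a - of_real w) = complex_of_real (\<Prod>b\<leftarrow>map Re xs. w + b)" by auto
      have "(-1) ^ length (x # xs) * (\<Prod>a\<leftarrow>x # xs. - a - of_real w) = (of_real w + x) * ((-1) ^ length xs * (\<Prod>a\<leftarrow>xs. - a - of_real w))"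
        by (simp add: algebra_simps)
      also have "\<dots> = (of_real w + of_real (Re x)) * complex_of_real (\<Prod>b\<leftarrow>map Re xs. w + b)"
        using IH x by metis
      finally show ?case by simp
    qed simp
    from this[of as] real show ?thesis
      unfolding det_shift[OF H] as(1) poly_prod_list by (simp add: as(2) bs_def o_def)
  qed
  then show ?thesis using real as(2) by (intro that[of bs]) (auto simp: bs_def H_def)
qed

text \<open>The truncation at \<open>s\<close> extends the integrand below to a bounded function on the whole line.\<close>

definition reg_sqrt :: "real \<Rightarrow> real \<Rightarrow> real" where "reg_sqrt s u = sqrt (max u s)"

text \<open>For \<open>u \<ge> s\<close> this is \<open>r / u\<close> minus the trace of the resolvent at \<open>u\<close>, which is minus the derivative of
  the log-determinant in the parameter.\<close>

definition trace_gap :: "nat \<Rightarrow> nat \<Rightarrow> real \<Rightarrow> (nat \<Rightarrow> nat \<Rightarrow> complex) \<Rightarrow> real \<Rightarrow> real" where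
  "trace_gap r t s C u = real r / (reg_sqrt s u)\<^sup>2 - (\<Sum>i<r. Re (res (r + t) r (\<lambda>_. reg_sqrt s u) C i i)) / reg_sqrt s u"

lemma reg_sqrt_pos: "0 < s \<Longrightarrow> 0 < reg_sqrt s u"
  by (simp add: reg_sqrt_def)

text \<open>The resolvent has norm at most \<open>1 / u\<close>, so the gap is nonnegative; inserting the two block equations into
  each other shows that it decays like \<open>1 / u\<^sup>2\<close>.\<close>

lemma trace_gap_bounds:
  assumes s: "0 < s"
  shows "0 \<le> trace_gap r t s C u" "trace_gap r t s C u \<le> (\<Sum>i<r. \<Sum>j<t. cmod (C i j))\<^sup>2 / (max u s)\<^sup>2"
proof -
  define e where "e = reg_sqrt s u"
  have e: "0 < e" using reg_sqrt_pos[OF s] by (simp add: e_def)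
  have e2: "e\<^sup>2 = max u s" using s by (simp add: e_def reg_sqrt_def)
  let ?R = "res (r + t) r (\<lambda>_. e) C"
  have ent: "cmod (?R i k) \<le> 1 / e" if "i < r + t" "k < r + t" for i k
    by (rule op_bound_entry[OF op_bound_res that]) (use e in auto)
  define q where "q = (\<Sum>i<r. \<Sum>j<t. cmod (C i j))"
  have q: "0 \<le> q" unfolding q_def by (intro sum_nonneg) auto
  have trace_gap: "trace_gap r t s C u = (\<Sum>i<r. (1 / e - Re (?R i i)) / e)"
    by (simp add: trace_gap_def e_def[symmetric] sum_subtractf sum_divide_distrib diff_divide_distrib power2_eq_square)
  show "0 \<le> trace_gap r t s C u"
    unfolding trace_gap
  proof (intro sum_nonneg divide_nonneg_nonneg)
    fix i assume "i \<in> {..<r}"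
    then show "0 \<le> 1 / e - Re (?R i i)" using ent[of i i] complex_Re_le_cmod[of "?R i i"] by simp
  qed (use e in simp)
  have "1 / e - Re (?R i i) \<le> (\<Sum>j<t. cmod (C i j)) * q / e ^ 3" if i: "i < r" for i
  proof -
    have off: "cmod (?R (r + j) i) \<le> q / e\<^sup>2" if j: "j < t" for j
    proof -
      have "of_real e * ?R (r + j) i - (\<Sum>m<r. cnj (C m j) * ?R m i) = kron (r + j) i"
        by (rule res_rows(2)) (use e i j in auto)
      then have "of_real e * ?R (r + j) i = (\<Sum>m<r. cnj (C m j) * ?R m i)" using i by (simp add: kron_def)
      then have "e * cmod (?R (r + j) i) = cmod (\<Sum>m<r. cnj (C m j) * ?R m i)"
        using e by (metis abs_of_pos norm_mult norm_of_real)
      also have "\<dots> \<le> (\<Sum>m<r. cmod (C m j) * (1 / e))"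
        by (rule order_trans[OF norm_sum], intro sum_mono, unfold norm_mult complex_mod_cnj, rule mult_left_mono[OF ent])
          (use i in auto)
      also have "\<dots> \<le> (\<Sum>m<r. (\<Sum>j<t. cmod (C m j)) * (1 / e))"
        using e j by (intro sum_mono mult_right_mono member_le_sum) auto
      also have "\<dots> = q / e" by (simp add: q_def sum_divide_distrib)
      finally show ?thesis using e by (simp add: field_simps power2_eq_square)
    qed
    have "of_real e * ?R i i + (\<Sum>j<t. C i j * ?R (r + j) i) = kron i i"
      by (rule res_rows(1)) (use e i in auto)
    then have "of_real e * ?R i i = 1 - (\<Sum>j<t. C i j * ?R (r + j) i)" by (simp add: kron_def eq_diff_eq)
    then have "Re (of_real e * ?R i i) = Re (1 - (\<Sum>j<t. C i j * ?R (r + j) i))" by (rule arg_cong)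
    then have "1 - e * Re (?R i i) = Re (\<Sum>j<t. C i j * ?R (r + j) i)" by simp
    also have "\<dots> \<le> (\<Sum>j<t. cmod (C i j) * (q / e\<^sup>2))"
      by (rule order_trans[OF complex_Re_le_cmod], rule order_trans[OF norm_sum], intro sum_mono, unfold norm_mult, rule mult_left_mono[OF off])
        auto
    also have "\<dots> = (\<Sum>j<t. cmod (C i j)) * q / e\<^sup>2" by (simp add: sum_distrib_right sum_divide_distrib)
    finally have "(1 - e * Re (?R i i)) / e \<le> (\<Sum>j<t. cmod (C i j)) * q / e\<^sup>2 / e"
      using e by (intro divide_right_mono) auto
    then show ?thesis using e by (simp add: diff_divide_distrib power2_eq_square power3_eq_cube)
  qed
  then have "trace_gap r t s C u \<le> (\<Sum>i<r. ((\<Sum>j<t. cmod (C i j)) * q / e ^ 3) / e)"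
    unfolding trace_gap using e by (intro sum_mono divide_right_mono) auto
  also have "\<dots> = q * q / e ^ 4"
    by (simp add: q_def sum_divide_distrib[symmetric] sum_distrib_right[symmetric] power3_eq_cube power4_eq_xxxx mult.assoc)
  also have "e ^ 4 = (max u s)\<^sup>2" unfolding e2[symmetric] by simp
  finally show "trace_gap r t s C u \<le> (\<Sum>i<r. \<Sum>j<t. cmod (C i j))\<^sup>2 / (max u s)\<^sup>2"
    by (simp add: q_def power2_eq_square)
qed

lemma trace_gap_measurable:
  assumes s: "0 < s"
    and [measurable]: "\<And>i j. i < r \<Longrightarrow> j < t \<Longrightarrow> (\<lambda>x. C x i j) \<in> borel_measurable M" "f \<in> borel_measurable M"
  shows "(\<lambda>x. trace_gap r t s (C x) (f x)) \<in> borel_measurable M"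
proof -
  have [measurable]: "(\<lambda>x. reg_sqrt s (f x)) \<in> borel_measurable M" unfolding reg_sqrt_def by measurable
  have [measurable]: "(\<lambda>x. res (r + t) r (\<lambda>_. reg_sqrt s (f x)) (C x) i i) \<in> borel_measurable M" if "i < r" for i
    unfolding res_def
  proof (rule minv_measurable)
    show "(\<lambda>x. skew_lin r (\<lambda>_. reg_sqrt s (f x)) (C x) a b) \<in> borel_measurable M" if ij: "a < r + t" "b < r + t" for a b
    proof -
      have cn: "cnj \<in> borel_measurable borel" by (intro borel_measurable_continuous_onI continuous_intros)
      consider "a = b" | "a \<noteq> b" "a < r" "r \<le> b" | "a \<noteq> b" "r \<le> a" "b < r" | "a \<noteq> b" "a < r" "b < r" | "a \<noteq> b" "r \<le> a" "r \<le> b"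
        by linarith
      moreover have "(\<lambda>x. cnj (C x i j)) \<in> borel_measurable M" if "i < r" "j < t" for i j
        using measurable_compose[OF assms(2)[OF that] cn] by simp
      ultimately show ?thesis using ij by cases (simp_all add: skew_lin_def)
    qed
  qed (use skew_lin_det reg_sqrt_pos[OF s] that in auto)
  show ?thesis unfolding trace_gap_def by measurable
qed

text \<open>The normalized determinant tends to one at infinity and minus its logarithm has the derivative
  \<open>trace_gap\<close>. Since the integrand is nonnegative, the fundamental theorem applies in extended
  nonnegative integrals without a separate integrability proof.\<close>

lemma logdet_integral:
  fixes A :: "complex mat"
  assumes A: "A \<in> carrier_mat r t" and s: "0 < s"
  shows "(\<integral>\<^sup>+u. ennreal (trace_gap r t s (\<lambda>i j. A $$ (i, j)) u) * indicator {s..} u \<partial>lborel)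
    = ennreal (ln (Re (Determinant.det (1\<^sub>m r + of_real (1 / s) \<cdot>\<^sub>m (A * mat_adjoint A)))))"
    and "0 \<le> ln (Re (Determinant.det (1\<^sub>m r + of_real (1 / s) \<cdot>\<^sub>m (A * mat_adjoint A))))"
proof -
  define H where "H = A * mat_adjoint A"
  note adj = mat_adjoint_carrier[OF A]
  have H: "H \<in> carrier_mat r r" unfolding H_def using A adj by (rule mult_carrier_mat)
  obtain bs where bs: "\<forall>b\<in>set bs. 0 \<le> b" "length bs = r"
    "\<And>w. Determinant.det (H + of_real w \<cdot>\<^sub>m 1\<^sub>m r) = of_real (\<Prod>b\<leftarrow>bs. w + b)"
    using gram_char_poly[OF A] unfolding H_def by blast
  (* det (H + w) in terms of the eigenvalues of H *)
  define g where "g w = (\<Prod>b\<leftarrow>bs. w + b)" for w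
  have g_pos: "0 < g w" if "0 < w" for w
    unfolding g_def using bs(1) that by (induction bs) (auto intro!: mult_pos_pos add_pos_nonneg)
  define f where "f w = Re (Determinant.det (1\<^sub>m r + of_real (1 / w) \<cdot>\<^sub>m H))" for w
  have scale: "1\<^sub>m r + of_real (1 / w) \<cdot>\<^sub>m H = complex_of_real (1 / w) \<cdot>\<^sub>m (H + of_real w \<cdot>\<^sub>m 1\<^sub>m r)" if "0 < w" for w
    using H that by (intro eq_matI) (auto simp: field_simps)
  have f_g: "f w = g w / w ^ r" if w: "0 < w" for w
    unfolding f_def scale[OF w] using H by (simp add: det_smult bs(3) g_def power_divide)
  have f_prod: "f w = (\<Prod>b\<leftarrow>bs. 1 + b / w)" if w: "0 < w" for w
  proof -
    have "(\<Prod>b\<leftarrow>xs. w + b) / w ^ length xs = (\<Prod>b\<leftarrow>xs. 1 + b / w)" for xs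
      using w by (induction xs) (simp_all add: add_divide_distrib flip: times_divide_times_eq)
    then show ?thesis unfolding f_g[OF w] g_def using bs(2) by metis
  qed
  have f_ge1: "1 \<le> f w" if w: "0 < w" for w
    unfolding f_prod[OF w] using bs(1)
  proof (induction bs)
    case (Cons b bs)
    then have "1 * 1 \<le> (1 + b / w) * (\<Prod>b\<leftarrow>bs. 1 + b / w)" using w by (intro mult_mono) auto
    then show ?case by simp
  qed simp
  have f_lim: "(f \<longlongrightarrow> 1) at_top"
  proof -
    have "((\<lambda>w. \<Prod>b\<leftarrow>xs. 1 + b / w) \<longlongrightarrow> 1) at_top" for xs :: "real list"
    proof (induction xs)
      case (Cons b xs)
      have "((\<lambda>w. b / w) \<longlongrightarrow> 0) at_top"
        by (intro real_tendsto_divide_at_top[OF tendsto_const] filterlim_ident)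
      then have "((\<lambda>w. 1 + b / w) \<longlongrightarrow> 1 + 0) at_top" by (intro tendsto_intros)
      from tendsto_mult[OF this Cons] show ?case by simp
    qed simp
    moreover have "eventually (\<lambda>w. (\<Prod>b\<leftarrow>bs. 1 + b / w) = f w) at_top"
      using eventually_gt_at_top[of 0] by eventually_elim (simp add: f_prod)
    ultimately show ?thesis by (rule Lim_transform_eventually)
  qed
  let ?h = "trace_gap r t s (\<lambda>i j. A $$ (i, j))"
  have der: "((\<lambda>w. - ln (f w)) has_real_derivative ?h w) (at w)" if w: "s \<le> w" for w
  proof -
    have w0: "0 < w" using w s by linarith
    let ?e = "sqrt w"
    let ?W = "H + of_real w \<cdot>\<^sub>m 1\<^sub>m r"
    have reg_sqrt: "reg_sqrt s w = ?e" using w by (simp add: reg_sqrt_def max_def)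
    have W: "?W \<in> carrier_mat r r" by simp
    have det: "Determinant.det ?W = of_real (g w)" using bs(3) by (simp add: g_def)
    have inv: "Determinant.cofactor ?W i i = Determinant.det ?W * (res (r + t) r (\<lambda>_. ?e) (\<lambda>i j. A $$ (i, j)) i i / of_real ?e)" if i: "i < r" for i
    proof -
      have WW: "Matrix.mat r r (\<lambda>(i, j). ?W $$ (i, j)) = ?W" by (rule eq_matI) (use W in auto)
      have "minv r (\<lambda>i j. ?W $$ (i, j)) i i = mat_inv ?W $$ (i, i)" by (simp only: minv_def WW)
      also have "mat_inv ?W = resolvent A w" using A by (simp add: resolvent_def H_def)
      also have "resolvent A w $$ (i, i) = res (r + t) r (\<lambda>_. ?e) (\<lambda>i j. A $$ (i, j)) i i / of_real ?e"
        using resolvent_eq(1)[OF A w0] i by simp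
      finally have 1: "minv r (\<lambda>i j. ?W $$ (i, j)) i i = res (r + t) r (\<lambda>_. ?e) (\<lambda>i j. A $$ (i, j)) i i / of_real ?e" .
      have "minv r (\<lambda>i j. ?W $$ (i, j)) i i = Determinant.cofactor ?W i i / Determinant.det ?W"
        using minv_cofactor[of r "\<lambda>i j. ?W $$ (i, j)" i i] i g_pos[OF w0] unfolding WW by (simp add: det)
      then show ?thesis unfolding 1[symmetric] using g_pos[OF w0] by (simp add: det)
    qed
    have "((\<lambda>w. Determinant.det (H + of_real w \<cdot>\<^sub>m 1\<^sub>m r)) has_vector_derivative (\<Sum>i<r. Determinant.cofactor ?W i i)) (at w)"
      by (rule has_vector_derivative_real_field[OF det_shift_derivative[OF H]])
    then have "((\<lambda>w. complex_of_real (g w)) has_vector_derivative (\<Sum>i<r. Determinant.cofactor ?W i i)) (at w)"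
      using bs(3) by (simp add: g_def)
    then have "((\<lambda>w. Re (complex_of_real (g w))) has_vector_derivative Re (\<Sum>i<r. Determinant.cofactor ?W i i)) (at w)"
      by (rule bounded_linear.has_vector_derivative[OF bounded_linear_Re])
    then have gd: "(g has_real_derivative (\<Sum>i<r. Re (Determinant.cofactor ?W i i))) (at w)"
      by (simp add: has_real_derivative_iff_has_vector_derivative)
    have Re_inv: "Re (Determinant.cofactor ?W i i) = g w * (Re (res (r + t) r (\<lambda>_. ?e) (\<lambda>i j. A $$ (i, j)) i i) / ?e)" if "i < r" for i
      unfolding inv[OF that] det by simp
    have gd': "(g has_real_derivative g w * ((\<Sum>i<r. Re (res (r + t) r (\<lambda>_. ?e) (\<lambda>i j. A $$ (i, j)) i i)) / ?e)) (at w)"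
      using gd by (simp add: Re_inv sum_distrib_left sum_divide_distrib)
    have "((\<lambda>w. real r * ln w - ln (g w)) has_real_derivative ?h w) (at w)"
      using gd' g_pos[OF w0] w0
      by (auto intro!: derivative_eq_intros simp: trace_gap_def reg_sqrt)
    moreover have "eventually (\<lambda>w. real r * ln w - ln (g w) = - ln (f w)) (nhds w)"
    proof -
      have "eventually (\<lambda>w. w \<in> {0<..}) (nhds w)" by (rule eventually_nhds_in_open) (use w0 in auto)
      then show ?thesis
      proof eventually_elim
        case (elim w)
        then have "0 < w" by simp
        then show ?case unfolding f_g[OF \<open>0 < w\<close>] using g_pos[OF \<open>0 < w\<close>] by (simp add: ln_div ln_realpow)
      qed
    qed
    ultimately show ?thesis by (subst (asm) DERIV_cong_ev[OF refl _ refl]) auto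
  qed
  have "(\<integral>\<^sup>+u. ennreal (?h u) * indicator {s..} u \<partial>lborel) = ennreal (0 - (- ln (f s)))"
  proof (rule nn_integral_FTC_atLeast[OF _ der])
    show "?h \<in> borel_measurable borel"
      using trace_gap_measurable[OF s, of r t "\<lambda>_ i j. A $$ (i, j)" borel "\<lambda>u. u"] by simp
    show "((\<lambda>w. - ln (f w)) \<longlongrightarrow> 0) at_top"
      using tendsto_minus[OF tendsto_ln[OF f_lim]] by simp
  qed (use trace_gap_bounds(1)[OF s] in auto)
  then show "(\<integral>\<^sup>+u. ennreal (?h u) * indicator {s..} u \<partial>lborel)
    = ennreal (ln (Re (Determinant.det (1\<^sub>m r + of_real (1 / s) \<cdot>\<^sub>m (A * mat_adjoint A)))))"
    by (simp add: f_def H_def)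
  show "0 \<le> ln (Re (Determinant.det (1\<^sub>m r + of_real (1 / s) \<cdot>\<^sub>m (A * mat_adjoint A))))"
    using f_ge1[OF s] by (simp add: f_def H_def)
qed

section \<open>The canonical pair\<close>

context gaussian_model
begin

definition Dm :: "complex mat" where "Dm = mat_diag r (\<lambda>i. of_real (d i))"
definition Dtm :: "complex mat" where "Dtm = mat_diag t (\<lambda>j. of_real (dt j))"

text \<open>The scaling by \<open>e\<close> that passes from \<open>(\<beta>, \<beta>~)\<close> to a fixed point of \<open>Phi\<close>.\<close>

definition pair_point :: "real \<Rightarrow> real \<Rightarrow> bool \<Rightarrow> real" where
  "pair_point b bt = (\<lambda>a. e * (if a then bt else b))"

lemma T_of_res:
  assumes A: "A \<in> carrier_mat r t" and BA: "B = (\<lambda>i j. A $$ (i, j))" and s: "e = sqrt s" "0 < s"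
    and b: "0 \<le> b" "0 \<le> bt"
  shows "T_of A Dm Dtm s b bt = Matrix.mat r r (\<lambda>(i, k). res n r (wt pp e (pair_point b bt)) B i k / of_real e)"
    and "Tt_of A Dm Dtm s b bt = Matrix.mat t t (\<lambda>(j, l). res n r (wt pp e (pair_point b bt)) B (r + j) (r + l) / of_real e)"
proof -
  have "wt pp e (pair_point b bt) i = sqrt s * (1 + bt * d i)" if "i < r" for i
    using that by (simp add: wt_def pp_def pair_point_def s(1)[symmetric] algebra_simps)
  moreover have "wt pp e (pair_point b bt) (r + j) = sqrt s * (1 + b * dt j)" if "j < t" for j
    using that by (simp add: wt_def pp_def pair_point_def s(1)[symmetric] algebra_simps)
  ultimately show "T_of A Dm Dtm s b bt = Matrix.mat r r (\<lambda>(i, k). res n r (wt pp e (pair_point b bt)) B i k / of_real e)"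
    and "Tt_of A Dm Dtm s b bt = Matrix.mat t t (\<lambda>(j, l). res n r (wt pp e (pair_point b bt)) B (r + j) (r + l) / of_real e)"
    unfolding Dm_def Dtm_def n_eq BA s(1) by (intro T_of_eq[OF A s(2)] d0 dt0 b; simp)+
qed

lemma mat_trace_diag:
  fixes f :: "nat \<Rightarrow> complex"
  assumes "W \<in> carrier_mat m m"
  shows "mat_trace (mat_diag m f * W) = (\<Sum>i<m. f i * W $$ (i, i))"
  using assms by (simp add: mat_trace_def mat_diag_mult_left[OF assms])

text \<open>The canonical equations are the equations of \<open>Phi\<close> after the scaling by \<open>e\<close>, since
  \<open>T\<close> and \<open>T~\<close> are \<open>1 / e\<close> times the corners of \<open>res\<close>.\<close>

lemma canonical_solution_iff:
  assumes A: "A \<in> carrier_mat r t" and BA: "B = (\<lambda>i j. A $$ (i, j))" and s: "e = sqrt s" "0 < s"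
  shows "canonical_solution A Dm Dtm s (b, bt) \<longleftrightarrow> is_fixed_point n r t pp B e (pair_point b bt)"
proof (cases "0 < b \<and> 0 < bt")
  case True
  then have b: "0 \<le> b" "0 \<le> bt" by auto
  let ?m = "pair_point b bt"
  have m: "0 < ?m a" for a using True e_pos by (simp add: pair_point_def)
  have m0: "0 \<le> ?m True" "0 \<le> ?m False" using m less_imp_le by blast+
  have real: "res n r (wt pp e ?m) B i i = of_real (Re (res n r (wt pp e ?m) B i i))" if "i < n" for i
    by (rule res_diag_real[OF wt_pos[OF e_pos m0] that])
  have dims: "dim_col A = t" "dim_row A = r" using A by auto
  have 1: "1 / of_nat (dim_col A) * mat_trace (Dm * T_of A Dm Dtm s b bt) = of_real (Phi n r t pp B e ?m False / e)"
  proof -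
    have "mat_trace (Dm * T_of A Dm Dtm s b bt) = (\<Sum>i<r. of_real (d i) * (res n r (wt pp e ?m) B i i / of_real e))"
      unfolding T_of_res(1)[OF A BA s b] unfolding Dm_def by (subst mat_trace_diag) auto
    also have "\<dots> = of_real ((\<Sum>i<r. d i * Re (res n r (wt pp e ?m) B i i)) / e)"
      unfolding of_real_divide of_real_sum sum_divide_distrib
    proof (intro sum.cong refl)
      fix i assume "i \<in> {..<r}"
      then have i: "i < n" using n_eq by simp
      show "of_real (d i) * (res n r (wt pp e ?m) B i i / of_real e) = complex_of_real (d i * Re (res n r (wt pp e ?m) B i i)) / of_real e"
        by (subst real[OF i]) simp
    qed
    also have "(\<Sum>i<r. d i * Re (res n r (wt pp e ?m) B i i)) = (\<Sum>i<n. pp False i * Re (res n r (wt pp e ?m) B i i))"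
      unfolding n_eq sum_split by (simp add: pp_def)
    finally show ?thesis by (simp add: dims Phi_def)
  qed
  have 2: "1 / of_nat (dim_col A) * mat_trace (Dtm * Tt_of A Dm Dtm s b bt) = of_real (Phi n r t pp B e ?m True / e)"
  proof -
    have "mat_trace (Dtm * Tt_of A Dm Dtm s b bt) = (\<Sum>i<t. of_real (dt i) * (res n r (wt pp e ?m) B (r + i) (r + i) / of_real e))"
      unfolding T_of_res(2)[OF A BA s b] unfolding Dtm_def by (subst mat_trace_diag) auto
    also have "\<dots> = of_real ((\<Sum>i<t. dt i * Re (res n r (wt pp e ?m) B (r + i) (r + i))) / e)"
      unfolding of_real_divide of_real_sum sum_divide_distrib
    proof (intro sum.cong refl)
      fix i assume "i \<in> {..<t}"
      then have i: "r + i < n" using n_eq by simp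
      show "of_real (dt i) * (res n r (wt pp e ?m) B (r + i) (r + i) / of_real e) = complex_of_real (dt i * Re (res n r (wt pp e ?m) B (r + i) (r + i))) / of_real e"
        by (subst real[OF i]) simp
    qed
    also have "(\<Sum>i<t. dt i * Re (res n r (wt pp e ?m) B (r + i) (r + i))) = (\<Sum>i<n. pp True i * Re (res n r (wt pp e ?m) B i i))"
      unfolding n_eq sum_split by (simp add: pp_def)
    finally show ?thesis by (simp add: dims Phi_def)
  qed
  have "canonical_solution A Dm Dtm s (b, bt) \<longleftrightarrow> b = Phi n r t pp B e ?m False / e \<and> bt = Phi n r t pp B e ?m True / e"
    unfolding canonical_solution_def prod.case 1 2 of_real_eq_iff using True by simp
  also have "\<dots> \<longleftrightarrow> is_fixed_point n r t pp B e ?m"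
    unfolding is_fixed_point_def all_bool_eq using e_pos True by (auto simp: pair_point_def field_simps)
  finally show ?thesis .
next
  case False
  then show ?thesis
    using e_pos by (auto simp: canonical_solution_def is_fixed_point_def pair_point_def all_bool_eq zero_less_mult_iff)
qed

lemma T_mat_res:
  assumes A: "A \<in> carrier_mat r t" and BA: "B = (\<lambda>i j. A $$ (i, j))" and s: "e = sqrt s" "0 < s"
  shows "T_mat A Dm Dtm s = Matrix.mat r r (\<lambda>(i, k). res n r (wt pp e (fixed_pt B e)) B i k / of_real e)"
    and "Tt_mat A Dm Dtm s = Matrix.mat t t (\<lambda>(j, l). res n r (wt pp e (fixed_pt B e)) B (r + j) (r + l) / of_real e)"
proof -
  note rows = spectral_norm_rows[OF A] and cols = spectral_norm_columns[OF A]
  have fp: "is_fixed_point n r t pp B e (fixed_pt B e)"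
    unfolding BA by (rule fixed_pt[OF e_pos rows cols])
  define b where "b = fixed_pt B e False / e"
  define bt where "bt = fixed_pt B e True / e"
  have ptb: "pair_point b bt = fixed_pt B e"
    using e_pos by (auto simp: pair_point_def b_def bt_def fun_eq_iff)
  have pos: "0 \<le> b" "0 \<le> bt" using fp e_pos by (auto simp: is_fixed_point_def b_def bt_def less_imp_le)
  have "canonical_pair A Dm Dtm s = (b, bt)"
    unfolding canonical_pair_def
  proof (rule the_equality)
    show "canonical_solution A Dm Dtm s (b, bt)"
      unfolding canonical_solution_iff[OF A BA s] ptb by (rule fp)
    fix q assume q: "canonical_solution A Dm Dtm s q"
    obtain b' bt' where q': "q = (b', bt')" by (cases q)
    have "is_fixed_point n r t pp B e (pair_point b' bt')"
      using q unfolding q' canonical_solution_iff[OF A BA s] .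
    then have "pair_point b' bt' = fixed_pt B e"
      using fp_unique[OF e_pos rows cols, of "fixed_pt B e" "pair_point b' bt'"] fp unfolding BA by simp
    then have "pair_point b' bt' True = pair_point b bt True" "pair_point b' bt' False = pair_point b bt False" by (simp_all only: ptb)
    then show "q = (b, bt)" using e_pos by (simp add: q' pair_point_def)
  qed
  then show "T_mat A Dm Dtm s = Matrix.mat r r (\<lambda>(i, k). res n r (wt pp e (fixed_pt B e)) B i k / of_real e)"
    and "Tt_mat A Dm Dtm s = Matrix.mat t t (\<lambda>(j, l). res n r (wt pp e (fixed_pt B e)) B (r + j) (r + l) / of_real e)"
    unfolding T_mat_def Tt_mat_def using T_of_res[OF A BA s pos] by (simp_all add: ptb)
qed

end

section \<open>The law of the real coordinates\<close>

text \<open>The real coordinates of a random matrix, in the indexing of the Gaussian model.\<close>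

definition coords :: "nat \<Rightarrow> nat \<Rightarrow> ('a \<Rightarrow> complex mat) \<Rightarrow> 'a \<Rightarrow> (nat \<times> nat) \<times> bool \<Rightarrow> real" where
  "coords r t X \<omega> = (\<lambda>k\<in>({..<r} \<times> {..<t}) \<times> UNIV. case k of ((i, j), b) \<Rightarrow>
     if b then Im (X \<omega> $$ (i, j)) else Re (X \<omega> $$ (i, j)))"

text \<open>Entries are independent of each other, and the real and imaginary parts of one entry are independent;
  on measurable rectangles the two facts multiply up to independence of all real coordinates.\<close>

lemma coords_law:
  assumes P: "prob_space P" and rt: "0 < r" "0 < t"
    and indep: "prob_space.indep_vars P (\<lambda>_. borel) (\<lambda>(i, j) \<omega>. X \<omega> $$ (i, j)) ({..<r} \<times> {..<t})"
    and gau: "\<And>i j. i < r \<Longrightarrow> j < t \<Longrightarrow> std_complex_gaussian P (\<lambda>\<omega>. X \<omega> $$ (i, j))"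
  shows "distr P (Pi\<^sub>M (({..<r} \<times> {..<t}) \<times> UNIV) (\<lambda>_. gauss)) (coords r t X) = Pi\<^sub>M (({..<r} \<times> {..<t}) \<times> UNIV) (\<lambda>_. gauss)"
    and "coords r t X \<in> measurable P (Pi\<^sub>M (({..<r} \<times> {..<t}) \<times> UNIV) (\<lambda>_. gauss))"
proof -
  interpret P: prob_space P by fact
  interpret N: prob_space gauss by (rule prob_space_gauss)
  interpret S: product_sigma_finite "\<lambda>_ :: (nat \<times> nat) \<times> bool. gauss" by standard
  let ?I = "({..<r} \<times> {..<t}) \<times> (UNIV :: bool set)"
  let ?x = "\<lambda>k \<omega>. case k of ((i, j), b) \<Rightarrow> if b then Im (X \<omega> $$ (i, j)) else Re (X \<omega> $$ (i, j))"
  have Xm: "(\<lambda>\<omega>. X \<omega> $$ (i, j)) \<in> borel_measurable P" if "i < r" "j < t" for i j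
    using indep that unfolding P.indep_vars_def by auto
  have comp: "distr P borel (\<lambda>\<omega>. Re (X \<omega> $$ (i, j))) = gauss" "distr P borel (\<lambda>\<omega>. Im (X \<omega> $$ (i, j))) = gauss" if "i < r" "j < t" for i j
  proof -
    have "distributed P lborel (\<lambda>\<omega>. Re (X \<omega> $$ (i, j))) (normal_density 0 (sqrt (1/2)))"
      "distributed P lborel (\<lambda>\<omega>. Im (X \<omega> $$ (i, j))) (normal_density 0 (sqrt (1/2)))"
      using gau[OF that] by (auto simp: std_complex_gaussian_def)
    from this[THEN distributed_distr_eq_density]
    show "distr P borel (\<lambda>\<omega>. Re (X \<omega> $$ (i, j))) = gauss" "distr P borel (\<lambda>\<omega>. Im (X \<omega> $$ (i, j))) = gauss"
      unfolding gauss_def by (simp_all cong: distr_cong)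
  qed
  have xm: "?x k \<in> borel_measurable P" if "k \<in> ?I" for k
  proof -
    obtain i j b where k0: "k = ((i, j), b)" by (metis surj_pair)
    with that have k: "k = ((i, j), b)" "i < r" "j < t" by auto
    have [measurable]: "(\<lambda>\<omega>. X \<omega> $$ (i, j)) \<in> borel_measurable P" by (rule Xm[OF k(2,3)])
    show ?thesis unfolding k(1) by (cases b) simp_all
  qed
  have xm': "?x k \<in> measurable P gauss" if "k \<in> ?I" for k
    using xm[OF that] by (simp cong: measurable_cong_sets)
  show meas: "coords r t X \<in> measurable P (Pi\<^sub>M ?I (\<lambda>_. gauss))"
    unfolding coords_def by (rule measurable_restrict[OF xm'])
  have sx: "emeasure gauss A = ennreal (P.prob (?x k -` A \<inter> space P))" if "k \<in> ?I" "A \<in> sets borel" for k A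
  proof -
    obtain i j b where k0: "k = ((i, j), b)" by (metis surj_pair)
    with that have k: "k = ((i, j), b)" "i < r" "j < t" by auto
    have "gauss = distr P borel (?x k)" using comp[OF k(2,3)] unfolding k(1) by (cases b) simp_all
    then have "emeasure gauss A = emeasure (distr P borel (?x k)) A" by simp
    also have "\<dots> = emeasure P (?x k -` A \<inter> space P)" by (rule emeasure_distr[OF xm[OF that(1)] that(2)])
    finally show ?thesis by (simp add: P.emeasure_eq_measure)
  qed
  show "distr P (Pi\<^sub>M ?I (\<lambda>_. gauss)) (coords r t X) = Pi\<^sub>M ?I (\<lambda>_. gauss)"
  proof (rule S.PiM_eqI)
    fix A assume A: "\<And>k. k \<in> ?I \<Longrightarrow> A k \<in> sets gauss"
    let ?J = "{..<r} \<times> {..<t}"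
    define Bx where "Bx z = {w :: complex. Re w \<in> A (z, False) \<and> Im w \<in> A (z, True)}" for z
    have A': "A (z, b) \<in> sets borel" if "z \<in> ?J" for z b using A[of "(z, b)"] that by simp
    have Bm: "Bx z \<in> sets borel" if "z \<in> ?J" for z
    proof -
      have [measurable]: "A (z, False) \<in> sets borel" "A (z, True) \<in> sets borel" using A'[OF that] by auto
      have "Bx z = (Re -` A (z, False) \<inter> space borel) \<inter> (Im -` A (z, True) \<inter> space borel)" by (auto simp: Bx_def)
      also have "\<dots> \<in> sets borel" by (intro sets.Int measurable_sets[of _ borel borel]) auto
      finally show ?thesis .
    qed
    have one: "P.prob ((\<lambda>\<omega>. X \<omega> $$ z) -` Bx z \<inter> space P) = P.prob (?x (z, False) -` A (z, False) \<inter> space P) * P.prob (?x (z, True) -` A (z, True) \<inter> space P)"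
      if z: "z \<in> ?J" for z
    proof -
      obtain i j where ij: "z = (i, j)" "i < r" "j < t" using z by auto
      have "P.indep_var borel (\<lambda>\<omega>. Re (X \<omega> $$ (i, j))) borel (\<lambda>\<omega>. Im (X \<omega> $$ (i, j)))"
        using gau[OF ij(2,3)] by (simp add: std_complex_gaussian_def)
      from P.indep_varD[OF this A'[OF z, of False] A'[OF z, of True]]
      show ?thesis unfolding ij(1) Bx_def by (simp add: vimage_def conj_ac)
    qed
    have PE: "Pi\<^sub>E ?I A \<in> sets (Pi\<^sub>M ?I (\<lambda>_. gauss))" by (rule sets_PiM_I_finite) (use A in auto)
    have "emeasure (distr P (Pi\<^sub>M ?I (\<lambda>_. gauss)) (coords r t X)) (Pi\<^sub>E ?I A) = emeasure P (coords r t X -` Pi\<^sub>E ?I A \<inter> space P)"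
      by (rule emeasure_distr[OF meas PE])
    also have "coords r t X -` Pi\<^sub>E ?I A \<inter> space P = (\<Inter>z\<in>?J. (\<lambda>(i, j) \<omega>. X \<omega> $$ (i, j)) z -` Bx z \<inter> space P)"
    proof (intro Set.set_eqI)
      fix \<omega>
      have "coords r t X \<omega> \<in> Pi\<^sub>E ?I A \<longleftrightarrow> (\<forall>z\<in>?J. \<forall>b. ?x (z, b) \<omega> \<in> A (z, b))"
        unfolding PiE_iff by (simp add: coords_def Ball_def)
      also have "\<dots> \<longleftrightarrow> (\<forall>z\<in>?J. (\<lambda>(i, j) \<omega>. X \<omega> $$ (i, j)) z \<omega> \<in> Bx z)"
        by (simp add: Bx_def all_bool_eq conj_commute)
      finally show "\<omega> \<in> coords r t X -` Pi\<^sub>E ?I A \<inter> space P \<longleftrightarrow> \<omega> \<in> (\<Inter>z\<in>?J. (\<lambda>(i, j) \<omega>. X \<omega> $$ (i, j)) z -` Bx z \<inter> space P)"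
        using rt by auto
    qed
    also have "emeasure P \<dots> = ennreal (P.prob (\<Inter>z\<in>?J. (\<lambda>(i, j) \<omega>. X \<omega> $$ (i, j)) z -` Bx z \<inter> space P))"
      by (rule P.emeasure_eq_measure)
    also have "P.prob (\<Inter>z\<in>?J. (\<lambda>(i, j) \<omega>. X \<omega> $$ (i, j)) z -` Bx z \<inter> space P) = (\<Prod>z\<in>?J. P.prob ((\<lambda>(i, j) \<omega>. X \<omega> $$ (i, j)) z -` Bx z \<inter> space P))"
      by (rule P.indep_varsD_finite[OF indep]) (use rt Bm in auto)
    also have "\<dots> = (\<Prod>z\<in>?J. \<Prod>b\<in>UNIV. P.prob (?x (z, b) -` A (z, b) \<inter> space P))"
      using one by (intro prod.cong refl) (auto simp: UNIV_bool mult.commute)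
    also have "\<dots> = (\<Prod>k\<in>?I. P.prob (?x k -` A k \<inter> space P))"
      by (simp add: prod.cartesian_product')
    also have "ennreal \<dots> = (\<Prod>k\<in>?I. ennreal (P.prob (?x k -` A k \<inter> space P)))"
      by (rule prod_ennreal[symmetric]) simp
    also have "\<dots> = (\<Prod>k\<in>?I. emeasure gauss (A k))"
      by (intro prod.cong refl sx[symmetric]) (use A in auto)
    finally show "emeasure (distr P (Pi\<^sub>M ?I (\<lambda>_. gauss)) (coords r t X)) (Pi\<^sub>E ?I A) = (\<Prod>k\<in>?I. emeasure gauss (A k))" .
  qed simp_all
qed

section \<open>The mean log-determinant\<close>

context gaussian_model
begin

definition Sm :: "((nat \<times> nat) \<times> bool \<Rightarrow> real) \<Rightarrow> complex mat" where
  "Sm x = Matrix.mat r t (\<lambda>(i, j). noisy x i j)"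

definition logdet :: "real \<Rightarrow> ((nat \<times> nat) \<times> bool \<Rightarrow> real) \<Rightarrow> real" where
  "logdet s x = ln (Re (Determinant.det (1\<^sub>m r + of_real (1 / s) \<cdot>\<^sub>m (Sm x * mat_adjoint (Sm x)))))"

lemma noisy_measurable: "i < r \<Longrightarrow> j < t \<Longrightarrow> (\<lambda>x. noisy x i j) \<in> borel_measurable PG"
proof -
  assume ij: "i < r" "j < t"
  have [measurable]: "(\<lambda>x. x ((i, j), b)) \<in> borel_measurable PG" for b
    using measurable_component_singleton[of "((i, j), b)" I "\<lambda>_. gauss"] ij
    by (simp add: I_def cong: measurable_cong_sets)
  show ?thesis unfolding noisy_def Complex_eq by measurable
qed

text \<open>This dominates the integral of \<open>trace_gap\<close> and makes the log-determinant integrable.\<close>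

lemma noisy_second_moment:
  "integrable PG (\<lambda>x. (\<Sum>i<r. \<Sum>j<t. cmod (noisy x i j))\<^sup>2)"
proof -
  note [measurable] = noisy_measurable
  have sq: "integrable PG (\<lambda>x. (x k)\<^sup>2)" if "k \<in> I" for k
  proof -
    have "integrable (distr PG gauss (\<lambda>x. x k)) (\<lambda>u. u\<^sup>2)"
      using integrable_gauss_poly[of 2] distr_PiM_component[of I "\<lambda>_. gauss" k] prob_space_gauss that by simp
    then show ?thesis using that by (subst (asm) integrable_distr_eq) auto
  qed
  interpret P: prob_space PG by (rule PG)
  have ent: "integrable PG (\<lambda>x. (cmod (noisy x i j))\<^sup>2)" if ij: "i < r" "j < t" for i j
  proof (rule Bochner_Integration.integrable_bound)
    have k: "((i, j), b) \<in> I" for b using ij by (simp add: I_def)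
    show "integrable PG (\<lambda>x. 2 * (cmod (B i j))\<^sup>2 + 2 * (noise_scale i j)\<^sup>2 * ((x ((i, j), False))\<^sup>2 + (x ((i, j), True))\<^sup>2))"
      by (intro Bochner_Integration.integrable_add integrable_mult_right sq k) simp
    show "(\<lambda>x. (cmod (noisy x i j))\<^sup>2) \<in> borel_measurable PG" using ij by measurable
    show "AE x in PG. norm ((cmod (noisy x i j))\<^sup>2) \<le> norm (2 * (cmod (B i j))\<^sup>2 + 2 * (noise_scale i j)\<^sup>2 * ((x ((i, j), False))\<^sup>2 + (x ((i, j), True))\<^sup>2))"
    proof (rule AE_I2)
      fix x
      have "(cmod (noisy x i j))\<^sup>2 \<le> (cmod (B i j) + cmod (of_real (noise_scale i j) * Complex (x ((i, j), False)) (x ((i, j), True))))\<^sup>2"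
        unfolding noisy_def by (intro power_mono norm_triangle_ineq) simp
      also have "\<dots> \<le> 2 * (cmod (B i j))\<^sup>2 + 2 * (cmod (of_real (noise_scale i j) * Complex (x ((i, j), False)) (x ((i, j), True))))\<^sup>2"
      proof -
        have "(a + b)\<^sup>2 \<le> 2 * a\<^sup>2 + 2 * b\<^sup>2" for a b :: real
          using zero_le_power2[of "a - b"] by (simp add: power2_eq_square algebra_simps)
        then show ?thesis .
      qed
      also have "(cmod (of_real (noise_scale i j) * Complex (x ((i, j), False)) (x ((i, j), True))))\<^sup>2 = (noise_scale i j)\<^sup>2 * ((x ((i, j), False))\<^sup>2 + (x ((i, j), True))\<^sup>2)"
        by (simp add: norm_mult power_mult_distrib cmod_power2)
      finally show "norm ((cmod (noisy x i j))\<^sup>2) \<le> norm (2 * (cmod (B i j))\<^sup>2 + 2 * (noise_scale i j)\<^sup>2 * ((x ((i, j), False))\<^sup>2 + (x ((i, j), True))\<^sup>2))"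
        by (simp add: mult.assoc)
    qed
  qed
  show ?thesis
  proof (rule Bochner_Integration.integrable_bound)
    show "integrable PG (\<lambda>x. real (r * t) * (\<Sum>i<r. \<Sum>j<t. (cmod (noisy x i j))\<^sup>2))"
      by (intro integrable_mult_right Bochner_Integration.integrable_sum ent) auto
    show "(\<lambda>x. (\<Sum>i<r. \<Sum>j<t. cmod (noisy x i j))\<^sup>2) \<in> borel_measurable PG"
      by (intro borel_measurable_power borel_measurable_sum borel_measurable_norm noisy_measurable) auto
    show "AE x in PG. norm ((\<Sum>i<r. \<Sum>j<t. cmod (noisy x i j))\<^sup>2) \<le> norm (real (r * t) * (\<Sum>i<r. \<Sum>j<t. (cmod (noisy x i j))\<^sup>2))"
    proof (rule AE_I2)
      fix x
      have "(\<Sum>z\<in>{..<r} \<times> {..<t}. (case z of (i, j) \<Rightarrow> cmod (noisy x i j)) * 1)\<^sup>2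
        \<le> (\<Sum>z\<in>{..<r} \<times> {..<t}. (case z of (i, j) \<Rightarrow> cmod (noisy x i j))\<^sup>2) * (\<Sum>z\<in>{..<r} \<times> {..<t}. 1\<^sup>2)"
        by (rule Cauchy_Schwarz_ineq_sum)
      then have "(\<Sum>i<r. \<Sum>j<t. cmod (noisy x i j))\<^sup>2 \<le> real (r * t) * (\<Sum>i<r. \<Sum>j<t. (cmod (noisy x i j))\<^sup>2)"
        by (simp add: sum.cartesian_product' mult.commute)
      then show "norm ((\<Sum>i<r. \<Sum>j<t. cmod (noisy x i j))\<^sup>2) \<le> norm (real (r * t) * (\<Sum>i<r. \<Sum>j<t. (cmod (noisy x i j))\<^sup>2))"
        by (simp add: sum_nonneg)
    qed
  qed
qed

lemma nn_integral_inverse_square: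
  assumes "0 < (s :: real)" "0 \<le> c"
  shows "(\<integral>\<^sup>+u. ennreal (c / (max u s)\<^sup>2) * indicator {s..} u \<partial>lborel) = ennreal (c / s)"
proof -
  have "(\<integral>\<^sup>+u. ennreal (c / (max u s)\<^sup>2) * indicator {s..} u \<partial>lborel) = ennreal (0 - (- c / s))"
  proof (rule nn_integral_FTC_atLeast[of _ s "\<lambda>u. - c / u" 0])
    show "(\<lambda>u. c / (max u s)\<^sup>2) \<in> borel_measurable borel" by measurable
    fix u assume u: "s \<le> u"
    then show "((\<lambda>u. - c / u) has_real_derivative c / (max u s)\<^sup>2) (at u)"
      using assms(1) by (auto intro!: derivative_eq_intros simp: max_def power2_eq_square)
    show "0 \<le> c / (max u s)\<^sup>2" using assms(2) by simp
  next
    show "((\<lambda>u. - c / u) \<longlongrightarrow> 0) at_top"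
      by (intro real_tendsto_divide_at_top[OF tendsto_const] filterlim_ident)
  qed
  then show ?thesis by simp
qed

definition mean_trace_gap :: "real \<Rightarrow> real \<Rightarrow> real" where
  "mean_trace_gap s u = (\<integral>x. trace_gap r t s (noisy x) u \<partial>PG)"

lemma trace_gap_trivial_bound: "0 < s \<Longrightarrow> \<bar>trace_gap r t s C u\<bar> \<le> 2 * real r / s"
proof -
  assume s: "0 < s"
  define v where "v = reg_sqrt s u"
  have v: "0 < v" "s \<le> v\<^sup>2" using s by (auto simp: v_def reg_sqrt_def)
  have "\<bar>Re (res (r + t) r (\<lambda>_. v) C i i)\<bar> \<le> 1 / v" if "i < r" for i
    by (rule order_trans[OF abs_Re_le_cmod], rule op_bound_entry[OF op_bound_res]) (use v that in auto)
  then have "\<bar>\<Sum>i<r. Re (res (r + t) r (\<lambda>_. v) C i i)\<bar> \<le> (\<Sum>i<r. 1 / v)"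
    by (intro order_trans[OF sum_abs] sum_mono) auto
  then have S: "\<bar>(\<Sum>i<r. Re (res (r + t) r (\<lambda>_. v) C i i)) / v\<bar> \<le> real r / v\<^sup>2"
    using divide_right_mono[of _ "real r * (1 / v)" v] v unfolding abs_divide by (simp add: power2_eq_square)
  have "\<bar>trace_gap r t s C u\<bar> \<le> \<bar>real r / v\<^sup>2\<bar> + \<bar>(\<Sum>i<r. Re (res (r + t) r (\<lambda>_. v) C i i)) / v\<bar>"
    unfolding trace_gap_def v_def[symmetric] by (rule abs_triangle_ineq4)
  also have "\<dots> \<le> real r / v\<^sup>2 + real r / v\<^sup>2" by (rule add_mono[OF _ S]) simp
  also have "\<dots> = 2 * real r / v\<^sup>2" by simp
  also have "\<dots> \<le> 2 * real r / s" using v s by (intro divide_left_mono) auto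
  finally show ?thesis .
qed

lemma trace_gap_joint_measurable:
  "0 < s \<Longrightarrow> (\<lambda>(x, u). trace_gap r t s (noisy x) u) \<in> borel_measurable (PG \<Otimes>\<^sub>M lborel)"
  unfolding case_prod_unfold
  by (rule trace_gap_measurable) (auto intro: measurable_compose[OF measurable_fst noisy_measurable])

text \<open>Expectation and integration over the parameter commute because the integrand is nonnegative.\<close>

lemma logdet_expectation:
  assumes s: "0 < s"
  shows "set_integrable lborel {s..} (mean_trace_gap s)"
    and "(\<integral>x. logdet s x \<partial>PG) = (LINT u:{s..}|lborel. mean_trace_gap s u)"
    and "logdet s \<in> borel_measurable PG"
proof -
  interpret P: prob_space PG by (rule PG)
  interpret PL: pair_sigma_finite PG lborel ..
  let ?h = "\<lambda>x u. trace_gap r t s (noisy x) u"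
  note hm[measurable] = trace_gap_joint_measurable[OF s]
  have Sm: "Sm x \<in> carrier_mat r t" for x by (simp add: Sm_def)
  have hS: "trace_gap r t s (\<lambda>i j. Sm x $$ (i, j)) u = ?h x u" for x u
  proof -
    have "res (r + t) r (\<lambda>_. reg_sqrt s u) (\<lambda>i j. Sm x $$ (i, j)) = res (r + t) r (\<lambda>_. reg_sqrt s u) (noisy x)"
      by (rule res_cong) (auto simp: Sm_def)
    then show ?thesis by (simp add: trace_gap_def)
  qed
  have ptw: "(\<integral>\<^sup>+u. ennreal (?h x u) * indicator {s..} u \<partial>lborel) = ennreal (logdet s x)" and nn: "0 \<le> logdet s x" for x
    using logdet_integral[OF Sm[of x] s] by (simp_all add: hS logdet_def)
  have "(\<lambda>x. \<integral>\<^sup>+u. ennreal (?h x u) * indicator {s..} u \<partial>lborel) \<in> borel_measurable PG" by measurable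
  then have em: "(\<lambda>x. ennreal (logdet s x)) \<in> borel_measurable PG" by (simp only: ptw)
  have "logdet s = (\<lambda>x. enn2real (ennreal (logdet s x)))" using nn by (simp add: fun_eq_iff)
  also have "\<dots> \<in> borel_measurable PG" using em by measurable
  finally show lm: "logdet s \<in> borel_measurable PG" .
  have hi: "integrable PG (\<lambda>x. ?h x u)" for u
  proof (rule P.integrable_bdd[of _ "2 * real r / s"])
    show "(\<lambda>x. ?h x u) \<in> borel_measurable PG"
      by (rule trace_gap_measurable[OF s noisy_measurable]) auto
  qed (use trace_gap_trivial_bound[OF s] in auto)
  have Hnn: "0 \<le> mean_trace_gap s u" for u
    unfolding mean_trace_gap_def by (rule Bochner_Integration.integral_nonneg) (rule trace_gap_bounds(1)[OF s])
  have Hm[measurable]: "mean_trace_gap s \<in> borel_measurable borel"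
  proof -
    have "(\<lambda>u. \<integral>x. ?h x u \<partial>PG) \<in> borel_measurable lborel"
    proof (rule P.borel_measurable_lebesgue_integral)
      show "(\<lambda>(u, x). ?h x u) \<in> borel_measurable (lborel \<Otimes>\<^sub>M PG)"
        using measurable_compose[OF measurable_pair_swap' hm] by (simp add: case_prod_unfold)
    qed
    then show ?thesis unfolding mean_trace_gap_def[abs_def] by simp
  qed
  have swap: "(\<integral>\<^sup>+x. ennreal (logdet s x) \<partial>PG) = (\<integral>\<^sup>+u. ennreal (mean_trace_gap s u) * indicator {s..} u \<partial>lborel)"
  proof -
    have "(\<integral>\<^sup>+x. ennreal (logdet s x) \<partial>PG) = (\<integral>\<^sup>+x. (\<integral>\<^sup>+u. ennreal (?h x u) * indicator {s..} u \<partial>lborel) \<partial>PG)"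
      by (simp only: ptw)
    also have "\<dots> = (\<integral>\<^sup>+u. (\<integral>\<^sup>+x. ennreal (?h x u) * indicator {s..} u \<partial>PG) \<partial>lborel)"
      by (rule PL.Fubini'[symmetric]) measurable
    also have "\<dots> = (\<integral>\<^sup>+u. ennreal (mean_trace_gap s u) * indicator {s..} u \<partial>lborel)"
    proof (intro nn_integral_cong)
      fix u
      have "(\<integral>\<^sup>+x. ennreal (?h x u) * indicator {s..} u \<partial>PG) = (\<integral>\<^sup>+x. ennreal (?h x u) \<partial>PG) * indicator {s..} u"
        by (rule nn_integral_multc) (use hi[of u] in measurable)
      also have "(\<integral>\<^sup>+x. ennreal (?h x u) \<partial>PG) = ennreal (mean_trace_gap s u)"
        unfolding mean_trace_gap_def by (rule nn_integral_eq_integral[OF hi]) (use trace_gap_bounds(1)[OF s] in auto)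
      finally show "(\<integral>\<^sup>+x. ennreal (?h x u) * indicator {s..} u \<partial>PG) = ennreal (mean_trace_gap s u) * indicator {s..} u" .
    qed
    finally show ?thesis .
  qed
  have fin: "(\<integral>\<^sup>+x. ennreal (logdet s x) \<partial>PG) < \<infinity>"
  proof -
    let ?q = "\<lambda>x. (\<Sum>i<r. \<Sum>j<t. cmod (noisy x i j))\<^sup>2"
    have "ennreal (logdet s x) \<le> ennreal (?q x / s)" for x
    proof -
      have "ennreal (logdet s x) \<le> (\<integral>\<^sup>+u. ennreal (?q x / (max u s)\<^sup>2) * indicator {s..} u \<partial>lborel)"
        unfolding ptw[symmetric] by (intro nn_integral_mono mult_right_mono ennreal_leI trace_gap_bounds(2)[OF s]) simp
      also have "\<dots> = ennreal (?q x / s)" by (rule nn_integral_inverse_square[OF s]) simp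
      finally show ?thesis .
    qed
    then have "(\<integral>\<^sup>+x. ennreal (logdet s x) \<partial>PG) \<le> (\<integral>\<^sup>+x. ennreal (?q x / s) \<partial>PG)" by (intro nn_integral_mono) auto
    also have "\<dots> = ennreal (\<integral>x. ?q x / s \<partial>PG)"
      by (rule nn_integral_eq_integral) (use noisy_second_moment s in auto)
    also have "\<dots> < \<infinity>" by simp
    finally show ?thesis .
  qed
  have indi: "ennreal (mean_trace_gap s u) * indicator {s..} u = ennreal (indicator {s..} u *\<^sub>R mean_trace_gap s u)" for u
    by (simp split: split_indicator)
  show "set_integrable lborel {s..} (mean_trace_gap s)"
    unfolding set_integrable_def
  proof (rule integrableI_nonneg)
    show "(\<integral>\<^sup>+u. ennreal (indicator {s..} u *\<^sub>R mean_trace_gap s u) \<partial>lborel) < \<infinity>"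
      using fin unfolding swap indi .
  qed (use Hnn in \<open>auto split: split_indicator\<close>)
  have "(\<integral>x. logdet s x \<partial>PG) = enn2real (\<integral>\<^sup>+x. ennreal (logdet s x) \<partial>PG)"
    by (rule integral_eq_nn_integral[OF lm]) (use nn in auto)
  also have "\<dots> = (LINT u:{s..}|lborel. mean_trace_gap s u)"
    unfolding swap indi set_lebesgue_integral_def
    by (rule integral_eq_nn_integral[symmetric]) (use Hnn in \<open>auto split: split_indicator\<close>)
  finally show "(\<integral>x. logdet s x \<partial>PG) = (LINT u:{s..}|lborel. mean_trace_gap s u)" .
qed

end

section \<open>Quantitative estimates at a fixed size\<close>

lemma complex_variance_scale: "complex_variance P (\<lambda>x. a * f x) = (cmod a)\<^sup>2 * complex_variance P f"
proof (cases "a = 0")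
  case False
  then show ?thesis by (simp add: complex_variance_def norm_mult power_mult_distrib right_diff_distrib)
qed (simp add: complex_variance_def)

lemma complex_variance_cong: "(\<And>x. x \<in> space P \<Longrightarrow> f x = g x) \<Longrightarrow> complex_variance P f = complex_variance P g"
  unfolding complex_variance_def by (simp cong: Bochner_Integration.integral_cong)

lemma complex_variance_distr:
  assumes "g \<in> measurable P M" "f \<in> borel_measurable M"
  shows "complex_variance (distr P M g) f = complex_variance P (\<lambda>x. f (g x))"
  unfolding complex_variance_def using assms by (simp add: integral_distr)

text \<open>The quotient \<open>dl / cond_const\<close> is the constant of \<open>uniform_bounds\<close> for \<open>e0 = \<surd>s\<close>: a lower bound
  for \<open>e\<close> times the solution of the canonical equations.\<close>

definition cond_const :: "real \<Rightarrow> real \<Rightarrow> real \<Rightarrow> real \<Rightarrow> real" where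
  "cond_const pm nu b s = (1 + 2 * pm\<^sup>2 * nu / s)\<^sup>2 + b\<^sup>2 / s"

text \<open>The bound of \<open>mean_res_fixed_point\<close> with the factors that still depend on \<open>e\<close> replaced by
  bounds valid for all \<open>e \<ge> \<surd>s\<close>.\<close>

definition det_const :: "real \<Rightarrow> real \<Rightarrow> real \<Rightarrow> real \<Rightarrow> real \<Rightarrow> real" where
  "det_const pm nu dl b s = 2 * pm ^ 4 * nu + 4 * (4 * (pm * nu * cond_const pm nu b s / dl)\<^sup>2) * pm ^ 6 * nu\<^sup>2 / s"

lemma (in profile) det_const_nonneg: "0 < s \<Longrightarrow> 0 \<le> det_const pm nu dl b s"
  unfolding det_const_def using nu_pos pm_nonneg by simp

text \<open>The factor \<open>1 / e ^ 5\<close> is kept because the log-determinant integrates this bound over \<open>e\<close>.\<close>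

lemma (in gaussian_model) mean_res_deterministic:
  assumes A: "A \<in> carrier_mat r t" and BA: "B = (\<lambda>i j. A $$ (i, j))" and b: "spectral_norm A \<le> b"
    and s: "0 < s" "sqrt s \<le> e"
    and large: "4 * pm ^ 5 * nu \<le> dl / cond_const pm nu b s * s\<^sup>2 * (real t)\<^sup>2"
    and Q: "op_bound n Q c"
  shows "cmod (mtr n (mm n mean_res Q) - mtr n (mm n (res n r (wt pp e (fixed_pt B e)) B) Q)) \<le> c * det_const pm nu dl b s / (real t * e ^ 5)"
proof -
  have sn: "0 \<le> spectral_norm A" by (rule spectral_norm_nonneg[OF A])
  then have b2: "(spectral_norm A)\<^sup>2 \<le> b\<^sup>2" using b by (intro power_mono) auto
  have rows: "(\<Sum>j<t. (cmod (B i j))\<^sup>2) \<le> b\<^sup>2" if "i < r" for i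
    unfolding BA by (rule order_trans[OF spectral_norm_rows[OF A that] b2])
  have cols: "(\<Sum>i<r. (cmod (B i j))\<^sup>2) \<le> b\<^sup>2" if "j < t" for j
    unfolding BA by (rule order_trans[OF spectral_norm_columns[OF A that] b2])
  have e0: "0 < sqrt s" "(sqrt s)\<^sup>2 = s" using s by auto
  obtain Cs Cl where C: "0 < Cs" "0 < Cl" "\<And>e. sqrt s \<le> e \<Longrightarrow> stab_const b e \<le> Cs" "\<And>e. sqrt s \<le> e \<Longrightarrow> Cl / e \<le> fp_floor b e"
    "Cs = 4 * (pm * nu * cond_const pm nu b s / dl)\<^sup>2" "Cl = dl / cond_const pm nu b s"
    using uniform_bounds[OF e0(1), of b] unfolding e0(2) cond_const_def by metis
  have c0: "0 \<le> c" by (rule op_bound_nonneg[OF Q])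
  have e2: "s \<le> e\<^sup>2" using power_mono[OF s(2), of 2] e0 by simp
  have small: "2 * pm ^ 5 * nu / ((real t)\<^sup>2 * e ^ 5) \<le> fp_floor b e / 2"
  proof -
    have "s\<^sup>2 \<le> (e\<^sup>2)\<^sup>2" using e2 s by (intro power_mono) auto
    then have s4: "s\<^sup>2 \<le> e ^ 4" by simp
    have "4 * pm ^ 5 * nu \<le> Cl * s\<^sup>2 * (real t)\<^sup>2" using large C(6) by simp
    also have "\<dots> \<le> Cl * e ^ 4 * (real t)\<^sup>2"
      using C(2) s4 by (intro mult_right_mono mult_left_mono) auto
    finally have "4 * pm ^ 5 * nu / ((real t)\<^sup>2 * e ^ 5) \<le> Cl * e ^ 4 * (real t)\<^sup>2 / ((real t)\<^sup>2 * e ^ 5)"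
      using e_pos by (intro divide_right_mono) auto
    also have "\<dots> = Cl / e" using e_pos t_pos by (simp add: eval_nat_numeral)
    also have "\<dots> \<le> fp_floor b e" by (rule C(4)[OF s(2)])
    finally show ?thesis by simp
  qed
  have "cmod (mtr n (mm n mean_res Q) - mtr n (mm n (res n r (wt pp e (fixed_pt B e)) B) Q))
    \<le> c / (real t * e ^ 5) * (2 * pm ^ 4 * nu + 4 * stab_const b e * pm ^ 6 * nu\<^sup>2 / e\<^sup>2)"
    by (rule mean_res_fixed_point[OF rows cols fixed_pt[OF e_pos rows cols] Q small])
  also have "\<dots> \<le> c / (real t * e ^ 5) * det_const pm nu dl b s"
  proof (rule mult_left_mono)
    have "4 * stab_const b e * pm ^ 6 * nu\<^sup>2 / e\<^sup>2 \<le> 4 * Cs * pm ^ 6 * nu\<^sup>2 / s"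
      using C(3)[OF s(2)] C(1) s e2 e_pos by (intro frac_le mult_right_mono mult_left_mono) auto
    then show "2 * pm ^ 4 * nu + 4 * stab_const b e * pm ^ 6 * nu\<^sup>2 / e\<^sup>2 \<le> det_const pm nu dl b s"
      unfolding det_const_def C(5) by simp
  qed (use c0 e_pos in simp)
  finally show ?thesis by simp
qed

text \<open>The passage from an abstract probability space and matrix-valued random variables to the coordinates of
  the model: all four quantities depend on the law of the coordinates alone, and both resolvents and
  \<open>T\<close>, \<open>T~\<close> are \<open>1 / e\<close> times corners, which divides the bounds on traces of \<open>G\<close> by \<open>e\<close>.\<close>

lemma (in gaussian_model) trace_estimates:
  assumes P: "prob_space P" and xi: "xi \<in> measurable P PG" "distr P PG xi = PG"
    and Sig: "\<And>\<omega>. \<omega> \<in> space P \<Longrightarrow> Sig \<omega> \<in> carrier_mat r t"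
      "\<And>\<omega> i j. \<omega> \<in> space P \<Longrightarrow> i < r \<Longrightarrow> j < t \<Longrightarrow> Sig \<omega> $$ (i, j) = noisy (xi \<omega>) i j"
    and A: "A \<in> carrier_mat r t" and BA: "B = (\<lambda>i j. A $$ (i, j))" and b: "spectral_norm A \<le> b"
    and s: "0 < s" "e = sqrt s"
    and large: "4 * pm ^ 5 * nu \<le> dl / cond_const pm nu b s * s\<^sup>2 * (real t)\<^sup>2"
  shows "M \<in> carrier_mat r r \<Longrightarrow> spectral_norm M \<le> c \<Longrightarrow>
      \<bar>complex_variance P (\<lambda>\<omega>. mat_trace (resolvent (Sig \<omega>) s * M))\<bar> \<le> pm\<^sup>2 * nu * c\<^sup>2 / s ^ 3"
    and "M' \<in> carrier_mat t t \<Longrightarrow> spectral_norm M' \<le> c \<Longrightarrow>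
      \<bar>complex_variance P (\<lambda>\<omega>. mat_trace (co_resolvent (Sig \<omega>) s * M'))\<bar> \<le> pm\<^sup>2 * nu * c\<^sup>2 / s ^ 3"
    and "M \<in> carrier_mat r r \<Longrightarrow> spectral_norm M \<le> c \<Longrightarrow>
      cmod (mat_trace ((mat_expectation P (\<lambda>\<omega>. resolvent (Sig \<omega>) s) r r - T_mat A Dm Dtm s) * M)) \<le> c * det_const pm nu dl b s / s ^ 3 / real t"
    and "M' \<in> carrier_mat t t \<Longrightarrow> spectral_norm M' \<le> c \<Longrightarrow>
      cmod (mat_trace ((mat_expectation P (\<lambda>\<omega>. co_resolvent (Sig \<omega>) s) t t - Tt_mat A Dm Dtm s) * M')) \<le> c * det_const pm nu dl b s / s ^ 3 / real t"
proof -
  have e6: "e ^ 5 * e = s ^ 3" and e42: "e ^ 4 * e\<^sup>2 = s ^ 3" and e2: "e\<^sup>2 = s"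
  proof -
    show e2: "e\<^sup>2 = s" using s by simp
    have "e ^ 5 * e = (e\<^sup>2) ^ 3" "e ^ 4 * e\<^sup>2 = (e\<^sup>2) ^ 3" by (simp_all add: eval_nat_numeral)
    then show "e ^ 5 * e = s ^ 3" "e ^ 4 * e\<^sup>2 = s ^ 3" unfolding e2 by auto
  qed
  have resG: "res (r + t) r (\<lambda>_. sqrt s) (\<lambda>i j. Sig \<omega> $$ (i, j)) = rand_res (xi \<omega>)" if "\<omega> \<in> space P" for \<omega>
  proof -
    have "rand_res (xi \<omega>) = res (r + t) r (\<lambda>_. sqrt s) (noisy (xi \<omega>))"
      unfolding rand_res_def s(2)[symmetric] n_eq[symmetric] ..
    moreover have "res (r + t) r (\<lambda>_. sqrt s) (\<lambda>i j. Sig \<omega> $$ (i, j)) = res (r + t) r (\<lambda>_. sqrt s) (noisy (xi \<omega>))"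
      by (rule res_cong) (use Sig(2)[OF that] in auto)
    ultimately show ?thesis by simp
  qed
  have R1: "resolvent (Sig \<omega>) s = Matrix.mat r r (\<lambda>(i, k). rand_res (xi \<omega>) i k / of_real e)"
    and R2: "co_resolvent (Sig \<omega>) s = Matrix.mat t t (\<lambda>(j, l). rand_res (xi \<omega>) (r + j) (r + l) / of_real e)" if "\<omega> \<in> space P" for \<omega>
    using resolvent_eq[OF Sig(1)[OF that] s(1)] unfolding resG[OF that] unfolding s(2)[symmetric] by auto
  have var: "\<bar>complex_variance P (\<lambda>\<omega>. lin_stat Q (xi \<omega>) / of_real e)\<bar> \<le> pm\<^sup>2 * nu * c\<^sup>2 / s ^ 3" if Q: "op_bound n Q c" for Q c
  proof -
    have "complex_variance P (\<lambda>\<omega>. lin_stat Q (xi \<omega>) / of_real e) = (cmod (1 / of_real e))\<^sup>2 * complex_variance P (\<lambda>\<omega>. lin_stat Q (xi \<omega>))"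
      using complex_variance_scale[of P "1 / of_real e" "\<lambda>\<omega>. lin_stat Q (xi \<omega>)"] by simp
    also have "complex_variance P (\<lambda>\<omega>. lin_stat Q (xi \<omega>)) = complex_variance PG (lin_stat Q)"
      using complex_variance_distr[OF xi(1) lin_stat_props(1)[OF Q]] xi(2) by simp
    also have "(cmod (1 / of_real e))\<^sup>2 = 1 / e\<^sup>2" using e_pos by (simp add: norm_divide power_divide)
    finally have eq: "complex_variance P (\<lambda>\<omega>. lin_stat Q (xi \<omega>) / of_real e) = 1 / e\<^sup>2 * complex_variance PG (lin_stat Q)" .
    interpret PG: prob_space PG by (rule PG)
    have "0 \<le> 1 / e\<^sup>2 * complex_variance PG (lin_stat Q)"
      using PG.variance_bounds(1)[OF lin_stat_props[OF Q]] by simp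
    moreover have "1 / e\<^sup>2 * complex_variance PG (lin_stat Q) \<le> 1 / e\<^sup>2 * (pm\<^sup>2 * nu * c\<^sup>2 / e ^ 4)"
      by (intro mult_left_mono variance_lin_stat[OF Q]) simp
    moreover have "1 / e\<^sup>2 * (pm\<^sup>2 * nu * c\<^sup>2 / e ^ 4) = pm\<^sup>2 * nu * c\<^sup>2 / s ^ 3"
      unfolding e42[symmetric] by (simp add: mult.commute)
    ultimately show ?thesis unfolding eq by linarith
  qed
  show "\<bar>complex_variance P (\<lambda>\<omega>. mat_trace (resolvent (Sig \<omega>) s * M))\<bar> \<le> pm\<^sup>2 * nu * c\<^sup>2 / s ^ 3"
    if M: "M \<in> carrier_mat r r" "spectral_norm M \<le> c"
  proof -
    have "complex_variance P (\<lambda>\<omega>. mat_trace (resolvent (Sig \<omega>) s * M)) = complex_variance P (\<lambda>\<omega>. lin_stat (corner r M) (xi \<omega>) / of_real e)"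
      by (rule complex_variance_cong) (simp only: R1 mat_trace_corner[OF M(1), where t = t, folded n_eq] lin_stat_def)
    then show ?thesis by (simp only:) (rule var, unfold n_eq, rule op_bound_corner[OF M])
  qed
  show "\<bar>complex_variance P (\<lambda>\<omega>. mat_trace (co_resolvent (Sig \<omega>) s * M'))\<bar> \<le> pm\<^sup>2 * nu * c\<^sup>2 / s ^ 3"
    if M: "M' \<in> carrier_mat t t" "spectral_norm M' \<le> c"
  proof -
    have "complex_variance P (\<lambda>\<omega>. mat_trace (co_resolvent (Sig \<omega>) s * M')) = complex_variance P (\<lambda>\<omega>. lin_stat (cocorner r M') (xi \<omega>) / of_real e)"
      by (rule complex_variance_cong) (simp only: R2 mat_trace_cocorner[OF M(1), where r = r, folded n_eq] lin_stat_def)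
    then show ?thesis by (simp only:) (rule var, unfold n_eq, rule op_bound_cocorner[OF M])
  qed
  have mean: "(\<integral>\<omega>. rand_res (xi \<omega>) i k / of_real e \<partial>P) = mean_res i k / of_real e" if "i < n" "k < n" for i k
  proof -
    have "(\<integral>\<omega>. rand_res (xi \<omega>) i k \<partial>P) = (\<integral>x. rand_res x i k \<partial>distr P PG xi)"
      by (rule integral_distr[symmetric, OF xi(1) rand_res_measurable[OF that]])
    then show ?thesis unfolding xi(2) by (simp add: mean_res_def)
  qed
  let ?T = "res n r (wt pp e (fixed_pt B e)) B"
  note T = T_mat_res[OF A BA s(2) s(1)]
  have det: "cmod (mtr n (mm n (\<lambda>i k. mean_res i k - ?T i k) Q) / of_real e) \<le> c * det_const pm nu dl b s / s ^ 3 / real t" if Q: "op_bound n Q c" for Q c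
  proof -
    have "mtr n (mm n (\<lambda>i k. mean_res i k - ?T i k) Q) = mtr n (mm n mean_res Q) - mtr n (mm n ?T Q)"
      by (simp add: mtr_def mm_def left_diff_distrib sum_subtractf)
    then have "cmod (mtr n (mm n (\<lambda>i k. mean_res i k - ?T i k) Q) / of_real e) = cmod (mtr n (mm n mean_res Q) - mtr n (mm n ?T Q)) / e"
      using e_pos by (simp add: norm_divide)
    also have "\<dots> \<le> c * det_const pm nu dl b s / (real t * e ^ 5) / e"
      using e_pos s by (intro divide_right_mono mean_res_deterministic[OF A BA b s(1) _ large Q]) auto
    also have "\<dots> = c * det_const pm nu dl b s / (real t * (e ^ 5 * e))" by simp
    also have "\<dots> = c * det_const pm nu dl b s / s ^ 3 / real t" unfolding e6 by simp
    finally show ?thesis .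
  qed
  show "cmod (mat_trace ((mat_expectation P (\<lambda>\<omega>. resolvent (Sig \<omega>) s) r r - T_mat A Dm Dtm s) * M)) \<le> c * det_const pm nu dl b s / s ^ 3 / real t"
    if M: "M \<in> carrier_mat r r" "spectral_norm M \<le> c"
  proof -
    have "mat_expectation P (\<lambda>\<omega>. resolvent (Sig \<omega>) s) r r - T_mat A Dm Dtm s = Matrix.mat r r (\<lambda>(i, k). (mean_res i k - ?T i k) / of_real e)"
    proof (rule eq_matI)
      fix i k assume "i < dim_row (Matrix.mat r r (\<lambda>(i, k). (mean_res i k - ?T i k) / of_real e))" "k < dim_col (Matrix.mat r r (\<lambda>(i, k). (mean_res i k - ?T i k) / of_real e))"
      then have ik: "i < r" "k < r" by auto
      have "(\<integral>\<omega>. resolvent (Sig \<omega>) s $$ (i, k) \<partial>P) = (\<integral>\<omega>. rand_res (xi \<omega>) i k / of_real e \<partial>P)"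
        by (intro Bochner_Integration.integral_cong refl) (simp add: R1 ik)
      also have "\<dots> = mean_res i k / of_real e" by (rule mean) (use ik n_eq in auto)
      finally show "(mat_expectation P (\<lambda>\<omega>. resolvent (Sig \<omega>) s) r r - T_mat A Dm Dtm s) $$ (i, k) = Matrix.mat r r (\<lambda>(i, k). (mean_res i k - ?T i k) / of_real e) $$ (i, k)"
        using ik by (simp add: mat_expectation_def T(1) diff_divide_distrib)
    qed (auto simp: mat_expectation_def T(1))
    then have "mat_trace ((mat_expectation P (\<lambda>\<omega>. resolvent (Sig \<omega>) s) r r - T_mat A Dm Dtm s) * M) = mtr n (mm n (\<lambda>i k. mean_res i k - ?T i k) (corner r M)) / of_real e"
      using mat_trace_corner[OF M(1), where t = t and R = "\<lambda>i k. mean_res i k - ?T i k"] by (simp only: n_eq)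
    then show ?thesis using det[of "corner r M" c] op_bound_corner[OF M] by (simp only: n_eq)
  qed
  show "cmod (mat_trace ((mat_expectation P (\<lambda>\<omega>. co_resolvent (Sig \<omega>) s) t t - Tt_mat A Dm Dtm s) * M')) \<le> c * det_const pm nu dl b s / s ^ 3 / real t"
    if M: "M' \<in> carrier_mat t t" "spectral_norm M' \<le> c"
  proof -
    have "mat_expectation P (\<lambda>\<omega>. co_resolvent (Sig \<omega>) s) t t - Tt_mat A Dm Dtm s = Matrix.mat t t (\<lambda>(i, k). (mean_res (r + i) (r + k) - ?T (r + i) (r + k)) / of_real e)"
    proof (rule eq_matI)
      fix i k assume "i < dim_row (Matrix.mat t t (\<lambda>(i, k). (mean_res (r + i) (r + k) - ?T (r + i) (r + k)) / of_real e))" "k < dim_col (Matrix.mat t t (\<lambda>(i, k). (mean_res (r + i) (r + k) - ?T (r + i) (r + k)) / of_real e))"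
      then have ik: "i < t" "k < t" by auto
      have "(\<integral>\<omega>. co_resolvent (Sig \<omega>) s $$ (i, k) \<partial>P) = (\<integral>\<omega>. rand_res (xi \<omega>) (r + i) (r + k) / of_real e \<partial>P)"
        by (intro Bochner_Integration.integral_cong refl) (simp add: R2 ik)
      also have "\<dots> = mean_res (r + i) (r + k) / of_real e" by (rule mean) (use ik n_eq in auto)
      finally show "(mat_expectation P (\<lambda>\<omega>. co_resolvent (Sig \<omega>) s) t t - Tt_mat A Dm Dtm s) $$ (i, k) = Matrix.mat t t (\<lambda>(i, k). (mean_res (r + i) (r + k) - ?T (r + i) (r + k)) / of_real e) $$ (i, k)"
        using ik by (simp add: mat_expectation_def T(2) diff_divide_distrib)
    qed (auto simp: mat_expectation_def T(2))
    then have "mat_trace ((mat_expectation P (\<lambda>\<omega>. co_resolvent (Sig \<omega>) s) t t - Tt_mat A Dm Dtm s) * M') = mtr n (mm n (\<lambda>i k. mean_res i k - ?T i k) (cocorner r M')) / of_real e"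
      using mat_trace_cocorner[OF M(1), where r = r and R = "\<lambda>i k. mean_res i k - ?T i k"] by (simp only: n_eq)
    then show ?thesis using det[of "cocorner r M'" c] op_bound_cocorner[OF M] by (simp only: n_eq)
  qed
qed

text \<open>Both sides are integrals over \<open>u \<ge> s\<close> of trace gaps: one of the mean resolvent, one of \<open>T\<close>. Their
  integrands differ by \<open>O(1 / (t u\<^sup>2))\<close>, which is integrable at infinity.\<close>

lemma (in gaussian_model) mutual_information_estimate:
  assumes A: "A \<in> carrier_mat r t" and BA: "B = (\<lambda>i j. A $$ (i, j))" and b: "spectral_norm A \<le> b"
    and s: "0 < s" and r_pos: "0 < r"
    and large: "4 * pm ^ 5 * nu \<le> dl / cond_const pm nu b s * s\<^sup>2 * (real t)\<^sup>2"
  shows "\<bar>(\<integral>x. logdet s x \<partial>PG) - mutual_information_approx A Dm Dtm s\<bar> \<le> det_const pm nu dl b s / s\<^sup>2 / real t"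
proof -
  define K where "K = det_const pm nu dl b s / (s * real t)"
  have K0: "0 \<le> K" using det_const_nonneg[OF s] s by (simp add: K_def)
  have rows': "\<And>i. i < r \<Longrightarrow> (\<Sum>j<t. (cmod (B i j))\<^sup>2) \<le> (spectral_norm A)\<^sup>2"
    and cols': "\<And>j. j < t \<Longrightarrow> (\<Sum>i<r. (cmod (B i j))\<^sup>2) \<le> (spectral_norm A)\<^sup>2"
    unfolding BA by (auto intro: spectral_norm_rows[OF A] spectral_norm_columns[OF A])
  define M where "M u = res n r (wt pp (reg_sqrt s u) (fixed_pt B (reg_sqrt s u))) B" for u
  define ft where "ft u = real r / (reg_sqrt s u)\<^sup>2 - (\<Sum>i<r. Re (M u i i)) / reg_sqrt s u" for u
  have pos: "0 < wt pp (reg_sqrt s u) (fixed_pt B (reg_sqrt s u)) i" if "i < n" for u i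
  proof (rule wt_pos[OF reg_sqrt_pos[OF s] _ _ that])
    have "is_fixed_point n r t pp B (reg_sqrt s u) (fixed_pt B (reg_sqrt s u))" by (rule fixed_pt[OF reg_sqrt_pos[OF s] rows' cols'])
    then show "0 \<le> fixed_pt B (reg_sqrt s u) True" "0 \<le> fixed_pt B (reg_sqrt s u) False" by (auto simp: is_fixed_point_def less_imp_le)
  qed
  have ftm[measurable]: "ft \<in> borel_measurable borel"
  proof -
    have reg_sqrt[measurable]: "reg_sqrt s \<in> borel_measurable borel" unfolding reg_sqrt_def[abs_def] by measurable
    have fm[measurable]: "(\<lambda>u. fixed_pt B (reg_sqrt s u) a) \<in> borel_measurable borel" for a
    proof -
      have "(\<lambda>e. indicator {0<..} e *\<^sub>R fixed_pt B e a) \<in> borel_measurable borel"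
        by (rule borel_measurable_continuous_on_indicator) (auto intro: fixed_pt_continuous[OF rows' cols'])
      from measurable_compose[OF reg_sqrt this] show ?thesis using reg_sqrt_pos[OF s] by simp
    qed
    have [measurable]: "(\<lambda>u. M u i i) \<in> borel_measurable borel" if "i < n" for i
      unfolding M_def res_def
    proof (rule minv_measurable[OF _ _ that that])
      show "(\<lambda>u. skew_lin r (wt pp (reg_sqrt s u) (fixed_pt B (reg_sqrt s u))) B a b) \<in> borel_measurable borel" for a b
        unfolding skew_lin_def wt_def by measurable
    qed (use skew_lin_det pos in auto)
    have "i < n" if "i \<in> {..<r}" for i using that n_eq by simp
    then show ?thesis unfolding ft_def[abs_def] by measurable
  qed
  have close: "\<bar>ft u - mean_trace_gap s u\<bar> \<le> K / (max u s)\<^sup>2" and T_eq: "real r * (1 / u - 1 / real r * Re (mat_trace (T_mat A Dm Dtm u))) = ft u"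
    if u: "s \<le> u" for u
  proof -
    have u0: "0 < u" using u s by linarith
    have reg_sqrt: "reg_sqrt s u = sqrt u" "(reg_sqrt s u)\<^sup>2 = u" using u u0 by (auto simp: reg_sqrt_def max_def)
    interpret U: gaussian_model r t n pp pm nu dl d dt B "sqrt u"
      by unfold_locales (use u0 pp_def d0 dt0 in auto)
    have T: "T_mat A Dm Dtm u = Matrix.mat r r (\<lambda>(i, k). M u i k / of_real (sqrt u))"
      using U.T_mat_res(1)[OF A BA refl u0] by (simp add: M_def reg_sqrt(1))
    have "mat_trace (T_mat A Dm Dtm u) = (\<Sum>i<r. M u i i / of_real (sqrt u))"
      unfolding T by (simp add: mat_trace_def)
    then have "Re (mat_trace (T_mat A Dm Dtm u)) = (\<Sum>i<r. Re (M u i i)) / sqrt u"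
      by (simp add: sum_divide_distrib)
    then show "real r * (1 / u - 1 / real r * Re (mat_trace (T_mat A Dm Dtm u))) = ft u"
      unfolding ft_def reg_sqrt using r_pos u0 by (simp add: right_diff_distrib)
    have Hm: "mean_trace_gap s u = real r / u - (\<Sum>i<r. Re (U.mean_res i i)) / sqrt u"
    proof -
      interpret P: prob_space PG by (rule PG)
      have Gi: "integrable PG (\<lambda>x. Re (U.rand_res x i i))" if "i < r" for i
        using U.rand_res_product_integrable(2)[of i i i i] that n_eq by (intro integrable_Re) auto
      have "mean_trace_gap s u = (\<integral>x. real r / u - (\<Sum>i<r. Re (U.rand_res x i i)) / sqrt u \<partial>PG)"
        unfolding mean_trace_gap_def trace_gap_def reg_sqrt U.rand_res_def n_eq[symmetric] using u0 by simp
      also have "\<dots> = real r / u - (\<Sum>i<r. (\<integral>x. Re (U.rand_res x i i) \<partial>PG)) / sqrt u"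
      proof -
        have "integrable PG (\<lambda>x. (\<Sum>i<r. Re (U.rand_res x i i)) / sqrt u)"
          by (intro integrable_divide Bochner_Integration.integrable_sum Gi) auto
        then have "(\<integral>x. real r / u - (\<Sum>i<r. Re (U.rand_res x i i)) / sqrt u \<partial>PG) = (\<integral>x. real r / u \<partial>PG) - (\<integral>x. (\<Sum>i<r. Re (U.rand_res x i i)) / sqrt u \<partial>PG)"
          by (intro Bochner_Integration.integral_diff) auto
        moreover have "(\<integral>x. (\<Sum>i<r. Re (U.rand_res x i i)) \<partial>PG) = (\<Sum>i<r. (\<integral>x. Re (U.rand_res x i i) \<partial>PG))"
          by (intro Bochner_Integration.integral_sum Gi) auto
        ultimately show ?thesis by (simp add: P.prob_space)
      qed
      also have "(\<Sum>i<r. (\<integral>x. Re (U.rand_res x i i) \<partial>PG)) = (\<Sum>i<r. Re (U.mean_res i i))"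
        unfolding U.mean_res_def
      proof (intro sum.cong refl integral_Re)
        fix i assume "i \<in> {..<r}"
        then have "i < n" using n_eq by simp
        then show "integrable PG (\<lambda>x. U.rand_res x i i)" using U.rand_res_product_integrable(2)[of i i i i] by simp
      qed
      finally show ?thesis .
    qed
    define Q where "Q = dg (\<lambda>i. if i < r then 1 else 0)"
    have Q: "op_bound n Q 1" unfolding Q_def by (rule op_bound_dg) auto
    have tr: "mtr n (mm n W Q) = (\<Sum>i<r. W i i)" for W
      unfolding mtr_def Q_def n_eq by (simp add: mm_dg_right sum_split)
    have "ft u - mean_trace_gap s u = ((\<Sum>i<r. Re (U.mean_res i i)) - (\<Sum>i<r. Re (M u i i))) / sqrt u"
      unfolding ft_def Hm reg_sqrt using u0 by (simp add: diff_divide_distrib)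
    also have "\<dots> = Re (mtr n (mm n U.mean_res Q) - mtr n (mm n (M u) Q)) / sqrt u" by (simp add: tr)
    finally have "\<bar>ft u - mean_trace_gap s u\<bar> = \<bar>Re (mtr n (mm n U.mean_res Q) - mtr n (mm n (M u) Q))\<bar> / sqrt u"
      using u0 by simp
    also have "\<dots> \<le> cmod (mtr n (mm n U.mean_res Q) - mtr n (mm n (M u) Q)) / sqrt u"
      using u0 by (intro divide_right_mono abs_Re_le_cmod) auto
    also have "\<dots> \<le> 1 * det_const pm nu dl b s / (real t * sqrt u ^ 5) / sqrt u"
      unfolding M_def reg_sqrt(1)
      by (intro divide_right_mono U.mean_res_deterministic[OF A BA b s _ large Q]) (use u u0 in auto)
    also have "\<dots> = det_const pm nu dl b s / (real t * (sqrt u ^ 5 * sqrt u))" by simp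
    also have "sqrt u ^ 5 * sqrt u = u ^ 3"
    proof -
      have "sqrt u ^ 5 * sqrt u = sqrt u ^ 6" by (simp add: eval_nat_numeral)
      also have "\<dots> = ((sqrt u)\<^sup>2) ^ 3" by (simp only: power_mult[symmetric]) simp
      finally show ?thesis using u0 by simp
    qed
    also have "det_const pm nu dl b s / (real t * u ^ 3) \<le> det_const pm nu dl b s / (real t * (s * u\<^sup>2))"
    proof (rule divide_left_mono)
      have "s * u\<^sup>2 \<le> u * u\<^sup>2" using u by (intro mult_right_mono) auto
      then show "real t * (s * u\<^sup>2) \<le> real t * u ^ 3" by (intro mult_left_mono) (simp_all add: eval_nat_numeral)
    qed (use det_const_nonneg[OF s] u0 s t_pos in auto)
    also have "\<dots> = K / (max u s)\<^sup>2" using u by (simp add: K_def max_def mult_ac)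
    finally show "\<bar>ft u - mean_trace_gap s u\<bar> \<le> K / (max u s)\<^sup>2" .
  qed
  note H = logdet_expectation[OF s]
  have bound: "set_integrable lborel {s..} (\<lambda>u. K / (max u s)\<^sup>2)" "(LINT u:{s..}|lborel. K / (max u s)\<^sup>2) = K / s"
  proof -
    have ind: "ennreal (indicator {s..} u *\<^sub>R (K / (max u s)\<^sup>2)) = ennreal (K / (max u s)\<^sup>2) * indicator {s..} u" for u
      by (simp split: split_indicator)
    have nn: "(\<integral>\<^sup>+u. ennreal (indicator {s..} u *\<^sub>R (K / (max u s)\<^sup>2)) \<partial>lborel) = ennreal (K / s)"
      unfolding ind by (rule nn_integral_inverse_square[OF s K0])
    have "has_bochner_integral lborel (\<lambda>u. indicator {s..} u *\<^sub>R (K / (max u s)\<^sup>2)) (K / s)"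
    proof (rule has_bochner_integral_nn_integral[OF _ _ _ nn])
      show "0 \<le> K / s" using K0 s by simp
    qed (use K0 in \<open>auto split: split_indicator\<close>)
    then show "set_integrable lborel {s..} (\<lambda>u. K / (max u s)\<^sup>2)" "(LINT u:{s..}|lborel. K / (max u s)\<^sup>2) = K / s"
      unfolding set_integrable_def set_lebesgue_integral_def by (auto simp: has_bochner_integral_iff)
  qed
  have Hmeas: "set_borel_measurable lborel {s..} (mean_trace_gap s)"
    using H(1) unfolding set_integrable_def set_borel_measurable_def by (rule borel_measurable_integrable)
  have gi: "set_integrable lborel {s..} (\<lambda>u. ft u - mean_trace_gap s u)"
  proof (rule set_integrable_bound[OF bound(1)])
    have "(\<lambda>u. indicator {s..} u *\<^sub>R ft u - indicator {s..} u *\<^sub>R mean_trace_gap s u) \<in> borel_measurable lborel"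
      using Hmeas unfolding set_borel_measurable_def by measurable
    then show "set_borel_measurable lborel {s..} (\<lambda>u. ft u - mean_trace_gap s u)"
      unfolding set_borel_measurable_def by (simp add: right_diff_distrib)
    show "AE u in lborel. u \<in> {s..} \<longrightarrow> norm (ft u - mean_trace_gap s u) \<le> norm (K / (max u s)\<^sup>2)"
      using close K0 by auto
  qed
  have fti: "(LINT u:{s..}|lborel. ft u) = (LINT u:{s..}|lborel. mean_trace_gap s u) + (LINT u:{s..}|lborel. ft u - mean_trace_gap s u)"
    using set_integral_add(2)[OF H(1) gi] by simp
  have approx: "mutual_information_approx A Dm Dtm s = (LINT u:{s..}|lborel. ft u)"
  proof -
    have "dim_row A = r" using A by simp
    then have "mutual_information_approx A Dm Dtm s = (LINT u:{s..}|lborel. real r * (1 / u - 1 / real r * Re (mat_trace (T_mat A Dm Dtm u))))"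
      unfolding mutual_information_approx_def by (simp add: set_integral_mult_right)
    also have "\<dots> = (LINT u:{s..}|lborel. ft u)"
      by (rule set_lebesgue_integral_cong) (use T_eq in auto)
    finally show ?thesis .
  qed
  have "\<bar>(\<integral>x. logdet s x \<partial>PG) - mutual_information_approx A Dm Dtm s\<bar> = \<bar>LINT u:{s..}|lborel. ft u - mean_trace_gap s u\<bar>"
    unfolding approx fti H(2) by simp
  also have "\<dots> \<le> (LINT u:{s..}|lborel. K / (max u s)\<^sup>2)"
  proof -
    have "norm (\<integral>u. indicator {s..} u *\<^sub>R (ft u - mean_trace_gap s u) \<partial>lborel) \<le> (\<integral>u. norm (indicator {s..} u *\<^sub>R (ft u - mean_trace_gap s u)) \<partial>lborel)"
      by (rule integral_norm_bound)
    also have "\<dots> \<le> (\<integral>u. indicator {s..} u *\<^sub>R (K / (max u s)\<^sup>2) \<partial>lborel)"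
      using gi bound(1) close unfolding set_integrable_def
      by (intro integral_mono integrable_norm) (auto split: split_indicator)
    finally show ?thesis unfolding set_lebesgue_integral_def by simp
  qed
  also have "\<dots> = det_const pm nu dl b s / s\<^sup>2 / real t"
    unfolding bound(2) by (simp add: K_def power2_eq_square mult_ac)
  finally show ?thesis .
qed

section \<open>The asymptotic statement\<close>

lemma diagonal_entry_le_spectral_norm:
  assumes "i < k" "0 \<le> x i"
  shows "x i \<le> spectral_norm (mat_diag k (\<lambda>i. complex_of_real (x i)))"
proof -
  let ?A = "mat_diag k (\<lambda>i. complex_of_real (x i))"
  have A: "?A \<in> carrier_mat k k" by simp
  have "(x i)\<^sup>2 = (cmod (?A $$ (i, i)))\<^sup>2" using assms by (simp add: mat_diag_def)
  also have "\<dots> \<le> (\<Sum>l<k. (cmod (?A $$ (l, i)))\<^sup>2)"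
    by (rule member_le_sum) (use assms in auto)
  also have "\<dots> \<le> (spectral_norm ?A)\<^sup>2" by (rule spectral_norm_columns[OF A assms(1)])
  finally show ?thesis by (rule power2_le_imp_le) (rule spectral_norm_nonneg[OF A])
qed

lemma mat_trace_mat_diag: "mat_trace (mat_diag k f) = (\<Sum>i<k. f i)"
  by (simp add: mat_trace_def mat_diag_def)

lemma bdd_above_image_bound:
  fixes f :: "nat \<Rightarrow> real"
  assumes "bdd_above (f ` {1..})"
  obtains C where "0 \<le> C" "\<And>t. 1 \<le> t \<Longrightarrow> f t \<le> C"
proof -
  from assms obtain C where C: "\<And>x. x \<in> f ` {1..} \<Longrightarrow> x \<le> C" unfolding bdd_above_def by auto
  show ?thesis by (rule that[of "max 0 C"]) (auto intro!: C max.coboundedI2)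
qed

theorem theorem2:
  fixes P :: "'a measure"
    and r :: "nat \<Rightarrow> nat"
    and c s2 :: real
    and d dt :: "nat \<Rightarrow> nat \<Rightarrow> real"
    and B D Dt M Mt :: "nat \<Rightarrow> complex mat"
    and X Y Sig :: "nat \<Rightarrow> 'a \<Rightarrow> complex mat"
  assumes "prob_space P"
    and r_lim: "filterlim r at_top at_top"
    and ratio_lim: "(\<lambda>t. real t / real (r t)) \<longlonglongrightarrow> c" and "c > 0"
    and B_dim: "\<And>t. t \<ge> 1 \<Longrightarrow> B t \<in> carrier_mat (r t) t"
    and d_nonneg: "\<And>t i. t \<ge> 1 \<Longrightarrow> i < r t \<Longrightarrow> d t i \<ge> 0"
    and dt_nonneg: "\<And>t j. t \<ge> 1 \<Longrightarrow> j < t \<Longrightarrow> dt t j \<ge> 0"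
    and D_eq: "\<And>t. D t = mat_diag (r t) (\<lambda>i. complex_of_real (d t i))"
    and Dt_eq: "\<And>t. Dt t = mat_diag t (\<lambda>j. complex_of_real (dt t j))"
    and X_dim: "\<And>t \<omega>. t \<ge> 1 \<Longrightarrow> \<omega> \<in> space P \<Longrightarrow> X t \<omega> \<in> carrier_mat (r t) t"
    and X_indep: "\<And>t. t \<ge> 1 \<Longrightarrow> prob_space.indep_vars P (\<lambda>_. borel)
          (\<lambda>(i, j) \<omega>. X t \<omega> $$ (i, j)) ({..<r t} \<times> {..<t})"
    and X_gauss: "\<And>t i j. t \<ge> 1 \<Longrightarrow> i < r t \<Longrightarrow> j < t \<Longrightarrow>
          std_complex_gaussian P (\<lambda>\<omega>. X t \<omega> $$ (i, j))"
    and Y_eq: "\<And>t \<omega>. Y t \<omega> = complex_of_real (1 / sqrt (real t)) \<cdot>\<^sub>m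
          (mat_diag (r t) (\<lambda>i. complex_of_real (sqrt (d t i))) * X t \<omega>
           * mat_diag t (\<lambda>j. complex_of_real (sqrt (dt t j))))"
    and Sig_eq: "\<And>t \<omega>. Sig t \<omega> = B t + Y t \<omega>"
    and B_bdd: "bdd_above ((\<lambda>t. spectral_norm (B t)) ` {1..})"
    and D_bdd: "bdd_above ((\<lambda>t. spectral_norm (D t)) ` {1..})"
    and Dt_bdd: "bdd_above ((\<lambda>t. spectral_norm (Dt t)) ` {1..})"
    and D_inf: "(INF t\<in>{1..}. 1 / real t * Re (mat_trace (D t))) > 0"
    and Dt_inf: "(INF t\<in>{1..}. 1 / real t * Re (mat_trace (Dt t))) > 0"
    and "s2 > 0"
    and M_dim: "\<And>t. t \<ge> 1 \<Longrightarrow> M t \<in> carrier_mat (r t) (r t)"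
    and Mt_dim: "\<And>t. t \<ge> 1 \<Longrightarrow> Mt t \<in> carrier_mat t t"
    and M_bdd: "bdd_above ((\<lambda>t. spectral_norm (M t)) ` {1..})"
    and Mt_bdd: "bdd_above ((\<lambda>t. spectral_norm (Mt t)) ` {1..})"
  shows "(\<lambda>t. complex_variance P
            (\<lambda>\<omega>. 1 / of_nat (r t) * mat_trace (resolvent (Sig t \<omega>) s2 * M t)))
           \<in> O(\<lambda>t. 1 / (real t)\<^sup>2)
       \<and> (\<lambda>t. complex_variance P
            (\<lambda>\<omega>. 1 / of_nat t * mat_trace (co_resolvent (Sig t \<omega>) s2 * Mt t)))
           \<in> O(\<lambda>t. 1 / (real t)\<^sup>2)
       \<and> (\<lambda>t. 1 / of_nat (r t) * mat_trace
            ((mat_expectation P (\<lambda>\<omega>. resolvent (Sig t \<omega>) s2) (r t) (r t)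
              - T_mat (B t) (D t) (Dt t) s2) * M t))
           \<in> O(\<lambda>t. 1 / (of_nat t)\<^sup>2)
       \<and> (\<lambda>t. 1 / of_nat t * mat_trace
            ((mat_expectation P (\<lambda>\<omega>. co_resolvent (Sig t \<omega>) s2) t t
              - Tt_mat (B t) (D t) (Dt t) s2) * Mt t))
           \<in> O(\<lambda>t. 1 / (of_nat t)\<^sup>2)
       \<and> (\<lambda>t. mutual_information P (Sig t) s2
              - mutual_information_approx (B t) (D t) (Dt t) s2)
           \<in> O(\<lambda>t. 1 / real t)"
proof -
  interpret P: prob_space P by fact
  note s0 = \<open>s2 > 0\<close>
  obtain b where b: "0 \<le> b" "\<And>t. 1 \<le> t \<Longrightarrow> spectral_norm (B t) \<le> b"
    using bdd_above_image_bound[OF B_bdd] by blast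
  obtain pd where pd: "0 \<le> pd" "\<And>t. 1 \<le> t \<Longrightarrow> spectral_norm (D t) \<le> pd"
    using bdd_above_image_bound[OF D_bdd] by blast
  obtain pdt where pdt: "0 \<le> pdt" "\<And>t. 1 \<le> t \<Longrightarrow> spectral_norm (Dt t) \<le> pdt"
    using bdd_above_image_bound[OF Dt_bdd] by blast
  obtain cm where cm: "0 \<le> cm" "\<And>t. 1 \<le> t \<Longrightarrow> spectral_norm (M t) \<le> cm"
    using bdd_above_image_bound[OF M_bdd] by blast
  obtain cmt where cmt: "0 \<le> cmt" "\<And>t. 1 \<le> t \<Longrightarrow> spectral_norm (Mt t) \<le> cmt"
    using bdd_above_image_bound[OF Mt_bdd] by blast
  define pm where "pm = max pd pdt"
  (* n / t = 1 + r / t, and r / t is eventually at most 2 / c *)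
  define nu where "nu = 1 + 2 / c"
  have dle: "d t i \<le> pm" if "1 \<le> t" "i < r t" for t i
    using diagonal_entry_le_spectral_norm[of i "r t" "d t", folded D_eq] d_nonneg[OF that] pd(2)[OF that(1)] that
    by (simp add: pm_def)
  have dtle: "dt t j \<le> pm" if "1 \<le> t" "j < t" for t j
    using diagonal_entry_le_spectral_norm[of j t "dt t", folded Dt_eq] dt_nonneg[OF that] pdt(2)[OF that(1)] that
    by (simp add: pm_def)
  have trD: "1 / real t * Re (mat_trace (D t)) = (\<Sum>i<r t. d t i) / real t" for t
    by (simp add: D_eq mat_trace_mat_diag)
  have trDt: "1 / real t * Re (mat_trace (Dt t)) = (\<Sum>j<t. dt t j) / real t" for t
    by (simp add: Dt_eq mat_trace_mat_diag)
  (* the smaller infimum serves as the common lower bound of both normalized traces *)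
  define dl where "dl = min (INF t\<in>{1..}. 1 / real t * Re (mat_trace (D t))) (INF t\<in>{1..}. 1 / real t * Re (mat_trace (Dt t)))"
  have dl0: "0 < dl" using D_inf Dt_inf by (simp add: dl_def)
  have dlD: "dl \<le> (\<Sum>i<r t. d t i) / real t" if "1 \<le> t" for t
  proof -
    have "bdd_below ((\<lambda>t. 1 / real t * Re (mat_trace (D t))) ` {1..})"
      unfolding trD by (rule bdd_belowI2[of _ 0]) (auto intro!: divide_nonneg_nonneg sum_nonneg d_nonneg)
    then have "(INF t\<in>{1..}. 1 / real t * Re (mat_trace (D t))) \<le> 1 / real t * Re (mat_trace (D t))"
      by (rule cINF_lower) (use that in simp)
    then show ?thesis unfolding dl_def trD by simp
  qed
  have dlDt: "dl \<le> (\<Sum>j<t. dt t j) / real t" if "1 \<le> t" for t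
  proof -
    have "bdd_below ((\<lambda>t. 1 / real t * Re (mat_trace (Dt t))) ` {1..})"
      unfolding trDt by (rule bdd_belowI2[of _ 0]) (auto intro!: divide_nonneg_nonneg sum_nonneg dt_nonneg)
    then have "(INF t\<in>{1..}. 1 / real t * Re (mat_trace (Dt t))) \<le> 1 / real t * Re (mat_trace (Dt t))"
      by (rule cINF_lower) (use that in simp)
    then show ?thesis unfolding dl_def trDt by simp
  qed
  have rpos: "0 < r t" if "1 \<le> t" for t
  proof (rule ccontr)
    assume "\<not> 0 < r t"
    then show False using dlD[OF that] dl0 by simp
  qed
  (* sizes at which t / r lies between c / 2 and 2 c and stability applies to the mean traces *)
  define large where "large t \<longleftrightarrow> 1 \<le> t \<and> real (r t) \<le> 2 / c * real t \<and> 1 / real (r t) \<le> 2 * c / real t \<and>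
    4 * pm ^ 5 * nu \<le> dl / cond_const pm nu b s2 * s2\<^sup>2 * (real t)\<^sup>2" for t
  have ev: "eventually large sequentially"
  proof -
    have "c / 2 < c" "c < 2 * c" using \<open>c > 0\<close> by auto
    then have "\<forall>\<^sub>F t in sequentially. c / 2 < real t / real (r t)" "\<forall>\<^sub>F t in sequentially. real t / real (r t) < 2 * c"
      using order_tendstoD[OF ratio_lim] by blast+
    moreover have "\<forall>\<^sub>F t in sequentially. 4 * pm ^ 5 * nu \<le> dl / cond_const pm nu b s2 * s2\<^sup>2 * (real t)\<^sup>2"
    proof -
      have "0 < nu" using \<open>c > 0\<close> by (simp add: nu_def add_pos_pos)
      then have "0 \<le> 2 * pm\<^sup>2 * nu / s2" using s0 by simp
      then have "1 \<le> (1 + 2 * pm\<^sup>2 * nu / s2)\<^sup>2" by (intro one_le_power) simp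
      then have "0 < cond_const pm nu b s2" unfolding cond_const_def using s0 by (intro add_pos_nonneg) auto
      then have k: "0 < dl / cond_const pm nu b s2 * s2\<^sup>2" using dl0 s0 by simp
      have "filterlim (\<lambda>t. dl / cond_const pm nu b s2 * s2\<^sup>2 * (real t)\<^sup>2) at_top sequentially"
        using k by (intro filterlim_tendsto_pos_mult_at_top[OF tendsto_const] filterlim_pow_at_top filterlim_real_sequentially) auto
      then show ?thesis by (simp add: filterlim_at_top)
    qed
    ultimately show ?thesis
      using eventually_ge_at_top[of "1::nat"]
    proof eventually_elim
      case (elim t)
      have r0: "0 < real (r t)" using rpos[OF elim(4)] by simp
      have "real (r t) \<le> 2 / c * real t" using elim(1) r0 \<open>c > 0\<close> by (simp add: field_simps)
      moreover have "1 / real (r t) \<le> 2 * c / real t" using elim(2) elim(4) r0 by (simp add: field_simps)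
      ultimately show ?case using elim unfolding large_def by simp
    qed
  qed
  define V where "V C = pm\<^sup>2 * nu * C\<^sup>2 / s2 ^ 3" for C
  define Z where "Z C = C * det_const pm nu dl b s2 / s2 ^ 3" for C
  have est: "\<bar>complex_variance P (\<lambda>\<omega>. mat_trace (resolvent (Sig t \<omega>) s2 * M t))\<bar> \<le> V cm"
    "\<bar>complex_variance P (\<lambda>\<omega>. mat_trace (co_resolvent (Sig t \<omega>) s2 * Mt t))\<bar> \<le> V cmt"
    "cmod (mat_trace ((mat_expectation P (\<lambda>\<omega>. resolvent (Sig t \<omega>) s2) (r t) (r t) - T_mat (B t) (D t) (Dt t) s2) * M t)) \<le> Z cm / real t"
    "cmod (mat_trace ((mat_expectation P (\<lambda>\<omega>. co_resolvent (Sig t \<omega>) s2) t t - Tt_mat (B t) (D t) (Dt t) s2) * Mt t)) \<le> Z cmt / real t"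
    "\<bar>mutual_information P (Sig t) s2 - mutual_information_approx (B t) (D t) (Dt t) s2\<bar> \<le> det_const pm nu dl b s2 / s2\<^sup>2 / real t"
    if "large t" for t
  proof -
    have t1: "1 \<le> t" and rle: "real (r t) \<le> 2 / c * real t"
      and big: "4 * pm ^ 5 * nu \<le> dl / cond_const pm nu b s2 * s2\<^sup>2 * (real t)\<^sup>2"
      using that by (auto simp: large_def)
    define pp where "pp a i = (if a then if i < r t then 0 else dt t (i - r t) else if i < r t then d t i else 0)" for a i
    have spl: "(\<Sum>i<r t + t. f i) = (\<Sum>i<r t. f i) + (\<Sum>j<t. f (r t + j))" for f :: "nat \<Rightarrow> real"
      by (rule sum_split)
    interpret gaussian_model "r t" t "r t + t" pp pm nu dl "d t" "dt t" "\<lambda>i j. B t $$ (i, j)" "sqrt s2"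
    proof unfold_locales
      show "0 \<le> pp a i" "pp a i \<le> pm" if "i < r t + t" for a i
        using that t1 d_nonneg dt_nonneg dle dtle pd(1) by (auto simp: pp_def pm_def)
      show "dl \<le> (\<Sum>i<r t + t. pp a i) / real t" for a
        using dlD[OF t1] dlDt[OF t1] by (cases a) (simp_all add: pp_def spl)
      show "real (r t + t) \<le> nu * real t" using rle by (simp add: nu_def distrib_right)
    qed (use t1 dl0 s0 d_nonneg dt_nonneg in \<open>auto simp: pp_def\<close>)
    let ?xi = "coords (r t) t (X t)"
    have law: "distr P PG ?xi = PG" and xim: "?xi \<in> measurable P PG"
      using coords_law[OF P.prob_space_axioms rpos[OF t1] _ X_indep[OF t1] X_gauss[OF t1]] t1 by (auto simp: I_def)
    have Sc: "Sig t \<omega> \<in> carrier_mat (r t) t" if "\<omega> \<in> space P" for \<omega>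
      using X_dim[OF t1 that] B_dim[OF t1] unfolding Sig_eq Y_eq
      by (intro add_carrier_mat smult_carrier_mat mult_carrier_mat[where n = t] mult_carrier_mat[where n = "r t"]) auto
    have Se: "Sig t \<omega> $$ (i, j) = noisy (?xi \<omega>) i j" if "\<omega> \<in> space P" "i < r t" "j < t" for \<omega> i j
    proof -
      have X: "X t \<omega> \<in> carrier_mat (r t) t" by (rule X_dim[OF t1 that(1)])
      have "(mat_diag (r t) (\<lambda>i. complex_of_real (sqrt (d t i))) * X t \<omega>) * mat_diag t (\<lambda>j. complex_of_real (sqrt (dt t j)))
          = Matrix.mat (r t) t (\<lambda>(i, j). complex_of_real (sqrt (d t i)) * X t \<omega> $$ (i, j) * of_real (sqrt (dt t j)))"
        unfolding mat_diag_mult_left[OF X]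
        by (subst mat_diag_mult_right[OF mat_carrier]) (auto intro!: eq_matI)
      moreover have "Complex (?xi \<omega> ((i, j), False)) (?xi \<omega> ((i, j), True)) = X t \<omega> $$ (i, j)"
        using that by (simp add: coords_def complex_eq_iff)
      ultimately show ?thesis
        using that X B_dim[OF t1] unfolding Sig_eq Y_eq by (simp add: noisy_def noise_scale_def)
    qed
    have DD: "Dm = D t" "Dtm = Dt t" by (simp_all add: D_eq Dt_eq Dm_def Dtm_def comp_def)
    note te = trace_estimates[OF P.prob_space_axioms xim law Sc Se B_dim[OF t1] refl b(2)[OF t1] s0 refl big, unfolded DD]
    show "\<bar>complex_variance P (\<lambda>\<omega>. mat_trace (resolvent (Sig t \<omega>) s2 * M t))\<bar> \<le> V cm"
      unfolding V_def by (rule te(1)[OF _ _ _ _ M_dim[OF t1] cm(2)[OF t1]])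
    show "\<bar>complex_variance P (\<lambda>\<omega>. mat_trace (co_resolvent (Sig t \<omega>) s2 * Mt t))\<bar> \<le> V cmt"
      unfolding V_def by (rule te(2)[OF _ _ _ _ Mt_dim[OF t1] cmt(2)[OF t1]])
    show "cmod (mat_trace ((mat_expectation P (\<lambda>\<omega>. resolvent (Sig t \<omega>) s2) (r t) (r t) - T_mat (B t) (D t) (Dt t) s2) * M t)) \<le> Z cm / real t"
      unfolding Z_def by (rule te(3)[OF _ _ _ _ M_dim[OF t1] cm(2)[OF t1]])
    show "cmod (mat_trace ((mat_expectation P (\<lambda>\<omega>. co_resolvent (Sig t \<omega>) s2) t t - Tt_mat (B t) (D t) (Dt t) s2) * Mt t)) \<le> Z cmt / real t"
      unfolding Z_def by (rule te(4)[OF _ _ _ _ Mt_dim[OF t1] cmt(2)[OF t1]])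
    have "mutual_information P (Sig t) s2 = (\<integral>\<omega>. logdet s2 (?xi \<omega>) \<partial>P)"
      unfolding mutual_information_def
    proof (intro Bochner_Integration.integral_cong refl)
      fix \<omega> assume w: "\<omega> \<in> space P"
      have "Sig t \<omega> = Sm (?xi \<omega>)" using Sc[OF w] Se[OF w] by (intro eq_matI) (auto simp: Sm_def)
      then show "ln (Re (Determinant.det (1\<^sub>m (dim_row (Sig t \<omega>)) + complex_of_real (1 / s2) \<cdot>\<^sub>m (Sig t \<omega> * mat_adjoint (Sig t \<omega>))))) = logdet s2 (?xi \<omega>)"
        using Sc[OF w] by (simp add: logdet_def)
    qed
    also have "\<dots> = (\<integral>x. logdet s2 x \<partial>distr P PG ?xi)"
      by (rule integral_distr[symmetric, OF xim logdet_expectation(3)[OF s0]])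
    finally have "mutual_information P (Sig t) s2 = (\<integral>x. logdet s2 x \<partial>PG)" unfolding law .
    then show "\<bar>mutual_information P (Sig t) s2 - mutual_information_approx (B t) (D t) (Dt t) s2\<bar> \<le> det_const pm nu dl b s2 / s2\<^sup>2 / real t"
      using mutual_information_estimate[OF B_dim[OF t1] refl b(2)[OF t1] s0 rpos[OF t1] big] unfolding DD by simp
  qed
  have sq: "(1 / real (r t))\<^sup>2 \<le> (2 * c)\<^sup>2 / (real t)\<^sup>2" if "large t" for t
  proof -
    have "(1 / real (r t))\<^sup>2 \<le> (2 * c / real t)\<^sup>2" using that by (intro power_mono) (auto simp: large_def)
    then show ?thesis by (simp add: power_divide)
  qed
  have tpos: "0 < real t" and rinv: "1 / real (r t) \<le> 2 * c / real t" if "large t" for t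
    using that by (auto simp: large_def)
  show ?thesis
  proof (intro conjI)
    show "(\<lambda>t. complex_variance P (\<lambda>\<omega>. 1 / of_nat (r t) * mat_trace (resolvent (Sig t \<omega>) s2 * M t))) \<in> O(\<lambda>t. 1 / (real t)\<^sup>2)"
    proof (rule bigoI[where c = "(2 * c)\<^sup>2 * V cm"], rule eventually_mono[OF ev])
      fix t assume L: "large t"
      have "\<bar>(1 / real (r t))\<^sup>2 * complex_variance P (\<lambda>\<omega>. mat_trace (resolvent (Sig t \<omega>) s2 * M t))\<bar> \<le> (2 * c)\<^sup>2 / (real t)\<^sup>2 * V cm"
        unfolding abs_mult by (rule mult_mono) (use sq[OF L] est(1)[OF L] in auto)
      then show "norm (complex_variance P (\<lambda>\<omega>. 1 / of_nat (r t) * mat_trace (resolvent (Sig t \<omega>) s2 * M t))) \<le> (2 * c)\<^sup>2 * V cm * norm (1 / (real t)\<^sup>2)"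
        unfolding complex_variance_scale by (simp add: norm_divide)
    qed
    show "(\<lambda>t. complex_variance P (\<lambda>\<omega>. 1 / of_nat t * mat_trace (co_resolvent (Sig t \<omega>) s2 * Mt t))) \<in> O(\<lambda>t. 1 / (real t)\<^sup>2)"
    proof (rule bigoI[where c = "V cmt"], rule eventually_mono[OF ev])
      fix t assume L: "large t"
      have "\<bar>(1 / real t)\<^sup>2 * complex_variance P (\<lambda>\<omega>. mat_trace (co_resolvent (Sig t \<omega>) s2 * Mt t))\<bar> \<le> (1 / real t)\<^sup>2 * V cmt"
        unfolding abs_mult by (rule mult_mono) (use est(2)[OF L] in auto)
      then show "norm (complex_variance P (\<lambda>\<omega>. 1 / of_nat t * mat_trace (co_resolvent (Sig t \<omega>) s2 * Mt t))) \<le> V cmt * norm (1 / (real t)\<^sup>2)"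
        unfolding complex_variance_scale by (simp add: norm_divide power_divide)
    qed
    show "(\<lambda>t. 1 / of_nat (r t) * mat_trace ((mat_expectation P (\<lambda>\<omega>. resolvent (Sig t \<omega>) s2) (r t) (r t)
        - T_mat (B t) (D t) (Dt t) s2) * M t)) \<in> O(\<lambda>t. 1 / (of_nat t)\<^sup>2)"
    proof (rule bigoI[where c = "2 * c * Z cm"], rule eventually_mono[OF ev])
      fix t assume L: "large t"
      let ?z = "mat_trace ((mat_expectation P (\<lambda>\<omega>. resolvent (Sig t \<omega>) s2) (r t) (r t) - T_mat (B t) (D t) (Dt t) s2) * M t)"
      have "1 / real (r t) * cmod ?z \<le> 2 * c / real t * (Z cm / real t)"
        by (rule mult_mono) (use rinv[OF L] est(3)[OF L] \<open>c > 0\<close> in auto)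
      then show "norm (1 / of_nat (r t) * ?z) \<le> 2 * c * Z cm * norm (1 / (of_nat t :: complex)\<^sup>2)"
        by (simp add: norm_mult norm_divide norm_power power2_eq_square)
    qed
    show "(\<lambda>t. 1 / of_nat t * mat_trace ((mat_expectation P (\<lambda>\<omega>. co_resolvent (Sig t \<omega>) s2) t t
        - Tt_mat (B t) (D t) (Dt t) s2) * Mt t)) \<in> O(\<lambda>t. 1 / (of_nat t)\<^sup>2)"
    proof (rule bigoI[where c = "Z cmt"], rule eventually_mono[OF ev])
      fix t assume L: "large t"
      let ?z = "mat_trace ((mat_expectation P (\<lambda>\<omega>. co_resolvent (Sig t \<omega>) s2) t t - Tt_mat (B t) (D t) (Dt t) s2) * Mt t)"
      have "1 / real t * cmod ?z \<le> 1 / real t * (Z cmt / real t)"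
        by (rule mult_left_mono) (use est(4)[OF L] in auto)
      then show "norm (1 / of_nat t * ?z) \<le> Z cmt * norm (1 / (of_nat t :: complex)\<^sup>2)"
        by (simp add: norm_mult norm_divide norm_power power2_eq_square)
    qed
    show "(\<lambda>t. mutual_information P (Sig t) s2 - mutual_information_approx (B t) (D t) (Dt t) s2) \<in> O(\<lambda>t. 1 / real t)"
    proof (rule bigoI[where c = "det_const pm nu dl b s2 / s2\<^sup>2"], rule eventually_mono[OF ev])
      fix t assume L: "large t"
      show "norm (mutual_information P (Sig t) s2 - mutual_information_approx (B t) (D t) (Dt t) s2) \<le> det_const pm nu dl b s2 / s2\<^sup>2 * norm (1 / real t)"
        using est(5)[OF L] by simp
    qed
  qed
qed

end
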